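(* Let $k_1k_2\neq 0$ and let $f\colon M^m\to \mathbb{Q}_{k_1}^{n_1}\times \mathbb{Q}_{k_2}^{n_2}$ be an isometric immersion of an $m$-dimensional Riemannian manifold. Then the following assertions are equivalent: (i) $k_1k_2>0$ and there exist $\ell\geq 0$, an isometric immersion $\bar f\colon M^m\to\mathbb{Q}_k^{m+\ell}$, with $k=k_1k_2/(k_1+k_2)$, and a totally geodesic inclusion $j\colon\mathbb{Q}_{k_1}^{m+\ell}\times\mathbb{Q}_{k_2}^{m+\ell}\to\mathbb{Q}_{k_1}^{n_1}\times\mathbb{Q}_{k_2}^{n_2}$ such that $f=j\circ g\circ\bar f$, where $g\colon\mathbb{Q}_k^{m+\ell}\to\mathbb{Q}_{k_1}^{m+\ell}\times\mathbb{Q}_{k_2}^{m+\ell}$ is a totally geodesic embedding of the form $g(x)=(aT_1(x),bT_2(x))$, with $a=\sqrt{k_2/(k_1+k_2)}$, $b=\sqrt{k_1/(k_1+k_2)}$ and $T_1,T_2\in O_\epsilon(m+\ell+1)$, $\epsilon=\sigma(k_1)=\sigma(k_2)$; (ii) $\Phi=0$ and there exists a vector subbundle $L$ (of some rank $\ell\ge 0$) of $S(TM)^\perp$ such that $N_1\subset L$, $L$ is parallel in the normal connection and $(T-b^2I)L\subset L^\perp$, where $b:=\sqrt{\frac{k_1}{k_1+k_2}}$.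
   Context: Manifolds are assumed connected. $\mathbb{R}^N_s$ denotes flat $\mathbb{R}^N$ with a metric of index $s$; $\sigma(k)=1$ if $k<0$ and $\sigma(k)=0$ otherwise. For $k\neq 0$, $\mathbb{Q}_k^n=\{X\in\mathbb{R}^{n+1}_{\sigma(k)}:\langle X,X\rangle=1/k\}$ (a connected component of this set if $k<0$), with the induced Riemannian metric. $O_\epsilon(n+1)$ is the group of linear isometries of $\mathbb{R}^{n+1}_\epsilon$ (when $\epsilon=1$, $T_1,T_2$ are taken so that $g$ maps into the chosen components). A totally geodesic inclusion is an isometric embedding onto a totally geodesic submanifold; the inclusion $j$ between products is a product of totally geodesic inclusions of the factors. Let $N_fM$ be the normal bundle and $\pi_2$ the orthogonal projection of $T(\mathbb{Q}_{k_1}^{n_1}\times\mathbb{Q}_{k_2}^{n_2})$ onto the subbundle tangent to the second factor. The tensors $R\colon TM\to TM$, $S\colon TM\to N_fM$, $T\colon N_fM\to N_fM$ are defined by the decomposition into tangent and normal parts $$\pi_2f_*X=f_*RX+SX,\qquad \pi_2\xi=f_*S^t\xi+T\xi,$$ for $X\in TM$, $\xi\in N_fM$, where $S^t$ is the transpose of $S$. Set $\Phi=k_1I-(k_1+k_2)R$. $S(TM)^\perp$ and $L^\perp$ are orthogonal complements in $N_fM$. $N_1(x)\subset N_fM(x)$ is the first normal space, spanned by the image of the second fundamental form of $f$ at $x$. $L$ parallel in the normal connection means $\nabla^\perp_X\xi\in L$ for all sections $\xi$ of $L$ and $X\in TM$. (When $k_1k_2\neq0$, $\Phi=0$ implies $k_1k_2>0$,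 so $b$ in (ii) is well defined.) *)

theory Defs
  imports "HOL-Analysis.Analysis"
begin

section \<open>Smooth functions on open subsets of Euclidean space\<close>

text \<open>Dimensions occur bound inside the statement, so \<open>\<real>\<^sup>n\<close> is the topology
  \<^const>\<open>Euclidean_space\<close> \<open>n\<close>: sequences vanishing from index \<open>n\<close> on.\<close>

definition pderiv_at :: "nat \<Rightarrow> ((nat \<Rightarrow> real) \<Rightarrow> real) \<Rightarrow> (nat \<Rightarrow> real) \<Rightarrow> real" where
  "pderiv_at i F y = deriv (\<lambda>t. F (y(i := t))) (y i)"

fun C_k :: "nat \<Rightarrow> nat \<Rightarrow> (nat \<Rightarrow> real) set \<Rightarrow> ((nat \<Rightarrow> real) \<Rightarrow> real) \<Rightarrow> bool" where
  "C_k n 0 U F \<longleftrightarrow> continuous_map (subtopology (Euclidean_space n) U) euclideanreal F"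
| "C_k n (Suc r) U F \<longleftrightarrow>
     continuous_map (subtopology (Euclidean_space n) U) euclideanreal F \<and>
     (\<forall>i<n. (\<forall>y\<in>U. (\<lambda>t. F (y(i := t))) field_differentiable at (y i)) \<and>
            C_k n r U (pderiv_at i F))"

definition C_inf :: "nat \<Rightarrow> (nat \<Rightarrow> real) set \<Rightarrow> ((nat \<Rightarrow> real) \<Rightarrow> real) \<Rightarrow> bool" where
  "C_inf n U F \<longleftrightarrow> (\<forall>r. C_k n r U F)"

section \<open>Riemannian manifolds\<close>

type_synonym 'a chart = "'a set \<times> ('a \<Rightarrow> nat \<Rightarrow> real)"

text \<open>A tangent vector at \<open>x\<close> is a derivation on the real functions that are smooth near \<open>x\<close>,
  extended by \<open>0\<close> to all other functions.\<close>

type_synonym 'a tvec = "('a \<Rightarrow> real) \<Rightarrow> real"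

record 'a rmanifold =
  mtop :: "'a topology"
  mdim :: nat
  atlas :: "'a chart set"
  metric :: "'a \<Rightarrow> 'a tvec \<Rightarrow> 'a tvec \<Rightarrow> real"

definition smooth_manifold :: "'a rmanifold \<Rightarrow> bool" where
  "smooth_manifold M \<longleftrightarrow>
     topspace (mtop M) \<noteq> {} \<and> Hausdorff_space (mtop M) \<and> second_countable (mtop M) \<and>
     topspace (mtop M) = (\<Union>(U, \<phi>)\<in>atlas M. U) \<and>
     (\<forall>(U, \<phi>)\<in>atlas M. openin (mtop M) U \<and>
        openin (Euclidean_space (mdim M)) (\<phi> ` U) \<and>
        homeomorphic_map (subtopology (mtop M) U)
          (subtopology (Euclidean_space (mdim M)) (\<phi> ` U)) \<phi>) \<and>
     (\<forall>(U, \<phi>)\<in>atlas M. \<forall>(V, \<psi>)\<in>atlas M. \<forall>i<mdim M.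
        C_inf (mdim M) (\<phi> ` (U \<inter> V)) (\<lambda>y. \<psi> (inv_into U \<phi> y) i))"

definition smooth_fun_on :: "'a rmanifold \<Rightarrow> 'a set \<Rightarrow> ('a \<Rightarrow> real) \<Rightarrow> bool" where
  "smooth_fun_on M W h \<longleftrightarrow>
     (\<forall>(U, \<phi>)\<in>atlas M. C_inf (mdim M) (\<phi> ` (U \<inter> W)) (\<lambda>y. h (inv_into U \<phi> y)))"

definition smooth_near :: "'a rmanifold \<Rightarrow> 'a \<Rightarrow> ('a \<Rightarrow> real) \<Rightarrow> bool" where
  "smooth_near M x h \<longleftrightarrow> (\<exists>W. openin (mtop M) W \<and> x \<in> W \<and> smooth_fun_on M W h)"

text \<open>The coordinate vector \<open>\<partial>/\<partial>\<phi>\<^sub>i\<close> at \<open>x\<close>.\<close>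

definition coord_vec :: "'a rmanifold \<Rightarrow> 'a chart \<Rightarrow> 'a \<Rightarrow> nat \<Rightarrow> 'a tvec" where
  "coord_vec M c x i = (\<lambda>h. if smooth_near M x h
      then pderiv_at i (\<lambda>y. h (inv_into (fst c) (snd c) y)) (snd c x) else 0)"

definition tangent_space :: "'a rmanifold \<Rightarrow> 'a \<Rightarrow> 'a tvec set" where
  "tangent_space M x =
     {(\<lambda>h. \<Sum>i<mdim M. a i * coord_vec M c x i h) | a c. c \<in> atlas M \<and> x \<in> fst c}"

definition vector_field_on :: "'a rmanifold \<Rightarrow> 'a set \<Rightarrow> ('a \<Rightarrow> 'a tvec) \<Rightarrow> bool" where
  "vector_field_on M U Y \<longleftrightarrow>
     (\<forall>x\<in>U. Y x \<in> tangent_space M x) \<and>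
     (\<forall>W h. openin (mtop M) W \<and> W \<subseteq> U \<and> smooth_fun_on M W h \<longrightarrow>
        smooth_fun_on M W (\<lambda>x. Y x h))"

definition riemannian_manifold :: "'a rmanifold \<Rightarrow> bool" where
  "riemannian_manifold M \<longleftrightarrow>
     smooth_manifold M \<and> connected_space (mtop M) \<and>
     (\<forall>x\<in>topspace (mtop M). \<forall>X\<in>tangent_space M x. \<forall>Y\<in>tangent_space M x.
        metric M x X Y = metric M x Y X \<and>
        (X \<noteq> (\<lambda>h. 0) \<longrightarrow> metric M x X X > 0) \<and>
        (\<forall>Z\<in>tangent_space M x. \<forall>a b.
           metric M x (\<lambda>h. a * X h + b * Y h) Z = a * metric M x X Z + b * metric M x Y Z)) \<and>
     (\<forall>c\<in>atlas M. \<forall>i<mdim M. \<forall>j<mdim M.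
        smooth_fun_on M (fst c) (\<lambda>x. metric M x (coord_vec M c x i) (coord_vec M c x j)))"

section \<open>Riemannian submanifolds of flat space as targets\<close>

text \<open>A target is an embedded Riemannian submanifold of a flat pseudo-Euclidean space of
  vectors \<open>'i \<Rightarrow> real\<close>, given by its points, its tangent spaces inside the flat space, and
  the flat scalar product.\<close>

record 'i target =
  points :: "('i \<Rightarrow> real) set"
  tspace :: "('i \<Rightarrow> real) \<Rightarrow> ('i \<Rightarrow> real) set"
  form :: "('i \<Rightarrow> real) \<Rightarrow> ('i \<Rightarrow> real) \<Rightarrow> real"

definition smooth_vec_on :: "'a rmanifold \<Rightarrow> 'a set \<Rightarrow> ('a \<Rightarrow> 'i \<Rightarrow> real) \<Rightarrow> bool" where
  "smooth_vec_on M W F \<longleftrightarrow> (\<forall>i. smooth_fun_on M W (\<lambda>x. F x i))"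

text \<open>The flat derivative of a vector-valued map along a tangent vector \<open>X\<close>.
  In particular \<open>f\<^sub>* X = dvec X f\<close>.\<close>

definition dvec :: "'a tvec \<Rightarrow> ('a \<Rightarrow> 'i \<Rightarrow> real) \<Rightarrow> 'i \<Rightarrow> real" where
  "dvec X F = (\<lambda>i. X (\<lambda>x. F x i))"

text \<open>As the targets are embedded submanifolds, smoothness into a target is smoothness into
  the flat space.\<close>

definition isometric_immersion :: "'a rmanifold \<Rightarrow> 'i target \<Rightarrow> ('a \<Rightarrow> 'i \<Rightarrow> real) \<Rightarrow> bool" where
  "isometric_immersion M N f \<longleftrightarrow>
     f ` topspace (mtop M) \<subseteq> points N \<and> smooth_vec_on M (topspace (mtop M)) f \<and>
     (\<forall>x\<in>topspace (mtop M). \<forall>X\<in>tangent_space M x. \<forall>Y\<in>tangent_space M x.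
        form N (dvec X f) (dvec Y f) = metric M x X Y)"

definition orth_proj ::
  "(('i \<Rightarrow> real) \<Rightarrow> ('i \<Rightarrow> real) \<Rightarrow> real) \<Rightarrow> ('i \<Rightarrow> real) set \<Rightarrow> ('i \<Rightarrow> real) \<Rightarrow> 'i \<Rightarrow> real" where
  "orth_proj B V w = (THE v. v \<in> V \<and> (\<forall>u\<in>V. B v u = B w u))"

definition vec_span :: "('i \<Rightarrow> real) set \<Rightarrow> ('i \<Rightarrow> real) set" where
  "vec_span V = {(\<lambda>i. \<Sum>j<r. c j * v j i) | r c v. \<forall>j<(r::nat). v j \<in> V}"

definition image_tangent :: "'a rmanifold \<Rightarrow> ('a \<Rightarrow> 'i \<Rightarrow> real) \<Rightarrow> 'a \<Rightarrow> ('i \<Rightarrow> real) set" where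
  "image_tangent M f x = (\<lambda>X. dvec X f) ` tangent_space M x"

definition normal_space ::
  "'a rmanifold \<Rightarrow> 'i target \<Rightarrow> ('a \<Rightarrow> 'i \<Rightarrow> real) \<Rightarrow> 'a \<Rightarrow> ('i \<Rightarrow> real) set" where
  "normal_space M N f x =
     {\<xi> \<in> tspace N (f x). \<forall>v\<in>image_tangent M f x. form N \<xi> v = 0}"

text \<open>The Levi-Civita connection of a Riemannian submanifold of flat space is the tangential
  part of the flat derivative; here it is applied to a field \<open>Z\<close> along \<open>f\<close>.\<close>

definition target_conn ::
  "'i target \<Rightarrow> ('a \<Rightarrow> 'i \<Rightarrow> real) \<Rightarrow> 'a \<Rightarrow> 'a tvec \<Rightarrow> ('a \<Rightarrow> 'i \<Rightarrow> real) \<Rightarrow> 'i \<Rightarrow> real" where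
  "target_conn N f x X Z = orth_proj (form N) (tspace N (f x)) (dvec X Z)"

definition normal_conn ::
  "'a rmanifold \<Rightarrow> 'i target \<Rightarrow> ('a \<Rightarrow> 'i \<Rightarrow> real) \<Rightarrow> 'a \<Rightarrow> 'a tvec \<Rightarrow> ('a \<Rightarrow> 'i \<Rightarrow> real) \<Rightarrow> 'i \<Rightarrow> real" where
  "normal_conn M N f x X \<xi> =
     orth_proj (form N) (normal_space M N f x) (target_conn N f x X \<xi>)"

text \<open>The second fundamental form at \<open>x\<close> (Gauss formula), on a tangent vector \<open>X\<close> at \<open>x\<close> and a
  vector field \<open>Y\<close> near \<open>x\<close>.\<close>

definition second_ff ::
  "'a rmanifold \<Rightarrow> 'i target \<Rightarrow> ('a \<Rightarrow> 'i \<Rightarrow> real) \<Rightarrow> 'a \<Rightarrow> 'a tvec \<Rightarrow> ('a \<Rightarrow> 'a tvec) \<Rightarrow> 'i \<Rightarrow> real" where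
  "second_ff M N f x X Y =
     orth_proj (form N) (normal_space M N f x) (target_conn N f x X (\<lambda>y. dvec (Y y) f))"

definition first_normal_space ::
  "'a rmanifold \<Rightarrow> 'i target \<Rightarrow> ('a \<Rightarrow> 'i \<Rightarrow> real) \<Rightarrow> 'a \<Rightarrow> ('i \<Rightarrow> real) set" where
  "first_normal_space M N f x =
     vec_span {second_ff M N f x X Y | X U Y. X \<in> tangent_space M x \<and>
        openin (mtop M) U \<and> x \<in> U \<and> vector_field_on M U Y}"

definition totally_geodesic_embedding ::
  "'a rmanifold \<Rightarrow> 'i target \<Rightarrow> ('a \<Rightarrow> 'i \<Rightarrow> real) \<Rightarrow> bool" where
  "totally_geodesic_embedding M N f \<longleftrightarrow>
     isometric_immersion M N f \<and> embedding_map (mtop M) (powertop_real UNIV) f \<and>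
     (\<forall>U Y. openin (mtop M) U \<and> vector_field_on M U Y \<longrightarrow>
        (\<forall>x\<in>U. \<forall>X\<in>tangent_space M x. second_ff M N f x X Y = (\<lambda>i. 0)))"

section \<open>Space forms and their products\<close>

text \<open>The scalar product of index \<open>s\<close> on \<open>\<real>\<^sup>N\<close>; the first \<open>s\<close> coordinates are negative.\<close>

definition flat_ip :: "nat \<Rightarrow> nat \<Rightarrow> (nat \<Rightarrow> real) \<Rightarrow> (nat \<Rightarrow> real) \<Rightarrow> real" where
  "flat_ip s N u v = (\<Sum>i<N. (if i < s then - 1 else 1) * u i * v i)"

definition sig :: "real \<Rightarrow> nat" where
  "sig k = (if k < 0 then 1 else 0)"

text \<open>For \<open>k < 0\<close> the chosen component of the hyperboloid is the one with \<open>x\<^sub>0 > 0\<close>. The tangent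
  space at \<open>x\<close> is the kernel of the differential of \<open>\<langle>x, x\<rangle>\<close>.\<close>

definition Q_space :: "real \<Rightarrow> nat \<Rightarrow> nat target" where
  "Q_space k n = \<lparr>
     points = {x \<in> topspace (Euclidean_space (Suc n)).
                 flat_ip (sig k) (Suc n) x x = 1 / k \<and> (k < 0 \<longrightarrow> x 0 > 0)},
     tspace = (\<lambda>x. {v \<in> topspace (Euclidean_space (Suc n)). flat_ip (sig k) (Suc n) x v = 0}),
     form = flat_ip (sig k) (Suc n)\<rparr>"

text \<open>The same space as a manifold on its own. The charts are the graph coordinates: on the
  part where \<open>x\<^sub>i\<close> is positive (or negative), omit the coordinate \<open>x\<^sub>i\<close>.\<close>

definition omit_coord :: "nat \<Rightarrow> (nat \<Rightarrow> real) \<Rightarrow> nat \<Rightarrow> real" where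
  "omit_coord i x = (\<lambda>j. if j < i then x j else x (Suc j))"

definition Q_manifold :: "real \<Rightarrow> nat \<Rightarrow> (nat \<Rightarrow> real) rmanifold" where
  "Q_manifold k n = \<lparr>
     mtop = subtopology (Euclidean_space (Suc n)) (points (Q_space k n)),
     mdim = n,
     atlas = {({x \<in> points (Q_space k n). s * x i > 0}, omit_coord i) | i s.
                i \<le> n \<and> s \<in> {1, - 1}},
     metric = (\<lambda>x X Y. form (Q_space k n) (dvec X (\<lambda>z. z)) (dvec Y (\<lambda>z. z)))\<rparr>"

text \<open>The pair \<open>(u, v)\<close> in a product of two flat spaces is the vector \<^term>\<open>case_sum u v\<close>,
  indexed by \<open>nat + nat\<close>.\<close>

definition product_target :: "nat target \<Rightarrow> nat target \<Rightarrow> (nat + nat) target" where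
  "product_target P Q = \<lparr>
     points = {case_sum x y | x y. x \<in> points P \<and> y \<in> points Q},
     tspace = (\<lambda>z. {case_sum u v | u v. u \<in> tspace P (z \<circ> Inl) \<and> v \<in> tspace Q (z \<circ> Inr)}),
     form = (\<lambda>w z. form P (w \<circ> Inl) (z \<circ> Inl) + form Q (w \<circ> Inr) (z \<circ> Inr))\<rparr>"

definition proj2 :: "(nat + nat \<Rightarrow> real) \<Rightarrow> nat + nat \<Rightarrow> real" where
  "proj2 w = case_sum (\<lambda>_. 0) (w \<circ> Inr)"

definition linear_isometry_of :: "nat \<Rightarrow> nat \<Rightarrow> ((nat \<Rightarrow> real) \<Rightarrow> nat \<Rightarrow> real) \<Rightarrow> bool" where
  "linear_isometry_of s N A \<longleftrightarrow>
     bij_betw A (topspace (Euclidean_space N)) (topspace (Euclidean_space N)) \<and>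
     (\<forall>u\<in>topspace (Euclidean_space N). \<forall>v\<in>topspace (Euclidean_space N).
        (\<forall>a b. A (\<lambda>i. a * u i + b * v i) = (\<lambda>i. a * A u i + b * A v i)) \<and>
        flat_ip s N (A u) (A v) = flat_ip s N u v)"

section \<open>The tensors of an isometric immersion into a product\<close>

text \<open>\<open>R X\<close> and \<open>S X\<close> are the tangential and normal parts of \<open>\<pi>\<^sub>2 f\<^sub>* X\<close>, and \<open>T \<xi>\<close> is the normal
  part of \<open>\<pi>\<^sub>2 \<xi>\<close>. Normal vectors are kept as vectors of the flat space.\<close>

definition R_tensor ::
  "'a rmanifold \<Rightarrow> (nat + nat) target \<Rightarrow> ('a \<Rightarrow> nat + nat \<Rightarrow> real) \<Rightarrow> 'a \<Rightarrow> 'a tvec \<Rightarrow> 'a tvec" where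
  "R_tensor M N f x X = (THE Y. Y \<in> tangent_space M x \<and>
     dvec Y f = orth_proj (form N) (image_tangent M f x) (proj2 (dvec X f)))"

definition S_tensor ::
  "'a rmanifold \<Rightarrow> (nat + nat) target \<Rightarrow> ('a \<Rightarrow> nat + nat \<Rightarrow> real) \<Rightarrow> 'a \<Rightarrow> 'a tvec
     \<Rightarrow> nat + nat \<Rightarrow> real" where
  "S_tensor M N f x X = orth_proj (form N) (normal_space M N f x) (proj2 (dvec X f))"

definition T_tensor ::
  "'a rmanifold \<Rightarrow> (nat + nat) target \<Rightarrow> ('a \<Rightarrow> nat + nat \<Rightarrow> real) \<Rightarrow> 'a \<Rightarrow> (nat + nat \<Rightarrow> real)
     \<Rightarrow> nat + nat \<Rightarrow> real" where
  "T_tensor M N f x \<xi> = orth_proj (form N) (normal_space M N f x) (proj2 \<xi>)"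

definition Phi_tensor ::
  "real \<Rightarrow> real \<Rightarrow> 'a rmanifold \<Rightarrow> (nat + nat) target \<Rightarrow> ('a \<Rightarrow> nat + nat \<Rightarrow> real) \<Rightarrow> 'a \<Rightarrow> 'a tvec
     \<Rightarrow> 'a tvec" where
  "Phi_tensor k1 k2 M N f x X = (\<lambda>h. k1 * X h - (k1 + k2) * R_tensor M N f x X h)"

section \<open>Subbundles of the normal bundle\<close>

text \<open>Orthogonal complement inside the normal space at \<open>x\<close>.\<close>

definition normal_orth ::
  "'a rmanifold \<Rightarrow> 'i target \<Rightarrow> ('a \<Rightarrow> 'i \<Rightarrow> real) \<Rightarrow> 'a \<Rightarrow> ('i \<Rightarrow> real) set \<Rightarrow> ('i \<Rightarrow> real) set" where
  "normal_orth M N f x V = {\<eta> \<in> normal_space M N f x. \<forall>\<xi>\<in>V. form N \<eta> \<xi> = 0}"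

definition normal_subbundle ::
  "'a rmanifold \<Rightarrow> 'i target \<Rightarrow> ('a \<Rightarrow> 'i \<Rightarrow> real) \<Rightarrow> nat \<Rightarrow> ('a \<Rightarrow> ('i \<Rightarrow> real) set) \<Rightarrow> bool" where
  "normal_subbundle M N f l L \<longleftrightarrow>
     (\<forall>x\<in>topspace (mtop M). L x \<subseteq> normal_space M N f x) \<and>
     (\<forall>x\<in>topspace (mtop M). \<exists>U e. openin (mtop M) U \<and> x \<in> U \<and>
        (\<forall>j<l. smooth_vec_on M U (e j)) \<and>
        (\<forall>y\<in>U. L y = {(\<lambda>i. \<Sum>j<l. c j * e j y i) | c. True} \<and>
           (\<forall>c. (\<forall>i. (\<Sum>j<l. c j * e j y i) = 0) \<longrightarrow> (\<forall>j<l. c j = 0))))"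

definition parallel_subbundle ::
  "'a rmanifold \<Rightarrow> 'i target \<Rightarrow> ('a \<Rightarrow> 'i \<Rightarrow> real) \<Rightarrow> ('a \<Rightarrow> ('i \<Rightarrow> real) set) \<Rightarrow> bool" where
  "parallel_subbundle M N f L \<longleftrightarrow>
     (\<forall>U \<xi>. openin (mtop M) U \<and> smooth_vec_on M U \<xi> \<and> (\<forall>y\<in>U. \<xi> y \<in> L y) \<longrightarrow>
        (\<forall>x\<in>U. \<forall>X\<in>tangent_space M x. normal_conn M N f x X \<xi> \<in> L x))"

end

theory Submission
  imports Defs
begin

text \<open>Suppose (ii) holds. Then \<open>\<Phi> = 0\<close> says that \<open>\<pi>\<^sub>2\<close> multiplies the metric of \<open>TM\<close> by \<open>b\<^sup>2\<close>, and
  together with the condition on \<open>T\<close> the same holds on the subspace \<open>F(x)\<close> of the flat space spanned by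
  \<open>f(x)\<close>, \<open>f\<^sub>*T\<^sub>xM\<close> and \<open>L(x)\<close>. Since \<open>N\<^sub>1 \<subseteq> L\<close> and \<open>L\<close> is parallel, \<open>F\<close> is parallel along \<open>M\<close> in the
  flat space and therefore constant. In an orthonormal basis of \<open>F\<close> the position vector \<open>f(x)\<close> has
  coordinates \<open>fbar(x)\<close> in a space form of curvature \<open>k\<close>, and the two components of the basis, divided by \<open>a\<close> and \<open>b\<close>,
  define \<open>j\<^sub>1\<close> and \<open>j\<^sub>2\<close>.

  Conversely, a totally geodesic embedding between space forms is locally the restriction of a linear map. So
  locally \<open>f = A \<circ> fbar\<close> with \<open>A\<close> linear and homothetic in each factor, and the image under \<open>A\<close> of the normal
  bundle of \<open>fbar\<close> is the required subbundle \<open>L\<close>.\<close>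

text \<open>Flat differentiation of a field \<open>Z\<close> tangent to the product along
  \<open>f\<close> produces, besides tangent and normal parts, the corrections
  \<open>-k1 <X,Z>_1 f_1\<close> and \<open>-k2 <X,Z>_2 f_2\<close> in two independent directions.
  For a general \<open>f\<close> the span of \<open>f(x)\<close>, the tangent space and
  \<open>L(x)\<close> is therefore not parallel. Where the two projections scale products by
  \<open>1 - b^2\<close> and \<open>b^2\<close>, the coefficients agree, because
  \<open>k1 (1 - b^2) = k2 b^2 = k1 k2 / (k1 + k2)\<close>. This is the origin of \<open>k\<close>:
  the corrections merge into \<open>-k <X,Z> f\<close>. For a tangent vector and a vector of
  \<open>L\<close> both vanish. Constancy of the span is proved without differential equations,
  through the vanishing derivative of the orthogonal projection onto it; at most one vector of the
  frame, the position vector, is time-like. In the converse direction the linear map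
  \<open>A\<close> exists only near each point, while \<open>L\<close> must be given on all of
  \<open>M\<close>. Hence \<open>L\<close> is defined by the differentials of the two totally
  geodesic maps, which every local \<open>A\<close> computes; its rank comes from a dimension count
  in the space form.\<close>

section \<open>Functions of class \<open>C\<^sup>k\<close>\<close>

text \<open>Coordinates from \<open>n\<close> on vanish on the whole space, so only \<open>n\<close>
  of the radii provided by a basic open box matter and their minimum is positive. The
  \<open>insert 1\<close> in \<open>d\<close> covers \<open>n = 0\<close>.\<close>

lemma Euclidean_space_open_box:
  assumes "openin (Euclidean_space n) U" "y \<in> U"
  obtains e where "e > 0"
    "\<And>z. z \<in> topspace (Euclidean_space n) \<Longrightarrow> (\<And>i. i < n \<Longrightarrow> \<bar>z i - y i\<bar> < e) \<Longrightarrow> z \<in> U"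
proof -
  obtain T where T: "openin (powertop_real UNIV) T" "U = T \<inter> {x. \<forall>i\<ge>n. x i = 0}"
    using assms(1) by (auto simp: Euclidean_space_def openin_subtopology)
  have "y \<in> T" using T assms by auto
  then obtain X where X: "\<And>i. openin euclideanreal (X i)" "y \<in> Pi\<^sub>E UNIV X" "Pi\<^sub>E UNIV X \<subseteq> T"
    using T(1) unfolding openin_product_topology_alt by (metis UNIV_I)
  have "\<exists>e>0. \<forall>s. \<bar>s - y i\<bar> < e \<longrightarrow> s \<in> X i" for i
  proof -
    have "y i \<in> X i" using X(2) by (auto simp: PiE_iff)
    then show ?thesis using X(1)[of i] unfolding open_openin[symmetric] open_dist dist_real_def by auto
  qed
  then obtain e where e: "\<And>i. e i > 0" "\<And>i s. \<bar>s - y i\<bar> < e i \<Longrightarrow> s \<in> X i" by metis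
  define d where "d = Min (insert 1 (e ` {..<n}))"
  have d: "d > 0" using e(1) by (auto simp: d_def)
  have de: "d \<le> e i" if "i < n" for i using that by (auto simp: d_def)
  have y0: "y \<in> {x. \<forall>i\<ge>n. x i = 0}" using assms T by auto
  show thesis
  proof (rule that[OF d])
    fix z assume z: "z \<in> topspace (Euclidean_space n)" "\<And>i. i < n \<Longrightarrow> \<bar>z i - y i\<bar> < d"
    have "z i \<in> X i" for i
    proof (cases "i < n")
      case True then show ?thesis using z(2)[OF True] de[OF True] by (intro e(2)) auto
    next
      case False
      then show ?thesis using z(1) y0 e(1)[of i] by (intro e(2)) (auto simp: topspace_Euclidean_space)
    qed
    then have "z \<in> T" using X(3) by (auto simp: PiE_iff)
    then show "z \<in> U" using z T by (auto simp: topspace_Euclidean_space)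
  qed
qed

lemma openin_Euclidean_subset:
  "openin (Euclidean_space n) U \<Longrightarrow> y \<in> U \<Longrightarrow> i \<ge> n \<Longrightarrow> y i = 0"
  using openin_subset by (fastforce simp: topspace_Euclidean_space)

text \<open>Partial derivatives probe \<open>F\<close> only on this line, so on an open set they
  depend on the values of \<open>F\<close> there alone.\<close>

lemma Euclidean_space_open_line:
  assumes "openin (Euclidean_space n) U" "y \<in> U" "i < n"
  shows "\<forall>\<^sub>F t in nhds (y i). y(i := t) \<in> U"
proof -
  obtain e where e: "e > 0"
    "\<And>z. z \<in> topspace (Euclidean_space n) \<Longrightarrow> (\<And>i. i < n \<Longrightarrow> \<bar>z i - y i\<bar> < e) \<Longrightarrow> z \<in> U"
    using Euclidean_space_open_box[OF assms(1,2)] by blast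
  have "y(i := t) \<in> U" if "dist t (y i) < e" for t
    by (rule e(2)) (use assms that e(1) openin_Euclidean_subset[OF assms(1,2)] in
        \<open>auto simp: topspace_Euclidean_space dist_real_def\<close>)
  then show ?thesis using e(1) by (auto simp: eventually_nhds_metric)
qed

section \<open>Congruence and closure properties of the class \<open>C_k\<close>\<close>

lemma C_k_DERIV:
  assumes "C_k n (Suc r) U F" "y \<in> U" "i < n"
  shows "((\<lambda>t. F (y(i := t))) has_field_derivative pderiv_at i F y) (at (y i))"
  using assms by (auto simp: pderiv_at_def DERIV_deriv_iff_field_differentiable)

lemma C_k_continuous: "C_k n r U F \<Longrightarrow> continuous_map (subtopology (Euclidean_space n) U) euclideanreal F"
  by (cases r) auto

lemma pderiv_at_cong:
  assumes "openin (Euclidean_space n) U" "\<And>y. y \<in> U \<Longrightarrow> F y = G y" "y \<in> U" "i < n"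
  shows "pderiv_at i F y = pderiv_at i G y"
  unfolding pderiv_at_def
  by (rule deriv_cong_ev)
    (use Euclidean_space_open_line[OF assms(1,3,4)] assms(2) in \<open>auto elim: eventually_mono\<close>)

lemma C_k_cong:
  assumes "openin (Euclidean_space n) U" "\<And>y. y \<in> U \<Longrightarrow> F y = G y" "C_k n r U F"
  shows "C_k n r U G"
  using assms(2,3)
proof (induction r arbitrary: F G)
  case 0
  then show ?case by (auto intro: continuous_map_eq)
next
  case (Suc r)
  have "(\<lambda>t. G (y(i := t))) field_differentiable at (y i)" if "y \<in> U" "i < n" for y i
  proof -
    have ev: "\<forall>\<^sub>F t in nhds (y i). F (y(i := t)) = G (y(i := t))"
      using Euclidean_space_open_line[OF assms(1) that] by (rule eventually_mono) (use Suc.prems(1) in blast)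
    have "((\<lambda>t. F (y(i := t))) has_field_derivative pderiv_at i F y) (at (y i))"
      using C_k_DERIV Suc.prems(2) that by blast
    then have "((\<lambda>t. G (y(i := t))) has_field_derivative pderiv_at i F y) (at (y i))"
      using ev by (subst DERIV_cong_ev[OF refl _ refl, symmetric]) auto
    then show ?thesis by (auto simp: field_differentiable_def)
  qed
  moreover have "C_k n r U (pderiv_at i G)" if "i < n" for i
    using Suc.IH[of "pderiv_at i F" "pderiv_at i G"] Suc.prems that
      pderiv_at_cong[OF assms(1) Suc.prems(1)] by auto
  ultimately show ?case using Suc.prems by (auto intro: continuous_map_eq)
qed

lemma C_k_Suc_imp: "C_k n (Suc r) U F \<Longrightarrow> C_k n r U F"
  by (induction r arbitrary: F) (auto simp: C_k_continuous)

lemma C_k_subset: "C_k n r U F \<Longrightarrow> V \<subseteq> U \<Longrightarrow> C_k n r V F"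
  by (induction r arbitrary: F) (auto intro: continuous_map_from_subtopology_mono)

text \<open>An explicit formula \<open>D\<close> may replace \<open>pderiv_at\<close>: the two agree
  on the open set \<open>U\<close>, and \<open>C_k_cong\<close> transfers the class. The closure
  rules below supply their differentiation formulas through \<open>D\<close>.\<close>

lemma C_k_SucI:
  assumes "openin (Euclidean_space n) U"
    and "continuous_map (subtopology (Euclidean_space n) U) euclideanreal F"
    and "\<And>i y. i < n \<Longrightarrow> y \<in> U \<Longrightarrow> ((\<lambda>t. F (y(i := t))) has_field_derivative D i y) (at (y i))"
    and "\<And>i. i < n \<Longrightarrow> C_k n r U (D i)"
  shows "C_k n (Suc r) U F"
proof -
  have "pderiv_at i F y = D i y" if "i < n" "y \<in> U" for i y
    using assms(3)[OF that] by (auto simp: pderiv_at_def DERIV_imp_deriv)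
  then show ?thesis
    using assms C_k_cong[OF assms(1) _ assms(4)] by (auto simp: field_differentiable_def) metis+
qed

lemma C_k_const: "openin (Euclidean_space n) U \<Longrightarrow> C_k n r U (\<lambda>y. c)"
proof (induction r arbitrary: c)
  case (Suc r)
  show ?case by (rule C_k_SucI[where D = "\<lambda>i y. 0"]) (use Suc in auto)
qed auto

lemma C_k_coord:
  assumes "openin (Euclidean_space n) U" shows "C_k n r U (\<lambda>y. y j)"
proof -
  have c: "continuous_map (subtopology (Euclidean_space n) U) euclideanreal (\<lambda>y. y j)"
    unfolding Euclidean_space_def subtopology_subtopology
    by (intro continuous_map_from_subtopology continuous_map_product_projection) auto
  show ?thesis
  proof (cases r)
    case (Suc s)
    show ?thesis unfolding Suc
      by (rule C_k_SucI[OF assms c, where D = "\<lambda>i y. if i = j then 1 else 0"])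
        (auto intro!: derivative_eq_intros C_k_const assms)
  qed (use c in auto)
qed

lemma C_k_add:
  "openin (Euclidean_space n) U \<Longrightarrow> C_k n r U F \<Longrightarrow> C_k n r U G \<Longrightarrow> C_k n r U (\<lambda>y. F y + G y)"
proof (induction r arbitrary: F G)
  case (Suc r)
  show ?case
  proof (rule C_k_SucI[where D = "\<lambda>i y. pderiv_at i F y + pderiv_at i G y"])
    fix i y assume "i < n" "y \<in> U"
    then show "((\<lambda>t. F (y(i := t)) + G (y(i := t))) has_real_derivative
            pderiv_at i F y + pderiv_at i G y) (at (y i))"
      using C_k_DERIV[OF Suc.prems(2)] C_k_DERIV[OF Suc.prems(3)] by (intro DERIV_add) blast+
  qed (use Suc in \<open>auto intro: continuous_map_add\<close>)
qed (auto intro: continuous_map_add)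

lemma C_k_mult:
  "openin (Euclidean_space n) U \<Longrightarrow> C_k n r U F \<Longrightarrow> C_k n r U G \<Longrightarrow> C_k n r U (\<lambda>y. F y * G y)"
proof (induction r arbitrary: F G)
  case (Suc r)
  show ?case
  proof (rule C_k_SucI[where D = "\<lambda>i y. pderiv_at i F y * G y + pderiv_at i G y * F y"])
    fix i assume i: "i < n"
    have "C_k n r U F" "C_k n r U G" using Suc.prems C_k_Suc_imp by blast+
    then show "C_k n r U (\<lambda>y. pderiv_at i F y * G y + pderiv_at i G y * F y)"
      using Suc.prems i by (intro C_k_add Suc.IH) auto
    fix y assume y: "y \<in> U"
    show "((\<lambda>t. F (y(i := t)) * G (y(i := t))) has_real_derivative
            pderiv_at i F y * G y + pderiv_at i G y * F y) (at (y i))"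
      by (rule DERIV_cong[OF DERIV_mult[OF C_k_DERIV[OF Suc.prems(2) y i] C_k_DERIV[OF Suc.prems(3) y i]]]) simp
  qed (use Suc.prems in \<open>auto intro: continuous_map_real_mult\<close>)
qed (auto intro: continuous_map_real_mult)

lemma C_k_sum:
  "openin (Euclidean_space n) U \<Longrightarrow> (\<And>j. j \<in> J \<Longrightarrow> C_k n r U (F j)) \<Longrightarrow>
    C_k n r U (\<lambda>y. \<Sum>j\<in>J. F j y)"
proof (induction J rule: infinite_finite_induct)
  case (insert x J)
  then show ?case by (auto intro: C_k_add)
qed (auto simp: C_k_const)

text \<open>The derivative of \<open>1/F\<close> is \<open>F'\<close> times a polynomial in
  \<open>1/F\<close> itself, so one more order of smoothness follows from the previous order with
  the same \<open>F\<close>.\<close>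

lemma C_k_inverse:
  "openin (Euclidean_space n) U \<Longrightarrow> C_k n r U F \<Longrightarrow> (\<And>y. y \<in> U \<Longrightarrow> F y \<noteq> 0) \<Longrightarrow>
     C_k n r U (\<lambda>y. inverse (F y))"
proof (induction r)
  case (Suc r)
  show ?case
  proof (rule C_k_SucI[where D = "\<lambda>i y. (- 1) * (pderiv_at i F y * (inverse (F y) * inverse (F y)))"])
    fix i assume i: "i < n"
    have "C_k n r U (\<lambda>y. inverse (F y))" using Suc C_k_Suc_imp by blast
    then show "C_k n r U (\<lambda>y. (- 1) * (pderiv_at i F y * (inverse (F y) * inverse (F y))))"
      using Suc.prems i by (intro C_k_mult C_k_const) auto
    fix y assume y: "y \<in> U"
    show "((\<lambda>t. inverse (F (y(i := t)))) has_real_derivative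
            (- 1) * (pderiv_at i F y * (inverse (F y) * inverse (F y)))) (at (y i))"
      by (rule DERIV_cong[OF DERIV_inverse'[OF C_k_DERIV[OF Suc.prems(2) y i]]])
        (use Suc.prems(3)[OF y] in auto)
  qed (use Suc.prems C_k_continuous in \<open>auto intro!: continuous_map_real_inverse simp: topspace_subtopology\<close>)
qed (auto intro!: continuous_map_real_inverse)

text \<open>Same scheme: the derivative contains the inverse of \<open>sqrt F\<close>, which
  \<open>C_k_inverse\<close> handles one order lower because \<open>F\<close> stays
  positive.\<close>

lemma C_k_sqrt:
  "openin (Euclidean_space n) U \<Longrightarrow> C_k n r U F \<Longrightarrow> (\<And>y. y \<in> U \<Longrightarrow> F y > 0) \<Longrightarrow>
     C_k n r U (\<lambda>y. sqrt (F y))"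
proof (induction r)
  case (Suc r)
  show ?case
  proof (rule C_k_SucI[where D = "\<lambda>i y. (1/2) * (pderiv_at i F y * inverse (sqrt (F y)))"])
    fix i assume i: "i < n"
    have "C_k n r U (\<lambda>y. sqrt (F y))" using Suc C_k_Suc_imp by blast
    moreover have "sqrt (F y) \<noteq> 0" if "y \<in> U" for y using Suc.prems(3)[OF that] by auto
    ultimately show "C_k n r U (\<lambda>y. (1/2) * (pderiv_at i F y * inverse (sqrt (F y))))"
      using Suc.prems i by (intro C_k_mult C_k_const C_k_inverse) auto
    fix y assume y: "y \<in> U"
    show "((\<lambda>t. sqrt (F (y(i := t)))) has_real_derivative
            (1/2) * (pderiv_at i F y * inverse (sqrt (F y)))) (at (y i))"
      by (rule DERIV_cong[OF DERIV_chain2[OF DERIV_real_sqrt C_k_DERIV[OF Suc.prems(2) y i]]])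
        (use Suc.prems(3)[OF y] in \<open>auto simp: field_simps\<close>)
  qed (use Suc.prems C_k_continuous in \<open>auto intro!: continuous_map_sqrt\<close>)
qed (auto intro!: continuous_map_sqrt)

section \<open>Differentiability, the chain rule and mixed partial derivatives\<close>

lemma C_k_open_near:
  assumes "openin (Euclidean_space n) U" "C_k n r U F" "y \<in> U" "e > 0"
  obtains d where "d > 0" "\<And>z. z \<in> topspace (Euclidean_space n) \<Longrightarrow>
    (\<And>i. i < n \<Longrightarrow> \<bar>z i - y i\<bar> < d) \<Longrightarrow> z \<in> U \<and> \<bar>F z - F y\<bar> < e"
proof -
  have "openin (subtopology (Euclidean_space n) U)
      {z \<in> topspace (subtopology (Euclidean_space n) U). F z \<in> {F y - e<..<F y + e}}"
    using C_k_continuous[OF assms(2)] by (rule openin_continuous_map_preimage) auto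
  then have "openin (Euclidean_space n) {z \<in> U. F z \<in> {F y - e<..<F y + e}}"
    using assms(1) openin_subset[OF assms(1)]
    by (auto simp: openin_open_subtopology topspace_subtopology Int_absorb1 cong: conj_cong)
  then obtain d where "d > 0" "\<And>z. z \<in> topspace (Euclidean_space n) \<Longrightarrow>
    (\<And>i. i < n \<Longrightarrow> \<bar>z i - y i\<bar> < d) \<Longrightarrow> z \<in> {z \<in> U. F z \<in> {F y - e<..<F y + e}}"
    by (rule Euclidean_space_open_box[where y = y]) (use assms in auto)
  then show thesis
    by (intro that[of d]) (blast, unfold abs_less_iff, fastforce)
qed

text \<open>The endpoints are unordered because a coordinate of \<open>z\<close> may lie on either
  side of the corresponding coordinate of \<open>y\<close>.\<close>

lemma real_MVT_between:
  fixes g :: "real \<Rightarrow> real"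
  assumes "a \<noteq> b" "\<And>t. min a b \<le> t \<Longrightarrow> t \<le> max a b \<Longrightarrow> DERIV g t :> g' t"
  shows "\<exists>t. min a b \<le> t \<and> t \<le> max a b \<and> g b - g a = g' t * (b - a)"
proof (cases "a < b")
  case True
  then obtain z where "a < z" "z < b" "g b - g a = (b - a) * g' z"
    using MVT2[of a b g g'] assms(2) by auto
  then show ?thesis using True by (intro exI[of _ z]) auto
next
  case False
  then have "b < a" using assms(1) by auto
  then obtain z where "b < z" "z < a" "g a - g b = (a - b) * g' z"
    using MVT2[of b a g g'] assms(2) by auto
  then show ?thesis by (intro exI[of _ z]) (auto simp: algebra_simps)
qed

text \<open>The passage from \<open>y\<close> to \<open>z\<close> changes one coordinate at a time.
  The mean value theorem on each edge gives \<open>q j\<close> as a partial derivative at an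
  intermediate point, and continuity of the partials makes \<open>q j\<close> tend to
  \<open>pderiv_at j F y\<close>. Continuous partials thus yield differentiability in a form without
  remainder.\<close>

lemma C_k_Caratheodory:
  assumes U: "openin (Euclidean_space n) U" and F: "C_k n (Suc 0) U F" and y: "y \<in> U"
  shows "\<exists>q. \<exists>d>0.
    (\<forall>z\<in>topspace (Euclidean_space n). (\<forall>i<n. \<bar>z i - y i\<bar> < d) \<longrightarrow>
        F z = F y + (\<Sum>j<n. q j z * (z j - y j))) \<and>
    (\<forall>e>0. \<exists>d>0. \<forall>z\<in>topspace (Euclidean_space n). (\<forall>i<n. \<bar>z i - y i\<bar> < d) \<longrightarrow>
        (\<forall>j<n. \<bar>q j z - pderiv_at j F y\<bar> < e))"
proof -
  \<comment> \<open>\<open>h z j\<close> is the corner reached after the first \<open>j\<close>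
    coordinates have been replaced: it starts at \<open>y\<close> and, for \<open>z\<close> in the
    space, ends at \<open>z\<close>.\<close>
  define h where "h z j = (\<lambda>i. if i < j then z i else y i)" for z :: "nat \<Rightarrow> real" and j :: nat
  obtain d0 where d0: "d0 > 0"
    "\<And>z. z \<in> topspace (Euclidean_space n) \<Longrightarrow> (\<And>i. i < n \<Longrightarrow> \<bar>z i - y i\<bar> < d0) \<Longrightarrow> z \<in> U"
    using Euclidean_space_open_box[OF U y] by blast
  have y0: "y i = 0" if "i \<ge> n" for i using openin_Euclidean_subset[OF U y that] .
  define P where "P j z t \<longleftrightarrow> min (y j) (z j) \<le> t \<and> t \<le> max (y j) (z j) \<and>
     F (h z (Suc j)) - F (h z j) = pderiv_at j F ((h z j)(j := t)) * (z j - y j)" for j z t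
  have box: "(h z j)(j := t) \<in> topspace (Euclidean_space n) \<and> (\<forall>i<n. \<bar>((h z j)(j := t)) i - y i\<bar> < d)"
    if "z \<in> topspace (Euclidean_space n)" "\<And>i. i < n \<Longrightarrow> \<bar>z i - y i\<bar> < d"
      "j < n" "min (y j) (z j) \<le> t" "t \<le> max (y j) (z j)" "d > 0" for z j t d
  proof -
    have "\<bar>t - y j\<bar> \<le> \<bar>z j - y j\<bar>" using that(4,5) by (auto simp: min_def max_def split: if_splits)
    then have "\<bar>t - y j\<bar> < d" using that(2)[OF that(3)] by linarith
    then have "\<bar>((h z j)(j := t)) i - y i\<bar> < d" if "i < n" for i
      using that(1) \<open>\<And>i. i < n \<Longrightarrow> \<bar>z i - y i\<bar> < d\<close> \<open>d > 0\<close> by (simp add: h_def)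
    moreover have "(h z j)(j := t) \<in> topspace (Euclidean_space n)"
      using that(1,3) y0 by (auto simp: h_def topspace_Euclidean_space)
    ultimately show ?thesis by blast
  qed
  have hn: "h z n = z" if "z \<in> topspace (Euclidean_space n)" for z
    using that y0 by (auto simp: h_def topspace_Euclidean_space fun_eq_iff)
  have ex: "\<exists>t. P j z t"
    if z: "z \<in> topspace (Euclidean_space n)" "\<And>i. i < n \<Longrightarrow> \<bar>z i - y i\<bar> < d0" and j: "j < n" for z j
  proof (cases "y j = z j")
    case True
    then have "h z (Suc j) = h z j" by (auto simp: h_def less_Suc_eq)
    then show ?thesis using True by (auto simp: P_def)
  next
    case False
    have "\<exists>t. min (y j) (z j) \<le> t \<and> t \<le> max (y j) (z j) \<and>
       F ((h z j)(j := z j)) - F ((h z j)(j := y j)) = pderiv_at j F ((h z j)(j := t)) * (z j - y j)"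
    proof (rule real_MVT_between[OF False])
      fix t assume "min (y j) (z j) \<le> t" "t \<le> max (y j) (z j)"
      then have "(h z j)(j := t) \<in> U" using box[OF z j _ _ d0(1)] d0(2) by blast
      then show "((\<lambda>t. F ((h z j)(j := t))) has_real_derivative pderiv_at j F ((h z j)(j := t))) (at t)"
        using C_k_DERIV[OF F _ j, of "(h z j)(j := t)"] by simp
    qed
    moreover have "(h z j)(j := z j) = h z (Suc j)" "(h z j)(j := y j) = h z j" by (auto simp: h_def)
    ultimately show ?thesis by (auto simp: P_def)
  qed
  \<comment> \<open>Outside the box the choice is arbitrary; the claims concern only points
    inside.\<close>
  define \<xi> where "\<xi> j z = (SOME t. P j z t)" for j z
  have \<xi>: "P j z (\<xi> j z)"
    if "z \<in> topspace (Euclidean_space n)" "\<And>i. i < n \<Longrightarrow> \<bar>z i - y i\<bar> < d0" "j < n" for z j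
    unfolding \<xi>_def using ex[OF that] by (rule someI_ex)
  show ?thesis
  proof (rule exI[of _ "\<lambda>j z. pderiv_at j F ((h z j)(j := \<xi> j z))"], rule exI[of _ d0], intro conjI d0(1) ballI impI allI)
    fix z assume z: "z \<in> topspace (Euclidean_space n)" and z': "\<forall>i<n. \<bar>z i - y i\<bar> < d0"
    have "F (h z n) - F (h z 0) = (\<Sum>j<n. F (h z (Suc j)) - F (h z j))"
      by (rule sum_lessThan_telescope[symmetric])
    also have "\<dots> = (\<Sum>j<n. pderiv_at j F ((h z j)(j := \<xi> j z)) * (z j - y j))"
      using \<xi>[OF z] z' by (auto simp: P_def)
    finally show "F z = F y + (\<Sum>j<n. pderiv_at j F ((h z j)(j := \<xi> j z)) * (z j - y j))"
      using hn[OF z] by (simp add: h_def)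
  next
    fix e :: real assume e: "e > 0"
    have "\<exists>d>0. \<forall>z\<in>topspace (Euclidean_space n). (\<forall>i<n. \<bar>z i - y i\<bar> < d) \<longrightarrow>
        \<bar>pderiv_at j F z - pderiv_at j F y\<bar> < e" if "j < n" for j
    proof -
      have "C_k n 0 U (pderiv_at j F)" using F that by simp
      then obtain d where "d > 0" "\<And>z. z \<in> topspace (Euclidean_space n) \<Longrightarrow>
          (\<And>i. i < n \<Longrightarrow> \<bar>z i - y i\<bar> < d) \<Longrightarrow> z \<in> U \<and> \<bar>pderiv_at j F z - pderiv_at j F y\<bar> < e"
        using C_k_open_near[OF U _ y e] by blast
      then show ?thesis by blast
    qed
    then obtain D where D: "\<And>j. j < n \<Longrightarrow> D j > 0" "\<And>j z. j < n \<Longrightarrow> z \<in> topspace (Euclidean_space n) \<Longrightarrow>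
        (\<forall>i<n. \<bar>z i - y i\<bar> < D j) \<Longrightarrow> \<bar>pderiv_at j F z - pderiv_at j F y\<bar> < e" by metis
    define d where "d = Min (insert d0 (D ` {..<n}))"
    have d: "d > 0" "d \<le> d0" "\<And>j. j < n \<Longrightarrow> d \<le> D j" using D(1) d0(1) by (auto simp: d_def)
    have "\<bar>pderiv_at j F ((h z j)(j := \<xi> j z)) - pderiv_at j F y\<bar> < e"
      if z: "z \<in> topspace (Euclidean_space n)" "\<forall>i<n. \<bar>z i - y i\<bar> < d" and j: "j < n" for z j
    proof -
      have "P j z (\<xi> j z)" using \<xi> z d(2) j by force
      then have "min (y j) (z j) \<le> \<xi> j z" "\<xi> j z \<le> max (y j) (z j)" by (auto simp: P_def)
      then have "(h z j)(j := \<xi> j z) \<in> topspace (Euclidean_space n) \<and>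
          (\<forall>i<n. \<bar>((h z j)(j := \<xi> j z)) i - y i\<bar> < d)"
        using z j d(1) by (intro box) auto
      then show ?thesis using D(2)[OF j] d(3)[OF j] by (meson less_le_trans)
    qed
    then show "\<exists>d>0. \<forall>z\<in>topspace (Euclidean_space n). (\<forall>i<n. \<bar>z i - y i\<bar> < d) \<longrightarrow>
        (\<forall>j<n. \<bar>pderiv_at j F ((h z j)(j := \<xi> j z)) - pderiv_at j F y\<bar> < e)"
      using d(1) by blast
  qed
qed

text \<open>With the remainder-free form at \<open>\<gamma> t0\<close>, the difference quotient of
  the composite is exactly a sum of \<open>q j\<close> times difference quotients of the
  coordinates, and the limit is taken termwise.\<close>

lemma C_k_chain_rule:
  assumes U: "openin (Euclidean_space n) U" and F: "C_k n (Suc 0) U F" and y: "\<gamma> t0 \<in> U"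
    and ev: "\<forall>\<^sub>F t in nhds t0. \<gamma> t \<in> topspace (Euclidean_space n)"
    and d: "\<And>j. j < n \<Longrightarrow> ((\<lambda>t. \<gamma> t j) has_real_derivative D j) (at t0)"
  shows "((\<lambda>t. F (\<gamma> t)) has_real_derivative (\<Sum>j<n. pderiv_at j F (\<gamma> t0) * D j)) (at t0)"
proof -
  obtain q \<delta> where \<delta>: "\<delta> > 0"
    and q1: "\<forall>z\<in>topspace (Euclidean_space n). (\<forall>i<n. \<bar>z i - \<gamma> t0 i\<bar> < \<delta>) \<longrightarrow>
        F z = F (\<gamma> t0) + (\<Sum>j<n. q j z * (z j - \<gamma> t0 j))"
    and q2: "\<forall>e>0. \<exists>d>0. \<forall>z\<in>topspace (Euclidean_space n). (\<forall>i<n. \<bar>z i - \<gamma> t0 i\<bar> < d) \<longrightarrow>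
        (\<forall>j<n. \<bar>q j z - pderiv_at j F (\<gamma> t0)\<bar> < e)"
    using C_k_Caratheodory[OF U F y] by blast
  have ev': "\<forall>\<^sub>F t in at t0. \<gamma> t \<in> topspace (Euclidean_space n)"
    using ev by (simp add: eventually_at_filter eventually_mono)
  have near: "\<forall>\<^sub>F t in at t0. \<forall>i\<in>{..<n}. \<bar>\<gamma> t i - \<gamma> t0 i\<bar> < e" if "e > 0" for e
  proof (rule eventually_ball_finite)
    show "\<forall>i\<in>{..<n}. \<forall>\<^sub>F t in at t0. \<bar>\<gamma> t i - \<gamma> t0 i\<bar> < e"
    proof
      fix i assume "i \<in> {..<n}"
      then have "isCont (\<lambda>t. \<gamma> t i) t0" using d DERIV_isCont by blast
      then show "\<forall>\<^sub>F t in at t0. \<bar>\<gamma> t i - \<gamma> t0 i\<bar> < e"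
        using that by (auto simp: isCont_def tendsto_iff dist_real_def)
    qed
  qed auto
  have lim: "((\<lambda>t. q j (\<gamma> t)) \<longlongrightarrow> pderiv_at j F (\<gamma> t0)) (at t0)" if "j < n" for j
  proof (rule tendstoI)
    fix e :: real assume "e > 0"
    then obtain d where d: "d > 0" "\<forall>z\<in>topspace (Euclidean_space n). (\<forall>i<n. \<bar>z i - \<gamma> t0 i\<bar> < d) \<longrightarrow>
        (\<forall>j<n. \<bar>q j z - pderiv_at j F (\<gamma> t0)\<bar> < e)" using q2 by blast
    show "\<forall>\<^sub>F t in at t0. dist (q j (\<gamma> t)) (pderiv_at j F (\<gamma> t0)) < e"
      using near[OF d(1)] ev' by eventually_elim (use that d(2) in \<open>auto simp: dist_real_def\<close>)
  qed
  have "((\<lambda>t. \<Sum>j<n. q j (\<gamma> t) * ((\<gamma> t j - \<gamma> t0 j) / (t - t0))) \<longlongrightarrow> (\<Sum>j<n. pderiv_at j F (\<gamma> t0) * D j)) (at t0)"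
    using lim d by (intro tendsto_sum tendsto_mult) (auto simp: has_field_derivative_iff)
  moreover have "\<forall>\<^sub>F t in at t0. (\<Sum>j<n. q j (\<gamma> t) * ((\<gamma> t j - \<gamma> t0 j) / (t - t0))) =
      (F (\<gamma> t) - F (\<gamma> t0)) / (t - t0)"
    using near[OF \<delta>] ev'
  proof eventually_elim
    case (elim t)
    then have "F (\<gamma> t) = F (\<gamma> t0) + (\<Sum>j<n. q j (\<gamma> t) * (\<gamma> t j - \<gamma> t0 j))"
      using q1 by auto
    then show ?case by (simp add: sum_divide_distrib)
  qed
  ultimately show ?thesis
    unfolding has_field_derivative_iff by (rule Lim_transform_eventually)
qed

text \<open>Induction on the order with \<open>F\<close> arbitrary: by the chain rule a partial
  derivative of the composite contains \<open>pderiv_at j F\<close> composed with the same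
  \<open>G\<close>, to which the hypothesis one order lower applies.\<close>

lemma C_k_compose:
  assumes U: "openin (Euclidean_space n) U" and V: "openin (Euclidean_space m) V"
  shows "C_k n r U F \<Longrightarrow> (\<And>j. j < n \<Longrightarrow> C_k m r V (\<lambda>y. G y j)) \<Longrightarrow> (\<And>y. y \<in> V \<Longrightarrow> G y \<in> U) \<Longrightarrow>
      C_k m r V (\<lambda>y. F (G y))"
proof (induction r arbitrary: F)
  case 0
  \<comment> \<open>Continuity into \<open>Euclidean_space n\<close> is characterised for maps that
    are cut off at index \<open>n\<close>; on \<open>V\<close> the cut-off changes nothing.\<close>
  have "continuous_map (subtopology (Euclidean_space m) V) (Euclidean_space n)
      (\<lambda>y i. if i < n then G y i else 0)"
    using 0 by (simp add: continuous_map_componentwise_Euclidean_space)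
  moreover have "(\<lambda>i. if i < n then G y i else 0) = G y" if "y \<in> V" for y
    using openin_Euclidean_subset[OF U 0(3)[OF that]] by auto
  ultimately have "continuous_map (subtopology (Euclidean_space m) V) (Euclidean_space n) G"
    by (rule continuous_map_eq) auto
  then have "continuous_map (subtopology (Euclidean_space m) V) (subtopology (Euclidean_space n) U) G"
    using 0 by (auto simp: continuous_map_in_subtopology)
  then show ?case using 0(1) continuous_map_compose by (fastforce simp: o_def)
next
  case (Suc r)
  have G: "C_k m r V (\<lambda>y. G y j)" if "j < n" for j
    using Suc.prems(2)[OF that] C_k_Suc_imp by blast
  have F: "C_k n (Suc 0) U F"
    using Suc.prems(1) C_k_continuous by auto
  show ?case
  proof (rule C_k_SucI[OF V, where D = "\<lambda>i y. \<Sum>j<n. pderiv_at j F (G y) * pderiv_at i (\<lambda>y. G y j) y"])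
    have "C_k m r V (\<lambda>y. F (G y))" using Suc.IH[OF C_k_Suc_imp] Suc.prems G by blast
    then show "continuous_map (subtopology (Euclidean_space m) V) euclideanreal (\<lambda>y. F (G y))"
      by (rule C_k_continuous)
  next
    fix i y assume i: "i < m" and y: "y \<in> V"
    have "((\<lambda>t. F (G (y(i := t)))) has_real_derivative
       (\<Sum>j<n. pderiv_at j F (G (y(i := y i))) * pderiv_at i (\<lambda>y. G y j) y)) (at (y i))"
    proof (rule C_k_chain_rule[OF U F])
      show "G (y(i := y i)) \<in> U" using Suc.prems(3) y by simp
      show "\<forall>\<^sub>F t in nhds (y i). G (y(i := t)) \<in> topspace (Euclidean_space n)"
        using Euclidean_space_open_line[OF V y i]
        by eventually_elim (use Suc.prems(3) openin_subset[OF U] in blast)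
      show "((\<lambda>t. G (y(i := t)) j) has_real_derivative pderiv_at i (\<lambda>y. G y j) y) (at (y i))"
        if "j < n" for j using C_k_DERIV[OF Suc.prems(2)[OF that] y i] .
    qed
    then show "((\<lambda>t. F (G (y(i := t)))) has_real_derivative
       (\<Sum>j<n. pderiv_at j F (G y) * pderiv_at i (\<lambda>y. G y j) y)) (at (y i))"
      by simp
  next
    fix i assume i: "i < m"
    show "C_k m r V (\<lambda>y. \<Sum>j<n. pderiv_at j F (G y) * pderiv_at i (\<lambda>y. G y j) y)"
    proof (intro C_k_sum C_k_mult V)
      fix j assume "j \<in> {..<n}"
      then have j: "j < n" by simp
      show "C_k m r V (\<lambda>y. pderiv_at j F (G y))"
        by (rule Suc.IH) (use Suc.prems(1) j G Suc.prems(3) in \<open>simp_all\<close>)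
      show "C_k m r V (pderiv_at i (\<lambda>y. G y j))"
        using Suc.prems(2)[OF j] i by simp
    qed
  qed
qed

text \<open>A box is convex, so the segment from \<open>y\<close> to \<open>z\<close> stays in
  \<open>U\<close> and \<open>F\<close> has derivative 0 along it.\<close>

lemma C_k_locally_constant:
  assumes U: "openin (Euclidean_space n) U" and F: "C_k n (Suc 0) U F" and y: "y \<in> U"
    and 0: "\<And>z i. z \<in> U \<Longrightarrow> i < n \<Longrightarrow> pderiv_at i F z = 0"
    and d: "\<And>z. z \<in> topspace (Euclidean_space n) \<Longrightarrow>
      (\<And>i. i < n \<Longrightarrow> \<bar>z i - y i\<bar> < d) \<Longrightarrow> z \<in> U"
    and z: "z \<in> topspace (Euclidean_space n)" "\<And>i. i < n \<Longrightarrow> \<bar>z i - y i\<bar> < d"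
  shows "F z = F y"
proof -
    define \<gamma> where "\<gamma> t = (\<lambda>i. y i + t * (z i - y i))" for t :: real
    have E: "\<gamma> t \<in> topspace (Euclidean_space n)" for t
      using z(1) openin_Euclidean_subset[OF U y] by (auto simp: \<gamma>_def topspace_Euclidean_space)
    have "((\<lambda>t. F (\<gamma> t)) has_real_derivative 0) (at t)" if "0 \<le> t" "t \<le> 1" for t
    proof -
      have "\<bar>\<gamma> t i - y i\<bar> < d" if "i < n" for i
      proof -
        have "\<bar>\<gamma> t i - y i\<bar> \<le> \<bar>z i - y i\<bar>"
          using \<open>0 \<le> t\<close> \<open>t \<le> 1\<close> mult_right_mono[of t 1 "\<bar>z i - y i\<bar>"] by (simp add: \<gamma>_def abs_mult)
        then show ?thesis using z(2)[OF that] by simp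
      qed
      then have "\<gamma> t \<in> U" using d E by blast
      then have "((\<lambda>t. F (\<gamma> t)) has_real_derivative (\<Sum>j<n. pderiv_at j F (\<gamma> t) * (z j - y j))) (at t)"
        by (rule C_k_chain_rule[OF U F])
          (use E in \<open>auto simp: \<gamma>_def intro!: derivative_eq_intros\<close>)
      then show ?thesis using 0 \<open>\<gamma> t \<in> U\<close> by simp
    qed
    then have "F (\<gamma> 1) = F (\<gamma> 0)"
      by (intro DERIV_isconst2[of 0 1 "\<lambda>t. F (\<gamma> t)"])
        (auto intro!: continuous_at_imp_continuous_on DERIV_isCont)
    then show ?thesis by (simp add: \<gamma>_def)
qed

text \<open>Mean value theorem twice: in direction \<open>i\<close> for the change of
  \<open>F\<close> across a step \<open>h\<close> in direction \<open>j\<close>, then in direction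
  \<open>j\<close> for \<open>pderiv_at i F\<close>.\<close>

lemma C_k_second_difference:
  assumes F: "C_k n (Suc (Suc 0)) U F" and ij: "i < n" "j < n" "i \<noteq> j" and h: "h > 0"
    and U: "\<And>s t. 0 \<le> s \<Longrightarrow> s \<le> h \<Longrightarrow> 0 \<le> t \<Longrightarrow> t \<le> h \<Longrightarrow> y(i := y i + s, j := y j + t) \<in> U"
  shows "\<exists>s t. 0 \<le> s \<and> s \<le> h \<and> 0 \<le> t \<and> t \<le> h \<and>
     F (y(i := y i + h, j := y j + h)) - F (y(i := y i + h)) - F (y(j := y j + h)) + F y
       = h * h * pderiv_at j (pderiv_at i F) (y(i := y i + s, j := y j + t))"
proof -
  define p where "p s t = y(i := y i + s, j := y j + t)" for s t
  have F1: "C_k n (Suc 0) U F" and Fi: "C_k n (Suc 0) U (pderiv_at i F)"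
    using F ij C_k_continuous by auto
  have d1: "((\<lambda>s. G (p s t)) has_real_derivative pderiv_at i G (p s t)) (at s)"
    if "C_k n (Suc 0) U G" "0 \<le> s" "s \<le> h" "0 \<le> t" "t \<le> h" for s t G
  proof -
    have eq: "(p s t)(i := x) = p (x - y i) t" for x using ij by (auto simp: p_def)
    have "((\<lambda>x. G (p (x - y i) t)) has_real_derivative pderiv_at i G (p s t)) (at (y i + s))"
      using C_k_DERIV[OF that(1) U[OF that(2-5)] ij(1)] ij(3) eq unfolding p_def by simp
    from DERIV_shift[THEN iffD1, OF this[unfolded add.commute[of "y i"]]]
    show ?thesis by simp
  qed
  have d2: "((\<lambda>t. G (p s t)) has_real_derivative pderiv_at j G (p s t)) (at t)"
    if "C_k n (Suc 0) U G" "0 \<le> s" "s \<le> h" "0 \<le> t" "t \<le> h" for s t G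
  proof -
    have eq: "(p s t)(j := x) = p s (x - y j)" for x using ij by (auto simp: p_def)
    have "((\<lambda>x. G (p s (x - y j))) has_real_derivative pderiv_at j G (p s t)) (at (y j + t))"
      using C_k_DERIV[OF that(1) U[OF that(2-5)] ij(2)] ij(3) eq unfolding p_def by simp
    from DERIV_shift[THEN iffD1, OF this[unfolded add.commute[of "y j"]]]
    show ?thesis by simp
  qed
  have "\<exists>s. 0 < s \<and> s < h \<and>
    (F (p h h) - F (p h 0)) - (F (p 0 h) - F (p 0 0)) = (h - 0) * (pderiv_at i F (p s h) - pderiv_at i F (p s 0))"
    by (rule MVT2[OF h]) (rule DERIV_diff; rule d1[OF F1]; use h in simp)
  then obtain s where s: "0 < s" "s < h"
    "(F (p h h) - F (p h 0)) - (F (p 0 h) - F (p 0 0)) = (h - 0) * (pderiv_at i F (p s h) - pderiv_at i F (p s 0))"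
    by blast
  have "\<exists>t. 0 < t \<and> t < h \<and>
    pderiv_at i F (p s h) - pderiv_at i F (p s 0) = (h - 0) * pderiv_at j (pderiv_at i F) (p s t)"
    by (rule MVT2[OF h]) (rule d2[OF Fi]; use s in simp)
  then obtain t where t: "0 < t" "t < h"
    "pderiv_at i F (p s h) - pderiv_at i F (p s 0) = (h - 0) * pderiv_at j (pderiv_at i F) (p s t)"
    by blast
  have "p h 0 = y(i := y i + h)" "p 0 h = y(j := y j + h)" "p 0 0 = y" using ij by (auto simp: p_def)
  then have "F (p h h) - F (y(i := y i + h)) - F (y(j := y j + h)) + F y =
     h * h * pderiv_at j (pderiv_at i F) (p s t)"
    using s(3) t(3) by simp
  then show ?thesis using s t unfolding p_def by (intro exI[of _ s] exI[of _ t]) auto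
qed

text \<open>The second difference is symmetric in \<open>i\<close> and \<open>j\<close>, so both
  mixed partials attain a common value, each at some point of an arbitrarily small square.
  Continuity forces equality at \<open>y\<close>.\<close>

lemma C_k_mixed_partials:
  assumes U: "openin (Euclidean_space n) U" and F: "C_k n (Suc (Suc 0)) U F" and y: "y \<in> U"
    and ij: "i < n" "j < n"
  shows "pderiv_at i (pderiv_at j F) y = pderiv_at j (pderiv_at i F) y"
proof (cases "i = j")
  case False
  have C: "C_k n 0 U (pderiv_at i (pderiv_at j F))" "C_k n 0 U (pderiv_at j (pderiv_at i F))"
    using F ij by simp_all
  show ?thesis
  proof (rule ccontr)
    assume ne: "\<not> ?thesis"
    \<comment> \<open>Half the gap: two errors below \<open>e\<close> cannot bridge it.\<close>
    define e where "e = \<bar>pderiv_at i (pderiv_at j F) y - pderiv_at j (pderiv_at i F) y\<bar> / 2"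
    have e: "e > 0" using ne by (auto simp: e_def)
    obtain d1 where d1: "d1 > 0" "\<And>z. z \<in> topspace (Euclidean_space n) \<Longrightarrow>
      (\<And>k. k < n \<Longrightarrow> \<bar>z k - y k\<bar> < d1) \<Longrightarrow>
      z \<in> U \<and> \<bar>pderiv_at i (pderiv_at j F) z - pderiv_at i (pderiv_at j F) y\<bar> < e"
      using C_k_open_near[OF U C(1) y e] by blast
    obtain d2 where d2: "d2 > 0" "\<And>z. z \<in> topspace (Euclidean_space n) \<Longrightarrow>
      (\<And>k. k < n \<Longrightarrow> \<bar>z k - y k\<bar> < d2) \<Longrightarrow>
      z \<in> U \<and> \<bar>pderiv_at j (pderiv_at i F) z - pderiv_at j (pderiv_at i F) y\<bar> < e"
      using C_k_open_near[OF U C(2) y e] by blast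
    define h where "h = min d1 d2 / 2"
    have h: "h > 0" "h < d1" "h < d2" using d1 d2 by (auto simp: h_def)
    have box: "y(i := y i + s, j := y j + t) \<in> topspace (Euclidean_space n)"
      "\<bar>(y(i := y i + s, j := y j + t)) k - y k\<bar> \<le> h"
      if "0 \<le> s" "s \<le> h" "0 \<le> t" "t \<le> h" for s t k
      using that openin_Euclidean_subset[OF U y] ij h by (auto simp: topspace_Euclidean_space)
    have near: "y(i := y i + s, j := y j + t) \<in> U"
      "\<bar>pderiv_at i (pderiv_at j F) (y(i := y i + s, j := y j + t)) - pderiv_at i (pderiv_at j F) y\<bar> < e"
      "\<bar>pderiv_at j (pderiv_at i F) (y(i := y i + s, j := y j + t)) - pderiv_at j (pderiv_at i F) y\<bar> < e"
      if "0 \<le> s" "s \<le> h" "0 \<le> t" "t \<le> h" for s t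
      using d1(2)[OF box(1)[OF that]] d2(2)[OF box(1)[OF that]] box(2)[OF that] h
      by (meson le_less_trans)+
    obtain s t where st: "0 \<le> s" "s \<le> h" "0 \<le> t" "t \<le> h"
      "F (y(i := y i + h, j := y j + h)) - F (y(i := y i + h)) - F (y(j := y j + h)) + F y
       = h * h * pderiv_at j (pderiv_at i F) (y(i := y i + s, j := y j + t))"
      using C_k_second_difference[OF F ij False h(1)] near(1) by blast
    have "\<exists>s t. 0 \<le> s \<and> s \<le> h \<and> 0 \<le> t \<and> t \<le> h \<and>
       F (y(j := y j + h, i := y i + h)) - F (y(j := y j + h)) - F (y(i := y i + h)) + F y
         = h * h * pderiv_at i (pderiv_at j F) (y(j := y j + s, i := y i + t))"
      using near(1) False
      by (intro C_k_second_difference[OF F ij(2,1) False[symmetric] h(1)])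
        (auto simp: fun_upd_twist[OF False])
    then obtain s' t' where st': "0 \<le> s'" "s' \<le> h" "0 \<le> t'" "t' \<le> h"
      "F (y(i := y i + h, j := y j + h)) - F (y(j := y j + h)) - F (y(i := y i + h)) + F y
       = h * h * pderiv_at i (pderiv_at j F) (y(i := y i + t', j := y j + s'))"
      by (auto simp: fun_upd_twist[OF False])
    have "h * h * pderiv_at j (pderiv_at i F) (y(i := y i + s, j := y j + t)) =
      h * h * pderiv_at i (pderiv_at j F) (y(i := y i + t', j := y j + s'))"
      using st(5) st'(5) by linarith
    then have "pderiv_at j (pderiv_at i F) (y(i := y i + s, j := y j + t)) =
      pderiv_at i (pderiv_at j F) (y(i := y i + t', j := y j + s'))"
      using h(1) by simp
    then have "\<bar>pderiv_at i (pderiv_at j F) y - pderiv_at j (pderiv_at i F) y\<bar> < e + e"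
      using near(3)[OF st(1-4)] near(2)[OF st'(3,4,1,2)] by linarith
    then show False by (simp add: e_def)
  qed
qed simp

section \<open>Charts and tangent vectors\<close>

text \<open>The common setting of \<open>M\<close> and of the space forms \<open>Q_manifold\<close>:
  the calculus below is interpreted for both, so that totally geodesic maps between space forms are
  treated like \<open>f\<close>.\<close>

locale smooth_atlas =
  fixes M :: "'a rmanifold"
  assumes cover: "topspace (mtop M) = (\<Union>(U, \<phi>)\<in>atlas M. U)"
    and chart_open: "c \<in> atlas M \<Longrightarrow> openin (mtop M) (fst c)"
    and chart_image: "c \<in> atlas M \<Longrightarrow> openin (Euclidean_space (mdim M)) (snd c ` fst c)"
    and chart_homeo: "c \<in> atlas M \<Longrightarrow> homeomorphic_map (subtopology (mtop M) (fst c))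
          (subtopology (Euclidean_space (mdim M)) (snd c ` fst c)) (snd c)"
    and transition: "c \<in> atlas M \<Longrightarrow> c' \<in> atlas M \<Longrightarrow> i < mdim M \<Longrightarrow>
        C_inf (mdim M) (snd c ` (fst c \<inter> fst c')) (\<lambda>y. snd c' (inv_into (fst c) (snd c) y) i)"

lemma smooth_manifold_imp_smooth_atlas: "smooth_manifold M \<Longrightarrow> smooth_atlas M"
  unfolding smooth_manifold_def by unfold_locales (auto simp: case_prod_beta)

definition loc :: "'a chart \<Rightarrow> ('a \<Rightarrow> real) \<Rightarrow> (nat \<Rightarrow> real) \<Rightarrow> real" where
  "loc c h = (\<lambda>y. h (inv_into (fst c) (snd c) y))"

context smooth_atlas
begin

lemma topspace_chart:
  assumes "x \<in> topspace (mtop M)"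
  obtains c where "c \<in> atlas M" "x \<in> fst c"
  using assms cover by auto

lemma chart_inj: "c \<in> atlas M \<Longrightarrow> inj_on (snd c) (fst c)"
  using homeomorphic_imp_injective_map[OF chart_homeo] openin_subset[OF chart_open]
  by (auto simp: topspace_subtopology Int_absorb1)

lemma chart_inv: "c \<in> atlas M \<Longrightarrow> x \<in> fst c \<Longrightarrow> inv_into (fst c) (snd c) (snd c x) = x"
  using chart_inj by (auto intro: inv_into_f_f)

lemma loc_chart: "c \<in> atlas M \<Longrightarrow> x \<in> fst c \<Longrightarrow> loc c h (snd c x) = h x"
  by (simp add: loc_def chart_inv)

lemma chart_image_openin:
  assumes c: "c \<in> atlas M" and W: "openin (mtop M) W"
  shows "openin (Euclidean_space (mdim M)) (snd c ` (fst c \<inter> W))"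
proof -
  have "openin (subtopology (mtop M) (fst c)) (fst c \<inter> W)"
    using W by (metis inf_commute openin_subtopology_Int)
  then have "openin (subtopology (Euclidean_space (mdim M)) (snd c ` fst c)) (snd c ` (fst c \<inter> W))"
    using homeomorphic_imp_open_map[OF chart_homeo[OF c]] by (auto simp: open_map_def)
  then show ?thesis using openin_trans_full chart_image[OF c] by blast
qed

lemma smooth_funD:
  "smooth_fun_on M W h \<Longrightarrow> c \<in> atlas M \<Longrightarrow> C_k (mdim M) r (snd c ` (fst c \<inter> W)) (loc c h)"
  unfolding smooth_fun_on_def C_inf_def loc_def by (auto simp: case_prod_beta)

lemma smooth_funI:
  "(\<And>c r. c \<in> atlas M \<Longrightarrow> C_k (mdim M) r (snd c ` (fst c \<inter> W)) (loc c h)) \<Longrightarrow> smooth_fun_on M W h"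
  unfolding smooth_fun_on_def C_inf_def loc_def by fastforce

lemma smooth_fun_subset: "smooth_fun_on M W h \<Longrightarrow> V \<subseteq> W \<Longrightarrow> smooth_fun_on M V h"
  by (rule smooth_funI, rule C_k_subset, rule smooth_funD) auto

lemma smooth_fun_cong:
  assumes "openin (mtop M) W" "\<And>x. x \<in> W \<Longrightarrow> h x = g x" "smooth_fun_on M W h"
  shows "smooth_fun_on M W g"
proof (rule smooth_funI)
  fix c r assume c: "c \<in> atlas M"
  have "loc c h y = loc c g y" if "y \<in> snd c ` (fst c \<inter> W)" for y
    using that c assms(2) by (auto simp: loc_chart[OF c])
  then show "C_k (mdim M) r (snd c ` (fst c \<inter> W)) (loc c g)"
    by (rule C_k_cong[OF chart_image_openin[OF c assms(1)] _ smooth_funD[OF assms(3) c]])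
qed

lemma smooth_const: "openin (mtop M) W \<Longrightarrow> smooth_fun_on M W (\<lambda>x. a)"
  by (rule smooth_funI) (simp add: loc_def C_k_const chart_image_openin)

lemma smooth_add: "openin (mtop M) W \<Longrightarrow> smooth_fun_on M W h \<Longrightarrow> smooth_fun_on M W g \<Longrightarrow>
    smooth_fun_on M W (\<lambda>x. h x + g x)"
  by (rule smooth_funI)
    (use C_k_add[OF chart_image_openin smooth_funD smooth_funD] in \<open>auto simp: loc_def\<close>)

lemma smooth_mult: "openin (mtop M) W \<Longrightarrow> smooth_fun_on M W h \<Longrightarrow> smooth_fun_on M W g \<Longrightarrow>
    smooth_fun_on M W (\<lambda>x. h x * g x)"
  by (rule smooth_funI)
    (use C_k_mult[OF chart_image_openin smooth_funD smooth_funD] in \<open>auto simp: loc_def\<close>)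

lemma smooth_sum: "openin (mtop M) W \<Longrightarrow> (\<And>j. j \<in> J \<Longrightarrow> smooth_fun_on M W (h j)) \<Longrightarrow>
    smooth_fun_on M W (\<lambda>x. \<Sum>j\<in>J. h j x)"
  by (induction J rule: infinite_finite_induct) (auto intro: smooth_add smooth_const)

lemma smooth_diff: "openin (mtop M) W \<Longrightarrow> smooth_fun_on M W h \<Longrightarrow> smooth_fun_on M W g \<Longrightarrow>
    smooth_fun_on M W (\<lambda>x. h x - g x)"
  using smooth_add[OF _ _ smooth_mult[OF _ smooth_const[where a = "-1"]]] by fastforce

lemma smooth_inverse:
  assumes "openin (mtop M) W" "smooth_fun_on M W h" "\<And>x. x \<in> W \<Longrightarrow> h x \<noteq> 0"
  shows "smooth_fun_on M W (\<lambda>x. inverse (h x))"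
proof (rule smooth_funI)
  fix c r assume "c \<in> atlas M"
  then show "C_k (mdim M) r (snd c ` (fst c \<inter> W)) (loc c (\<lambda>x. inverse (h x)))"
    unfolding loc_def using assms(3)
    by (intro C_k_inverse[OF chart_image_openin smooth_funD[unfolded loc_def]])
      (auto simp: chart_inv assms(1,2))
qed

lemma smooth_sqrt:
  assumes "openin (mtop M) W" "smooth_fun_on M W h" "\<And>x. x \<in> W \<Longrightarrow> h x > 0"
  shows "smooth_fun_on M W (\<lambda>x. sqrt (h x))"
proof (rule smooth_funI)
  fix c r assume "c \<in> atlas M"
  then show "C_k (mdim M) r (snd c ` (fst c \<inter> W)) (loc c (\<lambda>x. sqrt (h x)))"
    unfolding loc_def using assms(3)
    by (intro C_k_sqrt[OF chart_image_openin smooth_funD[unfolded loc_def]])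
      (auto simp: chart_inv assms(1,2))
qed

lemmas smooth_intros = smooth_const smooth_add smooth_mult smooth_sum smooth_diff

lemma smooth_chart: "c \<in> atlas M \<Longrightarrow> i < mdim M \<Longrightarrow> smooth_fun_on M (fst c) (\<lambda>x. snd c x i)"
  by (rule smooth_funI) (use transition in \<open>auto simp: C_inf_def loc_def\<close>)

text \<open>Smooth functions are continuous in each chart and charts are homeomorphisms.
  Neighbourhoods are shrunk in this form below, to keep a norm positive in Gram-Schmidt or to keep
  coordinates close to those of a point.\<close>

lemma openin_positive:
  assumes W: "openin (mtop M) W" and h: "smooth_fun_on M W h"
  shows "openin (mtop M) {x \<in> W. h x > 0}"
proof -
  have "openin (mtop M) {x \<in> fst c \<inter> W. h x > 0}" if c: "c \<in> atlas M" for c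
  proof -
    let ?E = "Euclidean_space (mdim M)" and ?V = "snd c ` (fst c \<inter> W)"
    have "openin (subtopology ?E ?V) {z \<in> topspace (subtopology ?E ?V). loc c h z \<in> {0<..}}"
      using C_k_continuous[OF smooth_funD[OF h c, of 0]]
      by (rule openin_continuous_map_preimage) auto
    then have "openin ?E {z \<in> topspace (subtopology ?E ?V). loc c h z \<in> {0<..}}"
      using openin_trans_full chart_image_openin[OF c W] by blast
    moreover have "{z \<in> topspace (subtopology ?E ?V). loc c h z \<in> {0<..}} = {z \<in> ?V. loc c h z > 0}"
      using openin_subset[OF chart_image_openin[OF c W]] by (auto simp: topspace_subtopology)
    ultimately have "openin ?E {z \<in> ?V. loc c h z > 0}" by simp
    then have "openin (subtopology ?E (snd c ` fst c)) {z \<in> ?V. loc c h z > 0}"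
      by (subst openin_open_subtopology[OF chart_image[OF c]]) auto
    then have "openin (subtopology (mtop M) (fst c))
       {x \<in> topspace (subtopology (mtop M) (fst c)). snd c x \<in> {z \<in> ?V. loc c h z > 0}}"
      using homeomorphic_imp_continuous_map[OF chart_homeo[OF c]] openin_continuous_map_preimage by blast
    moreover have "{x \<in> topspace (subtopology (mtop M) (fst c)). snd c x \<in> {z \<in> ?V. loc c h z > 0}} =
        {x \<in> fst c \<inter> W. h x > 0}"
    proof -
      have "topspace (subtopology (mtop M) (fst c)) = fst c"
        using openin_subset[OF chart_open[OF c]] by (simp add: Int_absorb1)
      moreover have "snd c x \<in> {z \<in> ?V. loc c h z > 0} \<longleftrightarrow> x \<in> W \<and> h x > 0" if "x \<in> fst c" for x
        using inj_on_image_mem_iff[OF chart_inj[OF c] that, of "fst c \<inter> W"] that loc_chart[OF c that, of h]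
        by simp
      ultimately show ?thesis by blast
    qed
    ultimately have "openin (subtopology (mtop M) (fst c)) {x \<in> fst c \<inter> W. h x > 0}"
      by (simp only:)
    then show ?thesis using openin_trans_full chart_open[OF c] by blast
  qed
  then have "openin (mtop M) (\<Union>c\<in>atlas M. {x \<in> fst c \<inter> W. h x > 0})" by blast
  moreover have "(\<Union>c\<in>atlas M. {x \<in> fst c \<inter> W. h x > 0}) = {x \<in> W. h x > 0}"
  proof (intro equalityI subsetI)
    fix x assume x: "x \<in> {x \<in> W. h x > 0}"
    then obtain c where "c \<in> atlas M" "x \<in> fst c"
      using openin_subset[OF W] topspace_chart[of x] by blast
    then show "x \<in> (\<Union>c\<in>atlas M. {x \<in> fst c \<inter> W. h x > 0})" using x by blast
  qed blast
  ultimately show ?thesis by simp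
qed

lemma smooth_nearI: "openin (mtop M) W \<Longrightarrow> x \<in> W \<Longrightarrow> smooth_fun_on M W h \<Longrightarrow> smooth_near M x h"
  unfolding smooth_near_def by blast

lemma smooth_near_cong:
  assumes "openin (mtop M) W" "x \<in> W" "\<And>y. y \<in> W \<Longrightarrow> h y = g y"
  shows "smooth_near M x h \<longleftrightarrow> smooth_near M x g"
proof -
  have "smooth_near M x g" if n: "smooth_near M x h" and eq: "\<And>y. y \<in> W \<Longrightarrow> h y = g y" for h g
  proof -
    obtain V where V: "openin (mtop M) V" "x \<in> V" "smooth_fun_on M V h"
      using n by (auto simp: smooth_near_def)
    have "smooth_fun_on M (V \<inter> W) h" using smooth_fun_subset[OF V(3)] by blast
    then have "smooth_fun_on M (V \<inter> W) g"
      using eq V assms(1) by (intro smooth_fun_cong[where h = h and g = g]) auto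
    then show ?thesis using V assms by (intro smooth_nearI[of "V \<inter> W"]) auto
  qed
  then show ?thesis using assms(3) by metis
qed

lemma smooth_near_common:
  assumes "smooth_near M x h" "smooth_near M x g"
  obtains W where "openin (mtop M) W" "x \<in> W" "smooth_fun_on M W h" "smooth_fun_on M W g"
proof -
  obtain V W where "openin (mtop M) V" "x \<in> V" "smooth_fun_on M V h"
    "openin (mtop M) W" "x \<in> W" "smooth_fun_on M W g"
    using assms by (auto simp: smooth_near_def)
  then show thesis
    by (intro that[of "V \<inter> W"]) (auto intro: smooth_fun_subset[of V] smooth_fun_subset[of W])
qed

lemma smooth_near_const: "x \<in> topspace (mtop M) \<Longrightarrow> smooth_near M x (\<lambda>y. a)"
  by (rule smooth_nearI[of "topspace (mtop M)"]) (auto intro: smooth_const)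

lemma smooth_near_add: "smooth_near M x h \<Longrightarrow> smooth_near M x g \<Longrightarrow> smooth_near M x (\<lambda>y. h y + g y)"
  by (metis smooth_near_common smooth_add smooth_nearI)

lemma smooth_near_mult: "smooth_near M x h \<Longrightarrow> smooth_near M x g \<Longrightarrow> smooth_near M x (\<lambda>y. h y * g y)"
  by (metis smooth_near_common smooth_mult smooth_nearI)

lemma smooth_near_sum: "x \<in> topspace (mtop M) \<Longrightarrow> (\<And>j. j \<in> J \<Longrightarrow> smooth_near M x (h j)) \<Longrightarrow>
    smooth_near M x (\<lambda>y. \<Sum>j\<in>J. h j y)"
  by (induction J rule: infinite_finite_induct) (auto intro: smooth_near_add smooth_near_const)

section \<open>Coordinate vectors and tangent vectors\<close>

lemma coord_vec_DERIV:
  assumes c: "c \<in> atlas M" "x \<in> fst c" and h: "smooth_near M x h" and i: "i < mdim M"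
  shows "((\<lambda>t. loc c h ((snd c x)(i := t))) has_real_derivative coord_vec M c x i h) (at (snd c x i))"
proof -
  obtain W where W: "openin (mtop M) W" "x \<in> W" "smooth_fun_on M W h"
    using h by (auto simp: smooth_near_def)
  have "((\<lambda>t. loc c h ((snd c x)(i := t))) has_real_derivative pderiv_at i (loc c h) (snd c x)) (at (snd c x i))"
    by (rule C_k_DERIV[OF smooth_funD[OF W(3) c(1), of "Suc 0"] _ i]) (use c W in auto)
  then show ?thesis using h by (simp add: coord_vec_def loc_def)
qed

lemma coord_vec_eqI:
  assumes "c \<in> atlas M" "x \<in> fst c" "smooth_near M x h" "i < mdim M"
    and "((\<lambda>t. loc c h ((snd c x)(i := t))) has_real_derivative D) (at (snd c x i))"
  shows "coord_vec M c x i h = D"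
  using DERIV_unique[OF coord_vec_DERIV[OF assms(1-4)] assms(5)] .

lemma chart_topspace: "c \<in> atlas M \<Longrightarrow> x \<in> fst c \<Longrightarrow> x \<in> topspace (mtop M)"
  using openin_subset[OF chart_open] by blast

lemma coord_vec_cong:
  assumes c: "c \<in> atlas M" "x \<in> fst c" and i: "i < mdim M"
    and W: "openin (mtop M) W" "x \<in> W" "\<And>y. y \<in> W \<Longrightarrow> h y = g y"
  shows "coord_vec M c x i h = coord_vec M c x i g"
proof -
  have "pderiv_at i (loc c h) (snd c x) = pderiv_at i (loc c g) (snd c x)"
    by (rule pderiv_at_cong[OF chart_image_openin[OF c(1) W(1)]]) (use c W i in \<open>auto simp: loc_chart\<close>)
  then show ?thesis
    using smooth_near_cong[OF W] by (auto simp: coord_vec_def loc_def)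
qed

lemma coord_vec_const: "c \<in> atlas M \<Longrightarrow> x \<in> fst c \<Longrightarrow> i < mdim M \<Longrightarrow> coord_vec M c x i (\<lambda>y. a) = 0"
  by (rule coord_vec_eqI) (auto simp: loc_def intro: smooth_near_const chart_topspace)

lemma coord_vec_lin:
  assumes "c \<in> atlas M" "x \<in> fst c" "i < mdim M" "smooth_near M x h" "smooth_near M x g"
  shows "coord_vec M c x i (\<lambda>y. a * h y + b * g y) = a * coord_vec M c x i h + b * coord_vec M c x i g"
  using coord_vec_DERIV[OF assms(1,2,4,3)] coord_vec_DERIV[OF assms(1,2,5,3)] assms
  by (intro coord_vec_eqI) (auto simp: loc_def chart_topspace
      intro!: smooth_near_const smooth_near_add smooth_near_mult derivative_eq_intros simp del: fun_upd_apply)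

lemma coord_vec_mult:
  assumes "c \<in> atlas M" "x \<in> fst c" "i < mdim M" "smooth_near M x h" "smooth_near M x g"
  shows "coord_vec M c x i (\<lambda>y. h y * g y) = coord_vec M c x i h * g x + h x * coord_vec M c x i g"
  using DERIV_mult[OF coord_vec_DERIV[OF assms(1,2,4,3)] coord_vec_DERIV[OF assms(1,2,5,3)]] assms
  by (intro coord_vec_eqI) (auto simp: loc_def chart_inv algebra_simps
      intro!: smooth_near_mult)

lemma coord_vec_chart:
  assumes "c \<in> atlas M" "x \<in> fst c" "i < mdim M" "j < mdim M"
  shows "coord_vec M c x i (\<lambda>y. snd c y j) = (if i = j then 1 else 0)"
proof (rule coord_vec_eqI)
  have "\<forall>\<^sub>F t in nhds (snd c x i). (snd c x)(i := t) \<in> snd c ` fst c"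
    by (rule Euclidean_space_open_line[OF chart_image]) (use assms in auto)
  then have "\<forall>\<^sub>F t in nhds (snd c x i). loc c (\<lambda>y. snd c y j) ((snd c x)(i := t)) = (if i = j then t else snd c x j)"
    by eventually_elim (auto simp: loc_def f_inv_into_f)
  moreover have "((\<lambda>t. if i = j then t else snd c x j) has_real_derivative (if i = j then 1 else 0)) (at (snd c x i))"
    by (auto intro!: derivative_eq_intros)
  ultimately show "((\<lambda>t. loc c (\<lambda>y. snd c y j) ((snd c x)(i := t))) has_real_derivative (if i = j then 1 else 0)) (at (snd c x i))"
    by (subst DERIV_cong_ev[OF refl _ refl])
qed (use assms smooth_nearI[OF chart_open _ smooth_chart] in auto)

text \<open>Chain rule through the transition map \<open>tr\<close>. The coordinate vectors of one
  chart are combinations of those of another, which makes the union over charts in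
  \<open>tangent_space\<close> a single vector space.\<close>

lemma coord_vec_change:
  assumes c: "c \<in> atlas M" "x \<in> fst c" and c': "c' \<in> atlas M" "x \<in> fst c'" and i: "i < mdim M"
    and h: "smooth_near M x h"
  shows "coord_vec M c' x i h = (\<Sum>j<mdim M. coord_vec M c x j h * coord_vec M c' x i (\<lambda>y. snd c y j))"
proof (rule coord_vec_eqI[OF c' h i])
  obtain W where W: "openin (mtop M) W" "x \<in> W" "smooth_fun_on M W h"
    using h by (auto simp: smooth_near_def)
  let ?E = "Euclidean_space (mdim M)"
  define tr where "tr y = snd c (inv_into (fst c') (snd c') y)" for y
  have tr: "tr (snd c' y) = snd c y" if "y \<in> fst c'" for y
    using chart_inv[OF c'(1) that] by (simp add: tr_def)
  have ev: "\<forall>\<^sub>F t in nhds (snd c' x i). (snd c' x)(i := t) \<in> snd c' ` (fst c' \<inter> fst c)"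
    by (rule Euclidean_space_open_line[OF chart_image_openin[OF c'(1) chart_open[OF c(1)]]]) (use c c' i in auto)
  have "((\<lambda>t. loc c h (tr ((snd c' x)(i := t)))) has_real_derivative
      (\<Sum>j<mdim M. pderiv_at j (loc c h) (tr ((snd c' x)(i := snd c' x i))) * coord_vec M c' x i (\<lambda>y. snd c y j))) (at (snd c' x i))"
  proof (rule C_k_chain_rule[OF chart_image_openin[OF c(1) W(1)] smooth_funD[OF W(3) c(1)]])
    show "tr ((snd c' x)(i := snd c' x i)) \<in> snd c ` (fst c \<inter> W)"
      using c c' W by (auto simp: tr)
    show "\<forall>\<^sub>F t in nhds (snd c' x i). tr ((snd c' x)(i := t)) \<in> topspace ?E"
      using ev by eventually_elim (use openin_subset[OF chart_image[OF c(1)]] in \<open>auto simp: tr\<close>)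
    fix j assume j: "j < mdim M"
    have "smooth_near M x (\<lambda>y. snd c y j)" using smooth_nearI[OF chart_open _ smooth_chart] c j by blast
    from coord_vec_DERIV[OF c' this i]
    show "((\<lambda>t. tr ((snd c' x)(i := t)) j) has_real_derivative coord_vec M c' x i (\<lambda>y. snd c y j)) (at (snd c' x i))"
      by (simp add: loc_def tr_def)
  qed
  moreover have "pderiv_at j (loc c h) (tr (snd c' x)) = coord_vec M c x j h" for j
    using h c'(2) by (simp add: coord_vec_def loc_def tr)
  moreover have "\<forall>\<^sub>F t in nhds (snd c' x i). loc c' h ((snd c' x)(i := t)) = loc c h (tr ((snd c' x)(i := t)))"
    using ev by eventually_elim (use c c' in \<open>auto simp: tr loc_chart\<close>)
  ultimately show "((\<lambda>t. loc c' h ((snd c' x)(i := t))) has_real_derivative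
     (\<Sum>j<mdim M. coord_vec M c x j h * coord_vec M c' x i (\<lambda>y. snd c y j))) (at (snd c' x i))"
    by (subst DERIV_cong_ev[OF refl _ refl, where g = "\<lambda>t. loc c h (tr ((snd c' x)(i := t)))"]) auto
qed

lemma tangent_space_topspace: "X \<in> tangent_space M x \<Longrightarrow> x \<in> topspace (mtop M)"
  using chart_topspace by (auto simp: tangent_space_def)

lemma tangentD:
  assumes "X \<in> tangent_space M x"
  obtains a c where "c \<in> atlas M" "x \<in> fst c" "\<And>h. X h = (\<Sum>i<mdim M. a i * coord_vec M c x i h)"
  using assms by (auto simp: tangent_space_def)

lemma tangent_cong:
  assumes "X \<in> tangent_space M x" "openin (mtop M) W" "x \<in> W" "\<And>y. y \<in> W \<Longrightarrow> h y = g y"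
  shows "X h = X g"
proof -
  obtain a c where c: "c \<in> atlas M" "x \<in> fst c" and X: "\<And>h. X h = (\<Sum>i<mdim M. a i * coord_vec M c x i h)"
    using tangentD[OF assms(1)] by metis
  show ?thesis unfolding X by (intro sum.cong refl arg_cong2[where f = "(*)"] coord_vec_cong[OF c _ assms(2-4)]) auto
qed

lemma tangent_const: "X \<in> tangent_space M x \<Longrightarrow> X (\<lambda>y. a) = 0"
  by (elim tangentD) (simp add: coord_vec_const)

lemma tangent_lin:
  assumes "X \<in> tangent_space M x" "smooth_near M x h" "smooth_near M x g"
  shows "X (\<lambda>y. a * h y + b * g y) = a * X h + b * X g"
proof -
  obtain e c where c: "c \<in> atlas M" "x \<in> fst c" and X: "\<And>h. X h = (\<Sum>i<mdim M. e i * coord_vec M c x i h)"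
    using tangentD[OF assms(1)] by metis
  show ?thesis unfolding X
    by (simp add: coord_vec_lin[OF c _ assms(2,3)] sum_distrib_left algebra_simps sum.distrib)
qed

lemma tangent_add: "X \<in> tangent_space M x \<Longrightarrow> smooth_near M x h \<Longrightarrow> smooth_near M x g \<Longrightarrow>
    X (\<lambda>y. h y + g y) = X h + X g"
  using tangent_lin[of X x h g 1 1] by simp

lemma tangent_mult:
  assumes "X \<in> tangent_space M x" "smooth_near M x h" "smooth_near M x g"
  shows "X (\<lambda>y. h y * g y) = X h * g x + h x * X g"
proof -
  obtain e c where c: "c \<in> atlas M" "x \<in> fst c" and X: "\<And>h. X h = (\<Sum>i<mdim M. e i * coord_vec M c x i h)"
    using tangentD[OF assms(1)] by metis
  have "X (\<lambda>y. h y * g y) = (\<Sum>i<mdim M. e i * (coord_vec M c x i h * g x + h x * coord_vec M c x i g))"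
    unfolding X using coord_vec_mult[OF c _ assms(2,3)] by (intro sum.cong) auto
  then show ?thesis unfolding X
    by (simp add: sum_distrib_left sum_distrib_right algebra_simps sum.distrib)
qed

lemma tangent_sum:
  assumes X: "X \<in> tangent_space M x"
  shows "(\<And>j. j \<in> J \<Longrightarrow> smooth_near M x (h j)) \<Longrightarrow> X (\<lambda>y. \<Sum>j\<in>J. h j y) = (\<Sum>j\<in>J. X (h j))"
proof (induction J rule: infinite_finite_induct)
  case (insert j J)
  have "smooth_near M x (\<lambda>y. \<Sum>j\<in>J. h j y)"
    using insert.prems tangent_space_topspace[OF X] by (intro smooth_near_sum) auto
  then show ?case using insert tangent_add[OF X] by simp
qed (simp_all add: tangent_const[OF X])

lemma tangent_cmult:
  assumes "X \<in> tangent_space M x" "smooth_near M x h"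
  shows "X (\<lambda>y. a * h y) = a * X h"
  using tangent_lin[OF assms assms(2), of a 0] by simp

lemma coord_vec_tangent: "c \<in> atlas M \<Longrightarrow> x \<in> fst c \<Longrightarrow> i < mdim M \<Longrightarrow> coord_vec M c x i \<in> tangent_space M x"
  unfolding tangent_space_def
  by (rule CollectI, rule exI[of _ "\<lambda>j. if j = i then 1 else 0"], rule exI[of _ c])
    (simp add: if_distrib[of "\<lambda>z. z * _"] cong: if_cong)

text \<open>Any chart at \<open>x\<close> serves, whichever one produced \<open>X\<close>, and the
  coefficients are read off by applying \<open>X\<close> to the chart coordinates. At functions not
  smooth near \<open>x\<close> both sides are 0 by the default in \<open>coord_vec\<close>, so the
  equation holds between functions.\<close>

lemma tangent_chart:
  assumes X: "X \<in> tangent_space M x" and c: "c \<in> atlas M" "x \<in> fst c"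
  shows "X = (\<lambda>h. \<Sum>i<mdim M. X (\<lambda>y. snd c y i) * coord_vec M c x i h)"
proof
  fix h
  obtain e c' where c': "c' \<in> atlas M" "x \<in> fst c'" and X': "\<And>h. X h = (\<Sum>i<mdim M. e i * coord_vec M c' x i h)"
    using tangentD[OF X] by metis
  show "X h = (\<Sum>i<mdim M. X (\<lambda>y. snd c y i) * coord_vec M c x i h)"
  proof (cases "smooth_near M x h")
    case True
    have "X h = (\<Sum>i<mdim M. e i * (\<Sum>j<mdim M. coord_vec M c x j h * coord_vec M c' x i (\<lambda>y. snd c y j)))"
      unfolding X' by (simp add: coord_vec_change[OF c c' _ True])
    also have "\<dots> = (\<Sum>j<mdim M. X (\<lambda>y. snd c y j) * coord_vec M c x j h)"
      unfolding X' sum_distrib_left sum_distrib_right by (subst sum.swap) (simp add: ac_simps)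
    finally show ?thesis .
  next
    case False
    then show ?thesis unfolding X' by (simp add: coord_vec_def)
  qed
qed

lemma tangentI: "c \<in> atlas M \<Longrightarrow> x \<in> fst c \<Longrightarrow> (\<lambda>h. \<Sum>i<mdim M. a i * coord_vec M c x i h) \<in> tangent_space M x"
  unfolding tangent_space_def by blast

lemma tangent_space_lin:
  assumes X: "X \<in> tangent_space M x" and Y: "Y \<in> tangent_space M x"
  shows "(\<lambda>h. a * X h + b * Y h) \<in> tangent_space M x"
proof -
  obtain c where c: "c \<in> atlas M" "x \<in> fst c" using tangentD[OF X] by metis
  have "(\<lambda>h. a * X h + b * Y h) =
     (\<lambda>h. \<Sum>i<mdim M. (a * X (\<lambda>y. snd c y i) + b * Y (\<lambda>y. snd c y i)) * coord_vec M c x i h)"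
    by (subst tangent_chart[OF X c], subst tangent_chart[OF Y c])
      (simp add: sum_distrib_left algebra_simps sum.distrib)
  then show ?thesis using tangentI[OF c] by simp
qed

lemma tangent_space_zero: "x \<in> topspace (mtop M) \<Longrightarrow> (\<lambda>h. 0) \<in> tangent_space M x"
  using tangentI[of _ x "\<lambda>i. 0"] by (auto elim: topspace_chart)

text \<open>Seen in a second chart \<open>c'\<close>, the coordinate derivative is a partial
  derivative of \<open>loc c h\<close> composed with the transition map, so
  \<open>C_k_compose\<close> applies.\<close>

lemma smooth_coord_vec:
  assumes c: "c \<in> atlas M" and W: "openin (mtop M) W" "W \<subseteq> fst c" and h: "smooth_fun_on M W h"
    and i: "i < mdim M"
  shows "smooth_fun_on M W (\<lambda>x. coord_vec M c x i h)"
proof (rule smooth_funI)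
  fix c' r assume c': "c' \<in> atlas M"
  define tr where "tr y = snd c (inv_into (fst c') (snd c') y)" for y
  let ?V = "snd c' ` (fst c' \<inter> W)" and ?U = "snd c ` (fst c \<inter> W)"
  have tr: "tr (snd c' y) = snd c y" if "y \<in> fst c'" for y
    using chart_inv[OF c' that] by (simp add: tr_def)
  have A: "C_k (mdim M) r ?V (\<lambda>y. pderiv_at i (loc c h) (tr y))"
  proof (rule C_k_compose[OF chart_image_openin[OF c W(1)] chart_image_openin[OF c' W(1)], where G = tr])
    show "C_k (mdim M) r ?U (pderiv_at i (loc c h))"
      using smooth_funD[OF h c, of "Suc r"] i by simp
    show "tr y \<in> ?U" if "y \<in> ?V" for y using that W(2) by (auto simp: tr)
    show "C_k (mdim M) r ?V (\<lambda>y. tr y j)" if "j < mdim M" for j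
    proof (rule C_k_subset)
      show "C_k (mdim M) r (snd c' ` (fst c' \<inter> fst c)) (\<lambda>y. tr y j)"
        using transition[OF c' c that] by (simp add: C_inf_def tr_def)
    qed (use W(2) in auto)
  qed
  have B: "pderiv_at i (loc c h) (tr y) = loc c' (\<lambda>x. coord_vec M c x i h) y" if y: "y \<in> ?V" for y
  proof -
    obtain x where x: "x \<in> fst c'" "x \<in> W" "y = snd c' x" using y by auto
    have "smooth_near M x h" using smooth_nearI[OF W(1) x(2) h] .
    then show ?thesis using x by (simp add: tr loc_chart[OF c'] coord_vec_def loc_def[of c])
  qed
  show "C_k (mdim M) r ?V (loc c' (\<lambda>x. coord_vec M c x i h))"
    by (rule C_k_cong[OF chart_image_openin[OF c' W(1)] B A])
qed

lemma coord_vector_field: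
  assumes c: "c \<in> atlas M" and i: "i < mdim M"
  shows "vector_field_on M (fst c) (\<lambda>x. coord_vec M c x i)"
  unfolding vector_field_on_def using coord_vec_tangent[OF c _ i] smooth_coord_vec[OF c _ _ _ i] by blast

text \<open>Inside the single chart \<open>c\<close>, iterated coordinate vectors are iterated
  partial derivatives. This is the vanishing bracket of coordinate fields, the torsion-free half of
  the Koszul formula.\<close>

lemma coord_vec_commute:
  assumes c: "c \<in> atlas M" and W: "openin (mtop M) W" "W \<subseteq> fst c" and h: "smooth_fun_on M W h"
    and x: "x \<in> W" and ij: "i < mdim M" "j < mdim M"
  shows "coord_vec M c x i (\<lambda>y. coord_vec M c y j h) = coord_vec M c x j (\<lambda>y. coord_vec M c y i h)"
proof -
  have *: "coord_vec M c x i (\<lambda>y. coord_vec M c y j h) = pderiv_at i (pderiv_at j (loc c h)) (snd c x)"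
    if "i < mdim M" "j < mdim M" for i j
  proof -
    have "smooth_near M x (\<lambda>y. coord_vec M c y j h)"
      by (rule smooth_nearI[OF W(1) x smooth_coord_vec[OF c W h that(2)]])
    then have "coord_vec M c x i (\<lambda>y. coord_vec M c y j h) =
        pderiv_at i (loc c (\<lambda>y. coord_vec M c y j h)) (snd c x)"
      by (simp add: coord_vec_def loc_def)
    also have "\<dots> = pderiv_at i (pderiv_at j (loc c h)) (snd c x)"
    proof (rule pderiv_at_cong[OF chart_image_openin[OF c W(1)]])
      fix y assume "y \<in> snd c ` (fst c \<inter> W)"
      then obtain z where z: "z \<in> fst c" "z \<in> W" "y = snd c z" by auto
      have "smooth_near M z h" using smooth_nearI[OF W(1) z(2) h] .
      then show "loc c (\<lambda>y. coord_vec M c y j h) y = pderiv_at j (loc c h) y"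
        using z by (simp add: chart_inv[OF c] coord_vec_def loc_def)
    qed (use x W that in auto)
    finally show ?thesis .
  qed
  show ?thesis unfolding *[OF ij] *[OF ij(2,1)]
    by (rule C_k_mixed_partials[OF chart_image_openin[OF c W(1)] smooth_funD[OF h c]]) (use x W ij in auto)
qed

text \<open>A coordinate ball is the positive set of one smooth function \<open>q\<close>, and the
  ball of radius \<open>d\<close> lies in the box.\<close>

lemma coord_box_nbhd:
  assumes c: "c \<in> atlas M" and W: "openin (mtop M) W" "W \<subseteq> fst c" "x \<in> W" and d: "d > 0"
  obtains V where "openin (mtop M) V" "x \<in> V" "V \<subseteq> W" "\<And>y i. y \<in> V \<Longrightarrow> i < mdim M \<Longrightarrow> \<bar>snd c y i - snd c x i\<bar> < d"
proof -
  define q where "q y = d * d - (\<Sum>i<mdim M. (snd c y i - snd c x i) * (snd c y i - snd c x i))" for y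
  have "smooth_fun_on M W (\<lambda>y. snd c y i)" if "i < mdim M" for i
    using smooth_fun_subset[OF smooth_chart[OF c that] W(2)] .
  then have "smooth_fun_on M W q" unfolding q_def by (intro smooth_intros W(1)) auto
  then have "openin (mtop M) {y \<in> W. q y > 0}" by (rule openin_positive[OF W(1)])
  moreover have "\<bar>snd c y i - snd c x i\<bar> < d" if "q y > 0" "i < mdim M" for y i
  proof -
    have "(snd c y i - snd c x i) * (snd c y i - snd c x i) \<le> (\<Sum>i<mdim M. (snd c y i - snd c x i) * (snd c y i - snd c x i))"
      using that by (intro member_le_sum) auto
    then have "(snd c y i - snd c x i)\<^sup>2 < d\<^sup>2" using that by (simp add: q_def power2_eq_square)
    then show ?thesis using d power2_less_imp_less[of "\<bar>snd c y i - snd c x i\<bar>" d] by simp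
  qed
  ultimately show thesis using W(3) d by (intro that[of "{y \<in> W. q y > 0}"]) (auto simp: q_def)
qed

text \<open>The neighbourhood \<open>V\<close> is chosen before the function \<open>h\<close>. One
  \<open>V\<close> thus serves a whole family of functions, as is required for the projections of
  all vectors onto a moving subspace.\<close>

lemma locally_constant:
  assumes c: "c \<in> atlas M" and W: "openin (mtop M) W" "W \<subseteq> fst c" "x \<in> W"
  obtains V where "openin (mtop M) V" "x \<in> V" "V \<subseteq> W"
    "\<And>h y. smooth_fun_on M W h \<Longrightarrow>
       (\<And>z i. z \<in> W \<Longrightarrow> i < mdim M \<Longrightarrow> coord_vec M c z i h = 0) \<Longrightarrow> y \<in> V \<Longrightarrow> h y = h x"
proof -
  let ?V = "snd c ` (fst c \<inter> W)"
  have x: "snd c x \<in> ?V" using W by auto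
  obtain d where d: "d > 0" "\<And>z. z \<in> topspace (Euclidean_space (mdim M)) \<Longrightarrow>
      (\<And>i. i < mdim M \<Longrightarrow> \<bar>z i - snd c x i\<bar> < d) \<Longrightarrow> z \<in> ?V"
    using Euclidean_space_open_box[OF chart_image_openin[OF c W(1)] x] by blast
  obtain V where V: "openin (mtop M) V" "x \<in> V" "V \<subseteq> W"
    "\<And>y i. y \<in> V \<Longrightarrow> i < mdim M \<Longrightarrow> \<bar>snd c y i - snd c x i\<bar> < d"
    using coord_box_nbhd[OF c W d(1)] by blast
  show thesis
  proof (rule that[OF V(1-3)])
    fix h y assume h: "smooth_fun_on M W h" and y: "y \<in> V"
      and 0: "\<And>z i. z \<in> W \<Longrightarrow> i < mdim M \<Longrightarrow> coord_vec M c z i h = 0"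
    have "pderiv_at i (loc c h) z = 0" if z: "z \<in> ?V" and i: "i < mdim M" for z i
    proof -
      obtain y where y: "y \<in> W" "z = snd c y" using z by auto
      then show ?thesis using 0[OF y(1) i] smooth_nearI[OF W(1) y(1) h] by (simp add: coord_vec_def loc_def)
    qed
    moreover have "snd c y \<in> topspace (Euclidean_space (mdim M))"
      using y V(3) W(2) openin_subset[OF chart_image[OF c]] by auto
    ultimately have "loc c h (snd c y) = loc c h (snd c x)"
      using V(4)[OF y]
      by (intro C_k_locally_constant[OF chart_image_openin[OF c W(1)] smooth_funD[OF h c] x _ d(2)])
    then show "h y = h x" using y V(3) W by (auto simp: loc_chart[OF c] subset_iff)
  qed
qed

end

section \<open>Diagonal bilinear forms\<close>

text \<open>Finite support and arbitrary real weights cover \<open>flat_ip\<close>, its multiples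
  and sums over two factors, whatever the signature. Bilinearity, smoothness and the product rule
  then reduce to finite sums over coordinates.\<close>

definition is_form :: "(('i \<Rightarrow> real) \<Rightarrow> ('i \<Rightarrow> real) \<Rightarrow> real) \<Rightarrow> bool" where
  "is_form B \<longleftrightarrow> (\<exists>\<sigma> I. finite I \<and> B = (\<lambda>w z. \<Sum>i\<in>I. \<sigma> i * w i * z i))"

definition subsp :: "('i \<Rightarrow> real) set \<Rightarrow> bool" where
  "subsp V \<longleftrightarrow> (\<lambda>i. 0) \<in> V \<and> (\<forall>u\<in>V. \<forall>v\<in>V. \<forall>a b. (\<lambda>i. a * u i + b * v i) \<in> V)"

definition posdef :: "(('i \<Rightarrow> real) \<Rightarrow> ('i \<Rightarrow> real) \<Rightarrow> real) \<Rightarrow> ('i \<Rightarrow> real) set \<Rightarrow> bool" where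
  "posdef B V \<longleftrightarrow> (\<forall>v\<in>V. v \<noteq> (\<lambda>i. 0) \<longrightarrow> B v v > 0)"

definition lspan :: "nat \<Rightarrow> (nat \<Rightarrow> 'i \<Rightarrow> real) \<Rightarrow> ('i \<Rightarrow> real) set" where
  "lspan r e = {(\<lambda>i. \<Sum>j<r. c j * e j i) | c. True}"

lemma is_formE:
  assumes "is_form B"
  obtains \<sigma> I where "finite I" "B = (\<lambda>w z. \<Sum>i\<in>I. \<sigma> i * w i * z i)"
  using assms by (auto simp: is_form_def)

lemma subsp_lin: "subsp V \<Longrightarrow> u \<in> V \<Longrightarrow> v \<in> V \<Longrightarrow> (\<lambda>i. a * u i + b * v i) \<in> V"
  by (auto simp: subsp_def)

lemma subsp_zero: "subsp V \<Longrightarrow> (\<lambda>i. 0) \<in> V"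
  by (auto simp: subsp_def)

lemma subsp_scale: "subsp V \<Longrightarrow> u \<in> V \<Longrightarrow> (\<lambda>i. a * u i) \<in> V"
  using subsp_lin[of V u u a 0] by simp

lemma subsp_add: "subsp V \<Longrightarrow> u \<in> V \<Longrightarrow> v \<in> V \<Longrightarrow> (\<lambda>i. u i + v i) \<in> V"
  using subsp_lin[of V u v 1 1] by simp

lemma subsp_diff: "subsp V \<Longrightarrow> u \<in> V \<Longrightarrow> v \<in> V \<Longrightarrow> (\<lambda>i. u i - v i) \<in> V"
  using subsp_lin[of V u v 1 "-1"] by simp

lemma subsp_sum: "subsp V \<Longrightarrow> (\<And>j. j \<in> J \<Longrightarrow> v j \<in> V) \<Longrightarrow> (\<lambda>i. \<Sum>j\<in>J. c j * v j i) \<in> V"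
  by (induction J rule: infinite_finite_induct) (auto simp: subsp_zero subsp_add subsp_scale)

lemma subsp_lspan: "subsp (lspan r e)"
  unfolding subsp_def
proof (intro conjI ballI allI)
  show "(\<lambda>i. 0) \<in> lspan r e" by (auto simp: lspan_def intro: exI[of _ "\<lambda>j. 0"])
  fix u v a b assume "u \<in> lspan r e" "v \<in> lspan r e"
  then obtain c d where "u = (\<lambda>i. \<Sum>j<r. c j * e j i)" "v = (\<lambda>i. \<Sum>j<r. d j * e j i)"
    by (auto simp: lspan_def)
  then have "(\<lambda>i. a * u i + b * v i) = (\<lambda>i. \<Sum>j<r. (a * c j + b * d j) * e j i)"
    by (simp add: sum_distrib_left algebra_simps sum.distrib)
  then show "(\<lambda>i. a * u i + b * v i) \<in> lspan r e" by (auto simp: lspan_def)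
qed

lemma lspanI: "(\<lambda>i. \<Sum>j<r. c j * e j i) \<in> lspan r e"
  by (auto simp: lspan_def)

lemma lspan_base: "j < r \<Longrightarrow> e j \<in> lspan r e"
  unfolding lspan_def by (rule CollectI, rule exI[of _ "\<lambda>i. if i = j then 1 else 0"])
    (simp add: if_distrib[of "\<lambda>z. z * _"] cong: if_cong)

lemma lspan_subset: "subsp V \<Longrightarrow> (\<And>j. j < r \<Longrightarrow> e j \<in> V) \<Longrightarrow> lspan r e \<subseteq> V"
  by (auto simp: lspan_def intro!: subsp_sum)

lemma posdef_subset: "posdef B V \<Longrightarrow> U \<subseteq> V \<Longrightarrow> posdef B U"
  by (auto simp: posdef_def)

context
  fixes B :: "('i \<Rightarrow> real) \<Rightarrow> ('i \<Rightarrow> real) \<Rightarrow> real"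
  assumes B: "is_form B"
begin

lemma form_sym: "B u v = B v u"
  using B by (elim is_formE) (simp add: mult.commute mult.left_commute)

lemma form_lin: "B (\<lambda>i. a * u i + b * v i) z = a * B u z + b * B v z"
  using B by (elim is_formE) (simp add: sum_distrib_left algebra_simps sum.distrib)

lemma form_lin2: "B z (\<lambda>i. a * u i + b * v i) = a * B z u + b * B z v"
  using form_lin form_sym by metis

lemma form_zero: "B (\<lambda>i. 0) z = 0"
  using form_lin[of 0 _ 0] by simp

lemma form_zero2: "B z (\<lambda>i. 0) = 0"
  using form_zero form_sym by metis

lemma form_add: "B (\<lambda>i. u i + v i) z = B u z + B v z"
  using form_lin[of 1 u 1 v z] by simp

lemma form_add2: "B z (\<lambda>i. u i + v i) = B z u + B z v"
  using form_lin2[of z 1 u 1 v] by simp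

lemma form_diff: "B (\<lambda>i. u i - v i) z = B u z - B v z"
  using form_lin[of 1 u "-1" v z] by simp

lemma form_diff2: "B z (\<lambda>i. u i - v i) = B z u - B z v"
  using form_lin2[of z 1 u "-1" v] by simp

lemma form_scale: "B (\<lambda>i. a * u i) z = a * B u z"
  using form_lin[of a u 0 u z] by simp

lemma form_scale2: "B z (\<lambda>i. a * u i) = a * B z u"
  using form_lin2[of z a u 0 u] by simp

lemma form_sum: "B (\<lambda>i. \<Sum>j\<in>J. c j * e j i) z = (\<Sum>j\<in>J. c j * B (e j) z)"
  by (induction J rule: infinite_finite_induct) (auto simp: form_zero form_add form_scale)

lemma form_sum2: "B z (\<lambda>i. \<Sum>j\<in>J. c j * e j i) = (\<Sum>j\<in>J. c j * B z (e j))"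
  by (induction J rule: infinite_finite_induct) (auto simp: form_zero2 form_add2 form_scale2)

lemma form_unique:
  assumes "subsp V" "posdef B V" "v \<in> V" "v' \<in> V" "\<And>u. u \<in> V \<Longrightarrow> B v u = B v' u"
  shows "v = v'"
proof -
  have "(\<lambda>i. v i - v' i) \<in> V" using assms subsp_diff by blast
  moreover have "B (\<lambda>i. v i - v' i) (\<lambda>i. v i - v' i) = 0"
    using assms(5)[OF calculation] by (simp add: form_diff)
  ultimately have "(\<lambda>i. v i - v' i) = (\<lambda>i. 0)" using assms(2) unfolding posdef_def by fastforce
  then show ?thesis by (auto simp: fun_eq_iff)
qed

lemma orth_projI:
  assumes "subsp V" "posdef B V" "v \<in> V" "\<And>u. u \<in> V \<Longrightarrow> B v u = B w u"
  shows "orth_proj B V w = v"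
  unfolding orth_proj_def using assms form_unique[OF assms(1,2)] by (intro the_equality) auto

text \<open>Gram-Schmidt by induction: the new spanning vector is replaced by its residual
  \<open>q\<close> over the old span, and the component along \<open>q\<close> is added to the old
  projection. Positivity concerns the span; \<open>B\<close> itself may be indefinite.\<close>

lemma proj_exists:
  "posdef B (lspan r e) \<Longrightarrow> \<exists>v\<in>lspan r e. \<forall>u\<in>lspan r e. B v u = B w u"
proof (induction r arbitrary: w)
  case 0
  have "lspan 0 e = {\<lambda>i. 0}" by (auto simp: lspan_def)
  then show ?case by (auto simp: form_zero2)
next
  case (Suc r)
  have sub: "lspan r e \<subseteq> lspan (Suc r) e"
    by (rule lspan_subset[OF subsp_lspan]) (auto intro: lspan_base)
  have IH: "\<exists>v\<in>lspan r e. \<forall>u\<in>lspan r e. B v u = B w u" for w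
    using Suc.IH posdef_subset[OF Suc.prems sub] by blast
  obtain p where p: "p \<in> lspan r e" "\<And>u. u \<in> lspan r e \<Longrightarrow> B p u = B (e r) u" using IH by blast
  define q where "q = (\<lambda>i. e r i - p i)"
  have q: "q \<in> lspan (Suc r) e" unfolding q_def
    using p sub by (intro subsp_diff[OF subsp_lspan] lspan_base) auto
  have q0: "B q u = 0" if "u \<in> lspan r e" for u using p(2)[OF that] by (simp add: q_def form_diff)
  obtain v where v: "v \<in> lspan r e" "\<And>u. u \<in> lspan r e \<Longrightarrow> B v u = B w u" using IH by blast
  have dec: "\<exists>u'\<in>lspan r e. \<exists>t. u = (\<lambda>i. u' i + t * q i)" if u: "u \<in> lspan (Suc r) e" for u
  proof -
    obtain c where "u = (\<lambda>i. \<Sum>j<Suc r. c j * e j i)" using u by (auto simp: lspan_def)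
    then have "u = (\<lambda>i. (1 * (\<Sum>j<r. c j * e j i) + c r * p i) + c r * q i)"
      by (simp add: q_def algebra_simps)
    moreover have "(\<lambda>i. 1 * (\<Sum>j<r. c j * e j i) + c r * p i) \<in> lspan r e"
      using subsp_lin[OF subsp_lspan lspanI p(1)] .
    ultimately show ?thesis
      by (intro bexI[of _ "\<lambda>i. 1 * (\<Sum>j<r. c j * e j i) + c r * p i"] exI[of _ "c r"])
  qed
  \<comment> \<open>If \<open>e r\<close> already lies in the old span, then \<open>q = 0\<close>
    and division by zero yields \<open>t = 0\<close>, which is a correct coefficient.\<close>
  define t where "t = B w q / B q q"
  have "B q q * t = B w q"
  proof (cases "q = (\<lambda>i. 0)")
    case True then show ?thesis by (simp add: form_zero2)
  next
    case False then have "B q q > 0" using Suc.prems q by (auto simp: posdef_def)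
    then show ?thesis by (simp add: t_def)
  qed
  then have tq: "t * B q q = B w q" by (simp add: mult.commute)
  show ?case
  proof (intro bexI[of _ "\<lambda>i. v i + t * q i"] ballI)
    fix u assume "u \<in> lspan (Suc r) e"
    then obtain u' s where u: "u' \<in> lspan r e" "u = (\<lambda>i. u' i + s * q i)" using dec by blast
    have "B (\<lambda>i. v i + t * q i) u = B v u' + s * B v q + (t * B q u' + s * (t * B q q))"
      unfolding u(2) form_add form_add2 form_scale form_scale2 by (simp add: algebra_simps)
    also have "\<dots> = B w u' + s * B w q"
      using v(2)[OF u(1)] q0[OF u(1)] q0[OF v(1)] form_sym[of v q] tq by simp
    finally show "B (\<lambda>i. v i + t * q i) u = B w u" unfolding u(2) form_add2 form_scale2 .
  next
    show "(\<lambda>i. v i + t * q i) \<in> lspan (Suc r) e"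
      using subsp_add[OF subsp_lspan _ subsp_scale[OF subsp_lspan q]] v(1) sub by blast
  qed
qed

end

section \<open>Product rules for vector-valued maps\<close>

lemma dvec_app: "dvec X F i = X (\<lambda>x. F x i)"
  by (simp add: dvec_def)

context smooth_atlas
begin

lemma smooth_vecD: "smooth_vec_on M W F \<Longrightarrow> smooth_fun_on M W (\<lambda>x. F x i)"
  by (simp add: smooth_vec_on_def)

lemma smooth_vec_near: "openin (mtop M) W \<Longrightarrow> x \<in> W \<Longrightarrow> smooth_vec_on M W F \<Longrightarrow> smooth_near M x (\<lambda>y. F y i)"
  by (rule smooth_nearI[OF _ _ smooth_vecD])

lemma smooth_vec_subset: "smooth_vec_on M W F \<Longrightarrow> V \<subseteq> W \<Longrightarrow> smooth_vec_on M V F"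
  unfolding smooth_vec_on_def by (blast intro: smooth_fun_subset)

lemma smooth_vec_combination:
  assumes "openin (mtop M) W" "\<And>j. j \<in> J \<Longrightarrow> smooth_fun_on M W (C j)" "\<And>j. j \<in> J \<Longrightarrow> smooth_vec_on M W (e j)"
  shows "smooth_vec_on M W (\<lambda>y i. \<Sum>j\<in>J. C j y * e j y i)"
  unfolding smooth_vec_on_def
  by (intro allI smooth_intros assms smooth_vecD)

lemma smooth_form:
  assumes "is_form B" "openin (mtop M) W" "smooth_vec_on M W u" "smooth_vec_on M W v"
  shows "smooth_fun_on M W (\<lambda>y. B (u y) (v y))"
proof -
  obtain \<sigma> I where I: "finite I" "B = (\<lambda>w z. \<Sum>i\<in>I. \<sigma> i * w i * z i)" by (rule is_formE[OF assms(1)])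
  show ?thesis unfolding I(2) by (intro smooth_intros assms smooth_vecD)
qed

lemma tangent_form:
  assumes "is_form B" "openin (mtop M) W" "smooth_vec_on M W u" "smooth_vec_on M W v"
    and X: "X \<in> tangent_space M x" and x: "x \<in> W"
  shows "X (\<lambda>y. B (u y) (v y)) = B (dvec X u) (v x) + B (u x) (dvec X v)"
proof -
  obtain \<sigma> I where I: "finite I" "B = (\<lambda>w z. \<Sum>i\<in>I. \<sigma> i * w i * z i)" by (rule is_formE[OF assms(1)])
  have n: "smooth_near M x (\<lambda>y. u y i)" "smooth_near M x (\<lambda>y. v y i)" for i
    by (rule smooth_vec_near[OF assms(2) x assms(3)], rule smooth_vec_near[OF assms(2) x assms(4)])
  have t: "x \<in> topspace (mtop M)" using tangent_space_topspace[OF X] .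
  have *: "X (\<lambda>y. \<sigma> i * u y i * v y i) = \<sigma> i * (X (\<lambda>y. u y i) * v x i + u x i * X (\<lambda>y. v y i))" for i
    using tangent_cmult[OF X smooth_near_mult[OF n], of "\<sigma> i" i i] tangent_mult[OF X n, of i i]
    by (simp add: mult.assoc)
  have "X (\<lambda>y. B (u y) (v y)) = (\<Sum>i\<in>I. X (\<lambda>y. \<sigma> i * u y i * v y i))"
    unfolding I(2) using t by (intro tangent_sum[OF X] smooth_near_mult smooth_near_const n)
  then show ?thesis unfolding * I(2) by (simp add: dvec_app algebra_simps sum.distrib)
qed

lemma dvec_cong:
  assumes "X \<in> tangent_space M x" "openin (mtop M) W" "x \<in> W" "\<And>y. y \<in> W \<Longrightarrow> u y = v y"
  shows "dvec X u = dvec X v"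
  unfolding dvec_def using assms by (intro ext tangent_cong[OF assms(1-3)]) auto

lemma dvec_combination:
  assumes "openin (mtop M) W" "\<And>j. j \<in> J \<Longrightarrow> smooth_fun_on M W (C j)" "\<And>j. j \<in> J \<Longrightarrow> smooth_vec_on M W (e j)"
    and X: "X \<in> tangent_space M x" and x: "x \<in> W"
  shows "dvec X (\<lambda>y i. \<Sum>j\<in>J. C j y * e j y i) =
    (\<lambda>i. \<Sum>j\<in>J. X (C j) * e j x i + C j x * dvec X (e j) i)"
proof
  fix i
  have n: "smooth_near M x (C j)" "smooth_near M x (\<lambda>y. e j y i)" if "j \<in> J" for j
    by (rule smooth_nearI[OF assms(1) x assms(2)[OF that]], rule smooth_vec_near[OF assms(1) x assms(3)[OF that]])
  show "dvec X (\<lambda>y i. \<Sum>j\<in>J. C j y * e j y i) i = (\<Sum>j\<in>J. X (C j) * e j x i + C j x * dvec X (e j) i)"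
    unfolding dvec_app by (subst tangent_sum[OF X]) (auto simp: tangent_mult[OF X n] intro!: smooth_near_mult n)
qed

end

section \<open>Parallel families of subspaces\<close>

context smooth_atlas
begin

text \<open>Positivity is assumed at \<open>x\<close>; each step shrinks the neighbourhood to where
  the squared norm of the residual stays positive. The smooth coefficients \<open>C\<close> belong
  to the result because derivatives of the \<open>u j\<close> are later computed from those of the
  \<open>e l\<close> by the product rule.\<close>

lemma Gram_Schmidt:
  fixes B :: "('i \<Rightarrow> real) \<Rightarrow> ('i \<Rightarrow> real) \<Rightarrow> real"
  assumes B: "is_form B" and W: "openin (mtop M) W" "x \<in> W"
  shows "(\<And>j. j < r \<Longrightarrow> smooth_vec_on M W (e j)) \<Longrightarrow>
    (\<And>c. \<exists>j<r. c j \<noteq> 0 \<Longrightarrow> B (\<lambda>i. \<Sum>j<r. c j * e j x i) (\<lambda>i. \<Sum>j<r. c j * e j x i) > 0) \<Longrightarrow>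
    \<exists>V u C. openin (mtop M) V \<and> x \<in> V \<and> V \<subseteq> W \<and> (\<forall>j<r. smooth_vec_on M V (u j)) \<and>
      (\<forall>j<r. \<forall>l<r. smooth_fun_on M V (C j l)) \<and>
      (\<forall>y\<in>V. \<forall>j<r. u j y = (\<lambda>i. \<Sum>l<r. C j l y * e l y i)) \<and>
      (\<forall>y\<in>V. \<forall>j<r. \<forall>l<r. B (u j y) (u l y) = (if j = l then 1 else 0)) \<and>
      (\<forall>y\<in>V. \<forall>j<r. e j y \<in> lspan r (\<lambda>l. u l y))"
proof (induction r)
  case 0
  show ?case by (rule exI[of _ W]) (use W in auto)
next
  case (Suc r)
  have pos: "B (\<lambda>i. \<Sum>j<r. c j * e j x i) (\<lambda>i. \<Sum>j<r. c j * e j x i) > 0" if "\<exists>j<r. c j \<noteq> 0" for c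
  proof -
    have "\<exists>j<Suc r. (c(r := 0)) j \<noteq> 0" using that by (auto intro: less_SucI)
    from Suc.prems(2)[OF this] show ?thesis by simp
  qed
  have sm: "smooth_vec_on M W (e j)" if "j < r" for j using Suc.prems(1) that by simp
  have "\<exists>V u C. openin (mtop M) V \<and> x \<in> V \<and> V \<subseteq> W \<and> (\<forall>j<r. smooth_vec_on M V (u j)) \<and>
      (\<forall>j<r. \<forall>l<r. smooth_fun_on M V (C j l)) \<and>
      (\<forall>y\<in>V. \<forall>j<r. u j y = (\<lambda>i. \<Sum>l<r. C j l y * e l y i)) \<and>
      (\<forall>y\<in>V. \<forall>j<r. \<forall>l<r. B (u j y) (u l y) = (if j = l then 1 else 0)) \<and>
      (\<forall>y\<in>V. \<forall>j<r. e j y \<in> lspan r (\<lambda>l. u l y))"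
    by (rule Suc.IH) (erule sm, erule pos)
  then obtain V u C where V: "openin (mtop M) V" "x \<in> V" "V \<subseteq> W"
    and u': "\<forall>j<r. smooth_vec_on M V (u j)"
    and C': "\<forall>j<r. \<forall>l<r. smooth_fun_on M V (C j l)"
    and uC': "\<forall>y\<in>V. \<forall>j<r. u j y = (\<lambda>i. \<Sum>l<r. C j l y * e l y i)"
    and on': "\<forall>y\<in>V. \<forall>j<r. \<forall>l<r. B (u j y) (u l y) = (if j = l then 1 else 0)"
    and sp': "\<forall>y\<in>V. \<forall>j<r. e j y \<in> lspan r (\<lambda>l. u l y)"
    by blast
  note u = u'[rule_format] and C = C'[rule_format] and uC = uC'[rule_format]
    and on = on'[rule_format] and sp = sp'[rule_format]
  have eV: "smooth_vec_on M V (e j)" if "j < Suc r" for j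
    using smooth_vec_subset[OF Suc.prems(1)[OF that] V(3)] .
  define b where "b j y = B (e r y) (u j y)" for j y
  have b: "smooth_fun_on M V (b j)" if "j < r" for j
    unfolding b_def by (rule smooth_form[OF B V(1) eV u[OF that]]) simp
  define q where "q y = (\<lambda>i. e r y i - (\<Sum>j<r. b j y * u j y i))" for y
  \<comment> \<open>The coefficients of the residual in the original vectors. That of
    \<open>e r\<close> is 1, so the positivity hypothesis applies to \<open>q x\<close>.\<close>
  define D where "D l y = (if l = r then 1 else - (\<Sum>j<r. b j y * C j l y))" for l y
  have D: "smooth_fun_on M V (D l)" if "l < Suc r" for l
  proof (cases "l = r")
    case False
    then have "l < r" using that by simp
    then have "smooth_fun_on M V (\<lambda>y. 0 - (\<Sum>j<r. b j y * C j l y))"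
      by (intro smooth_intros V(1) b C) auto
    then show ?thesis using False by (simp add: D_def[abs_def])
  qed (simp add: D_def[abs_def] smooth_const V(1))
  have qD: "q y = (\<lambda>i. \<Sum>l<Suc r. D l y * e l y i)" if y: "y \<in> V" for y
  proof
    fix i
    have "(\<Sum>j<r. b j y * u j y i) = (\<Sum>j<r. b j y * (\<Sum>l<r. C j l y * e l y i))"
      using uC[OF y] by (intro sum.cong) auto
    also have "\<dots> = (\<Sum>l<r. (\<Sum>j<r. b j y * C j l y) * e l y i)"
      unfolding sum_distrib_left sum_distrib_right by (subst sum.swap) (simp add: mult.assoc)
    finally show "q y i = (\<Sum>l<Suc r. D l y * e l y i)"
      by (simp add: q_def D_def sum_negf)
  qed
  have qu: "B (q y) (u j y) = 0" if "y \<in> V" "j < r" for y j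
    using that on[OF that(1)] by (simp add: q_def form_diff[OF B] form_sum[OF B] b_def
        if_distrib[of "\<lambda>z. _ * z"] cong: if_cong)
  have "smooth_vec_on M V (\<lambda>y i. \<Sum>l<Suc r. D l y * e l y i)"
    by (rule smooth_vec_combination[OF V(1)]) (use D eV in auto)
  then have qs: "smooth_vec_on M V q"
    unfolding smooth_vec_on_def using qD
    by (intro allI smooth_fun_cong[OF V(1), where g = "\<lambda>y. q y _"]) auto
  define nr where "nr y = B (q y) (q y)" for y
  have nr: "smooth_fun_on M V nr" unfolding nr_def by (rule smooth_form[OF B V(1) qs qs])
  have "nr x > 0"
    unfolding nr_def qD[OF V(2)] by (rule Suc.prems(2)) (auto simp: D_def)
  define V' where "V' = {y \<in> V. nr y > 0}"
  have V': "openin (mtop M) V'" "x \<in> V'" "V' \<subseteq> V"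
    using openin_positive[OF V(1) nr] V(2) \<open>nr x > 0\<close> by (auto simp: V'_def)
  have s: "sqrt (nr y) > 0" if "y \<in> V'" for y using that by (simp add: V'_def)
  define t where "t y = inverse (sqrt (nr y))" for y
  have t: "smooth_fun_on M V' t" unfolding t_def
    using s V' by (intro smooth_inverse smooth_sqrt smooth_fun_subset[OF nr]) (auto simp: V'_def)
  define w where "w = (\<lambda>y i. t y * q y i)"
  have w: "smooth_vec_on M V' w" unfolding w_def smooth_vec_on_def
    using smooth_vecD[OF smooth_vec_subset[OF qs V'(3)]] by (intro allI smooth_mult V' t)
  define u' where "u' = u(r := w)"
  define C' where "C' j l = (\<lambda>y. if j = r then t y * D l y else if l = r then 0 else C j l y)" for j l
  show ?case
  proof (rule exI[of _ V'], rule exI[of _ u'], rule exI[of _ C'], intro conjI ballI allI impI)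
    show "openin (mtop M) V'" "x \<in> V'" "V' \<subseteq> W" using V' V by auto
    show "smooth_vec_on M V' (u' j)" if "j < Suc r" for j
      using that w smooth_vec_subset[OF u V'(3)] by (auto simp: u'_def less_Suc_eq)
    show "smooth_fun_on M V' (C' j l)" if "j < Suc r" "l < Suc r" for j l
    proof (cases "j = r")
      case True
      then show ?thesis using smooth_mult[OF V'(1) t smooth_fun_subset[OF D[OF that(2)] V'(3)]] by (simp add: C'_def)
    next
      case False
      then show ?thesis using that smooth_fun_subset[OF C V'(3)] smooth_const[OF V'(1)]
        by (cases "l = r") (auto simp: C'_def less_Suc_eq)
    qed
    fix y assume y: "y \<in> V'"
    then have yV: "y \<in> V" using V' by auto
    show "u' j y = (\<lambda>i. \<Sum>l<Suc r. C' j l y * e l y i)" if "j < Suc r" for j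
    proof (cases "j = r")
      case True
      then show ?thesis by (simp add: u'_def w_def C'_def qD[OF yV] sum_distrib_left mult.assoc distrib_left)
    next
      case False
      then show ?thesis using uC[OF yV] that by (simp add: u'_def C'_def)
    qed
    have tt: "t y * t y * nr y = 1"
    proof -
      have "sqrt (nr y) * sqrt (nr y) = nr y" using y by (simp add: V'_def)
      then show ?thesis using s[OF y] unfolding t_def by (simp add: field_simps)
    qed
    have ww: "B (w y) (w y) = 1"
      using tt by (simp add: w_def form_scale[OF B] form_scale2[OF B] nr_def)
    have wu: "B (w y) (u j y) = 0" "B (u j y) (w y) = 0" if "j < r" for j
      using qu[OF yV that] form_sym[OF B, of "q y"]
      by (simp_all add: w_def form_scale[OF B] form_scale2[OF B])
    show "B (u' j y) (u' l y) = (if j = l then 1 else 0)" if "j < Suc r" "l < Suc r" for j l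
      using that ww wu on[OF yV] by (auto simp: u'_def less_Suc_eq)
    have sub: "lspan r (\<lambda>l. u l y) \<subseteq> lspan (Suc r) (\<lambda>l. u' l y)"
    proof (rule lspan_subset[OF subsp_lspan])
      fix j assume "j < r"
      then show "u j y \<in> lspan (Suc r) (\<lambda>l. u' l y)"
        using lspan_base[of j "Suc r" "\<lambda>l. u' l y"] by (simp add: u'_def)
    qed
    show "e j y \<in> lspan (Suc r) (\<lambda>l. u' l y)" if "j < Suc r" for j
    proof (cases "j = r")
      case True
      have "w y \<in> lspan (Suc r) (\<lambda>l. u' l y)"
        using lspan_base[of r "Suc r" "\<lambda>l. u' l y"] by (simp add: u'_def)
      moreover have "(\<lambda>i. \<Sum>j<r. b j y * u j y i) \<in> lspan (Suc r) (\<lambda>l. u' l y)"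
        by (rule subsetD[OF sub lspanI])
      ultimately have "(\<lambda>i. sqrt (nr y) * w y i + 1 * (\<Sum>j<r. b j y * u j y i)) \<in> lspan (Suc r) (\<lambda>l. u' l y)"
        by (rule subsp_lin[OF subsp_lspan])
      moreover have "sqrt (nr y) * w y i = q y i" for i
      proof -
        have "sqrt (nr y) * inverse (sqrt (nr y)) = 1" using s[OF y] by (intro right_inverse) linarith
        then show ?thesis unfolding w_def t_def mult.assoc[symmetric] by simp
      qed
      then have "(\<lambda>i. sqrt (nr y) * w y i + 1 * (\<Sum>j<r. b j y * u j y i)) = e j y"
        using True by (auto simp: q_def)
      ultimately show ?thesis by simp
    next
      case False
      then show ?thesis using sp[OF yV] that sub by (auto simp: less_Suc_eq)
    qed
  qed
qed

text \<open>The matrix of the derivatives of an orthonormal frame is skew up to the signs \<open>\<epsilon>\<close>, so the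
  projection onto a parallel span has derivative zero.\<close>

lemma orthonormal_frame_parallel:
  assumes B: "is_form B" and c: "c \<in> atlas M" and W: "openin (mtop M) W" "W \<subseteq> fst c" "x \<in> W"
    and u: "\<And>j. j < s \<Longrightarrow> smooth_vec_on M W (u j)"
    and on: "\<And>y j l. y \<in> W \<Longrightarrow> j < s \<Longrightarrow> l < s \<Longrightarrow> B (u j y) (u l y) = (if j = l then \<epsilon> j else 0)"
    and \<epsilon>: "\<And>j. j < s \<Longrightarrow> \<epsilon> j * \<epsilon> j = 1"
    and par: "\<And>y k j. y \<in> W \<Longrightarrow> k < mdim M \<Longrightarrow> j < s \<Longrightarrow> dvec (coord_vec M c y k) (u j) \<in> lspan s (\<lambda>l. u l y)"
  obtains V where "openin (mtop M) V" "x \<in> V" "V \<subseteq> W" "\<And>y. y \<in> V \<Longrightarrow> lspan s (\<lambda>l. u l y) = lspan s (\<lambda>l. u l x)"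
proof -
  obtain V where V: "openin (mtop M) V" "x \<in> V" "V \<subseteq> W"
    and loc: "\<And>h y. smooth_fun_on M W h \<Longrightarrow>
       (\<And>z i. z \<in> W \<Longrightarrow> i < mdim M \<Longrightarrow> coord_vec M c z i h = 0) \<Longrightarrow> y \<in> V \<Longrightarrow> h y = h x"
    using locally_constant[OF c W] by blast
  \<comment> \<open>Coordinate \<open>i\<close> of the orthogonal projection of the fixed vector
    \<open>w\<close> onto the span at \<open>y\<close>. As \<open>\<epsilon> j\<close> is 1 or -1,
    multiplying by it divides by the square of \<open>u j\<close>.\<close>
  define p where "p w i y = (\<Sum>j<s. \<epsilon> j * B w (u j y) * u j y i)" for w i y
  have cs: "smooth_vec_on M W (\<lambda>y. w)" for w :: "'b \<Rightarrow> real"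
    unfolding smooth_vec_on_def by (intro allI smooth_const W(1))
  have bw: "smooth_fun_on M W (\<lambda>y. B w (u j y))" if "j < s" for j w
    using smooth_form[OF B W(1) cs u[OF that]] .
  have sm: "smooth_fun_on M W (p w i)" for w i
    unfolding p_def by (intro smooth_intros W(1) bw smooth_vecD[OF u]) auto
  have "coord_vec M c y k (p w i) = 0" if y: "y \<in> W" and k: "k < mdim M" for y k w i
  proof -
    let ?X = "coord_vec M c y k"
    have X: "?X \<in> tangent_space M y" using coord_vec_tangent[OF c _ k] y W(2) by auto
    have "\<exists>\<omega>. \<forall>j<s. dvec ?X (u j) = (\<lambda>i. \<Sum>l<s. \<omega> j l * u l y i)"
    proof -
      have "\<forall>j. \<exists>\<omega>. j < s \<longrightarrow> dvec ?X (u j) = (\<lambda>i. \<Sum>l<s. \<omega> l * u l y i)"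
        using par[OF y k] by (auto simp: lspan_def)
      then show ?thesis by metis
    qed
    then obtain \<omega> where \<omega>: "\<And>j. j < s \<Longrightarrow> dvec ?X (u j) = (\<lambda>i. \<Sum>l<s. \<omega> j l * u l y i)" by blast
    have Bw: "B (dvec ?X (u j)) (u l y) = \<omega> j l * \<epsilon> l" if "j < s" "l < s" for j l
      using that on[OF y] by (simp add: \<omega> form_sum[OF B] if_distrib[of "\<lambda>z. _ * z"] cong: if_cong)
    have skew: "\<omega> j l * \<epsilon> l + \<omega> l j * \<epsilon> j = 0" if "j < s" "l < s" for j l
    proof -
      have "?X (\<lambda>y. B (u j y) (u l y)) = ?X (\<lambda>y. if j = l then \<epsilon> j else 0)"
        by (rule tangent_cong[OF X W(1) y]) (use on that in auto)
      also have "\<dots> = 0" by (rule tangent_const[OF X])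
      finally show ?thesis
        using tangent_form[OF B W(1) u[OF that(1)] u[OF that(2)] X y] Bw that form_sym[OF B, of "u j y"] by simp
    qed
    have "?X (p w i) = (\<Sum>j<s. ?X (\<lambda>y. \<epsilon> j * B w (u j y)) * u j y i + \<epsilon> j * B w (u j y) * dvec ?X (u j) i)"
    proof -
      have "?X (p w i) = dvec ?X (\<lambda>y i. \<Sum>j\<in>{..<s}. (\<epsilon> j * B w (u j y)) * u j y i) i"
        by (simp add: dvec_app p_def[abs_def])
      also have "\<dots> = (\<Sum>j<s. ?X (\<lambda>y. \<epsilon> j * B w (u j y)) * u j y i + \<epsilon> j * B w (u j y) * dvec ?X (u j) i)"
        by (subst dvec_combination[OF W(1) _ _ X y]) (auto intro!: smooth_intros W(1) bw u)
      finally show ?thesis .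
    qed
    also have "\<dots> = (\<Sum>j<s. \<epsilon> j * B w (dvec ?X (u j)) * u j y i + \<epsilon> j * B w (u j y) * dvec ?X (u j) i)"
    proof (intro sum.cong refl)
      fix j assume "j \<in> {..<s}"
      then have j: "j < s" by simp
      have "?X (\<lambda>y. \<epsilon> j * B w (u j y)) = \<epsilon> j * ?X (\<lambda>y. B w (u j y))"
        by (rule tangent_cmult[OF X smooth_nearI[OF W(1) y bw[OF j]]])
      also have "?X (\<lambda>y. B w (u j y)) = B w (dvec ?X (u j))"
        using tangent_form[OF B W(1) cs u[OF j] X y, of w]
        by (simp add: dvec_def tangent_const[OF X] form_zero[OF B])
      finally show "?X (\<lambda>y. \<epsilon> j * B w (u j y)) * u j y i + \<epsilon> j * B w (u j y) * dvec ?X (u j) i =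
         \<epsilon> j * B w (dvec ?X (u j)) * u j y i + \<epsilon> j * B w (u j y) * dvec ?X (u j) i" by simp
    qed
    also have "\<dots> = (\<Sum>j<s. (\<Sum>l<s. \<epsilon> j * \<omega> j l * (B w (u l y) * u j y i)) + (\<Sum>l<s. \<epsilon> j * \<omega> j l * (B w (u j y) * u l y i)))"
      by (intro sum.cong refl) (simp add: \<omega> form_sum2[OF B] sum_distrib_left sum_distrib_right ac_simps)
    also have "\<dots> = (\<Sum>j<s. \<Sum>l<s. \<epsilon> j * \<omega> j l * (B w (u l y) * u j y i)) + (\<Sum>l<s. \<Sum>j<s. \<epsilon> j * \<omega> j l * (B w (u j y) * u l y i))"
      unfolding sum.distrib by (subst (2) sum.swap) simp
    \<comment> \<open>Exchanging the names of the indices in the second sum collects the coefficient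
      that vanishes by \<open>skew\<close>.\<close>
    also have "\<dots> = (\<Sum>j<s. \<Sum>l<s. (\<epsilon> j * \<omega> j l + \<epsilon> l * \<omega> l j) * (B w (u l y) * u j y i))"
      unfolding sum.distrib[symmetric] by (simp add: algebra_simps)
    also have "\<dots> = 0"
    proof (intro sum.neutral ballI)
      fix j l assume "j \<in> {..<s}" "l \<in> {..<s}"
      then have jl: "j < s" "l < s" by auto
      have "\<epsilon> j * \<omega> j l + \<epsilon> l * \<omega> l j = \<epsilon> j * \<omega> j l * (\<epsilon> l * \<epsilon> l) + \<epsilon> l * \<omega> l j * (\<epsilon> j * \<epsilon> j)"
        using \<epsilon> jl by simp
      also have "\<dots> = \<epsilon> j * \<epsilon> l * (\<omega> j l * \<epsilon> l + \<omega> l j * \<epsilon> j)" by (simp add: algebra_simps)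
      finally show "(\<epsilon> j * \<omega> j l + \<epsilon> l * \<omega> l j) * (B w (u l y) * u j y i) = 0" using skew[OF jl] by simp
    qed
    finally show ?thesis .
  qed
  then have p: "p w i y = p w i x" if "y \<in> V" for w i y
    using loc[OF sm _ that] by blast
  have fixp: "p (u k y) i y = u k y i" if "y \<in> W" "k < s" for k y i
  proof -
    have "p (u k y) i y = (\<Sum>j<s. if k = j then \<epsilon> j * \<epsilon> k * u j y i else 0)"
      unfolding p_def using on[OF that(1,2)] by (intro sum.cong) auto
    then show ?thesis using that \<epsilon> by simp
  qed
  have mem: "(\<lambda>i. p w i y) \<in> lspan s (\<lambda>l. u l y)" for w y
    unfolding p_def by (rule lspanI)
  have "lspan s (\<lambda>l. u l y) = lspan s (\<lambda>l. u l x)" if y: "y \<in> V" for y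
  proof (intro equalityI lspan_subset[OF subsp_lspan])
    fix k assume k: "k < s"
    have yW: "y \<in> W" using y V(3) by auto
    \<comment> \<open>\<open>u k y\<close> is fixed by the projection at \<open>y\<close>, hence by
      the equal projection at \<open>x\<close>, and so lies in the span at \<open>x\<close>. The
      second half exchanges the two points.\<close>
    have "u k y = (\<lambda>i. p (u k y) i x)" using fixp[OF yW k] p[OF y, of "u k y"] by (intro ext) simp
    then show "u k y \<in> lspan s (\<lambda>l. u l x)" using mem[of "u k y" x] by simp
    have "u k x = (\<lambda>i. p (u k x) i y)" using fixp[OF W(3) k] p[OF y, of "u k x"] by (intro ext) simp
    then show "u k x \<in> lspan s (\<lambda>l. u l y)" using mem[of "u k x" y] by simp
  qed
  then show thesis using that V by blast
qed

text \<open>The position vector may be time-like, so Gram-Schmidt is applied to the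
  \<open>e j\<close>, on whose span the form is positive, while \<open>F\<close>, orthogonal to them
  and of constant square, is merely rescaled. Derivatives of the orthonormal vectors stay in
  \<open>E\<close>, since differentiating the smooth coefficients contributes combinations of the
  \<open>e j\<close>.\<close>

lemma parallel_span_locally_constant:
  assumes B: "is_form B" and c: "c \<in> atlas M" and W: "openin (mtop M) W" "W \<subseteq> fst c" "x \<in> W"
    and F: "smooth_vec_on M W F" and e: "\<And>j. j < r \<Longrightarrow> smooth_vec_on M W (e j)"
    and \<kappa>: "\<kappa> \<noteq> 0" "\<And>y. y \<in> W \<Longrightarrow> B (F y) (F y) = 1 / \<kappa>"
    and orth: "\<And>y j. y \<in> W \<Longrightarrow> j < r \<Longrightarrow> B (F y) (e j y) = 0"
    and pos: "\<And>c. \<exists>j<r. c j \<noteq> 0 \<Longrightarrow> B (\<lambda>i. \<Sum>j<r. c j * e j x i) (\<lambda>i. \<Sum>j<r. c j * e j x i) > 0"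
    and E: "\<And>y. E y = lspan (Suc r) (case_nat (F y) (\<lambda>j. e j y))"
    and parF: "\<And>y k. y \<in> W \<Longrightarrow> k < mdim M \<Longrightarrow> dvec (coord_vec M c y k) F \<in> E y"
    and par: "\<And>y k j. y \<in> W \<Longrightarrow> k < mdim M \<Longrightarrow> j < r \<Longrightarrow> dvec (coord_vec M c y k) (e j) \<in> E y"
  obtains V where "openin (mtop M) V" "x \<in> V" "V \<subseteq> W" "\<And>y. y \<in> V \<Longrightarrow> E y = E x"
proof -
  have "\<exists>V u C. openin (mtop M) V \<and> x \<in> V \<and> V \<subseteq> W \<and> (\<forall>j<r. smooth_vec_on M V (u j)) \<and>
      (\<forall>j<r. \<forall>l<r. smooth_fun_on M V (C j l)) \<and>
      (\<forall>y\<in>V. \<forall>j<r. u j y = (\<lambda>i. \<Sum>l<r. C j l y * e l y i)) \<and>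
      (\<forall>y\<in>V. \<forall>j<r. \<forall>l<r. B (u j y) (u l y) = (if j = l then 1 else 0)) \<and>
      (\<forall>y\<in>V. \<forall>j<r. e j y \<in> lspan r (\<lambda>l. u l y))"
    by (rule Gram_Schmidt[OF B W(1,3)]) (erule e, erule pos)
  then obtain V u C where V: "openin (mtop M) V" "x \<in> V" "V \<subseteq> W"
    and u': "\<forall>j<r. smooth_vec_on M V (u j)"
    and C': "\<forall>j<r. \<forall>l<r. smooth_fun_on M V (C j l)"
    and uC': "\<forall>y\<in>V. \<forall>j<r. u j y = (\<lambda>i. \<Sum>l<r. C j l y * e l y i)"
    and on': "\<forall>y\<in>V. \<forall>j<r. \<forall>l<r. B (u j y) (u l y) = (if j = l then 1 else 0)"
    and sp': "\<forall>y\<in>V. \<forall>j<r. e j y \<in> lspan r (\<lambda>l. u l y)"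
    by blast
  note u = u'[rule_format] and C = C'[rule_format] and uC = uC'[rule_format]
    and on = on'[rule_format] and sp = sp'[rule_format]
  define s where "s = sqrt \<bar>\<kappa>\<bar>"
  have s: "s > 0" "s * s = \<bar>\<kappa>\<bar>" using \<kappa>(1) by (auto simp: s_def)
  define v where "v = case_nat (\<lambda>y i. s * F y i) u"
  define \<epsilon> where "\<epsilon> = case_nat (sgn \<kappa>) (\<lambda>j::nat. 1)"
  have FE: "F y \<in> E y" for y
    unfolding E using lspan_base[of 0 "Suc r" "case_nat (F y) (\<lambda>j. e j y)"] by simp
  have eE: "e j y \<in> E y" if "j < r" for j y
    unfolding E using lspan_base[of "Suc j" "Suc r" "case_nat (F y) (\<lambda>j. e j y)"] that by simp
  have subE: "subsp (E y)" for y unfolding E by (rule subsp_lspan)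
  have uE: "u j y \<in> E y" if "j < r" "y \<in> V" for j y
    unfolding uC[OF that(2,1)] by (rule subsp_sum[OF subE]) (use eE in auto)
  have lv: "lspan (Suc r) (\<lambda>l. v l y) = E y" if y: "y \<in> V" for y
  proof
    show "lspan (Suc r) (\<lambda>l. v l y) \<subseteq> E y"
    proof (rule lspan_subset[OF subE])
      fix j assume "j < Suc r"
      then show "v j y \<in> E y"
        using subsp_scale[OF subE FE] uE[OF _ y] by (cases j) (auto simp: v_def)
    qed
    have sub: "lspan r (\<lambda>l. u l y) \<subseteq> lspan (Suc r) (\<lambda>l. v l y)"
    proof (rule lspan_subset[OF subsp_lspan])
      fix j assume "j < r"
      then show "u j y \<in> lspan (Suc r) (\<lambda>l. v l y)"
        using lspan_base[of "Suc j" "Suc r" "\<lambda>l. v l y"] by (simp add: v_def)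
    qed
    have "(\<lambda>i. inverse s * (s * F y i)) \<in> lspan (Suc r) (\<lambda>l. v l y)"
      using subsp_scale[OF subsp_lspan lspan_base[of 0 "Suc r" "\<lambda>l. v l y"], of "inverse s"]
      by (simp add: v_def)
    then have Fv: "F y \<in> lspan (Suc r) (\<lambda>l. v l y)" using s(1) by (simp add: mult.assoc[symmetric])
    show "E y \<subseteq> lspan (Suc r) (\<lambda>l. v l y)"
      unfolding E
    proof (rule lspan_subset[OF subsp_lspan])
      fix j assume "j < Suc r"
      then show "case_nat (F y) (\<lambda>j. e j y) j \<in> lspan (Suc r) (\<lambda>l. v l y)"
        using Fv subsetD[OF sub sp[OF y]] by (cases j) auto
    qed
  qed
  have FV: "smooth_vec_on M V F" using smooth_vec_subset[OF F V(3)] .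
  have eV: "smooth_vec_on M V (e j)" if "j < r" for j using smooth_vec_subset[OF e[OF that] V(3)] .
  have vs: "smooth_vec_on M V (v j)" if "j < Suc r" for j
  proof (cases j)
    case 0
    then show ?thesis using smooth_mult[OF V(1) smooth_const[OF V(1)] smooth_vecD[OF FV]]
      by (simp add: v_def smooth_vec_on_def)
  next
    case (Suc l)
    then show ?thesis using that u by (simp add: v_def)
  qed
  have von: "B (v j y) (v l y) = (if j = l then \<epsilon> j else 0)" if y: "y \<in> V" and jl: "j < Suc r" "l < Suc r" for j l y
  proof -
    have yW: "y \<in> W" using y V(3) by auto
    have Fu: "B (F y) (u l y) = 0" if "l < r" for l
      using that y orth[OF yW] by (simp add: uC form_sum2[OF B])
    have uF: "B (u l y) (F y) = 0" if "l < r" for l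
      using Fu[OF that] form_sym[OF B, of "u l y" "F y"] by simp
    have "s * (s * (1 / \<kappa>)) = sgn \<kappa>"
      using s(2) \<kappa>(1) by (simp add: mult.assoc[symmetric] abs_if sgn_if)
    then have FF: "B (\<lambda>i. s * F y i) (\<lambda>i. s * F y i) = sgn \<kappa>"
      using \<kappa>(2)[OF yW] by (simp add: form_scale[OF B] form_scale2[OF B])
    show ?thesis
      using jl FF Fu uF on[OF y]
      by (cases j; cases l) (simp_all add: v_def \<epsilon>_def form_scale[OF B] form_scale2[OF B])
  qed
  have vpar: "dvec (coord_vec M c y k) (v j) \<in> lspan (Suc r) (\<lambda>l. v l y)"
    if y: "y \<in> V" and k: "k < mdim M" and j: "j < Suc r" for y k j
  proof -
    let ?X = "coord_vec M c y k"
    have yW: "y \<in> W" using y V(3) by auto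
    have X: "?X \<in> tangent_space M y" using coord_vec_tangent[OF c _ k] yW W(2) by auto
    have "dvec ?X (v j) \<in> E y"
    proof (cases j)
      case 0
      have "dvec ?X (\<lambda>y i. s * F y i) = (\<lambda>i. s * dvec ?X F i)"
        unfolding dvec_def using tangent_cmult[OF X smooth_vec_near[OF V(1) y FV]] by auto
      then show ?thesis using 0 subsp_scale[OF subE parF[OF yW k]] by (simp add: v_def)
    next
      case (Suc l)
      then have l: "l < r" using j by simp
      have "dvec ?X (u l) = dvec ?X (\<lambda>y i. \<Sum>q\<in>{..<r}. C l q y * e q y i)"
        by (rule dvec_cong[OF X V(1) y]) (use uC l in auto)
      also have "\<dots> = (\<lambda>i. \<Sum>q<r. ?X (C l q) * e q y i + C l q y * dvec ?X (e q) i)"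
        by (rule dvec_combination[OF V(1) _ _ X y]) (use C l eV in auto)
      also have "\<dots> = (\<lambda>i. \<Sum>q<r. 1 * (?X (C l q) * e q y i + C l q y * dvec ?X (e q) i))" by simp
      also have "\<dots> \<in> E y"
        by (rule subsp_sum[OF subE]) (use subsp_lin[OF subE eE par[OF yW k]] in auto)
      finally show ?thesis using Suc by (simp add: v_def)
    qed
    then show ?thesis by (simp add: lv[OF y])
  qed
  have \<epsilon>: "\<epsilon> j * \<epsilon> j = 1" for j
    using \<kappa>(1) by (cases j) (auto simp: \<epsilon>_def sgn_if)
  have Vc: "V \<subseteq> fst c" using V(3) W(2) by blast
  show thesis
  proof (rule orthonormal_frame_parallel[OF B c V(1) Vc V(2) vs von \<epsilon> vpar])
    fix V' assume V': "openin (mtop M) V'" "x \<in> V'" "V' \<subseteq> V"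
      "\<And>y. y \<in> V' \<Longrightarrow> lspan (Suc r) (\<lambda>l. v l y) = lspan (Suc r) (\<lambda>l. v l x)"
    show thesis
    proof (rule that[OF V'(1,2)])
      show "V' \<subseteq> W" using V' V by auto
      show "E y = E x" if "y \<in> V'" for y
        using V'(4)[OF that] lv[of y] lv[OF V(2)] V'(3) that by auto
    qed
  qed
qed

text \<open>Level sets of \<open>g\<close> are open and closed. The values have arbitrary type
  because the function of interest takes subspaces as values.\<close>

lemma connected_locally_constant:
  assumes "connected_space (mtop M)"
    and "\<And>x. x \<in> topspace (mtop M) \<Longrightarrow> \<exists>V. openin (mtop M) V \<and> x \<in> V \<and> (\<forall>y\<in>V. g y = g x)"
    and "x \<in> topspace (mtop M)" "y \<in> topspace (mtop M)"
  shows "g y = g x"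
proof -
  let ?S = "{z \<in> topspace (mtop M). g z = g x}" and ?T = "{z \<in> topspace (mtop M). g z \<noteq> g x}"
  have nb: "\<exists>V. openin (mtop M) V \<and> z \<in> V \<and> V \<subseteq> topspace (mtop M) \<and> (\<forall>y\<in>V. g y = g z)"
    if "z \<in> topspace (mtop M)" for z
    using assms(2)[OF that] openin_subset by blast
  have op: "openin (mtop M) {z \<in> topspace (mtop M). g z \<in> G}" for G
  proof (subst openin_subopen, intro ballI)
    fix z assume z: "z \<in> {z \<in> topspace (mtop M). g z \<in> G}"
    then obtain V where V: "openin (mtop M) V" "z \<in> V" "V \<subseteq> topspace (mtop M)" "\<forall>y\<in>V. g y = g z"
      using nb[of z] by blast
    have "g y \<in> G" if "y \<in> V" for y using V(4)[rule_format, OF that] z by simp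
    then show "\<exists>V. openin (mtop M) V \<and> z \<in> V \<and> V \<subseteq> {z \<in> topspace (mtop M). g z \<in> G}"
      using V(1-3) by blast
  qed
  have S: "openin (mtop M) ?S" and T: "openin (mtop M) ?T"
    using op[of "{g x}"] op[of "- {g x}"] by simp_all
  have "topspace (mtop M) \<subseteq> ?S \<union> ?T" "?S \<inter> ?T = {}" by auto
  then have "?S = {} \<or> ?T = {}" using assms(1) S T unfolding connected_space_def by blast
  then show ?thesis using assms(3,4) by blast
qed

end

section \<open>Isometric immersions\<close>

text \<open>Conditions under which \<open>orth_proj\<close> onto a tangent space denotes: positivity
  makes the projection unique, and existence is demanded for every vector of the flat space, since
  flat derivatives leave the tangent space.\<close>

definition target_geom :: "'i target \<Rightarrow> bool" where
  "target_geom N \<longleftrightarrow> is_form (form N) \<and> (\<forall>z\<in>points N. subsp (tspace N z) \<and> posdef (form N) (tspace N z) \<and>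
     (\<forall>w. \<exists>v\<in>tspace N z. \<forall>u\<in>tspace N z. form N v u = form N w u))"

locale immersion = smooth_atlas M for M :: "'a rmanifold" +
  fixes N :: "'i target" and f :: "'a \<Rightarrow> 'i \<Rightarrow> real"
  assumes geom: "target_geom N"
    and imm: "isometric_immersion M N f"
    and metric_pos: "\<And>x X. x \<in> topspace (mtop M) \<Longrightarrow> X \<in> tangent_space M x \<Longrightarrow> X \<noteq> (\<lambda>h. 0) \<Longrightarrow> metric M x X X > 0"
    and dvec_tspace: "\<And>x X. X \<in> tangent_space M x \<Longrightarrow> dvec X f \<in> tspace N (f x)"
begin

abbreviation "B \<equiv> form N"

lemma B: "is_form (form N)" using geom by (simp add: target_geom_def)

lemma f_points: "x \<in> topspace (mtop M) \<Longrightarrow> f x \<in> points N"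
  using imm by (auto simp: isometric_immersion_def)

lemma f_smooth: "smooth_vec_on M (topspace (mtop M)) f"
  using imm by (auto simp: isometric_immersion_def)

lemma f_isometric: "X \<in> tangent_space M x \<Longrightarrow> Y \<in> tangent_space M x \<Longrightarrow> B (dvec X f) (dvec Y f) = metric M x X Y"
  using imm tangent_space_topspace[of X x] by (auto simp: isometric_immersion_def)

lemma f_smooth_on: "openin (mtop M) W \<Longrightarrow> smooth_vec_on M W f"
  using smooth_vec_subset[OF f_smooth openin_subset] .

lemma tspace_subsp: "x \<in> topspace (mtop M) \<Longrightarrow> subsp (tspace N (f x))"
  and tspace_posdef: "x \<in> topspace (mtop M) \<Longrightarrow> posdef B (tspace N (f x))"
  and tspace_proj: "x \<in> topspace (mtop M) \<Longrightarrow> \<exists>v\<in>tspace N (f x). \<forall>u\<in>tspace N (f x). B v u = B w u"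
  using geom f_points[of x] by (auto simp: target_geom_def)

lemma image_tangent_subsp:
  assumes "x \<in> topspace (mtop M)" shows "subsp (image_tangent M f x)"
  unfolding subsp_def
proof (intro conjI ballI allI)
  show "(\<lambda>i. 0) \<in> image_tangent M f x"
    unfolding image_tangent_def by (rule image_eqI[OF _ tangent_space_zero[OF assms]]) (simp add: dvec_def)
  fix u v a b assume "u \<in> image_tangent M f x" "v \<in> image_tangent M f x"
  then obtain X Y where XY: "X \<in> tangent_space M x" "Y \<in> tangent_space M x" "u = dvec X f" "v = dvec Y f"
    by (auto simp: image_tangent_def)
  show "(\<lambda>i. a * u i + b * v i) \<in> image_tangent M f x"
    unfolding image_tangent_def
    by (rule image_eqI[OF _ tangent_space_lin[OF XY(1,2), of a b]]) (simp add: XY dvec_def)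
qed

lemma image_tangent_chart:
  assumes c: "c \<in> atlas M" "x \<in> fst c"
  shows "image_tangent M f x = lspan (mdim M) (\<lambda>i. dvec (coord_vec M c x i) f)"
proof
  show "lspan (mdim M) (\<lambda>i. dvec (coord_vec M c x i) f) \<subseteq> image_tangent M f x"
    by (rule lspan_subset[OF image_tangent_subsp[OF chart_topspace[OF c]]])
      (use coord_vec_tangent[OF c] in \<open>auto simp: image_tangent_def\<close>)
  show "image_tangent M f x \<subseteq> lspan (mdim M) (\<lambda>i. dvec (coord_vec M c x i) f)"
  proof
    fix v assume "v \<in> image_tangent M f x"
    then obtain X where X: "X \<in> tangent_space M x" "v = dvec X f" by (auto simp: image_tangent_def)
    have "v = (\<lambda>i. \<Sum>j<mdim M. X (\<lambda>y. snd c y j) * dvec (coord_vec M c x j) f i)"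
      unfolding X(2) dvec_def by (subst tangent_chart[OF X(1) c]) simp
    then show "v \<in> lspan (mdim M) (\<lambda>i. dvec (coord_vec M c x i) f)" by (auto simp: lspan_def)
  qed
qed

lemma image_tangent_tspace: "x \<in> topspace (mtop M) \<Longrightarrow> image_tangent M f x \<subseteq> tspace N (f x)"
  using dvec_tspace by (auto simp: image_tangent_def)

lemma normal_space_subsp:
  assumes "x \<in> topspace (mtop M)" shows "subsp (normal_space M N f x)"
  using tspace_subsp[OF assms] unfolding subsp_def normal_space_def
  by (auto simp: form_lin[OF B] form_zero[OF B])

lemma normal_space_posdef: "x \<in> topspace (mtop M) \<Longrightarrow> posdef B (normal_space M N f x)"
  by (rule posdef_subset[OF tspace_posdef]) (auto simp: normal_space_def)

text \<open>The metric is positive and \<open>f\<close> preserves it. This is the uniqueness behind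
  the definite description in \<open>R_tensor\<close>.\<close>

lemma dvec_inj:
  assumes "X \<in> tangent_space M x" "Y \<in> tangent_space M x" "dvec X f = dvec Y f"
  shows "X = Y"
proof -
  let ?Z = "\<lambda>h. 1 * X h + (- 1) * Y h"
  have Z: "?Z \<in> tangent_space M x" using tangent_space_lin[OF assms(1,2)] .
  have "dvec ?Z f = (\<lambda>i. 0)" using assms(3) by (auto simp: dvec_def fun_eq_iff)
  then have "metric M x ?Z ?Z = 0" using f_isometric[OF Z Z] by (simp add: form_zero[OF B])
  then have "?Z = (\<lambda>h. 0)" using metric_pos[OF tangent_space_topspace[OF Z] Z] by fastforce
  then show ?thesis by (auto simp: fun_eq_iff)
qed

lemma tangent_decomp:
  assumes x: "x \<in> topspace (mtop M)" and w: "w \<in> tspace N (f x)"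
  obtains t \<nu> where "t \<in> image_tangent M f x" "\<nu> \<in> normal_space M N f x" "w = (\<lambda>i. t i + \<nu> i)"
    "\<And>u. u \<in> image_tangent M f x \<Longrightarrow> B t u = B w u"
proof -
  obtain c where c: "c \<in> atlas M" "x \<in> fst c" using topspace_chart[OF x] .
  have pd: "posdef B (image_tangent M f x)"
    by (rule posdef_subset[OF tspace_posdef[OF x] image_tangent_tspace[OF x]])
  obtain t where t: "t \<in> image_tangent M f x" "\<And>u. u \<in> image_tangent M f x \<Longrightarrow> B t u = B w u"
    using proj_exists[OF B pd[unfolded image_tangent_chart[OF c]], of w] unfolding image_tangent_chart[OF c] by blast
  have "(\<lambda>i. w i - t i) \<in> normal_space M N f x"
    unfolding normal_space_def
    using subsp_diff[OF tspace_subsp[OF x] w subsetD[OF image_tangent_tspace[OF x] t(1)]] t(2)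
    by (auto simp: form_diff[OF B])
  then show thesis using t by (intro that[of t "\<lambda>i. w i - t i"]) auto
qed

lemma tangent_projI:
  assumes "x \<in> topspace (mtop M)" "t \<in> image_tangent M f x" "\<And>u. u \<in> image_tangent M f x \<Longrightarrow> B t u = B w u"
  shows "orth_proj B (image_tangent M f x) w = t"
  by (rule orth_projI[OF B image_tangent_subsp posdef_subset[OF tspace_posdef image_tangent_tspace]]) (use assms in auto)

lemma normal_projI:
  assumes x: "x \<in> topspace (mtop M)" and t: "t \<in> image_tangent M f x" and \<nu>: "\<nu> \<in> normal_space M N f x"
  shows "orth_proj B (normal_space M N f x) (\<lambda>i. t i + \<nu> i) = \<nu>"
proof (rule orth_projI[OF B normal_space_subsp[OF x] normal_space_posdef[OF x] \<nu>])
  fix u assume "u \<in> normal_space M N f x"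
  then have "B t u = 0" using t form_sym[OF B, of t u] by (auto simp: normal_space_def)
  then show "B \<nu> u = B (\<lambda>i. t i + \<nu> i) u" by (simp add: form_add[OF B])
qed

text \<open>This evaluates both projections in \<open>second_ff\<close> and
  \<open>normal_conn\<close> from one splitting of the flat derivative into a tangent part, a normal
  part and a part \<open>p\<close> orthogonal to the target. In the applications \<open>p\<close> is
  built from position vectors.\<close>

lemma normal_tangent_projI:
  assumes x: "x \<in> topspace (mtop M)" and t: "t \<in> image_tangent M f x" and \<nu>: "\<nu> \<in> normal_space M N f x"
    and p: "\<And>u. u \<in> tspace N (f x) \<Longrightarrow> B p u = 0" and w: "\<And>i. w i = t i + \<nu> i + p i"
  shows "orth_proj B (normal_space M N f x) (orth_proj B (tspace N (f x)) w) = \<nu>"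
proof -
  have w': "w = (\<lambda>i. (t i + \<nu> i) + p i)" using w by auto
  have "orth_proj B (tspace N (f x)) w = (\<lambda>i. t i + \<nu> i)"
  proof (rule orth_projI[OF B tspace_subsp[OF x] tspace_posdef[OF x]])
    show "(\<lambda>i. t i + \<nu> i) \<in> tspace N (f x)"
      using subsp_add[OF tspace_subsp[OF x]] t \<nu> image_tangent_tspace[OF x] by (auto simp: normal_space_def)
    show "B (\<lambda>i. t i + \<nu> i) u = B w u" if "u \<in> tspace N (f x)" for u
      using p[OF that] unfolding w' form_add[OF B] by simp
  qed
  then show ?thesis using normal_projI[OF x t \<nu>] by simp
qed

lemma flat_decomp:
  assumes x: "x \<in> topspace (mtop M)"
  obtains t \<nu> p where "t \<in> image_tangent M f x" "\<nu> \<in> normal_space M N f x"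
    "\<And>u. u \<in> tspace N (f x) \<Longrightarrow> B p u = 0" "\<And>i. w i = t i + \<nu> i + p i"
    "orth_proj B (normal_space M N f x) (orth_proj B (tspace N (f x)) w) = \<nu>"
proof -
  obtain v where v: "v \<in> tspace N (f x)" "\<forall>u\<in>tspace N (f x). B v u = B w u" using tspace_proj[OF x] by blast
  obtain t \<nu> where d: "t \<in> image_tangent M f x" "\<nu> \<in> normal_space M N f x" "v = (\<lambda>i. t i + \<nu> i)"
    using tangent_decomp[OF x v(1)] by blast
  define p where "p = (\<lambda>i. w i - v i)"
  have p: "B p u = 0" if "u \<in> tspace N (f x)" for u
    using v(2) that by (simp add: p_def form_diff[OF B])
  have w: "w i = t i + \<nu> i + p i" for i using d(3) by (simp add: p_def)
  show thesis using that[OF d(1,2) p w normal_tangent_projI[OF x d(1,2) p w]] .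
qed

lemma frame_smooth:
  assumes c: "c \<in> atlas M" and i: "i < mdim M"
  shows "smooth_vec_on M (fst c) (\<lambda>y. dvec (coord_vec M c y i) f)"
  unfolding smooth_vec_on_def dvec_def
  by (intro allI smooth_coord_vec[OF c chart_open[OF c] order_refl _ i] smooth_vecD f_smooth_on chart_open[OF c])

lemma frame_pos:
  assumes c: "c \<in> atlas M" "x \<in> fst c" and a: "\<exists>j<mdim M. a j \<noteq> 0"
  shows "B (\<lambda>i. \<Sum>j<mdim M. a j * dvec (coord_vec M c x j) f i) (\<lambda>i. \<Sum>j<mdim M. a j * dvec (coord_vec M c x j) f i) > 0"
proof -
  let ?X = "\<lambda>h. \<Sum>j<mdim M. a j * coord_vec M c x j h"
  have X: "?X \<in> tangent_space M x" by (rule tangentI[OF c])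
  obtain j where j: "j < mdim M" "a j \<noteq> 0" using a by auto
  have "?X (\<lambda>y. snd c y j) = a j"
    using j(1) by (simp add: coord_vec_chart[OF c] if_distrib[of "\<lambda>z. _ * z"] cong: if_cong)
  then have "?X \<noteq> (\<lambda>h. 0)" using j(2) by metis
  then have "metric M x ?X ?X > 0" using metric_pos[OF chart_topspace[OF c] X] by blast
  then show ?thesis using f_isometric[OF X X] by (simp add: dvec_def)
qed

lemma second_derivative_commute:
  assumes c: "c \<in> atlas M" and x: "x \<in> fst c" and ij: "i < mdim M" "j < mdim M"
  shows "dvec (coord_vec M c x i) (\<lambda>y. dvec (coord_vec M c y j) f) =
     dvec (coord_vec M c x j) (\<lambda>y. dvec (coord_vec M c y i) f)"
  unfolding dvec_def
  using coord_vec_commute[OF c chart_open[OF c] order_refl smooth_vecD[OF f_smooth_on[OF chart_open[OF c]]] x ij]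
  by auto

text \<open>The Koszul formula: the Christoffel symbols of an isometric immersion depend only on the metric.\<close>

lemma Christoffel:
  assumes c: "c \<in> atlas M" and x: "x \<in> fst c" and ijk: "i < mdim M" "j < mdim M" "k < mdim M"
  defines "g \<equiv> \<lambda>j k y. metric M y (coord_vec M c y j) (coord_vec M c y k)"
  shows "2 * B (dvec (coord_vec M c x i) (\<lambda>y. dvec (coord_vec M c y j) f)) (dvec (coord_vec M c x k) f) =
     coord_vec M c x i (g j k) + coord_vec M c x j (g i k) - coord_vec M c x k (g i j)"
proof -
  define e where "e j y = dvec (coord_vec M c y j) f" for j y
  define D where "D i j = dvec (coord_vec M c x i) (e j)" for i j
  have g: "coord_vec M c x i (g j k) = B (D i j) (e k x) + B (e j x) (D i k)"
    if "i < mdim M" "j < mdim M" "k < mdim M" for i j k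
  proof -
    have X: "coord_vec M c x i \<in> tangent_space M x" by (rule coord_vec_tangent[OF c x that(1)])
    have "coord_vec M c x i (g j k) = coord_vec M c x i (\<lambda>y. B (e j y) (e k y))"
      by (rule tangent_cong[OF X chart_open[OF c] x])
        (simp add: g_def e_def f_isometric[OF coord_vec_tangent[OF c _ that(2)] coord_vec_tangent[OF c _ that(3)]])
    also have "\<dots> = B (D i j) (e k x) + B (e j x) (D i k)"
      unfolding D_def
      by (rule tangent_form[OF B chart_open[OF c] _ _ X x]) (use frame_smooth[OF c] that in \<open>auto simp: e_def\<close>)
    finally show ?thesis .
  qed
  have comm: "D i j = D j i" if "i < mdim M" "j < mdim M" for i j
    using second_derivative_commute[OF c x that] by (simp add: D_def e_def[abs_def])
  \<comment> \<open>The three derivatives of the metric contain six terms; by \<open>comm\<close>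
    four of them cancel in pairs and the other two coincide.\<close>
  have "2 * B (D i j) (e k x) = coord_vec M c x i (g j k) + coord_vec M c x j (g i k) - coord_vec M c x k (g i j)"
    using g[OF ijk] g[OF ijk(2,1,3)] g[OF ijk(3,1,2)] comm[OF ijk(1,2)] comm[OF ijk(1,3)] comm[OF ijk(2,3)]
      form_sym[OF B, of "e j x" "D i k"] form_sym[OF B, of "e i x" "D j k"] form_sym[OF B, of "e i x" "D k j"]
    by simp
  then show ?thesis by (simp add: D_def e_def[abs_def])
qed

end

section \<open>Flat scalar products and the geometry of one sheet of a hyperboloid\<close>

lemma is_form_flat_ip: "is_form (flat_ip s N)"
  unfolding is_form_def flat_ip_def by (intro exI[of _ "\<lambda>i. if i < s then - 1 else 1"] exI[of _ "{..<N}"]) auto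

lemma flat_ip_0: "flat_ip 0 N u v = (\<Sum>i<N. u i * v i)"
  by (simp add: flat_ip_def)

lemma flat_ip_1: "flat_ip (Suc 0) (Suc n) u v = (\<Sum>i<n. u (Suc i) * v (Suc i)) - u 0 * v 0"
  by (simp add: flat_ip_def sum.lessThan_Suc_shift del: sum.lessThan_Suc)

lemma Q_space_simps [simp]:
  "form (Q_space \<kappa> n) = flat_ip (sig \<kappa>) (Suc n)"
  "x \<in> points (Q_space \<kappa> n) \<longleftrightarrow> x \<in> topspace (Euclidean_space (Suc n)) \<and>
     flat_ip (sig \<kappa>) (Suc n) x x = 1 / \<kappa> \<and> (\<kappa> < 0 \<longrightarrow> x 0 > 0)"
  "v \<in> tspace (Q_space \<kappa> n) x \<longleftrightarrow> v \<in> topspace (Euclidean_space (Suc n)) \<and> flat_ip (sig \<kappa>) (Suc n) x v = 0"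
  by (auto simp: Q_space_def)

lemma sig_neg: "\<kappa> < 0 \<Longrightarrow> sig \<kappa> = Suc 0" and sig_nonneg: "\<not> \<kappa> < 0 \<Longrightarrow> sig \<kappa> = 0"
  by (auto simp: sig_def)

text \<open>Cauchy-Schwarz in the space-like coordinates. Their squared length at \<open>x\<close>
  is \<open>(x 0)^2 + 1 / \<kappa>\<close>, strictly below \<open>(x 0)^2\<close> as
  \<open>\<kappa> < 0\<close>; this gap gives the strict inequalities below.\<close>

lemma hyperbolic_CS:
  assumes "\<kappa> < 0" "x \<in> points (Q_space \<kappa> n)"
  shows "(\<Sum>i<n. x (Suc i) * v (Suc i))\<^sup>2 \<le> ((x 0)\<^sup>2 + 1 / \<kappa>) * (\<Sum>i<n. (v (Suc i))\<^sup>2)"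
proof -
  have "(\<Sum>i<n. (x (Suc i))\<^sup>2) = (x 0)\<^sup>2 + 1 / \<kappa>"
    using assms by (simp add: sig_neg flat_ip_1 power2_eq_square)
  then show ?thesis using Cauchy_Schwarz_ineq_sum[of "\<lambda>i. x (Suc i)" "\<lambda>i. v (Suc i)" "{..<n}"] by simp
qed

text \<open>For \<open>\<kappa> < 0\<close> tangency expresses \<open>x 0 * v 0\<close> by the
  space-like coordinates, and Cauchy-Schwarz gives \<open>(v 0)^2 < s\<close>. The strict inequality
  requires \<open>s > 0\<close>: if \<open>s = 0\<close>, then \<open>v 0 = 0\<close> as well and
  \<open>v\<close> vanishes.\<close>

lemma Q_space_posdef:
  assumes x: "x \<in> points (Q_space \<kappa> n)"
  shows "posdef (flat_ip (sig \<kappa>) (Suc n)) (tspace (Q_space \<kappa> n) x)"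
  unfolding posdef_def
proof (intro ballI impI)
  fix v assume v: "v \<in> tspace (Q_space \<kappa> n) x" "v \<noteq> (\<lambda>i. 0)"
  then obtain i where i: "v i \<noteq> 0" "i < Suc n" by (auto simp: topspace_Euclidean_space fun_eq_iff) (meson not_less_eq not_le)
  show "flat_ip (sig \<kappa>) (Suc n) v v > 0"
  proof (cases "\<kappa> < 0")
    case False
    have "0 < (\<Sum>i<Suc n. v i * v i)" using i by (intro sum_pos2[of _ i]) (auto simp: zero_less_mult_iff)
    then show ?thesis using False by (simp add: sig_nonneg flat_ip_0)
  next
    case True
    define s where "s = (\<Sum>i<n. (v (Suc i))\<^sup>2)"
    have x0: "x 0 > 0" using x True by simp
    have "x 0 * v 0 = (\<Sum>i<n. x (Suc i) * v (Suc i))" using v True by (simp add: sig_neg flat_ip_1)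
    then have le: "(x 0)\<^sup>2 * (v 0)\<^sup>2 \<le> ((x 0)\<^sup>2 + 1 / \<kappa>) * s"
      using hyperbolic_CS[OF True x, of v] by (simp add: s_def power_mult_distrib[symmetric])
    have s0: "s \<ge> 0" by (simp add: s_def sum_nonneg)
    have "s > 0"
    proof (rule ccontr)
      assume "\<not> s > 0"
      then have s: "s = 0" using s0 by simp
      then have "(x 0)\<^sup>2 * (v 0)\<^sup>2 \<le> 0" using le by simp
      then have "v 0 = 0" using x0 by (simp add: mult_le_0_iff)
      moreover have "v (Suc j) = 0" if "j < n" for j
        using s that by (simp add: s_def sum_nonneg_eq_0_iff)
      ultimately show False using i by (cases i) auto
    qed
    then have "((x 0)\<^sup>2 + 1 / \<kappa>) * s < (x 0)\<^sup>2 * s" using True by (simp add: mult_strict_right_mono)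
    then have "(x 0)\<^sup>2 * (v 0)\<^sup>2 < (x 0)\<^sup>2 * s" using le by linarith
    then have "(v 0)\<^sup>2 < s" using x0 by simp
    then show ?thesis using True by (simp add: sig_neg flat_ip_1 s_def power2_eq_square)
  qed
qed

text \<open>On one sheet the time coordinates are positive and dominate: the space-like part of the
  product is below \<open>x 0 * y 0\<close> in absolute value.\<close>

lemma Q_space_future:
  assumes k: "\<kappa> < 0" and x: "x \<in> points (Q_space \<kappa> n)" and y: "y \<in> points (Q_space \<kappa> n)"
  shows "flat_ip (sig \<kappa>) (Suc n) x y < 0"
proof -
  have y0: "(\<Sum>i<n. (y (Suc i))\<^sup>2) = (y 0)\<^sup>2 + 1 / \<kappa>"
    using y k by (simp add: sig_neg flat_ip_1 power2_eq_square)
  then have ny: "0 \<le> (y 0)\<^sup>2 + 1 / \<kappa>" by (metis sum_nonneg zero_le_power2)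
  have "(\<Sum>i<n. x (Suc i) * y (Suc i))\<^sup>2 \<le> ((x 0)\<^sup>2 + 1 / \<kappa>) * ((y 0)\<^sup>2 + 1 / \<kappa>)"
    using hyperbolic_CS[OF k x, of y] y0 by simp
  also have "\<dots> \<le> (x 0)\<^sup>2 * ((y 0)\<^sup>2 + 1 / \<kappa>)" using ny k by (intro mult_right_mono) auto
  also have "\<dots> < (x 0)\<^sup>2 * (y 0)\<^sup>2" using k x by (intro mult_strict_left_mono) auto
  finally have "(\<Sum>i<n. x (Suc i) * y (Suc i))\<^sup>2 < (x 0 * y 0)\<^sup>2" by (simp add: power_mult_distrib)
  then have "(\<Sum>i<n. x (Suc i) * y (Suc i)) < x 0 * y 0"
    by (rule power2_less_imp_less) (use k x y in auto)
  then show ?thesis using k by (simp add: sig_neg flat_ip_1)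
qed

text \<open>If \<open>y\<close> lay on the other sheet, then \<open>-y\<close> would lie on the
  chosen one and have negative product with \<open>x\<close>. The sheet is thus recognised by a
  scalar product, which linear isometries preserve, instead of by coordinate 0.\<close>

lemma Q_space_futureI:
  assumes k: "\<kappa> < 0" and x: "x \<in> points (Q_space \<kappa> n)" and y: "y \<in> topspace (Euclidean_space (Suc n))"
    and yy: "flat_ip (sig \<kappa>) (Suc n) y y = 1 / \<kappa>" and xy: "flat_ip (sig \<kappa>) (Suc n) x y < 0"
  shows "y \<in> points (Q_space \<kappa> n)"
proof (rule ccontr)
  assume "y \<notin> points (Q_space \<kappa> n)"
  then have "y 0 \<le> 0" using y yy by auto
  moreover have "y 0 \<noteq> 0"
  proof
    assume "y 0 = 0"
    then have "flat_ip (sig \<kappa>) (Suc n) y y \<ge> 0" using k by (simp add: sig_neg flat_ip_1 sum_nonneg)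
    then show False using yy k by (simp add: field_simps)
  qed
  ultimately have y0: "y 0 < 0" by simp
  let ?y = "\<lambda>i. (- 1) * y i"
  have "?y \<in> points (Q_space \<kappa> n)"
    using y yy y0 unfolding Q_space_simps form_scale[OF is_form_flat_ip] form_scale2[OF is_form_flat_ip]
    by (auto simp: topspace_Euclidean_space)
  from Q_space_future[OF k x this] xy show False
    unfolding form_scale2[OF is_form_flat_ip] by simp
qed

lemma target_geom_Q:
  assumes "\<kappa> \<noteq> 0" shows "target_geom (Q_space \<kappa> n)"
  unfolding target_geom_def
proof (intro conjI ballI allI)
  let ?B = "flat_ip (sig \<kappa>) (Suc n)"
  note fl = is_form_flat_ip[of "sig \<kappa>" "Suc n"]
  show "is_form (form (Q_space \<kappa> n))" using fl by simp
  fix z assume z: "z \<in> points (Q_space \<kappa> n)"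
  show "subsp (tspace (Q_space \<kappa> n) z)"
    by (auto simp: subsp_def form_lin2[OF fl] form_zero2[OF fl] topspace_Euclidean_space)
  show "posdef (form (Q_space \<kappa> n)) (tspace (Q_space \<kappa> n) z)" using Q_space_posdef[OF z] by simp
  fix w :: "nat \<Rightarrow> real"
  \<comment> \<open>\<open>w\<close> is an arbitrary sequence; its coordinates from
    \<open>Suc n\<close> on, invisible to the form, are cut off so that \<open>v\<close> lies in the
    flat space.\<close>
  define w' where "w' i = (if i < Suc n then w i else 0)" for i
  have Bw: "?B w' u = ?B w u" "?B u w' = ?B u w" for u by (simp_all add: flat_ip_def w'_def)
  define v where "v = (\<lambda>i. w' i - (\<kappa> * ?B w z) * z i)"
  show "\<exists>v\<in>tspace (Q_space \<kappa> n) z. \<forall>u\<in>tspace (Q_space \<kappa> n) z. form (Q_space \<kappa> n) v u = form (Q_space \<kappa> n) w u"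
  proof (intro bexI[of _ v] ballI)
    show "v \<in> tspace (Q_space \<kappa> n) z"
      using z assms form_sym[OF fl, of z w] unfolding v_def Q_space_simps form_diff2[OF fl] form_scale2[OF fl] Bw
      by (simp add: topspace_Euclidean_space w'_def)
    fix u assume "u \<in> tspace (Q_space \<kappa> n) z"
    then show "form (Q_space \<kappa> n) v u = form (Q_space \<kappa> n) w u"
      unfolding v_def Q_space_simps form_diff[OF fl] form_scale[OF fl] Bw by simp
  qed
qed

section \<open>Products of targets\<close>

lemma case_sum_o [simp]: "case_sum u v \<circ> Inl = u" "case_sum u v \<circ> Inr = v"
  by (auto simp: fun_eq_iff)

lemma case_sum_eta: "case_sum (z \<circ> Inl) (z \<circ> Inr) = z"
  by (auto simp: fun_eq_iff split: sum.split)

lemma product_target_simps [simp]: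
  "z \<in> points (product_target P Q) \<longleftrightarrow> z \<circ> Inl \<in> points P \<and> z \<circ> Inr \<in> points Q"
  "w \<in> tspace (product_target P Q) z \<longleftrightarrow> w \<circ> Inl \<in> tspace P (z \<circ> Inl) \<and> w \<circ> Inr \<in> tspace Q (z \<circ> Inr)"
  "form (product_target P Q) = (\<lambda>w z. form P (w \<circ> Inl) (z \<circ> Inl) + form Q (w \<circ> Inr) (z \<circ> Inr))"
proof -
  show "z \<in> points (product_target P Q) \<longleftrightarrow> z \<circ> Inl \<in> points P \<and> z \<circ> Inr \<in> points Q"
  proof
    assume "z \<circ> Inl \<in> points P \<and> z \<circ> Inr \<in> points Q"
    then show "z \<in> points (product_target P Q)"
      unfolding product_target_def
      by (simp, intro exI[of _ "z \<circ> Inl"] exI[of _ "z \<circ> Inr"]) (simp add: case_sum_eta)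
  qed (auto simp: product_target_def)
  show "w \<in> tspace (product_target P Q) z \<longleftrightarrow> w \<circ> Inl \<in> tspace P (z \<circ> Inl) \<and> w \<circ> Inr \<in> tspace Q (z \<circ> Inr)"
  proof
    assume "w \<circ> Inl \<in> tspace P (z \<circ> Inl) \<and> w \<circ> Inr \<in> tspace Q (z \<circ> Inr)"
    then show "w \<in> tspace (product_target P Q) z"
      unfolding product_target_def
      by (simp, intro exI[of _ "w \<circ> Inl"] exI[of _ "w \<circ> Inr"]) (simp add: case_sum_eta)
  qed (auto simp: product_target_def)
qed (simp add: product_target_def)

lemma is_form_sum:
  assumes "is_form P" "is_form Q"
  shows "is_form (\<lambda>w z. P (w \<circ> Inl) (z \<circ> Inl) + Q (w \<circ> Inr) (z \<circ> Inr))"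
proof -
  obtain \<sigma> I where I: "finite I" "P = (\<lambda>w z. \<Sum>i\<in>I. \<sigma> i * w i * z i)" by (rule is_formE[OF assms(1)])
  obtain \<tau> J where J: "finite J" "Q = (\<lambda>w z. \<Sum>i\<in>J. \<tau> i * w i * z i)" by (rule is_formE[OF assms(2)])
  show ?thesis unfolding is_form_def
    by (intro exI[of _ "case_sum \<sigma> \<tau>"] exI[of _ "I <+> J"]) (simp add: I J sum.Plus)
qed

lemma target_geom_product:
  assumes P: "target_geom P" and Q: "target_geom Q"
  shows "target_geom (product_target P Q)"
  unfolding target_geom_def
proof (intro conjI ballI allI)
  have fP: "is_form (form P)" and fQ: "is_form (form Q)" using P Q by (auto simp: target_geom_def)
  show "is_form (form (product_target P Q))" using is_form_sum[OF fP fQ] by simp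
  fix z assume "z \<in> points (product_target P Q)"
  then have z: "z \<circ> Inl \<in> points P" "z \<circ> Inr \<in> points Q" by auto
  have tP: "subsp (tspace P (z \<circ> Inl))" "posdef (form P) (tspace P (z \<circ> Inl))"
    and tQ: "subsp (tspace Q (z \<circ> Inr))" "posdef (form Q) (tspace Q (z \<circ> Inr))"
    using P Q z by (auto simp: target_geom_def)
  show "subsp (tspace (product_target P Q) z)"
    using tP(1) tQ(1) unfolding subsp_def by (auto simp: o_def)
  show "posdef (form (product_target P Q)) (tspace (product_target P Q) z)"
    unfolding posdef_def
  proof (intro ballI impI)
    fix v assume v: "v \<in> tspace (product_target P Q) z" "v \<noteq> (\<lambda>i. 0)"
    have nn: "form P (v \<circ> Inl) (v \<circ> Inl) \<ge> 0" "form Q (v \<circ> Inr) (v \<circ> Inr) \<ge> 0"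
      using tP(2) tQ(2) v(1) form_zero[OF fP, of "v \<circ> Inl"] form_zero[OF fQ, of "v \<circ> Inr"]
      unfolding posdef_def by (metis less_imp_le order_refl product_target_simps(2))+
    have "v \<circ> Inl \<noteq> (\<lambda>i. 0) \<or> v \<circ> Inr \<noteq> (\<lambda>i. 0)"
    proof (rule ccontr)
      assume "\<not> ?thesis"
      then have "v i = 0" for i by (cases i) (auto simp: fun_eq_iff)
      then show False using v(2) by auto
    qed
    then have "form P (v \<circ> Inl) (v \<circ> Inl) > 0 \<or> form Q (v \<circ> Inr) (v \<circ> Inr) > 0"
      using tP(2) tQ(2) v(1) unfolding posdef_def by auto
    then show "form (product_target P Q) v v > 0" using nn by auto
  qed
  fix w :: "nat + nat \<Rightarrow> real"
  obtain a where a: "a \<in> tspace P (z \<circ> Inl)" "\<forall>u\<in>tspace P (z \<circ> Inl). form P a u = form P (w \<circ> Inl) u"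
    using P z(1) unfolding target_geom_def by blast
  obtain b where b: "b \<in> tspace Q (z \<circ> Inr)" "\<forall>u\<in>tspace Q (z \<circ> Inr). form Q b u = form Q (w \<circ> Inr) u"
    using Q z(2) unfolding target_geom_def by blast
  show "\<exists>v\<in>tspace (product_target P Q) z. \<forall>u\<in>tspace (product_target P Q) z.
      form (product_target P Q) v u = form (product_target P Q) w u"
    by (intro bexI[of _ "case_sum a b"]) (use a b in auto)
qed

text \<open>Both conditions come from differentiating constants: the square of \<open>F\<close>, and
  its coordinates from \<open>Suc n\<close> on.\<close>

lemma (in smooth_atlas) dvec_tspace_Q:
  assumes F: "smooth_vec_on M (topspace (mtop M)) F" "\<And>x. x \<in> topspace (mtop M) \<Longrightarrow> F x \<in> points (Q_space \<kappa> n)"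
    and X: "X \<in> tangent_space M x"
  shows "dvec X F \<in> tspace (Q_space \<kappa> n) (F x)"
proof -
  let ?B = "flat_ip (sig \<kappa>) (Suc n)"
  note fl = is_form_flat_ip[of "sig \<kappa>" "Suc n"]
  have x: "x \<in> topspace (mtop M)" using tangent_space_topspace[OF X] .
  have "X (\<lambda>y. ?B (F y) (F y)) = X (\<lambda>y. 1 / \<kappa>)"
    by (rule tangent_cong[OF X openin_topspace x]) (use F(2) in auto)
  then have "?B (F x) (dvec X F) = 0"
    using tangent_form[OF fl openin_topspace F(1) F(1) X x] form_sym[OF fl, of "F x"] by (simp add: tangent_const[OF X])
  moreover have "dvec X F i = 0" if "i \<ge> Suc n" for i
  proof -
    have "X (\<lambda>y. F y i) = X (\<lambda>y. 0)"
      by (rule tangent_cong[OF X openin_topspace x]) (use F(2) that in \<open>auto simp: topspace_Euclidean_space\<close>)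
    then show ?thesis by (simp add: dvec_app tangent_const[OF X])
  qed
  ultimately show ?thesis by (auto simp: topspace_Euclidean_space)
qed

lemma dvec_o: "dvec X F \<circ> h = dvec X (\<lambda>x. F x \<circ> h)"
  by (auto simp: dvec_def)

lemma (in smooth_atlas) immersion_Q:
  assumes "\<kappa> \<noteq> 0" "isometric_immersion M (Q_space \<kappa> n) F"
    "\<And>x X. x \<in> topspace (mtop M) \<Longrightarrow> X \<in> tangent_space M x \<Longrightarrow> X \<noteq> (\<lambda>h. 0) \<Longrightarrow> metric M x X X > 0"
  shows "immersion M (Q_space \<kappa> n) F"
proof (unfold_locales)
  show "target_geom (Q_space \<kappa> n)" using target_geom_Q[OF assms(1)] .
  show "dvec X F \<in> tspace (Q_space \<kappa> n) (F x)" if "X \<in> tangent_space M x" for x X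
    by (rule dvec_tspace_Q[OF _ _ that]) (use assms(2) in \<open>auto simp: isometric_immersion_def simp del: Q_space_simps\<close>)
qed (use assms in auto)

lemma (in smooth_atlas) immersion_product:
  assumes "\<kappa>1 \<noteq> 0" "\<kappa>2 \<noteq> 0" "isometric_immersion M (product_target (Q_space \<kappa>1 n1) (Q_space \<kappa>2 n2)) F"
    "\<And>x X. x \<in> topspace (mtop M) \<Longrightarrow> X \<in> tangent_space M x \<Longrightarrow> X \<noteq> (\<lambda>h. 0) \<Longrightarrow> metric M x X X > 0"
  shows "immersion M (product_target (Q_space \<kappa>1 n1) (Q_space \<kappa>2 n2)) F"
proof (unfold_locales)
  show "target_geom (product_target (Q_space \<kappa>1 n1) (Q_space \<kappa>2 n2))"
    using target_geom_product target_geom_Q assms by blast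
  fix x X assume X: "X \<in> tangent_space M x"
  have s: "smooth_vec_on M (topspace (mtop M)) F"
    and p: "\<And>x. x \<in> topspace (mtop M) \<Longrightarrow> F x \<in> points (product_target (Q_space \<kappa>1 n1) (Q_space \<kappa>2 n2))"
    using assms(3) by (auto simp: isometric_immersion_def simp del: Q_space_simps product_target_simps)
  have "dvec X (\<lambda>x. F x \<circ> Inl) \<in> tspace (Q_space \<kappa>1 n1) (F x \<circ> Inl)"
    by (rule dvec_tspace_Q[OF _ _ X]) (use s p in \<open>auto simp: smooth_vec_on_def simp del: Q_space_simps\<close>)
  moreover have "dvec X (\<lambda>x. F x \<circ> Inr) \<in> tspace (Q_space \<kappa>2 n2) (F x \<circ> Inr)"
    by (rule dvec_tspace_Q[OF _ _ X]) (use s p in \<open>auto simp: smooth_vec_on_def simp del: Q_space_simps\<close>)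
  ultimately show "dvec X F \<in> tspace (product_target (Q_space \<kappa>1 n1) (Q_space \<kappa>2 n2)) (F x)"
    by (simp only: product_target_simps dvec_o)
qed (use assms in auto)

section \<open>Space forms as manifolds\<close>

text \<open>The increasing enumeration of the indices other than \<open>i\<close>.\<close>

definition skip :: "nat \<Rightarrow> nat \<Rightarrow> nat" where
  "skip i j = (if j < i then j else Suc j)"

lemma omit_coord_skip: "omit_coord i x j = x (skip i j)"
  by (simp add: omit_coord_def skip_def)

definition fsgn :: "real \<Rightarrow> nat \<Rightarrow> real" where
  "fsgn \<kappa> i = (if i < sig \<kappa> then - 1 else 1)"

lemma fsgn_square [simp]: "fsgn \<kappa> i * fsgn \<kappa> i = 1" "fsgn \<kappa> i \<noteq> 0"
  by (auto simp: fsgn_def)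

lemma skip_bij: "i \<le> n \<Longrightarrow> bij_betw (skip i) {..<n} ({..<Suc n} - {i})"
  unfolding bij_betw_def
proof
  show "inj_on (skip i) {..<n}" by (auto simp: inj_on_def skip_def split: if_splits)
  assume i: "i \<le> n"
  show "skip i ` {..<n} = {..<Suc n} - {i}"
  proof
    show "{..<Suc n} - {i} \<subseteq> skip i ` {..<n}"
    proof
      fix j assume j: "j \<in> {..<Suc n} - {i}"
      show "j \<in> skip i ` {..<n}"
      proof (cases "j < i")
        case True then show ?thesis using i by (intro image_eqI[of _ _ j]) (auto simp: skip_def)
      next
        case False then show ?thesis using j by (intro image_eqI[of _ _ "j - 1"]) (auto simp: skip_def)
      qed
    qed
  qed (use i in \<open>auto simp: skip_def\<close>)
qed

lemma flat_ip_fsgn: "flat_ip (sig \<kappa>) n u v = (\<Sum>i<n. fsgn \<kappa> i * u i * v i)"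
  by (simp add: flat_ip_def fsgn_def)

lemma flat_ip_skip:
  assumes "i \<le> n"
  shows "flat_ip (sig \<kappa>) (Suc n) u v =
    fsgn \<kappa> i * u i * v i + (\<Sum>j<n. fsgn \<kappa> (skip i j) * u (skip i j) * v (skip i j))"
proof -
  have "flat_ip (sig \<kappa>) (Suc n) u v = fsgn \<kappa> i * u i * v i + (\<Sum>j\<in>{..<Suc n} - {i}. fsgn \<kappa> j * u j * v j)"
    unfolding flat_ip_fsgn using assms by (subst sum.remove[of _ i]) auto
  then show ?thesis
    unfolding sum.reindex_bij_betw[OF skip_bij[OF assms], of "\<lambda>j. fsgn \<kappa> j * u j * v j"] .
qed

context
  fixes \<kappa> :: real and n :: nat
  assumes \<kappa>: "\<kappa> \<noteq> 0"
begin

text \<open>The square of the omitted coordinate, solved for in \<open>\<langle>x, x\<rangle> = 1 / \<kappa>\<close>.\<close>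

definition radicand :: "nat \<Rightarrow> (nat \<Rightarrow> real) \<Rightarrow> real" where
  "radicand i y = fsgn \<kappa> i * (1 / \<kappa> - (\<Sum>j<n. fsgn \<kappa> (skip i j) * (y j * y j)))"

text \<open>Inverse of the chart \<open>omit_coord i\<close>; \<open>s\<close> is the sign of the
  omitted coordinate.\<close>

definition insert_coord :: "nat \<Rightarrow> real \<Rightarrow> (nat \<Rightarrow> real) \<Rightarrow> nat \<Rightarrow> real" where
  "insert_coord i s y j = (if j < i then y j else if j = i then s * sqrt (radicand i y) else y (j - 1))"

definition Q_dom :: "nat \<Rightarrow> real \<Rightarrow> (nat \<Rightarrow> real) set" where
  "Q_dom i s = {x \<in> points (Q_space \<kappa> n). s * x i > 0}"

text \<open>For \<open>\<kappa> < 0\<close> the condition \<open>x 0 > 0\<close> has to be read off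
  the chart: coordinate 0 is \<open>y 0\<close> unless it is the omitted one, in which case its sign
  is \<open>s\<close>. For \<open>i = 0\<close> and \<open>s = -1\<close> the set is then empty, as
  is the domain.\<close>

definition Q_img :: "nat \<Rightarrow> real \<Rightarrow> (nat \<Rightarrow> real) set" where
  "Q_img i s = {y \<in> topspace (Euclidean_space n). radicand i y > 0 \<and>
     (if \<kappa> < 0 then if i = 0 then s else y 0 else 1) > 0}"

lemma insert_coord_skip: "insert_coord i s y (skip i j) = y j"
  by (auto simp: insert_coord_def skip_def)

lemma radicand_omit:
  assumes "x \<in> points (Q_space \<kappa> n)" "i \<le> n"
  shows "radicand i (omit_coord i x) = x i * x i"
proof -
  have "1 / \<kappa> = fsgn \<kappa> i * (x i * x i) + (\<Sum>j<n. fsgn \<kappa> (skip i j) * (x (skip i j) * x (skip i j)))"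
    using assms flat_ip_skip[OF assms(2), of \<kappa> x x] by (simp add: mult.assoc)
  then have "radicand i (omit_coord i x) = fsgn \<kappa> i * (fsgn \<kappa> i * (x i * x i))"
    unfolding radicand_def omit_coord_skip by simp
  then show ?thesis by (simp add: mult.assoc[symmetric])
qed

lemma omit_in_img:
  assumes x: "x \<in> Q_dom i s" and i: "i \<le> n" and s: "s \<in> {1, - 1}"
  shows "omit_coord i x \<in> Q_img i s" "insert_coord i s (omit_coord i x) = x"
proof -
  have p: "x \<in> points (Q_space \<kappa> n)" "s * x i > 0" using x by (auto simp: Q_dom_def)
  have rad: "radicand i (omit_coord i x) = (x i)\<^sup>2" using radicand_omit[OF p(1) i] by (simp add: power2_eq_square)
  have x0: "\<kappa> < 0 \<Longrightarrow> x 0 > 0" and xE: "x \<in> topspace (Euclidean_space (Suc n))" using p(1) by auto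
  have "x i \<noteq> 0" using p(2) by auto
  then have "radicand i (omit_coord i x) > 0" unfolding rad by simp
  moreover have "s > 0" if "\<kappa> < 0" "i = 0"
    using p(2) x0[OF that(1)] that(2) by (simp add: zero_less_mult_iff)
  moreover have "omit_coord i x 0 > 0" if "\<kappa> < 0" "i \<noteq> 0"
    using x0[OF that(1)] that(2) by (simp add: omit_coord_def)
  moreover have "omit_coord i x \<in> topspace (Euclidean_space n)"
    using xE i by (simp add: topspace_Euclidean_space omit_coord_def)
  ultimately show "omit_coord i x \<in> Q_img i s" by (simp add: Q_img_def)
  have "s * sqrt ((x i)\<^sup>2) = x i" using s p(2) by auto
  then show "insert_coord i s (omit_coord i x) = x"
    unfolding insert_coord_def fun_eq_iff rad by (auto simp: omit_coord_def)
qed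

lemma insert_in_dom:
  assumes y: "y \<in> Q_img i s" and i: "i \<le> n" and s: "s \<in> {1, - 1}"
  shows "insert_coord i s y \<in> Q_dom i s" "omit_coord i (insert_coord i s y) = y"
proof -
  have rad: "radicand i y > 0" using y by (simp add: Q_img_def)
  have ii: "insert_coord i s y i = s * sqrt (radicand i y)" by (simp add: insert_coord_def)
  have sq: "insert_coord i s y i * insert_coord i s y i = radicand i y"
    unfolding ii using s rad by auto
  have "flat_ip (sig \<kappa>) (Suc n) (insert_coord i s y) (insert_coord i s y) =
     fsgn \<kappa> i * radicand i y + (\<Sum>j<n. fsgn \<kappa> (skip i j) * (y j * y j))"
    using flat_ip_skip[OF i, of \<kappa> "insert_coord i s y" "insert_coord i s y"] sq
    by (simp add: insert_coord_skip mult.assoc)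
  also have "\<dots> = 1 / \<kappa>"
    by (simp add: radicand_def mult.assoc[symmetric])
  finally have "flat_ip (sig \<kappa>) (Suc n) (insert_coord i s y) (insert_coord i s y) = 1 / \<kappa>" .
  moreover have "insert_coord i s y \<in> topspace (Euclidean_space (Suc n))"
    using y i by (auto simp: Q_img_def topspace_Euclidean_space insert_coord_def)
  moreover have "\<kappa> < 0 \<longrightarrow> insert_coord i s y 0 > 0"
    using y s rad by (auto simp: Q_img_def insert_coord_def split: if_splits)
  moreover have "s * insert_coord i s y i > 0" unfolding ii using s rad by auto
  ultimately show "insert_coord i s y \<in> Q_dom i s" by (simp add: Q_dom_def)
  show "omit_coord i (insert_coord i s y) = y"
    by (auto simp: fun_eq_iff omit_coord_skip insert_coord_skip)
qed

lemma omit_image: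
  assumes "i \<le> n" "s \<in> {1, - 1}" shows "omit_coord i ` Q_dom i s = Q_img i s"
proof (intro equalityI subsetI)
  fix y assume "y \<in> Q_img i s"
  then show "y \<in> omit_coord i ` Q_dom i s"
    using insert_in_dom[OF _ assms] by (metis image_eqI)
qed (use omit_in_img(1)[OF _ assms] in blast)

lemma omit_inj: "i \<le> n \<Longrightarrow> s \<in> {1, - 1} \<Longrightarrow> inj_on (omit_coord i) (Q_dom i s)"
  by (rule inj_on_inverseI[of _ "insert_coord i s"]) (rule omit_in_img)

lemma omit_inv: "i \<le> n \<Longrightarrow> s \<in> {1, - 1} \<Longrightarrow> y \<in> Q_img i s \<Longrightarrow>
    inv_into (Q_dom i s) (omit_coord i) y = insert_coord i s y"
  by (rule inv_into_f_eq[OF omit_inj]) (use insert_in_dom in auto)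

lemma C_k_radicand: "openin (Euclidean_space n) U \<Longrightarrow> C_k n r U (radicand i)"
proof -
  assume U: "openin (Euclidean_space n) U"
  have "C_k n r U (\<lambda>y. fsgn \<kappa> i * (1 / \<kappa> + (\<Sum>j<n. (- fsgn \<kappa> (skip i j)) * (y j * y j))))"
    by (intro C_k_mult C_k_add C_k_const C_k_sum C_k_coord U)
  moreover have "(\<lambda>y. fsgn \<kappa> i * (1 / \<kappa> + (\<Sum>j<n. (- fsgn \<kappa> (skip i j)) * (y j * y j)))) = radicand i"
    by (auto simp: fun_eq_iff radicand_def sum_negf)
  ultimately show ?thesis by simp
qed

lemma openin_Q_img: "openin (Euclidean_space n) (Q_img i s)"
proof -
  let ?E = "Euclidean_space n" and ?T = "topspace (Euclidean_space n)"
  have pos: "openin ?E {y \<in> ?T. h y > 0}" if "C_k n 0 ?T h" for h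
  proof -
    have "continuous_map ?E euclideanreal h" using that by simp
    then have "openin ?E {y \<in> ?T. h y \<in> {0<..}}" by (rule openin_continuous_map_preimage) auto
    then show ?thesis by simp
  qed
  have "openin ?E {y \<in> ?T. radicand i y > 0}" by (rule pos[OF C_k_radicand]) simp
  moreover have "openin ?E {y \<in> ?T. (if \<kappa> < 0 then if i = 0 then s else y 0 else 1) > 0}"
  proof (rule pos)
    show "C_k n 0 ?T (\<lambda>y. if \<kappa> < 0 then if i = 0 then s else y 0 else 1)"
      by (cases "\<kappa> < 0"; cases "i = 0") (simp_all add: C_k_const C_k_coord del: C_k.simps)
  qed
  ultimately have "openin ?E ({y \<in> ?T. radicand i y > 0} \<inter> {y \<in> ?T. (if \<kappa> < 0 then if i = 0 then s else y 0 else 1) > 0})"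
    by blast
  moreover have "{y \<in> ?T. radicand i y > 0} \<inter> {y \<in> ?T. (if \<kappa> < 0 then if i = 0 then s else y 0 else 1) > 0} = Q_img i s"
    by (auto simp: Q_img_def)
  ultimately show ?thesis by simp
qed

lemma C_k_insert_coord: "C_k n r (Q_img i s) (\<lambda>y. insert_coord i s y j)"
proof -
  note o = openin_Q_img[of i s]
  have "C_k n r (Q_img i s) (\<lambda>y. s * sqrt (radicand i y))"
    by (intro C_k_mult C_k_const C_k_sqrt C_k_radicand o) (simp add: Q_img_def)
  then show ?thesis
    by (cases "j < i"; cases "j = i") (auto simp: insert_coord_def[abs_def] intro: C_k_coord[OF o])
qed

lemma Q_manifold_simps:
  "mtop (Q_manifold \<kappa> n) = subtopology (Euclidean_space (Suc n)) (points (Q_space \<kappa> n))"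
  "mdim (Q_manifold \<kappa> n) = n"
  "metric (Q_manifold \<kappa> n) = (\<lambda>x X Y. flat_ip (sig \<kappa>) (Suc n) (dvec X (\<lambda>z. z)) (dvec Y (\<lambda>z. z)))"
  by (simp_all add: Q_manifold_def)

lemma topspace_Q: "topspace (mtop (Q_manifold \<kappa> n)) = points (Q_space \<kappa> n)"
  by (auto simp: Q_manifold_simps)

lemma atlas_Q: "atlas (Q_manifold \<kappa> n) = {(Q_dom i s, omit_coord i) | i s. i \<le> n \<and> s \<in> {1, - 1}}"
  by (simp add: Q_manifold_def Q_dom_def)

lemma continuous_map_omit: "continuous_map (Euclidean_space (Suc n)) (Euclidean_space n) (\<lambda>x. if i \<le> n then omit_coord i x else (\<lambda>j. 0))"
proof (cases "i \<le> n")
  case True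
  have "continuous_map (Euclidean_space (Suc n)) (Euclidean_space n) (\<lambda>x j. if j < n then x (skip i j) else 0)"
    unfolding continuous_map_componentwise_Euclidean_space
    using C_k_coord[OF openin_topspace, of "Suc n" 0] by simp
  then show ?thesis using True
    by (rule_tac continuous_map_eq) (auto simp: fun_eq_iff omit_coord_skip topspace_Euclidean_space skip_def)
qed (auto simp: topspace_Euclidean_space)

lemma Q_chart_homeo:
  assumes i: "i \<le> n" and s: "s \<in> {1, - 1}"
  shows "homeomorphic_map (subtopology (mtop (Q_manifold \<kappa> n)) (Q_dom i s))
     (subtopology (Euclidean_space n) (Q_img i s)) (omit_coord i)"
  unfolding homeomorphic_map_maps
proof (rule exI[of _ "insert_coord i s"], unfold homeomorphic_maps_def, intro conjI ballI)
  have top: "subtopology (mtop (Q_manifold \<kappa> n)) (Q_dom i s) = subtopology (Euclidean_space (Suc n)) (Q_dom i s)"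
    unfolding Q_manifold_simps subtopology_subtopology
    by (rule arg_cong[where f = "subtopology _"]) (auto simp: Q_dom_def)
  have t1: "topspace (subtopology (Euclidean_space (Suc n)) (Q_dom i s)) = Q_dom i s"
    by (auto simp: Q_dom_def)
  have t2: "topspace (subtopology (Euclidean_space n) (Q_img i s)) = Q_img i s"
    by (auto simp: Q_img_def)
  show "continuous_map (subtopology (mtop (Q_manifold \<kappa> n)) (Q_dom i s))
     (subtopology (Euclidean_space n) (Q_img i s)) (omit_coord i)"
    unfolding top continuous_map_in_subtopology t1
    using continuous_map_from_subtopology[OF continuous_map_omit[of i]] omit_image[OF i s] i by auto
  have "continuous_map (subtopology (Euclidean_space n) (Q_img i s)) (Euclidean_space (Suc n))
     (\<lambda>y j. if j < Suc n then insert_coord i s y j else 0)"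
    unfolding continuous_map_componentwise_Euclidean_space using C_k_continuous[OF C_k_insert_coord] by blast
  then have "continuous_map (subtopology (Euclidean_space n) (Q_img i s)) (Euclidean_space (Suc n)) (insert_coord i s)"
    by (rule continuous_map_eq)
      (use insert_in_dom(1)[OF _ i s] in \<open>fastforce simp: t2 fun_eq_iff Q_dom_def topspace_Euclidean_space\<close>)
  then show "continuous_map (subtopology (Euclidean_space n) (Q_img i s))
     (subtopology (mtop (Q_manifold \<kappa> n)) (Q_dom i s)) (insert_coord i s)"
    unfolding top continuous_map_in_subtopology t2 using insert_in_dom(1)[OF _ i s] by auto
  show "insert_coord i s (omit_coord i x) = x"
    if "x \<in> topspace (subtopology (mtop (Q_manifold \<kappa> n)) (Q_dom i s))" for x
    using that omit_in_img(2)[OF _ i s] unfolding top t1 by blast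
  show "omit_coord i (insert_coord i s y) = y"
    if "y \<in> topspace (subtopology (Euclidean_space n) (Q_img i s))" for y
    using that insert_in_dom(2)[OF _ i s] unfolding t2 by blast
qed

lemma openin_Q_dom:
  assumes "i \<le> n" shows "openin (mtop (Q_manifold \<kappa> n)) (Q_dom i s)"
proof -
  have "continuous_map (Euclidean_space (Suc n)) euclideanreal (\<lambda>x. s * x i)"
  proof -
    have "C_k (Suc n) 0 (topspace (Euclidean_space (Suc n))) (\<lambda>x. s * x i)"
      by (intro C_k_mult C_k_const C_k_coord openin_topspace)
    then show ?thesis by simp
  qed
  then have "openin (mtop (Q_manifold \<kappa> n)) {x \<in> topspace (mtop (Q_manifold \<kappa> n)). s * x i \<in> {0<..}}"
    unfolding Q_manifold_simps by (intro openin_continuous_map_preimage continuous_map_from_subtopology) auto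
  then show ?thesis unfolding topspace_Q by (simp add: Q_dom_def)
qed

lemma Q_cover:
  assumes x: "x \<in> points (Q_space \<kappa> n)"
  obtains i s where "i \<le> n" "s \<in> {1, - 1}" "x \<in> Q_dom i s"
proof -
  have "\<exists>i\<le>n. x i \<noteq> 0"
  proof (rule ccontr)
    assume "\<not> ?thesis"
    then have "flat_ip (sig \<kappa>) (Suc n) x x = 0" by (auto simp: flat_ip_def intro!: sum.neutral)
    then show False using x \<kappa> by simp
  qed
  then obtain i where i: "i \<le> n" "x i \<noteq> 0" by blast
  show thesis
    by (rule that[OF i(1), of "sgn (x i)"]) (use i x in \<open>auto simp: Q_dom_def sgn_if\<close>)
qed

text \<open>A transition map selects coordinates of \<open>insert_coord\<close>, so its smoothness
  reduces to that of one square root where the radicand is positive.\<close>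

lemma smooth_atlas_Q: "smooth_atlas (Q_manifold \<kappa> n)"
proof (unfold_locales, unfold atlas_Q Q_manifold_simps(2))
  show "topspace (mtop (Q_manifold \<kappa> n)) = (\<Union>(U, \<phi>)\<in>{(Q_dom i s, omit_coord i) | i s. i \<le> n \<and> s \<in> {1, - 1}}. U)"
    unfolding topspace_Q
  proof (intro equalityI subsetI)
    fix x assume "x \<in> points (Q_space \<kappa> n)"
    then obtain i s where "i \<le> n" "s \<in> {1, - 1}" "x \<in> Q_dom i s" by (rule Q_cover)
    then show "x \<in> (\<Union>(U, \<phi>)\<in>{(Q_dom i s, omit_coord i) | i s. i \<le> n \<and> s \<in> {1, - 1}}. U)"
      by (intro UN_I[of "(Q_dom i s, omit_coord i)"]) auto
  qed (auto simp: Q_dom_def)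
next
  fix c assume "c \<in> {(Q_dom i s, omit_coord i) | i s. i \<le> n \<and> s \<in> {1, - 1 :: real}}"
  then obtain i s where c: "c = (Q_dom i s, omit_coord i)" and i: "i \<le> n" and s: "s \<in> {1, - 1}" by blast
  show "openin (mtop (Q_manifold \<kappa> n)) (fst c)" using openin_Q_dom[OF i] c by simp
  show "openin (Euclidean_space n) (snd c ` fst c)" using openin_Q_img c omit_image[OF i s] by simp
  show "homeomorphic_map (subtopology (mtop (Q_manifold \<kappa> n)) (fst c)) (subtopology (Euclidean_space n) (snd c ` fst c)) (snd c)"
    using Q_chart_homeo[OF i s] omit_image[OF i s] c by simp
  fix c' l assume "c' \<in> {(Q_dom i s, omit_coord i) | i s. i \<le> n \<and> s \<in> {1, - 1 :: real}}"
  then obtain i' s' where c': "c' = (Q_dom i' s', omit_coord i')" and i': "i' \<le> n" and s': "s' \<in> {1, - 1}" by blast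
  have sm: "C_k n r (Q_img i s) (\<lambda>y. snd c' (inv_into (fst c) (snd c) y) l)" for r
    by (rule C_k_cong[OF openin_Q_img _ C_k_insert_coord[of r i s "skip i' l"]])
      (simp add: c c' omit_inv[OF i s] omit_coord_skip)
  have "snd c ` (fst c \<inter> fst c') \<subseteq> Q_img i s" using omit_image[OF i s] c by auto
  then show "C_inf n (snd c ` (fst c \<inter> fst c')) (\<lambda>y. snd c' (inv_into (fst c) (snd c) y) l)"
    unfolding C_inf_def using C_k_subset[OF sm] by blast
qed

section \<open>Tangent vectors of a space form as vectors of the flat space\<close>

interpretation Q: smooth_atlas "Q_manifold \<kappa> n"
  by (rule smooth_atlas_Q)

lemma Q_chart: "i \<le> n \<Longrightarrow> s \<in> {1, - 1} \<Longrightarrow> (Q_dom i s, omit_coord i) \<in> atlas (Q_manifold \<kappa> n)"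
  unfolding atlas_Q by blast

lemma Q_coord_smooth: "smooth_fun_on (Q_manifold \<kappa> n) (topspace (mtop (Q_manifold \<kappa> n))) (\<lambda>x. x j)"
proof (rule Q.smooth_funI)
  fix c r assume "c \<in> atlas (Q_manifold \<kappa> n)"
  then obtain i s where c: "c = (Q_dom i s, omit_coord i)" and i: "i \<le> n" and s: "s \<in> {1, - 1}"
    unfolding atlas_Q by blast
  have "C_k n r (Q_img i s) (loc c (\<lambda>x. x j))"
    by (rule C_k_cong[OF openin_Q_img _ C_k_insert_coord[of r i s j]]) (simp add: c loc_def omit_inv[OF i s])
  then show "C_k (mdim (Q_manifold \<kappa> n)) r (snd c ` (fst c \<inter> topspace (mtop (Q_manifold \<kappa> n)))) (loc c (\<lambda>x. x j))"
    unfolding Q_manifold_simps(2) by (rule C_k_subset) (use omit_image[OF i s] c in auto)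
qed

lemma Q_id_smooth: "smooth_vec_on (Q_manifold \<kappa> n) (topspace (mtop (Q_manifold \<kappa> n))) (\<lambda>z. z)"
  unfolding smooth_vec_on_def using Q_coord_smooth by blast

lemma Q_id_isometric: "isometric_immersion (Q_manifold \<kappa> n) (Q_space \<kappa> n) (\<lambda>z. z)"
  unfolding isometric_immersion_def using Q_id_smooth topspace_Q by (auto simp: Q_manifold_simps)

lemma Q_dvec_id_tspace: "X \<in> tangent_space (Q_manifold \<kappa> n) p \<Longrightarrow> dvec X (\<lambda>z. z) \<in> tspace (Q_space \<kappa> n) p"
  using Q.dvec_tspace_Q[OF Q_id_smooth] topspace_Q by blast

lemma Q_metric_pos:
  assumes X: "X \<in> tangent_space (Q_manifold \<kappa> n) p" "X \<noteq> (\<lambda>h. 0)"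
  shows "metric (Q_manifold \<kappa> n) p X X > 0"
proof -
  have p: "p \<in> points (Q_space \<kappa> n)" using Q.tangent_space_topspace[OF X(1)] topspace_Q by simp
  have "dvec X (\<lambda>z. z) \<noteq> (\<lambda>i. 0)"
  proof
    assume 0: "dvec X (\<lambda>z. z) = (\<lambda>i. 0)"
    obtain i s where ix: "i \<le> n" "s \<in> {1, - 1}" "p \<in> Q_dom i s" using Q_cover[OF p] .
    have "X (\<lambda>y. omit_coord i y j) = 0" for j
      using fun_cong[OF 0, of "skip i j"] by (simp add: dvec_def omit_coord_skip)
    then have "X = (\<lambda>h. 0)" using Q.tangent_chart[OF X(1) Q_chart[OF ix(1,2)]] ix(3) by simp
    then show False using X(2) by simp
  qed
  then show ?thesis
    using Q_space_posdef[OF p] Q_dvec_id_tspace[OF X(1)] unfolding posdef_def Q_manifold_simps by blast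
qed

text \<open>The coefficients are the coordinates of \<open>v\<close> other than the omitted one. The
  remaining coordinate is forced by orthogonality to \<open>p\<close>, because
  \<open>p i \<noteq> 0\<close> in this chart.\<close>

lemma Q_frame_expand:
  assumes p: "p \<in> Q_dom i s" and i: "i \<le> n" and s: "s \<in> {1, - 1}" and v: "v \<in> tspace (Q_space \<kappa> n) p"
  defines "X \<equiv> (\<lambda>h. \<Sum>k<n. v (skip i k) * coord_vec (Q_manifold \<kappa> n) (Q_dom i s, omit_coord i) p k h)"
  shows "X \<in> tangent_space (Q_manifold \<kappa> n) p" "dvec X (\<lambda>z. z) = v"
proof -
  let ?c = "(Q_dom i s, omit_coord i)"
  have c: "?c \<in> atlas (Q_manifold \<kappa> n)" "p \<in> fst ?c" using Q_chart[OF i s] p by auto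
  show X: "X \<in> tangent_space (Q_manifold \<kappa> n) p"
    unfolding X_def by (rule Q.tangentI[OF c, unfolded Q_manifold_simps(2)])
  have sk: "dvec X (\<lambda>z. z) (skip i j) = v (skip i j)" if "j < n" for j
  proof -
    have "dvec X (\<lambda>z. z) (skip i j) = X (\<lambda>y. snd ?c y j)" by (simp add: dvec_def omit_coord_skip)
    also have "\<dots> = (\<Sum>l<n. v (skip i l) * (if l = j then 1 else 0))"
      unfolding X_def by (intro sum.cong refl arg_cong2[where f = "(*)"] Q.coord_vec_chart[OF c])
        (use that in \<open>auto simp: Q_manifold_simps\<close>)
    also have "\<dots> = v (skip i j)" using that by (simp add: if_distrib[of "\<lambda>z. _ * z"] cong: if_cong)
    finally show ?thesis .
  qed
  have t: "dvec X (\<lambda>z. z) \<in> tspace (Q_space \<kappa> n) p" by (rule Q_dvec_id_tspace[OF X])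
  have pi: "p i \<noteq> 0" using p by (auto simp: Q_dom_def)
  define S where "S = (\<Sum>j<n. fsgn \<kappa> (skip i j) * p (skip i j) * v (skip i j))"
  have "fsgn \<kappa> i * p i * dvec X (\<lambda>z. z) i + S = 0"
    using t flat_ip_skip[OF i, of \<kappa> p "dvec X (\<lambda>z. z)"] sk by (simp add: S_def)
  moreover have "fsgn \<kappa> i * p i * v i + S = 0"
    using v flat_ip_skip[OF i, of \<kappa> p v] by (simp add: S_def)
  ultimately have "fsgn \<kappa> i * p i * dvec X (\<lambda>z. z) i = fsgn \<kappa> i * p i * v i" by linarith
  then have di: "dvec X (\<lambda>z. z) i = v i" using pi by simp
  show "dvec X (\<lambda>z. z) = v"
  proof
    fix j show "dvec X (\<lambda>z. z) j = v j"
    proof (cases "j < Suc n")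
      case True
      have "j = i \<or> j \<in> skip i ` {..<n}" using skip_bij[OF i] True by (auto simp: bij_betw_def)
      then show ?thesis using di sk by auto
    next
      case False
      then show ?thesis using t v by (auto simp: topspace_Euclidean_space)
    qed
  qed
qed

text \<open>Together with \<open>Q_dvec_id_tspace\<close> this identifies derivations at
  \<open>p\<close> with vectors orthogonal to \<open>p\<close>.\<close>

lemma Q_tangent_exists:
  assumes p: "p \<in> points (Q_space \<kappa> n)" and v: "v \<in> tspace (Q_space \<kappa> n) p"
  shows "\<exists>X\<in>tangent_space (Q_manifold \<kappa> n) p. dvec X (\<lambda>z. z) = v"
  by (rule Q_cover[OF p]) (use Q_frame_expand[OF _ _ _ v] in blast)

end

section \<open>Totally geodesic embeddings of space forms\<close>

text \<open>The matrix is given by columns: \<open>A s\<close> is the image of the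
  \<open>s\<close>-th basis vector. The index type of the target is free, so one notion serves the
  factors and their product.\<close>

definition mat_app :: "nat \<Rightarrow> (nat \<Rightarrow> 'i \<Rightarrow> real) \<Rightarrow> (nat \<Rightarrow> real) \<Rightarrow> 'i \<Rightarrow> real" where
  "mat_app N A w = (\<lambda>i. \<Sum>s<N. w s * A s i)"

lemma mat_app_lin: "mat_app N A (\<lambda>i. a * u i + b * v i) = (\<lambda>i. a * mat_app N A u i + b * mat_app N A v i)"
  by (simp add: mat_app_def sum_distrib_left algebra_simps sum.distrib)

lemma (in smooth_atlas) smooth_mat_app:
  "openin (mtop M) W \<Longrightarrow> smooth_vec_on M W F \<Longrightarrow> smooth_vec_on M W (\<lambda>y. mat_app N A (F y))"
  unfolding mat_app_def
  by (rule smooth_vec_combination) (auto intro: smooth_vecD simp: smooth_vec_on_def smooth_const)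

lemma (in smooth_atlas) dvec_mat_app:
  assumes "openin (mtop M) W" "smooth_vec_on M W F" "X \<in> tangent_space M x" "x \<in> W"
  shows "dvec X (\<lambda>y. mat_app N A (F y)) = mat_app N A (dvec X F)"
  unfolding mat_app_def
  by (subst dvec_combination[OF assms(1) _ _ assms(3,4)])
    (use assms in \<open>auto simp: smooth_vec_on_def smooth_const tangent_const dvec_app\<close>)

lemma smooth_vec_case_sum:
  assumes "smooth_vec_on M W u" "smooth_vec_on M W v"
  shows "smooth_vec_on M W (\<lambda>x. case_sum (u x) (v x))"
  unfolding smooth_vec_on_def
proof
  fix i show "smooth_fun_on M W (\<lambda>x. case_sum (u x) (v x) i)"
    using assms by (cases i) (simp_all add: smooth_vec_on_def)
qed

lemma dvec_case_sum: "dvec X (\<lambda>x. case_sum (u x) (v x)) = case_sum (dvec X u) (dvec X v)"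
proof
  fix i show "dvec X (\<lambda>x. case_sum (u x) (v x)) i = case_sum (dvec X u) (dvec X v) i"
    by (cases i) (simp_all add: dvec_def)
qed

lemma Euclidean_expand:
  assumes "w \<in> topspace (Euclidean_space N)"
  shows "w = (\<lambda>i. \<Sum>s<N. w s * (if i = s then 1 else 0))"
  using assms by (auto simp: topspace_Euclidean_space fun_eq_iff if_distrib[of "\<lambda>z. _ * z"] cong: if_cong)

lemma linear_eq_mat_app:
  assumes lin: "\<And>u v a b. A (\<lambda>i. a * u i + b * v i) = (\<lambda>i. a * A u i + b * A v i)"
    and w: "w \<in> topspace (Euclidean_space N)"
  shows "A w = mat_app N (\<lambda>s. A (\<lambda>i. if i = s then 1 else 0)) w"
proof -
  have *: "A (\<lambda>i. \<Sum>s<r. w s * (if i = s then 1 else 0)) = (\<lambda>i. \<Sum>s<r. w s * A (\<lambda>i. if i = s then 1 else 0) i)" for r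
  proof (induction r)
    case 0
    then show ?case using lin[of 0 _ 0] by simp
  next
    case (Suc r)
    have "A (\<lambda>i. 1 * (\<Sum>s<r. w s * (if i = s then 1 else 0)) + w r * (if i = r then 1 else 0)) =
      (\<lambda>i. 1 * A (\<lambda>i. \<Sum>s<r. w s * (if i = s then 1 else 0)) i + w r * A (\<lambda>i. if i = r then 1 else 0) i)"
      by (rule lin)
    then show ?case using Suc by simp
  qed
  show ?thesis unfolding mat_app_def *[symmetric] using Euclidean_expand[OF w] by simp
qed

text \<open>Gauss formula: differentiating the orthogonality of \<open>f\<close> and
  \<open>dvec (Y y) f\<close> shows that the flat second derivative has component
  \<open>-\<kappa> g f\<close> along the position vector. Once this is removed, the rest is tangent
  to the space form and its normal part is the second fundamental form.\<close>

lemma second_ff_eq: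
  assumes im: "immersion M (Q_space \<kappa> n) f" and x: "x \<in> topspace (mtop M)" and \<kappa>: "\<kappa> \<noteq> 0" and c: "c \<in> atlas M" "x \<in> fst c"
    and ij: "i < mdim M" "j < mdim M"
    and ff: "second_ff M (Q_space \<kappa> n) f x (coord_vec M c x i) (\<lambda>y. coord_vec M c y j) = (\<lambda>i. 0)"
  shows "(\<lambda>l. dvec (coord_vec M c x i) (\<lambda>y. dvec (coord_vec M c y j) f) l +
     \<kappa> * metric M x (coord_vec M c x i) (coord_vec M c x j) * f x l) \<in> image_tangent M f x"
proof -
  interpret immersion M "Q_space \<kappa> n" f by (rule im)
  let ?N = "Q_space \<kappa> n" and ?B = "form (Q_space \<kappa> n)"
  let ?X = "coord_vec M c x i" and ?Y = "\<lambda>y. coord_vec M c y j"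
  have X: "?X \<in> tangent_space M x" and Y: "\<And>y. y \<in> fst c \<Longrightarrow> ?Y y \<in> tangent_space M y"
    using coord_vec_tangent[OF c(1)] c(2) ij by auto
  define w where "w = dvec ?X (\<lambda>y. dvec (?Y y) f)"
  define g where "g = metric M x ?X (?Y x)"
  have wE: "w l = 0" if "l \<ge> Suc n" for l
  proof -
    have "w l = ?X (\<lambda>y. dvec (?Y y) f l)" by (simp add: w_def dvec_app)
    also have "\<dots> = ?X (\<lambda>y. 0)"
      by (rule tangent_cong[OF X chart_open[OF c(1)] c(2)])
        (use dvec_tspace[OF Y] that in \<open>auto simp: topspace_Euclidean_space\<close>)
    finally show ?thesis by (simp add: tangent_const[OF X])
  qed
  have "?X (\<lambda>y. ?B (f y) (dvec (?Y y) f)) = ?X (\<lambda>y. 0)"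
    by (rule tangent_cong[OF X chart_open[OF c(1)] c(2)]) (use dvec_tspace[OF Y] in \<open>auto\<close>)
  then have "?B (dvec ?X f) (dvec (?Y x) f) + ?B (f x) w = 0"
    using tangent_form[OF B chart_open[OF c(1)] f_smooth_on[OF chart_open[OF c(1)]] frame_smooth[OF c(1) ij(2)] X c(2)]
    by (simp add: tangent_const[OF X] w_def)
  then have fw: "?B (f x) w = - g" using f_isometric[OF X Y[OF c(2)]] by (simp add: g_def)
  define q where "q = (\<lambda>l. w l + \<kappa> * g * f x l)"
  have fx: "f x \<in> points (Q_space \<kappa> n)" using f_points[OF x] .
  have "?B (f x) q = 0"
    unfolding q_def form_add2[OF B] form_scale2[OF B] fw using fx \<kappa> by simp
  moreover have "q \<in> topspace (Euclidean_space (Suc n))"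
    using wE fx by (auto simp: q_def topspace_Euclidean_space)
  ultimately have q: "q \<in> tspace ?N (f x)" by simp
  obtain t \<nu> where t: "t \<in> image_tangent M f x" "\<nu> \<in> normal_space M ?N f x" "q = (\<lambda>l. t l + \<nu> l)"
    using tangent_decomp[OF x q] by blast
  have "orth_proj ?B (normal_space M ?N f x) (orth_proj ?B (tspace ?N (f x)) w) = \<nu>"
  proof (rule normal_tangent_projI[OF x t(1,2), where p = "\<lambda>l. (- \<kappa> * g) * f x l"])
    show "?B (\<lambda>l. (- \<kappa> * g) * f x l) u = 0" if "u \<in> tspace ?N (f x)" for u
      unfolding form_scale[OF B] using that by simp
    show "w l = t l + \<nu> l + (- \<kappa> * g) * f x l" for l
      using fun_cong[OF t(3), of l] by (simp add: q_def)
  qed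
  then have "\<nu> = (\<lambda>l. 0)" using ff by (simp add: second_ff_def target_conn_def w_def)
  then have "q = t" using t(3) by simp
  then show ?thesis using t(1) by (simp add: q_def w_def g_def)
qed

lemma immersion_Q_manifold:
  assumes "\<kappa> \<noteq> 0" "\<kappa>' \<noteq> 0" "isometric_immersion (Q_manifold \<kappa> n) (Q_space \<kappa>' n') j"
  shows "immersion (Q_manifold \<kappa> n) (Q_space \<kappa>' n') j"
proof -
  interpret smooth_atlas "Q_manifold \<kappa> n" by (rule smooth_atlas_Q[OF assms(1)])
  show ?thesis by (rule immersion_Q[OF assms(2,3) Q_metric_pos[OF assms(1)]])
qed

text \<open>The graph of a totally geodesic \<open>j\<close> is itself totally geodesic in the product, so the span of its position
  vector and its tangent space is parallel, hence locally constant; this span is the graph of a linear map.\<close>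

lemma totally_geodesic_locally_linear:
  assumes \<kappa>: "\<kappa> \<noteq> 0" and j: "totally_geodesic_embedding (Q_manifold \<kappa> n) (Q_space \<kappa> n') j"
    and p: "p \<in> points (Q_space \<kappa> n)"
  obtains A V where "openin (mtop (Q_manifold \<kappa> n)) V" "p \<in> V" "\<And>y. y \<in> V \<Longrightarrow> j y = mat_app (Suc n) A y"
    "\<And>u. u \<in> topspace (Euclidean_space (Suc n)) \<Longrightarrow> mat_app (Suc n) A u \<in> topspace (Euclidean_space (Suc n'))"
    "\<And>u v. u \<in> topspace (Euclidean_space (Suc n)) \<Longrightarrow> v \<in> topspace (Euclidean_space (Suc n)) \<Longrightarrow>
      flat_ip (sig \<kappa>) (Suc n') (mat_app (Suc n) A u) (mat_app (Suc n) A v) = flat_ip (sig \<kappa>) (Suc n) u v"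
proof -
  let ?M = "Q_manifold \<kappa> n" and ?B = "flat_ip (sig \<kappa>) (Suc n)" and ?B' = "flat_ip (sig \<kappa>) (Suc n')"
  note fB = is_form_flat_ip[of "sig \<kappa>" "Suc n"] and fB' = is_form_flat_ip[of "sig \<kappa>" "Suc n'"]
  have ji: "isometric_immersion ?M (Q_space \<kappa> n') j"
    and jff: "\<And>U Y x X. openin (mtop ?M) U \<Longrightarrow> vector_field_on ?M U Y \<Longrightarrow> x \<in> U \<Longrightarrow> X \<in> tangent_space ?M x \<Longrightarrow>
      second_ff ?M (Q_space \<kappa> n') j x X Y = (\<lambda>i. 0)"
    using j unfolding totally_geodesic_embedding_def by blast+
  interpret S: smooth_atlas ?M by (rule smooth_atlas_Q[OF \<kappa>])
  interpret J: immersion ?M "Q_space \<kappa> n'" j by (rule immersion_Q_manifold[OF \<kappa> \<kappa> ji])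
  interpret I: immersion ?M "Q_space \<kappa> n" "\<lambda>z. z" by (rule immersion_Q_manifold[OF \<kappa> \<kappa> Q_id_isometric[OF \<kappa>]])
  obtain i s where ix: "i \<le> n" "s \<in> {1, - 1}" "p \<in> Q_dom \<kappa> n i s" using Q_cover[OF \<kappa> p] .
  define c where "c = (Q_dom \<kappa> n i s, omit_coord i)"
  have c: "c \<in> atlas ?M" "p \<in> fst c" unfolding c_def using Q_chart[OF \<kappa> ix(1,2)] ix(3) by auto
  have dim: "mdim ?M = n" by (simp add: Q_manifold_simps[OF \<kappa>])
  define W where "W = fst c"
  have W: "openin (mtop ?M) W" "W \<subseteq> fst c" "p \<in> W" using S.chart_open[OF c(1)] c(2) by (auto simp: W_def)
  have Wt: "x \<in> topspace (mtop ?M)" if "x \<in> W" for x using S.chart_topspace[OF c(1)] that W(2) by blast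
  have Wp: "x \<in> points (Q_space \<kappa> n)" if "x \<in> W" for x using Wt[OF that] by (simp only: topspace_Q[OF \<kappa>])
  define H where "H = (\<lambda>x. case_sum x (j x))"
  define \<iota> where "\<iota> k y = dvec (coord_vec ?M c y k) (\<lambda>z. z)" for k y
  define \<eta> where "\<eta> k y = dvec (coord_vec ?M c y k) j" for k y
  define e where "e k y = case_sum (\<iota> k y) (\<eta> k y)" for k y
  have T: "coord_vec ?M c y k \<in> tangent_space ?M y" if "y \<in> W" "k < n" for y k
    using S.coord_vec_tangent[OF c(1)] that W(2) by (auto simp: dim)
  have \<iota>t: "\<iota> k y \<in> tspace (Q_space \<kappa> n) y" and \<eta>t: "\<eta> k y \<in> tspace (Q_space \<kappa> n') (j y)" if "y \<in> W" "k < n" for y k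
    using I.dvec_tspace[OF T[OF that]] J.dvec_tspace[OF T[OF that]] by (simp_all only: \<iota>_def \<eta>_def)
  have dH: "dvec (coord_vec ?M c y k) H = e k y" for k y
    unfolding e_def \<iota>_def \<eta>_def H_def by (rule dvec_case_sum)
  have gram: "?B' (\<eta> k y) (\<eta> l y) = ?B (\<iota> k y) (\<iota> l y)" if "y \<in> W" "k < n" "l < n" for k l y
    using I.f_isometric[OF T[OF that(1,2)] T[OF that(1,3)]] J.f_isometric[OF T[OF that(1,2)] T[OF that(1,3)]]
    by (simp add: \<iota>_def \<eta>_def)
  define B2 where "B2 = (\<lambda>w z. ?B (w \<circ> Inl) (z \<circ> Inl) + ?B' (w \<circ> Inr) (z \<circ> Inr))"
  have B2: "is_form B2" unfolding B2_def by (rule is_form_sum[OF fB fB'])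
  have jp: "j y \<in> points (Q_space \<kappa> n')" if "y \<in> W" for y using J.f_points[OF Wt[OF that]] .
  have sH: "smooth_vec_on ?M W H"
    unfolding H_def by (rule smooth_vec_case_sum[OF I.f_smooth_on[OF W(1)] J.f_smooth_on[OF W(1)]])
  have se: "smooth_vec_on ?M W (e k)" if "k < n" for k
    unfolding e_def \<iota>_def \<eta>_def W_def
    by (rule smooth_vec_case_sum[OF I.frame_smooth[OF c(1)] J.frame_smooth[OF c(1)]]) (simp_all add: dim that)
  define E where "E y = lspan (Suc n) (case_nat (H y) (\<lambda>k. e k y))" for y
  have subE: "subsp (E y)" for y unfolding E_def by (rule subsp_lspan)
  have HE: "H y \<in> E y" for y
    unfolding E_def using lspan_base[of 0 "Suc n" "case_nat (H y) (\<lambda>k. e k y)"] by simp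
  have eE: "e k y \<in> E y" if "k < n" for k y
    unfolding E_def using lspan_base[of "Suc k" "Suc n" "case_nat (H y) (\<lambda>k. e k y)"] that by simp
  have par: "dvec (coord_vec ?M c y k) (e l) \<in> E y" if y: "y \<in> W" and kl: "k < n" "l < n" for y k l
  proof -
    let ?X = "coord_vec ?M c y k"
    have yc: "y \<in> fst c" using y W(2) by auto
    define g where "g = metric ?M y ?X (coord_vec ?M c y l)"
    define DI where "DI = dvec ?X (\<iota> l)"
    define DJ where "DJ = dvec ?X (\<eta> l)"
    define qi where "qi = (\<lambda>r. DI r + \<kappa> * g * y r)"
    define qj where "qj = (\<lambda>r. DJ r + \<kappa> * g * j y r)"
    have vf: "vector_field_on ?M (fst c) (\<lambda>y. coord_vec ?M c y l)"
      using S.coord_vector_field[OF c(1)] kl by (simp add: dim)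
    have "second_ff ?M (Q_space \<kappa> n') j y ?X (\<lambda>y. coord_vec ?M c y l) = (\<lambda>i. 0)"
      using jff[OF S.chart_open[OF c(1)] vf yc T[OF y kl(1)]] .
    then have qj: "qj \<in> image_tangent ?M j y"
      using second_ff_eq[OF J.immersion_axioms Wt[OF y] \<kappa> c(1) yc, of k l] kl
      by (simp add: qj_def DJ_def \<eta>_def[abs_def] g_def dim)
    have im: "image_tangent ?M (\<lambda>z. z) y = tspace (Q_space \<kappa> n) y"
      using I.image_tangent_tspace[OF Wt[OF y]] Q_tangent_exists[OF \<kappa> Wp[OF y]]
      unfolding image_tangent_def by blast
    \<comment> \<open>The inclusion fills the whole tangent space of the target, so its normal space
      is zero.\<close>
    have "second_ff ?M (Q_space \<kappa> n) (\<lambda>z. z) y ?X (\<lambda>y. coord_vec ?M c y l) = (\<lambda>i. 0)"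
    proof -
      have z: "u = (\<lambda>i. 0)" if "u \<in> normal_space ?M (Q_space \<kappa> n) (\<lambda>z. z) y" for u
      proof -
        have "u \<in> tspace (Q_space \<kappa> n) y" "?B u u = 0" using that im by (auto simp: normal_space_def simp del: Q_space_simps(3))
        then show ?thesis using Q_space_posdef[OF Wp[OF y]] unfolding posdef_def by fastforce
      qed
      obtain \<nu> where "\<nu> \<in> normal_space ?M (Q_space \<kappa> n) (\<lambda>z. z) y"
        "orth_proj (form (Q_space \<kappa> n)) (normal_space ?M (Q_space \<kappa> n) (\<lambda>z. z) y)
          (orth_proj (form (Q_space \<kappa> n)) (tspace (Q_space \<kappa> n) y)
            (dvec ?X (\<lambda>y. dvec (coord_vec ?M c y l) (\<lambda>z. z)))) = \<nu>"
        by (rule I.flat_decomp[OF Wt[OF y], of "dvec ?X (\<lambda>y. dvec (coord_vec ?M c y l) (\<lambda>z. z))"])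
      then show ?thesis unfolding second_ff_def target_conn_def using z by simp
    qed
    then have qi: "qi \<in> image_tangent ?M (\<lambda>z. z) y"
      using second_ff_eq[OF I.immersion_axioms Wt[OF y] \<kappa> c(1) yc, of k l] kl
      by (simp add: qi_def DI_def \<iota>_def[abs_def] g_def dim)
    then obtain \<gamma> where \<gamma>: "qi = (\<lambda>r. \<Sum>m<n. \<gamma> m * \<iota> m y r)"
      unfolding I.image_tangent_chart[OF c(1) yc] dim lspan_def \<iota>_def by blast
    have imJ: "image_tangent ?M j y = lspan n (\<lambda>m. \<eta> m y)"
      unfolding J.image_tangent_chart[OF c(1) yc] dim \<eta>_def ..
    \<comment> \<open>The coefficients of \<open>qi\<close> serve for \<open>qj\<close> too:
      \<open>j\<close> and the inclusion induce the same metric, so their Christoffel symbols and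
      Gram matrices agree, and a tangent vector is determined by its products with the
      frame.\<close>
    have "qj = (\<lambda>r. \<Sum>m<n. \<gamma> m * \<eta> m y r)"
    proof (rule form_unique[OF fB' J.image_tangent_subsp[OF Wt[OF y]]])
      show "posdef ?B' (image_tangent ?M j y)"
        using posdef_subset[OF J.tspace_posdef[OF Wt[OF y]] J.image_tangent_tspace[OF Wt[OF y]]] by simp
      show "qj \<in> image_tangent ?M j y" by (rule qj)
      show "(\<lambda>r. \<Sum>m<n. \<gamma> m * \<eta> m y r) \<in> image_tangent ?M j y" unfolding imJ by (rule lspanI)
      have base: "?B' qj (\<eta> q y) = ?B' (\<lambda>r. \<Sum>m<n. \<gamma> m * \<eta> m y r) (\<eta> q y)" if q: "q < n" for q
      proof -
        have "?B' DJ (\<eta> q y) = ?B DI (\<iota> q y)"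
          using I.Christoffel[OF c(1) yc, of k l q] J.Christoffel[OF c(1) yc, of k l q] kl q
          by (simp add: dim DI_def DJ_def \<iota>_def[abs_def] \<eta>_def[abs_def])
        moreover have "?B' (j y) (\<eta> q y) = 0" "?B y (\<iota> q y) = 0"
          using \<eta>t[OF y q] \<iota>t[OF y q] by simp_all
        ultimately have "?B' qj (\<eta> q y) = ?B qi (\<iota> q y)"
          by (simp add: qi_def qj_def form_add[OF fB] form_add[OF fB'] form_scale[OF fB] form_scale[OF fB'])
        then show ?thesis unfolding \<gamma> by (simp add: form_sum[OF fB] form_sum[OF fB'] gram[OF y _ q])
      qed
      fix u assume "u \<in> image_tangent ?M j y"
      then obtain d where "u = (\<lambda>r. \<Sum>m<n. d m * \<eta> m y r)" unfolding imJ lspan_def by blast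
      then show "?B' qj u = ?B' (\<lambda>r. \<Sum>m<n. \<gamma> m * \<eta> m y r) u"
        by (simp add: form_sum2[OF fB'] base)
    qed
    then have DJ': "DJ r = (\<Sum>m<n. \<gamma> m * \<eta> m y r) - \<kappa> * g * j y r" for r
      by (simp add: qj_def fun_eq_iff eq_diff_eq)
    have DI': "DI r = (\<Sum>m<n. \<gamma> m * \<iota> m y r) - \<kappa> * g * y r" for r
      using fun_cong[OF \<gamma>, of r] by (simp add: qi_def)
    have "dvec ?X (e l) = case_sum DI DJ"
      unfolding e_def DI_def DJ_def by (rule dvec_case_sum)
    also have "\<dots> = (\<lambda>r. 1 * (\<Sum>m<n. \<gamma> m * e m y r) + (- \<kappa> * g) * H y r)"
      by (auto simp: fun_eq_iff e_def H_def DI' DJ' split: sum.split)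
    also have "\<dots> \<in> E y"
      by (rule subsp_lin[OF subE subsp_sum[OF subE] HE]) (use eE in auto)
    finally show ?thesis .
  qed
  \<comment> \<open>The curvature constant is \<open>\<kappa> / 2\<close> because both components of
    \<open>H\<close> have square \<open>1 / \<kappa>\<close>.\<close>
  obtain V where V: "openin (mtop ?M) V" "p \<in> V" "V \<subseteq> W" "\<And>y. y \<in> V \<Longrightarrow> E y = E p"
  proof (rule S.parallel_span_locally_constant[OF B2 c(1) W sH, of n e "\<kappa> / 2" E])
    show "smooth_vec_on ?M W (e k)" if "k < n" for k using se[OF that] .
    show "\<kappa> / 2 \<noteq> 0" using \<kappa> by simp
    show "B2 (H y) (H y) = 1 / (\<kappa> / 2)" if "y \<in> W" for y
      using Wp[OF that] jp[OF that] by (simp add: B2_def H_def)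
    show "B2 (H y) (e k y) = 0" if "y \<in> W" "k < n" for y k
      using \<iota>t[OF that] \<eta>t[OF that] by (simp add: B2_def H_def e_def)
    show "B2 (\<lambda>i. \<Sum>j<n. d j * e j p i) (\<lambda>i. \<Sum>j<n. d j * e j p i) > 0" if d: "\<exists>j<n. d j \<noteq> 0" for d
    proof -
      have "(\<lambda>i. \<Sum>j<n. d j * e j p i) \<circ> Inl = (\<lambda>i. \<Sum>j<n. d j * \<iota> j p i)"
        "(\<lambda>i. \<Sum>j<n. d j * e j p i) \<circ> Inr = (\<lambda>i. \<Sum>j<n. d j * \<eta> j p i)" by (auto simp: e_def o_def)
      then show ?thesis
        using I.frame_pos[OF c, of d] J.frame_pos[OF c, of d] d unfolding B2_def
        by (simp add: dim \<iota>_def \<eta>_def)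
    qed
    show "E y = lspan (Suc n) (case_nat (H y) (\<lambda>j. e j y))" for y by (simp add: E_def)
    show "dvec (coord_vec ?M c y k) H \<in> E y" if "y \<in> W" "k < mdim ?M" for y k
      using eE that by (simp add: dH dim)
    show "dvec (coord_vec ?M c y k) (e l) \<in> E y" if "y \<in> W" "k < mdim ?M" "l < n" for y k l
      using par that by (simp add: dim)
  qed blast
  \<comment> \<open>Coordinates in the basis \<open>\<beta>\<close>, that is \<open>p\<close>
    followed by the chart frame at \<open>p\<close>: the component along \<open>p\<close> comes from
    a scalar product, and the tangential rest is read off its coordinates other than
    \<open>i\<close>, as in \<open>Q_frame_expand\<close>.\<close>
  define coef where "coef w = case_nat (\<kappa> * ?B w p) (\<lambda>k. w (skip i k) - \<kappa> * ?B w p * p (skip i k))" for w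
  define \<beta> where "\<beta> = case_nat p (\<lambda>k. \<iota> k p)"
  define \<beta>' where "\<beta>' = case_nat (j p) (\<lambda>k. \<eta> k p)"
  define A0 where "A0 w = (\<lambda>r. \<Sum>q<Suc n. coef w q * \<beta>' q r)" for w
  have coef_lin: "coef (\<lambda>r. a * u r + b * v r) q = a * coef u q + b * coef v q" for a b u v q
    by (cases q) (auto simp: coef_def form_lin[OF fB] algebra_simps)
  have A0_lin: "A0 (\<lambda>r. a * u r + b * v r) = (\<lambda>r. a * A0 u r + b * A0 v r)" for a b u v
    unfolding A0_def coef_lin by (simp only: sum_distrib_left sum.distrib[symmetric]) (simp add: algebra_simps)
  have pp: "?B p p = 1 / \<kappa>" using p by simp
  have jjp: "?B' (j p) (j p) = 1 / \<kappa>" using jp[OF W(3)] by simp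
  have p\<iota>: "?B p (\<iota> k p) = 0" and j\<eta>: "?B' (j p) (\<eta> k p) = 0" if "k < n" for k
    using \<iota>t[OF W(3) that] \<eta>t[OF W(3) that] by simp_all
  have \<iota>p: "?B (\<iota> k p) p = 0" and \<eta>j: "?B' (\<eta> k p) (j p) = 0" if "k < n" for k
    using p\<iota>[OF that] j\<eta>[OF that] form_sym[OF fB, of p] form_sym[OF fB', of "j p"] by simp_all
  have gram2: "?B' (\<beta>' q) (\<beta>' r) = ?B (\<beta> q) (\<beta> r)" if "q < Suc n" "r < Suc n" for q r
    using that pp jjp gram[OF W(3)] p\<iota> \<iota>p j\<eta> \<eta>j
    by (cases q; cases r) (simp_all add: \<beta>_def \<beta>'_def)
  have expand: "w = (\<lambda>r. \<Sum>q<Suc n. coef w q * \<beta> q r)" if w: "w \<in> topspace (Euclidean_space (Suc n))" for w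
  proof -
    define v where "v = (\<lambda>r. w r - \<kappa> * ?B w p * p r)"
    have "?B p v = 0" unfolding v_def form_diff2[OF fB] form_scale2[OF fB] pp using \<kappa> form_sym[OF fB, of w p] by simp
    then have "v \<in> tspace (Q_space \<kappa> n) p" using w p by (auto simp: v_def topspace_Euclidean_space)
    then have "v = (\<lambda>r. \<Sum>k<n. v (skip i k) * \<iota> k p r)"
      using Q_frame_expand(2)[OF \<kappa> ix(3,1,2)] by (simp add: dvec_def \<iota>_def c_def)
    then have vr: "v r = (\<Sum>k<n. v (skip i k) * \<iota> k p r)" for r by (rule fun_cong)
    show ?thesis
    proof
      fix r
      have "w r = \<kappa> * ?B w p * p r + v r" by (simp add: v_def)
      also have "v r = (\<Sum>k<n. v (skip i k) * \<iota> k p r)" by (rule vr)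
      also have "\<kappa> * ?B w p * p r + \<dots> = (\<Sum>q<Suc n. coef w q * \<beta> q r)"
        by (simp add: sum.lessThan_Suc_shift coef_def \<beta>_def v_def del: sum.lessThan_Suc)
      finally show "w r = (\<Sum>q<Suc n. coef w q * \<beta> q r)" .
    qed
  qed
  have coef_\<beta>: "coef (\<beta> q) r = (if r = q then 1 else 0)" if "q < Suc n" "r < Suc n" for q r
  proof -
    have "\<iota> l p (skip i k) = (if l = k then 1 else 0)" if "k < n" "l < n" for k l
      using S.coord_vec_chart[OF c, of l k] that by (simp add: dim \<iota>_def c_def dvec_def omit_coord_skip)
    then show ?thesis
      using that pp \<kappa> \<iota>p by (cases q; cases r) (simp_all add: coef_def \<beta>_def)
  qed
  have A0\<beta>: "A0 (\<beta> q) = \<beta>' q" if "q < Suc n" for q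
    unfolding A0_def using coef_\<beta>[OF that] that
    by (simp add: if_distrib[of "\<lambda>z. z * _"] cong: if_cong del: sum.lessThan_Suc)
  have A0_sum: "A0 (\<lambda>r. \<Sum>q<m. d q * \<beta> q r) = (\<lambda>r. \<Sum>q<m. d q * A0 (\<beta> q) r)" for d m
  proof (induction m)
    case 0 then show ?case using A0_lin[of 0 _ 0] by simp
  next
    case (Suc m)
    then show ?case using A0_lin[of 1 "\<lambda>r. \<Sum>q<m. d q * \<beta> q r" "d m" "\<beta> m"] by simp
  qed
  define A where "A s = A0 (\<lambda>i. if i = s then 1 else 0)" for s
  have AA: "mat_app (Suc n) A w = A0 w" if "w \<in> topspace (Euclidean_space (Suc n))" for w
    using linear_eq_mat_app[of A0, OF A0_lin that] by (simp add: A_def[abs_def])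
  show thesis
  proof (rule that[OF V(1,2)])
    fix y assume y: "y \<in> V"
    \<comment> \<open>One set of coefficients \<open>d\<close> expands both components of
      \<open>H y\<close>; this is the linear relation between \<open>y\<close> and
      \<open>j y\<close>.\<close>
    have "H y \<in> E p" using HE[of y] V(4)[OF y] by simp
    then obtain d where d: "H y = (\<lambda>r. \<Sum>q<Suc n. d q * case_nat (H p) (\<lambda>k. e k p) q r)"
      unfolding E_def lspan_def by blast
    have b: "case_nat (H p) (\<lambda>k. e k p) q (Inl r) = \<beta> q r" "case_nat (H p) (\<lambda>k. e k p) q (Inr r) = \<beta>' q r" for q r
      by (cases q; simp add: H_def e_def \<beta>_def \<beta>'_def)+
    have "y = (\<lambda>r. \<Sum>q<Suc n. d q * \<beta> q r)"
    proof
      fix r show "y r = (\<Sum>q<Suc n. d q * \<beta> q r)"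
        using fun_cong[OF d, of "Inl r"] unfolding b by (simp add: H_def)
    qed
    moreover have "j y = (\<lambda>r. \<Sum>q<Suc n. d q * \<beta>' q r)"
    proof
      fix r show "j y r = (\<Sum>q<Suc n. d q * \<beta>' q r)"
        using fun_cong[OF d, of "Inr r"] unfolding b by (simp add: H_def)
    qed
    moreover have "A0 (\<lambda>r. \<Sum>q<Suc n. d q * \<beta> q r) = (\<lambda>r. \<Sum>q<Suc n. d q * \<beta>' q r)"
      unfolding A0_sum using A0\<beta> by (intro ext sum.cong) auto
    ultimately have "j y = A0 y" by metis
    moreover have "y \<in> topspace (Euclidean_space (Suc n))" using Wp[of y] y V(3) by auto
    ultimately show "j y = mat_app (Suc n) A y" using AA by simp
  next
    fix u :: "nat \<Rightarrow> real" assume u: "u \<in> topspace (Euclidean_space (Suc n))"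
    have "\<beta>' q r = 0" if "q < Suc n" "r \<ge> Suc n'" for q r
      using that jp[OF W(3)] \<eta>t[OF W(3)] by (cases q) (auto simp: \<beta>'_def topspace_Euclidean_space)
    then have "A0 u \<in> topspace (Euclidean_space (Suc n'))"
      by (auto simp: A0_def topspace_Euclidean_space intro!: sum.neutral simp del: sum.lessThan_Suc)
    then show "mat_app (Suc n) A u \<in> topspace (Euclidean_space (Suc n'))" using AA[OF u] by simp
  next
    fix u v :: "nat \<Rightarrow> real"
    assume u: "u \<in> topspace (Euclidean_space (Suc n))" and v: "v \<in> topspace (Euclidean_space (Suc n))"
    have "?B' (A0 u) (A0 v) = (\<Sum>q<Suc n. coef u q * (\<Sum>r<Suc n. coef v r * ?B' (\<beta>' q) (\<beta>' r)))"
      unfolding A0_def form_sum[OF fB'] form_sum2[OF fB'] ..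
    also have "\<dots> = (\<Sum>q<Suc n. coef u q * (\<Sum>r<Suc n. coef v r * ?B (\<beta> q) (\<beta> r)))"
      using gram2 by (intro sum.cong refl arg_cong2[where f = "(*)"]) auto
    also have "\<dots> = ?B (\<lambda>r. \<Sum>q<Suc n. coef u q * \<beta> q r) (\<lambda>r. \<Sum>q<Suc n. coef v q * \<beta> q r)"
      unfolding form_sum[OF fB] form_sum2[OF fB] ..
    also have "\<dots> = ?B u v" using expand[OF u] expand[OF v] by simp
    finally show "?B' (mat_app (Suc n) A u) (mat_app (Suc n) A v) = ?B u v" using AA u v by simp
  qed
qed

section \<open>Normal frames\<close>

lemma sum_skip:
  assumes "p \<le> (n::nat)" shows "(\<Sum>i<Suc n. (h i :: real)) = h p + (\<Sum>i<n. h (skip p i))"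
proof -
  have "(\<Sum>i<Suc n. h i) = h p + (\<Sum>i\<in>{..<Suc n} - {p}. h i)" using assms by (subst sum.remove[of _ p]) auto
  then show ?thesis unfolding sum.reindex_bij_betw[OF skip_bij[OF assms], of h] .
qed

text \<open>Gaussian elimination: the last equation is solved for an unknown \<open>p\<close> with
  nonzero coefficient and substituted into the others, which leaves one equation and one unknown
  fewer.\<close>

lemma homogeneous_system_solution:
  fixes a :: "nat \<Rightarrow> nat \<Rightarrow> real"
  shows "r < n \<Longrightarrow> \<exists>v. (\<exists>i<n. v i \<noteq> 0) \<and> (\<forall>j<r. (\<Sum>i<n. a j i * v i) = 0)"
proof (induction r arbitrary: n a)
  case 0
  then show ?case by (intro exI[of _ "\<lambda>i. 1"]) auto
next
  case (Suc r)
  show ?case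
  proof (cases "\<exists>p<n. a r p \<noteq> 0")
    case False
    obtain v where "\<exists>i<n. v i \<noteq> 0" "\<forall>j<r. (\<Sum>i<n. a j i * v i) = 0"
      using Suc.IH[of n a] Suc.prems by auto
    moreover have "(\<Sum>i<n. a r i * v i) = 0" using False by (auto intro: sum.neutral)
    ultimately show ?thesis by (auto simp: less_Suc_eq)
  next
    case True
    then obtain p where p: "p < n" "a r p \<noteq> 0" by blast
    obtain n' where n': "n = Suc n'" "r < n'" using Suc.prems by (cases n) auto
    define b where "b j i = a j (skip p i) - a j p * a r (skip p i) / a r p" for j i
    obtain w where w: "\<exists>i<n'. w i \<noteq> 0" "\<forall>j<r. (\<Sum>i<n'. b j i * w i) = 0"
      using Suc.IH[OF n'(2), of b] by blast
    define t where "t = - (\<Sum>i<n'. a r (skip p i) * w i) / a r p"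
    define v where "v i = (if i = p then t else if i < p then w i else w (i - 1))" for i
    have vs: "v (skip p i) = w i" for i by (auto simp: v_def skip_def)
    have vp: "v p = t" by (simp add: v_def)
    have eq: "(\<Sum>i<n. a j i * v i) = a j p * t + (\<Sum>i<n'. a j (skip p i) * w i)" for j
      unfolding n'(1) using p(1) n'(1) sum_skip[of p n' "\<lambda>i. a j i * v i"] by (simp add: vs vp)
    have "(\<Sum>i<n. a j i * v i) = 0" if "j < Suc r" for j
    proof (cases "j = r")
      case True
      then show ?thesis unfolding eq t_def using p(2) by simp
    next
      case False
      then have "(\<Sum>i<n'. b j i * w i) = 0" using w(2) that by auto
      moreover have "(\<Sum>i<n'. b j i * w i) = (\<Sum>i<n'. a j (skip p i) * w i) - a j p / a r p * (\<Sum>i<n'. a r (skip p i) * w i)"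
        unfolding b_def by (simp add: algebra_simps sum_subtractf sum_distrib_left)
      ultimately show ?thesis unfolding eq t_def by simp
    qed
    moreover have "\<exists>i<n. v i \<noteq> 0"
    proof -
      obtain i where "i < n'" "w i \<noteq> 0" using w(1) by blast
      then show ?thesis using vs[of i] n'(1) by (intro exI[of _ "skip p i"]) (auto simp: skip_def)
    qed
    ultimately show ?thesis by blast
  qed
qed

text \<open>Orthogonality to \<open>p\<close> and to \<open>r\<close> further vectors amounts to
  \<open>Suc r\<close> linear equations in \<open>Suc n\<close> unknowns.\<close>

lemma Q_tspace_orthogonal_vector:
  assumes "r < n"
  shows "\<exists>w\<in>tspace (Q_space \<kappa> n) p. w \<noteq> (\<lambda>i. 0) \<and> (\<forall>j<r. flat_ip (sig \<kappa>) (Suc n) w (v j) = 0)"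
proof -
  obtain u where u: "\<exists>i<Suc n. u i \<noteq> 0" "\<forall>j<Suc r. (\<Sum>i<Suc n. (fsgn \<kappa> i * case_nat p v j i) * u i) = 0"
    using homogeneous_system_solution[of "Suc r" "Suc n" "\<lambda>j i. fsgn \<kappa> i * case_nat p v j i"] assms by auto
  define w where "w i = (if i < Suc n then u i else 0)" for i
  have z: "(\<Sum>i<Suc n. (fsgn \<kappa> i * case_nat p v j i) * u i) = flat_ip (sig \<kappa>) (Suc n) (case_nat p v j) w" for j
    unfolding flat_ip_fsgn by (intro sum.cong) (auto simp: w_def)
  have "flat_ip (sig \<kappa>) (Suc n) p w = 0" using u(2)[unfolded z, rule_format, of 0] by simp
  moreover have "flat_ip (sig \<kappa>) (Suc n) w (v j) = 0" if "j < r" for j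
    using u(2)[unfolded z, rule_format, of "Suc j"] that form_sym[OF is_form_flat_ip, of "sig \<kappa>" "Suc n" w] by simp
  moreover have "w \<noteq> (\<lambda>i. 0)" using u(1) by (auto simp: w_def fun_eq_iff)
  moreover have "w \<in> topspace (Euclidean_space (Suc n))" by (auto simp: w_def topspace_Euclidean_space)
  ultimately show ?thesis by (intro bexI[of _ w]) auto
qed

text \<open>One vector at a time, each orthogonal to the \<open>v j\<close> and to those already
  found.\<close>

lemma Q_tspace_orthogonal_extension:
  assumes "r + l \<le> n"
  shows "\<exists>w. \<forall>i<l. w i \<in> tspace (Q_space \<kappa> n) p \<and> w i \<noteq> (\<lambda>i. 0) \<and>
     (\<forall>j<r. flat_ip (sig \<kappa>) (Suc n) (w i) (v j) = 0) \<and> (\<forall>j<l. j \<noteq> i \<longrightarrow> flat_ip (sig \<kappa>) (Suc n) (w i) (w j) = 0)"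
  using assms
proof (induction l)
  case (Suc l)
  let ?B = "flat_ip (sig \<kappa>) (Suc n)"
  obtain w where w: "\<forall>i<l. w i \<in> tspace (Q_space \<kappa> n) p \<and> w i \<noteq> (\<lambda>i. 0) \<and>
     (\<forall>j<r. ?B (w i) (v j) = 0) \<and> (\<forall>j<l. j \<noteq> i \<longrightarrow> ?B (w i) (w j) = 0)"
    using Suc by auto
  obtain q where q: "q \<in> tspace (Q_space \<kappa> n) p" "q \<noteq> (\<lambda>i. 0)"
    "\<forall>j<r + l. ?B q (if j < r then v j else w (j - r)) = 0"
    using Q_tspace_orthogonal_vector[of "r + l" n \<kappa> p "\<lambda>j. if j < r then v j else w (j - r)"] Suc.prems by auto
  have qv: "?B q (v j) = 0" if "j < r" for j using q(3)[rule_format, of j] that by simp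
  have qw: "?B q (w j) = 0" if "j < l" for j using q(3)[rule_format, of "r + j"] that by simp
  have wq: "?B (w j) q = 0" if "j < l" for j
    using qw[OF that] form_sym[OF is_form_flat_ip, of "sig \<kappa>" "Suc n" q "w j"] by simp
  show ?case
    by (rule exI[of _ "w(l := q)"]) (use w q(1,2) qv qw wq in \<open>auto simp: less_Suc_eq simp del: Q_space_simps\<close>)
qed auto

lemma (in smooth_atlas) continuous_map_smooth:
  assumes "smooth_fun_on M (topspace (mtop M)) h"
  shows "continuous_map (mtop M) euclideanreal h"
  unfolding continuous_map_upper_lower_semicontinuous_lt
proof (intro conjI allI)
  fix a
  have "smooth_fun_on M (topspace (mtop M)) (\<lambda>x. h x - a)" "smooth_fun_on M (topspace (mtop M)) (\<lambda>x. a - h x)"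
    by (intro smooth_intros assms openin_topspace)+
  from this[THEN openin_positive[OF openin_topspace]]
  show "openin (mtop M) {x \<in> topspace (mtop M). a < h x}" "openin (mtop M) {x \<in> topspace (mtop M). h x < a}"
    by simp_all
qed

lemma (in smooth_atlas) continuous_map_Q:
  assumes \<kappa>: "\<kappa> \<noteq> 0" and F: "smooth_vec_on M (topspace (mtop M)) F"
    "\<And>x. x \<in> topspace (mtop M) \<Longrightarrow> F x \<in> points (Q_space \<kappa> n)"
  shows "continuous_map (mtop M) (mtop (Q_manifold \<kappa> n)) F"
proof -
  have "continuous_map (mtop M) (Euclidean_space (Suc n)) (\<lambda>x i. if i < Suc n then F x i else 0)"
    unfolding continuous_map_componentwise_Euclidean_space
    using continuous_map_smooth smooth_vecD[OF F(1)] by blast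
  moreover have "(\<lambda>i. if i < Suc n then F x i else 0) = F x" if "x \<in> topspace (mtop M)" for x
    using F(2)[OF that] by (auto simp: topspace_Euclidean_space fun_eq_iff)
  ultimately have "continuous_map (mtop M) (Euclidean_space (Suc n)) F" by (rule continuous_map_eq) auto
  then show ?thesis
    unfolding Q_manifold_simps(1)[OF \<kappa>] continuous_map_in_subtopology using F(2) by blast
qed

lemma smooth_vec_o: "smooth_vec_on M W F \<Longrightarrow> smooth_vec_on M W (\<lambda>x. F x \<circ> h)"
  by (simp add: smooth_vec_on_def)

lemma independent_orthonormal:
  fixes c :: "nat \<Rightarrow> real"
  assumes B: "is_form B" and on: "\<And>j k. j < l \<Longrightarrow> k < l \<Longrightarrow> B (e j) (e k) = (if j = k then 1 else 0)"
    and 0: "\<And>i. (\<Sum>j<l. c j * e j i) = 0" and k: "k < l"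
  shows "c k = 0"
proof -
  have "B (\<lambda>i. \<Sum>j<l. c j * e j i) (e k) = (\<Sum>j<l. if j = k then c j else 0)"
    unfolding form_sum[OF B] using on k by (intro sum.cong) auto
  then show ?thesis using 0 form_zero[OF B] k by simp
qed

text \<open>At \<open>x\<close> a dimension count provides \<open>l\<close> orthogonal normal
  vectors. Projecting these fixed vectors to the nearby normal spaces gives smooth fields,
  independent near \<open>x\<close>, and a second dimension count shows that they span.\<close>

lemma normal_frame:
  assumes im: "immersion M (Q_space \<kappa> (m + l)) f" and \<kappa>: "\<kappa> \<noteq> 0" and dim: "mdim M = m" and x: "x \<in> topspace (mtop M)"
  obtains V e where "openin (mtop M) V" "x \<in> V" "\<And>j. j < l \<Longrightarrow> smooth_vec_on M V (e j)"
    "\<And>y. y \<in> V \<Longrightarrow> normal_space M (Q_space \<kappa> (m + l)) f y = lspan l (\<lambda>j. e j y)"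
    "\<And>y j k. y \<in> V \<Longrightarrow> j < l \<Longrightarrow> k < l \<Longrightarrow> flat_ip (sig \<kappa>) (Suc (m + l)) (e j y) (e k y) = (if j = k then 1 else 0)"
proof -
  let ?n = "m + l" let ?B = "flat_ip (sig \<kappa>) (Suc (m + l))" let ?N = "Q_space \<kappa> (m + l)"
  interpret immersion M ?N f by (rule im)
  note fB = is_form_flat_ip[of "sig \<kappa>" "Suc (m + l)"]
  obtain c where c: "c \<in> atlas M" "x \<in> fst c" using topspace_chart[OF x] .
  define t where "t k y = dvec (coord_vec M c y k) f" for k y
  have "\<exists>V u C. openin (mtop M) V \<and> x \<in> V \<and> V \<subseteq> fst c \<and> (\<forall>j<m. smooth_vec_on M V (u j)) \<and>
      (\<forall>j<m. \<forall>l<m. smooth_fun_on M V (C j l)) \<and>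
      (\<forall>y\<in>V. \<forall>j<m. u j y = (\<lambda>i. \<Sum>l<m. C j l y * t l y i)) \<and>
      (\<forall>y\<in>V. \<forall>j<m. \<forall>l<m. ?B (u j y) (u l y) = (if j = l then 1 else 0)) \<and>
      (\<forall>y\<in>V. \<forall>j<m. t j y \<in> lspan m (\<lambda>l. u l y))"
  proof (rule Gram_Schmidt[OF fB chart_open[OF c(1)] c(2)])
    show "smooth_vec_on M (fst c) (t j)" if "j < m" for j
      using frame_smooth[OF c(1)] that dim unfolding t_def by simp
    show "0 < ?B (\<lambda>i. \<Sum>j<m. d j * t j x i) (\<lambda>i. \<Sum>j<m. d j * t j x i)" if "\<exists>j<m. d j \<noteq> 0" for d
      using frame_pos[OF c, of d] that dim unfolding t_def by simp
  qed
  then obtain V u C where V: "openin (mtop M) V" "x \<in> V" "V \<subseteq> fst c"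
    and u': "\<forall>j<m. smooth_vec_on M V (u j)"
    and uC': "\<forall>y\<in>V. \<forall>j<m. u j y = (\<lambda>i. \<Sum>l<m. C j l y * t l y i)"
    and on': "\<forall>y\<in>V. \<forall>j<m. \<forall>l<m. ?B (u j y) (u l y) = (if j = l then 1 else 0)"
    and sp': "\<forall>y\<in>V. \<forall>j<m. t j y \<in> lspan m (\<lambda>l. u l y)"
    by blast
  note u = u'[rule_format] and uC = uC'[rule_format] and on = on'[rule_format] and sp = sp'[rule_format]
  have Vt: "y \<in> topspace (mtop M)" if "y \<in> V" for y using that V(3) chart_topspace[OF c(1)] by blast
  have im: "image_tangent M f y = lspan m (\<lambda>j. u j y)" if y: "y \<in> V" for y
  proof -
    have *: "image_tangent M f y = lspan m (\<lambda>j. t j y)"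
      using image_tangent_chart[OF c(1), of y] y V(3) dim unfolding t_def by auto
    show ?thesis unfolding *
    proof (intro equalityI lspan_subset[OF subsp_lspan])
      show "t j y \<in> lspan m (\<lambda>j. u j y)" if "j < m" for j using sp[OF y that] .
      show "u j y \<in> lspan m (\<lambda>j. t j y)" if "j < m" for j using uC[OF y that] lspanI[of _ "\<lambda>j. t j y" m] by simp
    qed
  qed
  have uI: "u j y \<in> image_tangent M f y" if "j < m" "y \<in> V" for j y
    unfolding im[OF that(2)] using lspan_base[of j m "\<lambda>j. u j y"] that by simp
  have uT: "u j y \<in> tspace ?N (f y)" if "j < m" "y \<in> V" for j y
    using uI[OF that] image_tangent_tspace[OF Vt[OF that(2)]] by blast
  have ff: "?B (f y) (f y) = 1 / \<kappa>" and fE: "f y \<in> topspace (Euclidean_space (Suc ?n))" if "y \<in> V" for y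
    using f_points[OF Vt[OF that]] by simp_all
  have fu: "?B (f y) (u j y) = 0" if "j < m" "y \<in> V" for j y using uT[OF that] by simp
  obtain w where w: "\<And>i. i < l \<Longrightarrow> w i \<in> tspace ?N (f x)" "\<And>i. i < l \<Longrightarrow> w i \<noteq> (\<lambda>i. 0)"
     "\<And>i j. i < l \<Longrightarrow> j < m \<Longrightarrow> ?B (w i) (u j x) = 0" "\<And>i j. i < l \<Longrightarrow> j < l \<Longrightarrow> j \<noteq> i \<Longrightarrow> ?B (w i) (w j) = 0"
    using Q_tspace_orthogonal_extension[of m l ?n \<kappa> "f x" "\<lambda>j. u j x"] by blast
  \<comment> \<open>The projection of the constant vector \<open>w j\<close> to the normal space at
    \<open>y\<close>: its components along the position vector and the orthonormal tangent frame are
    subtracted.\<close>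
  define \<omega> where "\<omega> j y = (\<lambda>i. (w j i - (\<kappa> * ?B (w j) (f y)) * f y i) - (\<Sum>k<m. ?B (w j) (u k y) * u k y i))" for j y
  have \<omega>x: "\<omega> j x = w j" if "j < l" for j
    using w(1)[OF that] w(3)[OF that] form_sym[OF fB, of "w j" "f x"] by (simp add: \<omega>_def)
  have \<omega>N: "\<omega> j y \<in> normal_space M ?N f y" if "j < l" "y \<in> V" for j y
  proof -
    have "?B (f y) (\<omega> j y) = 0"
      unfolding \<omega>_def form_diff2[OF fB] form_scale2[OF fB] form_sum2[OF fB]
      using ff[OF that(2)] fu[OF _ that(2)] \<kappa> form_sym[OF fB, of "w j" "f y"] by simp
    moreover have "\<omega> j y \<in> topspace (Euclidean_space (Suc ?n))"
    proof -
      have "w j i = 0 \<and> f y i = 0 \<and> (\<forall>k<m. u k y i = 0)" if i: "i \<ge> Suc ?n" for i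
        using w(1)[OF \<open>j < l\<close>] fE[OF \<open>y \<in> V\<close>] uT[OF _ \<open>y \<in> V\<close>] i by (simp add: topspace_Euclidean_space)
      then show ?thesis unfolding \<omega>_def topspace_Euclidean_space by simp
    qed
    moreover have "?B (\<omega> j y) v = 0" if v: "v \<in> image_tangent M f y" for v
    proof -
      have uk: "?B (\<omega> j y) (u k y) = 0" if "k < m" for k
        unfolding \<omega>_def form_diff[OF fB] form_scale[OF fB] form_sum[OF fB]
        using fu[OF that \<open>y \<in> V\<close>] on[OF \<open>y \<in> V\<close> _ that] that by (simp add: if_distrib[of "\<lambda>z. _ * z"] cong: if_cong)
      obtain d where "v = (\<lambda>i. \<Sum>k<m. d k * u k y i)" using v unfolding im[OF \<open>y \<in> V\<close>] lspan_def by blast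
      then show ?thesis by (simp add: form_sum2[OF fB] uk)
    qed
    ultimately show ?thesis by (simp add: normal_space_def)
  qed
  have cs: "smooth_vec_on M V (\<lambda>y. z)" for z :: "nat \<Rightarrow> real"
    unfolding smooth_vec_on_def by (intro allI smooth_const V(1))
  have \<omega>s: "smooth_vec_on M V (\<omega> j)" if "j < l" for j
    unfolding smooth_vec_on_def \<omega>_def
    by (intro allI smooth_diff smooth_mult smooth_sum smooth_const V(1) smooth_form[OF fB V(1) cs] smooth_vecD f_smooth_on u) auto
  have "\<exists>V' e C. openin (mtop M) V' \<and> x \<in> V' \<and> V' \<subseteq> V \<and> (\<forall>j<l. smooth_vec_on M V' (e j)) \<and>
      (\<forall>j<l. \<forall>q<l. smooth_fun_on M V' (C j q)) \<and>
      (\<forall>y\<in>V'. \<forall>j<l. e j y = (\<lambda>i. \<Sum>q<l. C j q y * \<omega> q y i)) \<and>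
      (\<forall>y\<in>V'. \<forall>j<l. \<forall>q<l. ?B (e j y) (e q y) = (if j = q then 1 else 0)) \<and>
      (\<forall>y\<in>V'. \<forall>j<l. \<omega> j y \<in> lspan l (\<lambda>q. e q y))"
  proof (rule Gram_Schmidt[OF fB V(1,2)])
    fix d :: "nat \<Rightarrow> real" assume "\<exists>j<l. d j \<noteq> 0"
    then obtain j where j: "j < l" "d j \<noteq> 0" by blast
    have ww: "?B (w i) (w i) > 0" if "i < l" for i
      using w(1,2)[OF that] tspace_posdef[OF x] unfolding posdef_def by simp
    have "?B (\<lambda>i. \<Sum>j<l. d j * \<omega> j x i) (\<lambda>i. \<Sum>j<l. d j * \<omega> j x i) = (\<Sum>j<l. d j * (\<Sum>q<l. d q * ?B (w j) (w q)))"
      unfolding form_sum[OF fB] form_sum2[OF fB] by (intro sum.cong refl arg_cong2[where f = "(*)"]) (simp_all add: \<omega>x)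
    also have "\<dots> = (\<Sum>j<l. d j * d j * ?B (w j) (w j))"
    proof (intro sum.cong refl)
      fix j assume "j \<in> {..<l}"
      then have "(\<Sum>q<l. d q * ?B (w j) (w q)) = (\<Sum>q<l. if q = j then d j * ?B (w j) (w j) else 0)"
        using w(4) by (intro sum.cong) auto
      then show "d j * (\<Sum>q<l. d q * ?B (w j) (w q)) = d j * d j * ?B (w j) (w j)"
        using \<open>j \<in> {..<l}\<close> by simp
    qed
    also have "\<dots> > 0"
      using j ww by (intro sum_pos2[of _ j]) (auto simp: zero_less_mult_iff less_imp_le linorder_neq_iff intro!: mult_nonneg_nonneg)
    finally show "0 < ?B (\<lambda>i. \<Sum>j<l. d j * \<omega> j x i) (\<lambda>i. \<Sum>j<l. d j * \<omega> j x i)" .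
  qed (rule \<omega>s)
  then obtain V' e C where V': "openin (mtop M) V'" "x \<in> V'" "V' \<subseteq> V"
    and e': "\<forall>j<l. smooth_vec_on M V' (e j)"
    and eC': "\<forall>y\<in>V'. \<forall>j<l. e j y = (\<lambda>i. \<Sum>q<l. C j q y * \<omega> q y i)"
    and eon': "\<forall>y\<in>V'. \<forall>j<l. \<forall>q<l. ?B (e j y) (e q y) = (if j = q then 1 else 0)"
    by blast
  note e = e'[rule_format] and eC = eC'[rule_format] and eon = eon'[rule_format]
  have eN: "e j y \<in> normal_space M ?N f y" if "y \<in> V'" "j < l" for y j
    unfolding eC[OF that]
    by (rule subsp_sum[OF normal_space_subsp[OF Vt]]) (use \<omega>N that V'(3) in auto)
  have "normal_space M ?N f y = lspan l (\<lambda>j. e j y)" if y: "y \<in> V'" for y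
  proof
    have yV: "y \<in> V" using y V'(3) by auto
    show "lspan l (\<lambda>j. e j y) \<subseteq> normal_space M ?N f y"
      by (rule lspan_subset[OF normal_space_subsp[OF Vt[OF yV]]]) (rule eN[OF y])
    show "normal_space M ?N f y \<subseteq> lspan l (\<lambda>j. e j y)"
    proof
      fix v assume v: "v \<in> normal_space M ?N f y"
      define v' where "v' = (\<lambda>i. v i - (\<Sum>j<l. ?B v (e j y) * e j y i))"
      have v'N: "v' \<in> normal_space M ?N f y"
        unfolding v'_def by (intro subsp_diff subsp_sum normal_space_subsp[OF Vt[OF yV]] v) (use eN[OF y] in auto)
      have v'e: "?B v' (e k y) = 0" if "k < l" for k
        unfolding v'_def form_diff[OF fB] form_sum[OF fB]
        using eon[OF y _ that] that by (simp add: if_distrib[of "\<lambda>z. _ * z"] cong: if_cong)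
      have v'T: "v' \<in> tspace ?N (f y)" and v'u: "\<And>k. k < m \<Longrightarrow> ?B v' (u k y) = 0"
        using v'N uI[OF _ yV] by (auto simp: normal_space_def simp del: Q_space_simps(3))
      have "v' = (\<lambda>i. 0)"
      proof (rule ccontr)
        assume "v' \<noteq> (\<lambda>i. 0)"
        then have pos: "?B v' v' > 0" using v'T tspace_posdef[OF Vt[OF yV]] unfolding posdef_def by simp
        \<comment> \<open>A leftover normal vector \<open>v'\<close> would make the tangent frame,
          the \<open>e j\<close>, \<open>f y\<close> and \<open>v'\<close> a family of
          \<open>m + l + 2\<close> mutually orthogonal vectors with nonzero squares in dimension
          \<open>m + l + 1\<close>.\<close>
        define z where "z q = (if q < m then u q y else if q < m + l then e (q - m) y else if q = m + l then f y else v')" for q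
        have eT: "e j y \<in> tspace ?N (f y)" and eu: "\<And>k. k < m \<Longrightarrow> ?B (e j y) (u k y) = 0" if "j < l" for j
          using eN[OF y that] uI[OF _ yV] by (auto simp: normal_space_def simp del: Q_space_simps(3))
        have zz: "?B (z q) (z r) = (if q = r then ?B (z q) (z q) else 0)" if "q < r" "r < Suc (Suc ?n)" for q r
          using that on[OF yV] eon[OF y] eu[THEN trans[OF form_sym[OF fB]]] v'u[THEN trans[OF form_sym[OF fB]]]
            v'e[THEN trans[OF form_sym[OF fB]]] fu[OF _ yV, THEN trans[OF form_sym[OF fB]]] v'T eT[THEN Q_space_simps(3)[THEN iffD1]]
            form_sym[OF fB, of "f y"]
          by (auto simp: z_def)
        have z0: "?B (z q) (z q) \<noteq> 0" if "q < Suc (Suc ?n)" for q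
          using that on[OF yV] eon[OF y] ff[OF yV] \<kappa> pos by (auto simp: z_def)
        obtain d where d: "\<exists>q<Suc (Suc ?n). d q \<noteq> 0" "\<forall>i<Suc ?n. (\<Sum>q<Suc (Suc ?n). z q i * d q) = 0"
          using homogeneous_system_solution[of "Suc ?n" "Suc (Suc ?n)" "\<lambda>i q. z q i"] by auto
        have "d r = 0" if r: "r < Suc (Suc ?n)" for r
        proof -
          have "?B (\<lambda>i. \<Sum>q<Suc (Suc ?n). d q * z q i) (z r) = ?B (\<lambda>i. 0) (z r)"
            unfolding flat_ip_def by (intro sum.cong refl) (use d(2) in \<open>simp add: mult.commute[of "d _"]\<close>)
          then have s0: "(\<Sum>q<Suc (Suc ?n). d q * ?B (z q) (z r)) = 0"
            unfolding form_sum[OF fB] form_zero[OF fB] .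
          have zr: "?B (z q) (z r) = (if q = r then ?B (z r) (z r) else 0)" if "q < Suc (Suc ?n)" for q
            using zz[of q r] zz[of r q] form_sym[OF fB, of "z q" "z r"] that r by (cases q r rule: linorder_cases) auto
          have "(\<Sum>q<Suc (Suc ?n). d q * ?B (z q) (z r)) = (\<Sum>q<Suc (Suc ?n). if q = r then d q * ?B (z r) (z r) else 0)"
          proof (intro sum.cong refl)
            fix q assume "q \<in> {..<Suc (Suc ?n)}"
            then show "d q * ?B (z q) (z r) = (if q = r then d q * ?B (z r) (z r) else 0)"
              using zr[of q] by (cases "q = r") auto
          qed
          then show ?thesis using s0 z0[OF r] r by (simp del: sum.lessThan_Suc)
        qed
        then show False using d(1) by blast
      qed
      then have "v = (\<lambda>i. \<Sum>j<l. ?B v (e j y) * e j y i)" by (simp add: v'_def fun_eq_iff)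
      then show "v \<in> lspan l (\<lambda>j. e j y)" using lspanI[of "\<lambda>j. ?B v (e j y)" "\<lambda>j. e j y" l] by simp
    qed
  qed
  then show thesis using that[OF V'(1,2), of e] e eon by blast
qed

section \<open>From a factorization to a parallel subbundle\<close>

lemma linear_isometryD:
  assumes "linear_isometry_of s N T"
  shows "u \<in> topspace (Euclidean_space N) \<Longrightarrow> T u \<in> topspace (Euclidean_space N)"
    and "u \<in> topspace (Euclidean_space N) \<Longrightarrow> v \<in> topspace (Euclidean_space N) \<Longrightarrow>
      T (\<lambda>i. a * u i + b * v i) = (\<lambda>i. a * T u i + b * T v i)"
    and "u \<in> topspace (Euclidean_space N) \<Longrightarrow> v \<in> topspace (Euclidean_space N) \<Longrightarrow> flat_ip s N (T u) (T v) = flat_ip s N u v"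
  using assms unfolding linear_isometry_of_def by (blast dest: bij_betwE)+

text \<open>The differential of \<open>j\<close> at \<open>p\<close>: a derivation \<open>Z\<close> is identified with the vector \<open>v\<close> of the
  flat space by letting it act on the inclusion.\<close>

definition push :: "real \<Rightarrow> nat \<Rightarrow> ((nat \<Rightarrow> real) \<Rightarrow> 'i \<Rightarrow> real) \<Rightarrow> (nat \<Rightarrow> real) \<Rightarrow> (nat \<Rightarrow> real) \<Rightarrow> 'i \<Rightarrow> real" where
  "push \<kappa> n j p v = dvec (SOME Z. Z \<in> tangent_space (Q_manifold \<kappa> n) p \<and> dvec Z (\<lambda>z. z) = v) j"

text \<open>Where \<open>j\<close> agrees with a linear map, its differential is that map. A bundle
  defined with \<open>push\<close> is therefore global, although each matrix \<open>A\<close>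
  describes \<open>j\<close> only on a neighbourhood.\<close>

lemma push_eq:
  assumes \<kappa>: "\<kappa> \<noteq> 0" and V: "openin (mtop (Q_manifold \<kappa> n)) V" "p \<in> V" and j: "\<And>y. y \<in> V \<Longrightarrow> j y = mat_app N A y"
    and v: "v \<in> tspace (Q_space \<kappa> n) p"
  shows "push \<kappa> n j p v = mat_app N A v"
proof -
  interpret smooth_atlas "Q_manifold \<kappa> n" by (rule smooth_atlas_Q[OF \<kappa>])
  have p: "p \<in> points (Q_space \<kappa> n)" using openin_subset[OF V(1)] V(2) unfolding topspace_Q[OF \<kappa>] by blast
  define Z where "Z = (SOME Z. Z \<in> tangent_space (Q_manifold \<kappa> n) p \<and> dvec Z (\<lambda>z. z) = v)"
  have Z: "Z \<in> tangent_space (Q_manifold \<kappa> n) p" "dvec Z (\<lambda>z. z) = v"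
    using someI_ex[of "\<lambda>Z. Z \<in> tangent_space (Q_manifold \<kappa> n) p \<and> dvec Z (\<lambda>z. z) = v"] Q_tangent_exists[OF \<kappa> p v]
    unfolding Z_def by blast+
  have "dvec Z j = dvec Z (\<lambda>y. mat_app N A y)" by (rule dvec_cong[OF Z(1) V j])
  also have "\<dots> = mat_app N A v"
    using dvec_mat_app[OF V(1) smooth_vec_subset[OF Q_id_smooth[OF \<kappa>] openin_subset[OF V(1)]] Z(1) V(2)] Z(2) by simp
  finally show ?thesis by (simp add: push_def Z_def)
qed

lemma scaled_isometry:
  assumes T: "linear_isometry_of (sig \<kappa>) (Suc n) T" and s: "sig k = sig \<kappa>" and x: "x \<in> topspace (Euclidean_space (Suc n))"
    and v: "v \<in> tspace (Q_space k n) x"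
  shows "(\<lambda>i. a * T v i) \<in> tspace (Q_space \<kappa> n) (\<lambda>i. a * T x i)"
  using linear_isometryD[OF T] x v
  by (simp add: form_scale[OF is_form_flat_ip] form_scale2[OF is_form_flat_ip] s topspace_Euclidean_space)

context smooth_atlas
begin

text \<open>Both totally geodesic maps are linear near the image of \<open>x\<close>; the preimages
  of these neighbourhoods under two continuous maps intersect in \<open>W\<close>. The numbers
  \<open>a^2\<close> and \<open>b^2\<close> are the ratios by which the two components of
  \<open>A\<close> scale scalar products.\<close>

lemma composition_locally_linear:
  fixes n :: nat
  assumes k: "k1 \<noteq> 0" "k2 \<noteq> 0" "k \<noteq> 0" "sig k = sig k1" "sig k = sig k2"
    and F: "smooth_vec_on M (topspace (mtop M)) F" "\<And>x. x \<in> topspace (mtop M) \<Longrightarrow> F x \<in> points (Q_space k n)"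
    and T1: "linear_isometry_of (sig k1) (Suc n) T1" and T2: "linear_isometry_of (sig k2) (Suc n) T2"
    and aT: "\<And>q. q \<in> points (Q_space k n) \<Longrightarrow> (\<lambda>i. a * T1 q i) \<in> points (Q_space k1 n)"
    and bT: "\<And>q. q \<in> points (Q_space k n) \<Longrightarrow> (\<lambda>i. b * T2 q i) \<in> points (Q_space k2 n)"
    and j1: "totally_geodesic_embedding (Q_manifold k1 n) (Q_space k1 n1) j1"
    and j2: "totally_geodesic_embedding (Q_manifold k2 n) (Q_space k2 n2) j2"
    and x: "x \<in> topspace (mtop M)"
  shows "\<exists>A W. openin (mtop M) W \<and> x \<in> W \<and>
     (\<forall>y\<in>W. case_sum (j1 (\<lambda>i. a * T1 (F y) i)) (j2 (\<lambda>i. b * T2 (F y) i)) = mat_app (Suc n) A (F y) \<and>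
       (\<forall>v\<in>tspace (Q_space k n) (F y).
          case_sum (push k1 n j1 (\<lambda>i. a * T1 (F y) i) (\<lambda>i. a * T1 v i)) (push k2 n j2 (\<lambda>i. b * T2 (F y) i) (\<lambda>i. b * T2 v i)) =
          mat_app (Suc n) A v)) \<and>
     (\<forall>u\<in>topspace (Euclidean_space (Suc n)). mat_app (Suc n) A u \<circ> Inl \<in> topspace (Euclidean_space (Suc n1)) \<and>
         mat_app (Suc n) A u \<circ> Inr \<in> topspace (Euclidean_space (Suc n2))) \<and>
     (\<forall>u\<in>topspace (Euclidean_space (Suc n)). \<forall>v\<in>topspace (Euclidean_space (Suc n)).
       flat_ip (sig k1) (Suc n1) (mat_app (Suc n) A u \<circ> Inl) (mat_app (Suc n) A v \<circ> Inl) = a\<^sup>2 * flat_ip (sig k) (Suc n) u v \<and>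
       flat_ip (sig k2) (Suc n2) (mat_app (Suc n) A u \<circ> Inr) (mat_app (Suc n) A v \<circ> Inr) = b\<^sup>2 * flat_ip (sig k) (Suc n) u v)"
proof -
  let ?E = "topspace (Euclidean_space (Suc n))"
  \<comment> \<open>\<open>T1\<close> and \<open>T2\<close> are known to be linear on sequences
    vanishing from \<open>Suc n\<close> on; composing with the cut-off \<open>\<rho>\<close> gives
    maps linear on all sequences, as \<open>linear_eq_mat_app\<close> requires.\<close>
  define \<rho> where "\<rho> u = (\<lambda>i. if i < Suc n then u i else 0)" for u :: "nat \<Rightarrow> real"
  have \<rho>E: "\<rho> u \<in> ?E" for u by (simp add: \<rho>_def topspace_Euclidean_space)
  have \<rho>id: "\<rho> u = u" if "u \<in> ?E" for u using that by (auto simp: \<rho>_def topspace_Euclidean_space fun_eq_iff)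
  have \<rho>lin: "\<rho> (\<lambda>i. c * u i + d * v i) = (\<lambda>i. c * \<rho> u i + d * \<rho> v i)" for c d u v by (auto simp: \<rho>_def)
  have FE: "F y \<in> ?E" if "y \<in> topspace (mtop M)" for y using F(2)[OF that] by simp
  have p1: "(\<lambda>i. a * T1 (F x) i) \<in> points (Q_space k1 n)" and p2: "(\<lambda>i. b * T2 (F x) i) \<in> points (Q_space k2 n)"
    using aT bT F(2)[OF x] by auto
  have smT: "smooth_vec_on M (topspace (mtop M)) (\<lambda>y i. c * T (F y) i)"
    if T: "linear_isometry_of s (Suc n) T" for c T s
  proof -
    define A where "A s = T (\<rho> (\<lambda>i. if i = s then 1 else 0))" for s
    have "T (\<rho> u) = mat_app (Suc n) A u" if "u \<in> ?E" for u
      using linear_eq_mat_app[of "\<lambda>u. T (\<rho> u)" u "Suc n", OF _ that] linear_isometryD(2)[OF T \<rho>E \<rho>E]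
      by (simp add: \<rho>lin A_def[abs_def])
    then have eq: "T (F y) i = mat_app (Suc n) A (F y) i" if "y \<in> topspace (mtop M)" for y i using FE[OF that] \<rho>id by metis
    have "smooth_vec_on M (topspace (mtop M)) (\<lambda>y. mat_app (Suc n) A (F y))" by (rule smooth_mat_app[OF openin_topspace F(1)])
    then have sm: "smooth_fun_on M (topspace (mtop M)) (\<lambda>y. c * mat_app (Suc n) A (F y) i)" for i
      by (intro smooth_mult smooth_const openin_topspace smooth_vecD)
    have "smooth_fun_on M (topspace (mtop M)) (\<lambda>y. c * T (F y) i)" for i
      by (rule smooth_fun_cong[OF openin_topspace _ sm[of i]]) (simp add: eq)
    then show ?thesis by (simp add: smooth_vec_on_def)
  qed
  have c1: "continuous_map (mtop M) (mtop (Q_manifold k1 n)) (\<lambda>y i. a * T1 (F y) i)"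
    by (rule continuous_map_Q[OF k(1) smT[OF T1]]) (use aT F(2) in blast)
  have c2: "continuous_map (mtop M) (mtop (Q_manifold k2 n)) (\<lambda>y i. b * T2 (F y) i)"
    by (rule continuous_map_Q[OF k(2) smT[OF T2]]) (use bT F(2) in blast)
  obtain A1 V1 where V1: "openin (mtop (Q_manifold k1 n)) V1" "(\<lambda>i. a * T1 (F x) i) \<in> V1"
    and A1: "\<And>y. y \<in> V1 \<Longrightarrow> j1 y = mat_app (Suc n) A1 y"
      "\<And>u. u \<in> ?E \<Longrightarrow> mat_app (Suc n) A1 u \<in> topspace (Euclidean_space (Suc n1))"
      "\<And>u v. u \<in> ?E \<Longrightarrow> v \<in> ?E \<Longrightarrow>
        flat_ip (sig k1) (Suc n1) (mat_app (Suc n) A1 u) (mat_app (Suc n) A1 v) = flat_ip (sig k1) (Suc n) u v"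
    by (rule totally_geodesic_locally_linear[OF k(1) j1 p1]) blast
  obtain A2 V2 where V2: "openin (mtop (Q_manifold k2 n)) V2" "(\<lambda>i. b * T2 (F x) i) \<in> V2"
    and A2: "\<And>y. y \<in> V2 \<Longrightarrow> j2 y = mat_app (Suc n) A2 y"
      "\<And>u. u \<in> ?E \<Longrightarrow> mat_app (Suc n) A2 u \<in> topspace (Euclidean_space (Suc n2))"
      "\<And>u v. u \<in> ?E \<Longrightarrow> v \<in> ?E \<Longrightarrow>
        flat_ip (sig k2) (Suc n2) (mat_app (Suc n) A2 u) (mat_app (Suc n) A2 v) = flat_ip (sig k2) (Suc n) u v"
    by (rule totally_geodesic_locally_linear[OF k(2) j2 p2]) blast
  define W where "W = {y \<in> topspace (mtop M). (\<lambda>i. a * T1 (F y) i) \<in> V1} \<inter> {y \<in> topspace (mtop M). (\<lambda>i. b * T2 (F y) i) \<in> V2}"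
  have W: "openin (mtop M) W" "x \<in> W"
    unfolding W_def using openin_continuous_map_preimage[OF c1 V1(1)] openin_continuous_map_preimage[OF c2 V2(1)] x V1(2) V2(2)
    by auto
  define A0 where "A0 u = case_sum (mat_app (Suc n) A1 (\<lambda>i. a * T1 (\<rho> u) i)) (mat_app (Suc n) A2 (\<lambda>i. b * T2 (\<rho> u) i))" for u
  have A0_lin: "A0 (\<lambda>i. c * u i + d * v i) = (\<lambda>i. c * A0 u i + d * A0 v i)" for c d u v
  proof -
    have e: "(\<lambda>i. e * T (\<rho> (\<lambda>i. c * u i + d * v i)) i) = (\<lambda>i. c * (e * T (\<rho> u) i) + d * (e * T (\<rho> v) i))"
      if "linear_isometry_of s (Suc n) T" for s T e
      unfolding \<rho>lin linear_isometryD(2)[OF that \<rho>E \<rho>E] by (simp add: algebra_simps)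
    show ?thesis
      unfolding A0_def e[OF T1] e[OF T2] mat_app_lin by (auto simp: fun_eq_iff split: sum.split)
  qed
  define A where "A s = A0 (\<lambda>i. if i = s then 1 else 0)" for s
  have AA: "mat_app (Suc n) A u = case_sum (mat_app (Suc n) A1 (\<lambda>i. a * T1 u i)) (mat_app (Suc n) A2 (\<lambda>i. b * T2 u i))"
    if "u \<in> ?E" for u
    using linear_eq_mat_app[of A0 u "Suc n", OF A0_lin that] by (simp add: A_def[abs_def] A0_def \<rho>id[OF that])
  have aE: "(\<lambda>i. c * T u i) \<in> ?E" if "linear_isometry_of s (Suc n) T" "u \<in> ?E" for s T c u
    using linear_isometryD(1)[OF that] by (simp add: topspace_Euclidean_space)
  show ?thesis
  proof (rule exI[of _ A], rule exI[of _ W], intro conjI W ballI)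
    fix y assume y: "y \<in> W"
    then have yt: "y \<in> topspace (mtop M)" and y1: "(\<lambda>i. a * T1 (F y) i) \<in> V1" and y2: "(\<lambda>i. b * T2 (F y) i) \<in> V2"
      by (auto simp: W_def)
    show "case_sum (j1 (\<lambda>i. a * T1 (F y) i)) (j2 (\<lambda>i. b * T2 (F y) i)) = mat_app (Suc n) A (F y)"
      unfolding AA[OF FE[OF yt]] A1(1)[OF y1] A2(1)[OF y2] ..
    fix v assume v: "v \<in> tspace (Q_space k n) (F y)"
    then have vE: "v \<in> ?E" by simp
    show "case_sum (push k1 n j1 (\<lambda>i. a * T1 (F y) i) (\<lambda>i. a * T1 v i)) (push k2 n j2 (\<lambda>i. b * T2 (F y) i) (\<lambda>i. b * T2 v i)) =
          mat_app (Suc n) A v"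
    proof -
      have "push k1 n j1 (\<lambda>i. a * T1 (F y) i) (\<lambda>i. a * T1 v i) = mat_app (Suc n) A1 (\<lambda>i. a * T1 v i)"
        by (rule push_eq[OF k(1) V1(1) y1 _ scaled_isometry[OF T1 k(4) FE[OF yt] v]]) (rule A1(1))
      moreover have "push k2 n j2 (\<lambda>i. b * T2 (F y) i) (\<lambda>i. b * T2 v i) = mat_app (Suc n) A2 (\<lambda>i. b * T2 v i)"
        by (rule push_eq[OF k(2) V2(1) y2 _ scaled_isometry[OF T2 k(5) FE[OF yt] v]]) (rule A2(1))
      ultimately show ?thesis unfolding AA[OF vE] by simp
    qed
  next
    fix u assume u: "u \<in> ?E"
    show "mat_app (Suc n) A u \<circ> Inl \<in> topspace (Euclidean_space (Suc n1))"
      "mat_app (Suc n) A u \<circ> Inr \<in> topspace (Euclidean_space (Suc n2))"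
      unfolding AA[OF u] case_sum_o using A1(2)[OF aE[OF T1 u]] A2(2)[OF aE[OF T2 u]] .
    fix v assume v: "v \<in> ?E"
    show "flat_ip (sig k1) (Suc n1) (mat_app (Suc n) A u \<circ> Inl) (mat_app (Suc n) A v \<circ> Inl) = a\<^sup>2 * flat_ip (sig k) (Suc n) u v"
      unfolding AA[OF u] AA[OF v] case_sum_o A1(3)[OF aE[OF T1 u] aE[OF T1 v]] form_scale[OF is_form_flat_ip] form_scale2[OF is_form_flat_ip]
        linear_isometryD(3)[OF T1 u v] k(4) by (simp add: power2_eq_square)
    show "flat_ip (sig k2) (Suc n2) (mat_app (Suc n) A u \<circ> Inr) (mat_app (Suc n) A v \<circ> Inr) = b\<^sup>2 * flat_ip (sig k) (Suc n) u v"
      unfolding AA[OF u] AA[OF v] case_sum_o A2(3)[OF aE[OF T2 u] aE[OF T2 v]] form_scale[OF is_form_flat_ip] form_scale2[OF is_form_flat_ip]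
        linear_isometryD(3)[OF T2 u v] k(5) by (simp add: power2_eq_square)
  qed
qed

end

lemma proj2_o [simp]: "proj2 w \<circ> Inl = (\<lambda>_. 0)" "proj2 w \<circ> Inr = w \<circ> Inr"
  by (simp_all add: proj2_def)

lemma proj2_form:
  "form (product_target (Q_space k1 n1) (Q_space k2 n2)) (proj2 u) v = flat_ip (sig k2) (Suc n2) (u \<circ> Inr) (v \<circ> Inr)"
  by (simp add: form_zero[OF is_form_flat_ip])

lemma proj2_tspace:
  "w \<in> tspace (product_target (Q_space k1 n1) (Q_space k2 n2)) z \<Longrightarrow>
    proj2 w \<in> tspace (product_target (Q_space k1 n1) (Q_space k2 n2)) z"
  by (simp add: topspace_Euclidean_space form_zero2[OF is_form_flat_ip])

text \<open>\<open>A\<close> is isometric because \<open>a^2 + b^2 = 1\<close>, and on its image the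
  second projection multiplies scalar products by \<open>b^2\<close>. On tangent vectors this makes
  \<open>R\<close> equal to \<open>b^2\<close> times the identity, and
  \<open>(k1 + k2) b^2 = k1\<close> turns it into \<open>\<Phi> = 0\<close>. On \<open>L\<close> it
  gives the conditions on \<open>S\<close> and \<open>T\<close>.\<close>

lemma factor_imp_parallel_subbundle:
  fixes k1 k2 k b :: real and m l n1 n2 :: nat
  defines "N \<equiv> product_target (Q_space k1 n1) (Q_space k2 n2)" and "Q \<equiv> Q_space k (m + l)"
    and "B \<equiv> flat_ip (sig k) (Suc (m + l))" and "E \<equiv> topspace (Euclidean_space (Suc (m + l)))"
  assumes f: "immersion M N f" and F: "immersion M Q F" and dim: "mdim M = m" and k: "k \<noteq> 0"
    and ab: "a\<^sup>2 + b\<^sup>2 = 1" "(k1 + k2) * b\<^sup>2 = k1"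
    and fac: "\<And>x. x \<in> topspace (mtop M) \<Longrightarrow> \<exists>A W. openin (mtop M) W \<and> x \<in> W \<and>
     (\<forall>y\<in>W. f y = mat_app (Suc (m + l)) A (F y) \<and> L y = mat_app (Suc (m + l)) A ` normal_space M Q F y) \<and>
     (\<forall>u\<in>E. mat_app (Suc (m + l)) A u \<circ> Inl \<in> topspace (Euclidean_space (Suc n1)) \<and>
         mat_app (Suc (m + l)) A u \<circ> Inr \<in> topspace (Euclidean_space (Suc n2))) \<and>
     (\<forall>u\<in>E. \<forall>v\<in>E.
       flat_ip (sig k1) (Suc n1) (mat_app (Suc (m + l)) A u \<circ> Inl) (mat_app (Suc (m + l)) A v \<circ> Inl) = a\<^sup>2 * B u v \<and>
       flat_ip (sig k2) (Suc n2) (mat_app (Suc (m + l)) A u \<circ> Inr) (mat_app (Suc (m + l)) A v \<circ> Inr) = b\<^sup>2 * B u v)"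
  shows "\<forall>x\<in>topspace (mtop M). \<forall>X\<in>tangent_space M x. Phi_tensor k1 k2 M N f x X = (\<lambda>h. 0)"
    and "normal_subbundle M N f l L"
    and "\<forall>x\<in>topspace (mtop M).
            L x \<subseteq> normal_orth M N f x (S_tensor M N f x ` tangent_space M x) \<and>
            first_normal_space M N f x \<subseteq> L x \<and>
            (\<forall>\<xi>\<in>L x. (\<lambda>i. T_tensor M N f x \<xi> i - b\<^sup>2 * \<xi> i) \<in> normal_orth M N f x (L x))"
    and "parallel_subbundle M N f L"
proof -
  interpret S: smooth_atlas M using f by (simp add: immersion_def)
  interpret f: immersion M N f by (rule f)
  interpret F: immersion M Q F by (rule F)
  have fB: "is_form B" unfolding B_def by (rule is_form_flat_ip)
  have fN: "is_form (form N)" by (rule f.B)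
  have formQ: "form Q = B" by (simp add: Q_def B_def)
  let ?n = "m + l"
  let ?A = "mat_app (Suc (m + l))"
  define good where "good x A W \<longleftrightarrow> openin (mtop M) W \<and> x \<in> W \<and>
     (\<forall>y\<in>W. f y = ?A A (F y) \<and> L y = ?A A ` normal_space M Q F y) \<and>
     (\<forall>u\<in>E. ?A A u \<circ> Inl \<in> topspace (Euclidean_space (Suc n1)) \<and> ?A A u \<circ> Inr \<in> topspace (Euclidean_space (Suc n2))) \<and>
     (\<forall>u\<in>E. \<forall>v\<in>E. flat_ip (sig k1) (Suc n1) (?A A u \<circ> Inl) (?A A v \<circ> Inl) = a\<^sup>2 * B u v \<and>
       flat_ip (sig k2) (Suc n2) (?A A u \<circ> Inr) (?A A v \<circ> Inr) = b\<^sup>2 * B u v)" for x A W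
  have ex: "\<exists>A W. good x A W" if "x \<in> topspace (mtop M)" for x
    unfolding good_def using fac[OF that] .
  have goodW: "openin (mtop M) W" "x \<in> W" if "good x A W" for x A W using that by (simp_all add: good_def)
  have goodf: "f y = ?A A (F y)" "L y = ?A A ` normal_space M Q F y" if "good x A W" "y \<in> W" for x A W y
    using that by (simp_all add: good_def)
  have goodE: "?A A u \<circ> Inl \<in> topspace (Euclidean_space (Suc n1))" "?A A u \<circ> Inr \<in> topspace (Euclidean_space (Suc n2))"
    if "good x A W" "u \<in> E" for x A W u using that by (simp_all add: good_def)
  have good1: "flat_ip (sig k1) (Suc n1) (?A A u \<circ> Inl) (?A A v \<circ> Inl) = a\<^sup>2 * B u v"
    and good2: "flat_ip (sig k2) (Suc n2) (?A A u \<circ> Inr) (?A A v \<circ> Inr) = b\<^sup>2 * B u v"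
    if "good x A W" "u \<in> E" "v \<in> E" for x A W u v using that by (simp_all add: good_def)
  have goodB: "form N (?A A u) (?A A v) = B u v" if "good x A W" "u \<in> E" "v \<in> E" for x A W u v
  proof -
    have "form N (?A A u) (?A A v) = (a\<^sup>2 + b\<^sup>2) * B u v"
      using good1[OF that] good2[OF that] by (simp add: N_def algebra_simps)
    then show ?thesis by (simp add: ab)
  qed
  have goodP: "form N (proj2 (?A A u)) (?A A v) = b\<^sup>2 * B u v" if "good x A W" "u \<in> E" "v \<in> E" for x A W u v
    using good2[OF that] unfolding N_def proj2_form .
  have Atop: "W \<subseteq> topspace (mtop M)" if "good x A W" for x A W using openin_subset goodW(1)[OF that] by blast
  have FE: "F y \<in> E" and FF: "B (F y) (F y) = 1 / k" if "y \<in> topspace (mtop M)" for y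
    using F.f_points[OF that] by (simp_all add: Q_def E_def B_def)
  have tE: "v \<in> E" and Ft: "B (F y) v = 0" if "v \<in> tspace Q (F y)" for v y
    using that by (simp_all add: Q_def E_def B_def)
  have nT: "v \<in> tspace Q (F y)" if "v \<in> normal_space M Q F y" for v y using that by (simp add: normal_space_def)
  have df: "dvec X f = ?A A (dvec X F)" if g: "good x A W" and y: "y \<in> W" and X: "X \<in> tangent_space M y" for x A W X y
  proof -
    have "dvec X f = dvec X (\<lambda>z. ?A A (F z))" by (rule S.dvec_cong[OF X goodW(1)[OF g] y goodf(1)[OF g]])
    also have "\<dots> = ?A A (dvec X F)"
      by (rule S.dvec_mat_app[OF goodW(1)[OF g] F.f_smooth_on[OF goodW(1)[OF g]] X y])
    finally show ?thesis .
  qed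
  have imf: "image_tangent M f y = ?A A ` image_tangent M F y" if "good x A W" "y \<in> W" for x A W y
    unfolding image_tangent_def image_image using df[OF that] by (intro image_cong) auto
  have tanT: "?A A v \<in> tspace N (f y)" if g: "good x A W" and y: "y \<in> W" and v: "v \<in> tspace Q (F y)" for x A W y v
  proof -
    have yt: "y \<in> topspace (mtop M)" using y Atop[OF g] by auto
    show ?thesis
      using goodE[OF g tE[OF v]] good1[OF g FE[OF yt] tE[OF v]] good2[OF g FE[OF yt] tE[OF v]] Ft[OF v]
      unfolding N_def goodf(1)[OF g y] by simp
  qed
  have norN: "?A A v \<in> normal_space M N f y" if g: "good x A W" and y: "y \<in> W" and v: "v \<in> normal_space M Q F y" for x A W y v
  proof -
    have "form N (?A A v) w = 0" if w: "w \<in> image_tangent M f y" for w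
    proof -
      obtain t where t: "t \<in> image_tangent M F y" "w = ?A A t" using w[unfolded imf[OF g y]] by blast
      have "t \<in> E" using t(1) F.image_tangent_tspace[of y] Atop[OF g] y tE by blast
      then show ?thesis using v t(1) goodB[OF g tE[OF nT[OF v]], of t] unfolding t(2) normal_space_def formQ by simp
    qed
    then show ?thesis using tanT[OF g y nT[OF v]] by (simp add: normal_space_def)
  qed
  \<comment> \<open>\<open>A\<close> takes tangent vectors, normal vectors and the position vector
    of \<open>F\<close> to tangent vectors of \<open>f\<close>, vectors of \<open>L\<close> and
    \<open>f\<close> itself. So the normal part of every \<open>A w\<close> lies in
    \<open>L\<close>; applied to second derivatives this covers the first normal space, applied to
    sections of \<open>L\<close> it gives parallelism.\<close>
  have key: "orth_proj (form N) (normal_space M N f y) (orth_proj (form N) (tspace N (f y)) (?A A w)) \<in> L y"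
    if g: "good x A W" and y: "y \<in> W" and w: "w \<in> E" for x A W y w
  proof -
    have yt: "y \<in> topspace (mtop M)" using y Atop[OF g] by auto
    define c where "c = k * B w (F y)"
    define v where "v = (\<lambda>i. w i - c * F y i)"
    have "B (F y) v = 0"
      unfolding v_def form_diff2[OF fB] form_scale2[OF fB] FF[OF yt] c_def using k form_sym[OF fB, of w "F y"] by simp
    then have "v \<in> tspace Q (F y)"
      using w FE[OF yt] by (simp add: Q_def E_def B_def v_def topspace_Euclidean_space)
    then obtain t \<nu> where t: "t \<in> image_tangent M F y" and \<nu>: "\<nu> \<in> normal_space M Q F y" and v': "v = (\<lambda>i. t i + \<nu> i)"
      using F.tangent_decomp[OF yt] by blast
    have "w = (\<lambda>i. 1 * (1 * t i + 1 * \<nu> i) + c * F y i)" using v' by (auto simp: v_def fun_eq_iff) (metis add.commute diff_add_cancel)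
    then have Aw: "?A A w i = ?A A t i + ?A A \<nu> i + c * f y i" for i
      unfolding goodf(1)[OF g y] by (simp only: mat_app_lin) simp
    have "orth_proj (form N) (normal_space M N f y) (orth_proj (form N) (tspace N (f y)) (?A A w)) = ?A A \<nu>"
    proof (rule f.normal_tangent_projI[OF yt _ norN[OF g y \<nu>] _ Aw])
      show "?A A t \<in> image_tangent M f y" unfolding imf[OF g y] using t by blast
      show "form N (\<lambda>i. c * f y i) u = 0" if "u \<in> tspace N (f y)" for u
        unfolding form_scale[OF fN] using that by (simp add: N_def)
    qed
    then show ?thesis using \<nu> goodf(2)[OF g y] by simp
  qed
  have dE: "dvec X Z \<in> E" if X: "X \<in> tangent_space M y" and U: "openin (mtop M) U" "y \<in> U" and Z: "\<And>z. z \<in> U \<Longrightarrow> Z z \<in> E" for X y U Z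
  proof -
    have "dvec X Z i = 0" if i: "i \<ge> Suc ?n" for i
    proof -
      have "X (\<lambda>z. Z z i) = X (\<lambda>z. 0)"
        by (rule S.tangent_cong[OF X U]) (use Z i in \<open>simp add: E_def topspace_Euclidean_space\<close>)
      then show ?thesis by (simp add: dvec_app S.tangent_const[OF X])
    qed
    then show ?thesis by (simp add: E_def topspace_Euclidean_space)
  qed
  have Lsub: "subsp (L y)" if y: "y \<in> topspace (mtop M)" for y
  proof -
    obtain A W where g: "good y A W" using ex[OF y] by blast
    note yW = goodW(2)[OF g]
    have ns: "subsp (normal_space M Q F y)" by (rule F.normal_space_subsp[OF y])
    show ?thesis
      unfolding goodf(2)[OF g yW] subsp_def
    proof (intro conjI ballI allI)
      show "(\<lambda>i. 0) \<in> ?A A ` normal_space M Q F y"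
        using subsp_zero[OF ns] by (intro image_eqI[of _ _ "\<lambda>i. 0"]) (auto simp: mat_app_def)
      fix u v c d assume "u \<in> ?A A ` normal_space M Q F y" "v \<in> ?A A ` normal_space M Q F y"
      then obtain u' v' where "u' \<in> normal_space M Q F y" "v' \<in> normal_space M Q F y" "u = ?A A u'" "v = ?A A v'" by blast
      then show "(\<lambda>i. c * u i + d * v i) \<in> ?A A ` normal_space M Q F y"
        using subsp_lin[OF ns] mat_app_lin[of "Suc ?n" A c u' d v', symmetric] by auto
    qed
  qed
  have Ln: "L y \<subseteq> normal_space M N f y" if y: "y \<in> topspace (mtop M)" for y
  proof -
    obtain A W where g: "good y A W" using ex[OF y] by blast
    show ?thesis unfolding goodf(2)[OF g goodW(2)[OF g]] using norN[OF g goodW(2)[OF g]] by blast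
  qed
  have pos_b: "form N (\<lambda>i. b\<^sup>2 * dvec X f i) v = form N (proj2 (dvec X f)) v"
    if X: "X \<in> tangent_space M y" and v: "v \<in> image_tangent M f y" for X y v
  proof -
    have y: "y \<in> topspace (mtop M)" using S.tangent_space_topspace[OF X] .
    obtain A W where g: "good y A W" using ex[OF y] by blast
    note yW = goodW(2)[OF g]
    obtain Y where Y: "Y \<in> tangent_space M y" "v = dvec Y f" using v by (auto simp: image_tangent_def)
    show ?thesis unfolding Y(2) df[OF g yW X] df[OF g yW Y(1)] form_scale[OF fN]
      using goodB[OF g, of "dvec X F" "dvec Y F"] goodP[OF g, of "dvec X F" "dvec Y F"]
        tE[OF F.dvec_tspace[OF X]] tE[OF F.dvec_tspace[OF Y(1)]] by simp
  qed
  have bI: "(\<lambda>i. b\<^sup>2 * dvec X f i) \<in> image_tangent M f y" if X: "X \<in> tangent_space M y" for X y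
    using subsp_scale[OF f.image_tangent_subsp[OF S.tangent_space_topspace[OF X]]] X by (auto simp: image_tangent_def)
  show "\<forall>x\<in>topspace (mtop M). \<forall>X\<in>tangent_space M x. Phi_tensor k1 k2 M N f x X = (\<lambda>h. 0)"
  proof (intro ballI)
    fix x X assume x: "x \<in> topspace (mtop M)" and X: "X \<in> tangent_space M x"
    define Y where "Y = (\<lambda>h. b\<^sup>2 * X h)"
    have Y: "Y \<in> tangent_space M x" using S.tangent_space_lin[OF X X, of "b\<^sup>2" 0] by (simp add: Y_def)
    have dY: "dvec Y f = (\<lambda>i. b\<^sup>2 * dvec X f i)" by (simp add: Y_def dvec_def)
    have pr: "orth_proj (form N) (image_tangent M f x) (proj2 (dvec X f)) = (\<lambda>i. b\<^sup>2 * dvec X f i)"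
      by (rule f.tangent_projI[OF x bI[OF X] pos_b[OF X]])
    have "R_tensor M N f x X = Y"
      unfolding R_tensor_def pr dY[symmetric] using Y f.dvec_inj by (intro the_equality) auto
    then show "Phi_tensor k1 k2 M N f x X = (\<lambda>h. 0)"
      by (simp add: Phi_tensor_def Y_def mult.assoc[symmetric] ab)
  qed
  show "normal_subbundle M N f l L"
    unfolding normal_subbundle_def
  proof (intro conjI ballI)
    fix x assume x: "x \<in> topspace (mtop M)"
    show "L x \<subseteq> normal_space M N f x" by (rule Ln[OF x])
    obtain A W where g: "good x A W" using ex[OF x] by blast
    obtain V e where V: "openin (mtop M) V" "x \<in> V" and e: "\<And>j. j < l \<Longrightarrow> smooth_vec_on M V (e j)"
      and sp: "\<And>y. y \<in> V \<Longrightarrow> normal_space M Q F y = lspan l (\<lambda>j. e j y)"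
      and on: "\<And>y j q. y \<in> V \<Longrightarrow> j < l \<Longrightarrow> q < l \<Longrightarrow> B (e j y) (e q y) = (if j = q then 1 else 0)"
      using normal_frame[OF F[unfolded Q_def] k dim x] unfolding B_def Q_def by blast
    have Asum: "?A A (\<lambda>i. \<Sum>j<l. c j * e j y i) = (\<lambda>i. \<Sum>j<l. c j * ?A A (e j y) i)" for c y
      unfolding mat_app_def sum_distrib_left sum_distrib_right by (subst sum.swap) (simp only: mult.assoc)
    have eE: "e j y \<in> E" if "j < l" "y \<in> V" for j y
      using lspan_base[of j l "\<lambda>j. e j y"] sp[OF that(2)] that(1) nT tE by blast
    show "\<exists>U e. openin (mtop M) U \<and> x \<in> U \<and> (\<forall>j<l. smooth_vec_on M U (e j)) \<and>
        (\<forall>y\<in>U. L y = {(\<lambda>i. \<Sum>j<l. c j * e j y i) | c. True} \<and>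
           (\<forall>c. (\<forall>i. (\<Sum>j<l. c j * e j y i) = 0) \<longrightarrow> (\<forall>j<l. c j = 0)))"
    proof (rule exI[of _ "V \<inter> W"], rule exI[of _ "\<lambda>j y. ?A A (e j y)"], intro conjI allI impI ballI)
      show "openin (mtop M) (V \<inter> W)" "x \<in> V \<inter> W" using V goodW[OF g] by auto
      show "smooth_vec_on M (V \<inter> W) (\<lambda>y. ?A A (e j y))" if "j < l" for j
        using S.smooth_mat_app[OF _ S.smooth_vec_subset[OF e[OF that]], of "V \<inter> W"] V goodW[OF g] by auto
      fix y assume y: "y \<in> V \<inter> W"
      then have yV: "y \<in> V" and yW: "y \<in> W" by auto
      show "L y = {(\<lambda>i. \<Sum>j<l. c j * ?A A (e j y) i) | c. True}"
        unfolding goodf(2)[OF g yW] sp[OF yV] lspan_def Asum[symmetric] by auto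
      fix c j assume c: "\<forall>i. (\<Sum>j<l. c j * ?A A (e j y) i) = 0" and j: "j < l"
      show "c j = 0"
      proof (rule independent_orthonormal[OF fN _ _ j, of "\<lambda>j. ?A A (e j y)"])
        show "form N (?A A (e j y)) (?A A (e q y)) = (if j = q then 1 else 0)" if "j < l" "q < l" for j q
          using goodB[OF g eE[OF that(1) yV] eE[OF that(2) yV]] on[OF yV that] by simp
      qed (use c in simp)
    qed
  qed
  show "\<forall>x\<in>topspace (mtop M).
            L x \<subseteq> normal_orth M N f x (S_tensor M N f x ` tangent_space M x) \<and>
            first_normal_space M N f x \<subseteq> L x \<and>
            (\<forall>\<xi>\<in>L x. (\<lambda>i. T_tensor M N f x \<xi> i - b\<^sup>2 * \<xi> i) \<in> normal_orth M N f x (L x))"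
  proof (intro ballI conjI)
    fix x assume x: "x \<in> topspace (mtop M)"
    obtain A W where g: "good x A W" using ex[OF x] by blast
    note xW = goodW(2)[OF g]
    show "L x \<subseteq> normal_orth M N f x (S_tensor M N f x ` tangent_space M x)"
    proof
      fix \<eta> assume \<eta>: "\<eta> \<in> L x"
      then obtain \<nu> where \<nu>: "\<nu> \<in> normal_space M Q F x" "\<eta> = ?A A \<nu>" using goodf(2)[OF g xW] by blast
      have "form N \<eta> (S_tensor M N f x X) = 0" if X: "X \<in> tangent_space M x" for X
      proof -
        let ?t = "\<lambda>i. b\<^sup>2 * dvec X f i"
        \<comment> \<open>By \<open>pos_b\<close> the tangent part of the second projection of
          \<open>dvec X f\<close> is \<open>b^2\<close> times \<open>dvec X f\<close>, so
          \<open>\<sigma>\<close> is its normal part.\<close>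
        define \<sigma> where "\<sigma> = (\<lambda>i. proj2 (dvec X f) i - ?t i)"
        have "\<sigma> \<in> tspace N (f x)" unfolding \<sigma>_def
          using proj2_tspace f.dvec_tspace[OF X] subsetD[OF f.image_tangent_tspace[OF x] bI[OF X]] unfolding N_def
          by (intro subsp_diff[OF f.tspace_subsp[OF x, unfolded N_def]]) auto
        then have \<sigma>: "\<sigma> \<in> normal_space M N f x"
          unfolding normal_space_def using pos_b[OF X] by (simp add: \<sigma>_def form_diff[OF fN])
        have "proj2 (dvec X f) = (\<lambda>i. ?t i + \<sigma> i)" by (simp add: \<sigma>_def)
        then have S: "S_tensor M N f x X = \<sigma>"
          unfolding S_tensor_def using f.normal_projI[OF x bI[OF X] \<sigma>] by simp
        have XE: "dvec X F \<in> E" by (rule tE[OF F.dvec_tspace[OF X]])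
        have nE: "\<nu> \<in> E" by (rule tE[OF nT[OF \<nu>(1)]])
        have "form N \<sigma> \<eta> = 0"
          unfolding \<sigma>_def form_diff[OF fN] form_scale[OF fN] \<nu>(2) df[OF g xW X] goodB[OF g XE nE] goodP[OF g XE nE] by simp
        then show ?thesis using S form_sym[OF fN, of \<eta>] by simp
      qed
      then show "\<eta> \<in> normal_orth M N f x (S_tensor M N f x ` tangent_space M x)"
        using subsetD[OF Ln[OF x] \<eta>] by (auto simp: normal_orth_def)
    qed
    have sff: "second_ff M N f x X Y \<in> L x"
      if X: "X \<in> tangent_space M x" and U: "openin (mtop M) U" "x \<in> U" and Y: "vector_field_on M U Y" for X U Y
    proof -
      let ?U = "U \<inter> W"
      have U': "openin (mtop M) ?U" "x \<in> ?U" using U goodW[OF g] by auto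
      have YT: "Y z \<in> tangent_space M z" if "z \<in> ?U" for z using Y that by (simp add: vector_field_on_def)
      have "smooth_fun_on M U (\<lambda>z. dvec (Y z) F i)" for i
        using Y U(1) S.smooth_vecD[OF F.f_smooth_on[OF U(1)], of i] unfolding vector_field_on_def dvec_def by blast
      then have sm: "smooth_vec_on M ?U (\<lambda>z. dvec (Y z) F)"
        unfolding smooth_vec_on_def using S.smooth_fun_subset by blast
      have "dvec X (\<lambda>z. dvec (Y z) f) = dvec X (\<lambda>z. ?A A (dvec (Y z) F))"
        by (rule S.dvec_cong[OF X U']) (use df[OF g] YT in auto)
      also have "\<dots> = ?A A (dvec X (\<lambda>z. dvec (Y z) F))" by (rule S.dvec_mat_app[OF U'(1) sm X U'(2)])
      finally have eq: "dvec X (\<lambda>z. dvec (Y z) f) = ?A A (dvec X (\<lambda>z. dvec (Y z) F))" .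
      have "dvec X (\<lambda>z. dvec (Y z) F) \<in> E"
        by (rule dE[OF X U']) (rule tE[OF F.dvec_tspace[OF YT]])
      then show ?thesis unfolding second_ff_def target_conn_def eq by (rule key[OF g xW])
    qed
    show "first_normal_space M N f x \<subseteq> L x"
    proof
      fix v assume "v \<in> first_normal_space M N f x"
      then obtain r :: nat and c w where v: "v = (\<lambda>i. \<Sum>j<r. c j * w j i)"
        and w: "\<forall>j<r. w j \<in> {second_ff M N f x X Y | X U Y. X \<in> tangent_space M x \<and>
          openin (mtop M) U \<and> x \<in> U \<and> vector_field_on M U Y}"
        unfolding first_normal_space_def vec_span_def by blast
      have "w j \<in> L x" if jr: "j < r" for j
      proof -
        obtain X U Y where "w j = second_ff M N f x X Y" and X: "X \<in> tangent_space M x"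
          and U: "openin (mtop M) U" "x \<in> U" and Y: "vector_field_on M U Y"
          using w[rule_format, OF jr] by blast
        then show ?thesis using sff[OF X U Y] by simp
      qed
      then show "v \<in> L x" unfolding v by (intro subsp_sum[OF Lsub[OF x]]) auto
    qed
    fix \<xi> assume \<xi>: "\<xi> \<in> L x"
    have \<xi>N: "\<xi> \<in> normal_space M N f x" using Ln[OF x] \<xi> by blast
    have "proj2 \<xi> \<in> tspace N (f x)" using proj2_tspace \<xi>N unfolding N_def normal_space_def by blast
    then obtain t \<nu> where t: "t \<in> image_tangent M f x" "\<nu> \<in> normal_space M N f x" "proj2 \<xi> = (\<lambda>i. t i + \<nu> i)"
      using f.tangent_decomp[OF x] by blast
    have T: "T_tensor M N f x \<xi> = \<nu>" unfolding T_tensor_def t(3) by (rule f.normal_projI[OF x t(1,2)])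
    have "form N (\<lambda>i. \<nu> i - b\<^sup>2 * \<xi> i) \<eta> = 0" if \<eta>: "\<eta> \<in> L x" for \<eta>
    proof -
      obtain u v where u: "u \<in> normal_space M Q F x" "\<xi> = ?A A u" and v: "v \<in> normal_space M Q F x" "\<eta> = ?A A v"
        using \<xi> \<eta> goodf(2)[OF g xW] by blast
      have uv: "u \<in> E" "v \<in> E" using tE[OF nT] u(1) v(1) by auto
      have "form N t \<eta> = 0" using subsetD[OF Ln[OF x] \<eta>] t(1) form_sym[OF fN, of t \<eta>] by (simp add: normal_space_def)
      then have "form N \<nu> \<eta> = form N (proj2 \<xi>) \<eta>" unfolding t(3) form_add[OF fN] by simp
      then show ?thesis unfolding form_diff[OF fN] form_scale[OF fN] u(2) v(2) goodB[OF g uv] goodP[OF g uv] by simp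
    qed
    moreover have "(\<lambda>i. \<nu> i - b\<^sup>2 * \<xi> i) \<in> normal_space M N f x"
      by (intro subsp_diff subsp_scale f.normal_space_subsp[OF x] t(2) \<xi>N)
    ultimately show "(\<lambda>i. T_tensor M N f x \<xi> i - b\<^sup>2 * \<xi> i) \<in> normal_orth M N f x (L x)"
      unfolding T normal_orth_def by blast
  qed
  show "parallel_subbundle M N f L"
    unfolding parallel_subbundle_def
  proof (intro allI impI ballI)
    fix U \<xi> x X
    assume "openin (mtop M) U \<and> smooth_vec_on M U \<xi> \<and> (\<forall>y\<in>U. \<xi> y \<in> L y)" and xU: "x \<in> U" and X: "X \<in> tangent_space M x"
    then have U: "openin (mtop M) U" and \<xi>: "smooth_vec_on M U \<xi>" and \<xi>L: "\<And>y. y \<in> U \<Longrightarrow> \<xi> y \<in> L y" by auto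
    have x: "x \<in> topspace (mtop M)" using S.tangent_space_topspace[OF X] .
    obtain A W where g: "good x A W" using ex[OF x] by blast
    note xW = goodW(2)[OF g]
    let ?U = "U \<inter> W"
    have U': "openin (mtop M) ?U" "x \<in> ?U" using U xU goodW[OF g] by auto
    define \<delta> where "\<delta> s = (\<lambda>i. if i = s then 1 else 0 :: real)" for s :: nat
    have \<delta>E: "\<delta> s \<in> E" if "s < Suc ?n" for s using that by (simp add: \<delta>_def E_def topspace_Euclidean_space)
    have B\<delta>: "B u (\<delta> s) = fsgn k s * u s" if "s < Suc ?n" for u s
      unfolding B_def flat_ip_fsgn \<delta>_def using that
      by (simp add: if_distrib[of "\<lambda>z. _ * z"] cong: if_cong del: sum.lessThan_Suc)
    \<comment> \<open>A left inverse of \<open>A\<close>, written with scalar products against the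
      images of the basis vectors. It shows that the preimage of a smooth section of
      \<open>L\<close> is smooth.\<close>
    define Ad where "Ad w = (\<lambda>i. if i < Suc ?n then fsgn k i * form N w (?A A (\<delta> i)) else 0)" for w
    have Ad: "Ad (?A A u) = u" if "u \<in> E" for u
    proof
      fix i show "Ad (?A A u) i = u i"
        using goodB[OF g that \<delta>E] B\<delta> that by (simp add: Ad_def mult.assoc[symmetric] E_def topspace_Euclidean_space)
    qed
    have AdE: "Ad w \<in> E" for w by (simp add: Ad_def E_def topspace_Euclidean_space)
    have eq: "\<xi> y = ?A A (Ad (\<xi> y))" if y: "y \<in> ?U" for y
    proof -
      obtain u where "u \<in> normal_space M Q F y" "\<xi> y = ?A A u" using \<xi>L goodf(2)[OF g] y by blast
      then show ?thesis using Ad[OF tE[OF nT]] by simp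
    qed
    have cs: "smooth_vec_on M ?U (\<lambda>y. z)" for z :: "nat + nat \<Rightarrow> real"
      unfolding smooth_vec_on_def by (intro allI S.smooth_const U')
    have "smooth_fun_on M ?U (\<lambda>y. Ad (\<xi> y) i)" for i
    proof (cases "i < Suc ?n")
      case True
      then show ?thesis unfolding Ad_def
        using S.smooth_mult[OF U'(1) S.smooth_const[OF U'(1)] S.smooth_form[OF fN U'(1) S.smooth_vec_subset[OF \<xi>, of ?U] cs]] by auto
    next
      case False
      then show ?thesis unfolding Ad_def using S.smooth_const[OF U'(1)] by auto
    qed
    then have sm: "smooth_vec_on M ?U (\<lambda>y. Ad (\<xi> y))" by (simp add: smooth_vec_on_def)
    have "dvec X \<xi> = dvec X (\<lambda>y. ?A A (Ad (\<xi> y)))" by (rule S.dvec_cong[OF X U' eq])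
    also have "\<dots> = ?A A (dvec X (\<lambda>y. Ad (\<xi> y)))" by (rule S.dvec_mat_app[OF U'(1) sm X U'(2)])
    finally have "dvec X \<xi> = ?A A (dvec X (\<lambda>y. Ad (\<xi> y)))" .
    moreover have "dvec X (\<lambda>y. Ad (\<xi> y)) \<in> E" by (rule dE[OF X U' AdE])
    ultimately show "normal_conn M N f x X \<xi> \<in> L x"
      unfolding normal_conn_def target_conn_def using key[OF g xW] by simp
  qed
qed

section \<open>Immersions into products of space forms\<close>

lemma dvec_mat_app_Q:
  assumes \<kappa>: "\<kappa> \<noteq> 0" and X: "X \<in> tangent_space (Q_manifold \<kappa> n) p"
  shows "dvec X (mat_app N A) = mat_app N A (dvec X (\<lambda>z. z))"
proof -
  interpret smooth_atlas "Q_manifold \<kappa> n" by (rule smooth_atlas_Q[OF \<kappa>])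
  have "dvec X (\<lambda>y. mat_app N A y) = mat_app N A (dvec X (\<lambda>z. z))"
    by (rule dvec_mat_app[OF openin_topspace Q_id_smooth[OF \<kappa>] X tangent_space_topspace[OF X]])
  then show ?thesis by simp
qed

text \<open>The flat second derivative of \<open>J\<close> is \<open>J w\<close>, with
  \<open>w\<close> that of the inclusion. Here \<open>w\<close> is a tangent vector plus a multiple
  of \<open>p\<close>; the former goes to a tangent vector of \<open>J\<close>, the latter to a
  multiple of \<open>J p\<close>, orthogonal to the target by \<open>pos\<close>. No normal part
  remains.\<close>

lemma linear_totally_geodesic:
  fixes A :: "nat \<Rightarrow> 'i \<Rightarrow> real" and n :: nat
  defines "J \<equiv> mat_app (Suc n) A"
  assumes \<kappa>: "\<kappa> \<noteq> 0" and fN: "is_form (form N)" and pts: "\<And>p. p \<in> points (Q_space \<kappa> n) \<Longrightarrow> J p \<in> points N"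
    and iso: "\<And>u v. u \<in> topspace (Euclidean_space (Suc n)) \<Longrightarrow> v \<in> topspace (Euclidean_space (Suc n)) \<Longrightarrow>
        form N (J u) (J v) = flat_ip (sig \<kappa>) (Suc n) u v"
    and pos: "\<And>p v. p \<in> points (Q_space \<kappa> n) \<Longrightarrow> v \<in> tspace N (J p) \<Longrightarrow> form N (J p) v = 0"
    and imm: "isometric_immersion (Q_manifold \<kappa> n) N J \<Longrightarrow> immersion (Q_manifold \<kappa> n) N J"
  shows "totally_geodesic_embedding (Q_manifold \<kappa> n) N J"
proof -
  let ?M = "Q_manifold \<kappa> n" and ?E = "topspace (Euclidean_space (Suc n))" and ?B = "flat_ip (sig \<kappa>) (Suc n)"
  note fB = is_form_flat_ip[of "sig \<kappa>" "Suc n"]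
  interpret S: smooth_atlas ?M by (rule smooth_atlas_Q[OF \<kappa>])
  have sJ: "smooth_vec_on ?M (topspace (mtop ?M)) J"
    unfolding J_def using S.smooth_mat_app[OF openin_topspace Q_id_smooth[OF \<kappa>], of "Suc n" A] by simp
  have dJ: "dvec X J = J (dvec X (\<lambda>z. z))" if "X \<in> tangent_space ?M p" for X p
    unfolding J_def by (rule dvec_mat_app_Q[OF \<kappa> that])
  have tE: "v \<in> ?E" if "v \<in> tspace (Q_space \<kappa> n) p" for v p using that by simp
  have pE: "p \<in> ?E" if "p \<in> points (Q_space \<kappa> n)" for p using that by simp
  have top: "topspace (mtop ?M) = points (Q_space \<kappa> n)" by (rule topspace_Q[OF \<kappa>])
  have ii: "isometric_immersion ?M N J"
    unfolding isometric_immersion_def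
  proof (intro conjI ballI)
    show "J ` topspace (mtop ?M) \<subseteq> points N" unfolding top using pts by blast
    fix p X Y assume X: "X \<in> tangent_space ?M p" and Y: "Y \<in> tangent_space ?M p"
    show "form N (dvec X J) (dvec Y J) = metric ?M p X Y"
      unfolding dJ[OF X] dJ[OF Y] Q_manifold_simps(3)[OF \<kappa>]
      by (rule iso[OF tE[OF Q_dvec_id_tspace[OF \<kappa> X]] tE[OF Q_dvec_id_tspace[OF \<kappa> Y]]])
  qed (rule sJ)
  interpret J: immersion ?M N J by (rule imm[OF ii])
  define \<delta> where "\<delta> s = (\<lambda>i. if i = s then 1 else 0 :: real)" for s :: nat
  have \<delta>E: "\<delta> s \<in> ?E" if "s < Suc n" for s using that by (simp add: \<delta>_def topspace_Euclidean_space)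
  have B\<delta>: "?B u (\<delta> s) = fsgn \<kappa> s * u s" if "s < Suc n" for u s
    unfolding flat_ip_fsgn \<delta>_def using that
    by (simp add: if_distrib[of "\<lambda>z. _ * z"] cong: if_cong del: sum.lessThan_Suc)
  \<comment> \<open>A continuous left inverse of \<open>J\<close>: coordinates are recovered, up to
    sign, as scalar products with the images of the basis vectors.\<close>
  define G where "G w = (\<lambda>i. if i < Suc n then fsgn \<kappa> i * form N w (J (\<delta> i)) else 0)" for w
  have GJ: "G (J u) = u" if u: "u \<in> ?E" for u
  proof
    fix i show "G (J u) i = u i"
      using iso[OF u \<delta>E] B\<delta> u by (simp add: G_def mult.assoc[symmetric] topspace_Euclidean_space)
  qed
  have "embedding_map (mtop ?M) (powertop_real UNIV) J"
    unfolding embedding_map_def homeomorphic_map_maps homeomorphic_maps_def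
  proof (intro exI[of _ G] conjI ballI)
    show "continuous_map (mtop ?M) (subtopology (powertop_real UNIV) (J ` topspace (mtop ?M))) J"
      unfolding continuous_map_in_subtopology continuous_map_componentwise_UNIV
      using S.continuous_map_smooth S.smooth_vecD[OF sJ] by auto
    have "continuous_map (powertop_real UNIV) euclideanreal (\<lambda>w. form N w z)" for z
    proof -
      obtain \<sigma> I where I: "finite I" "form N = (\<lambda>w z. \<Sum>i\<in>I. \<sigma> i * w i * z i)" by (rule is_formE[OF fN])
      show ?thesis unfolding I(2)
        by (intro continuous_map_sum continuous_map_real_mult continuous_map_product_projection I(1)) auto
    qed
    then have "continuous_map (powertop_real UNIV) euclideanreal (\<lambda>w. fsgn \<kappa> i * form N w (J (\<delta> i)))" for i
      by (intro continuous_map_real_mult) auto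
    then have "continuous_map (powertop_real UNIV) (Euclidean_space (Suc n)) G"
      unfolding G_def continuous_map_componentwise_Euclidean_space by blast
    then have "continuous_map (subtopology (powertop_real UNIV) (J ` topspace (mtop ?M))) (Euclidean_space (Suc n)) G"
      by (rule continuous_map_from_subtopology)
    moreover have "G ` (J ` topspace (mtop ?M)) \<subseteq> points (Q_space \<kappa> n)"
      unfolding top using GJ pE by auto
    ultimately show "continuous_map (subtopology (powertop_real UNIV) (J ` topspace (mtop ?M))) (mtop ?M) G"
      unfolding Q_manifold_simps(1)[OF \<kappa>] continuous_map_in_subtopology by (auto simp del: Q_space_simps)
    show "G (J x) = x" if "x \<in> topspace (mtop ?M)" for x using GJ[OF pE] that unfolding top by blast
    show "J (G y) = y" if "y \<in> topspace (subtopology (powertop_real UNIV) (J ` topspace (mtop ?M)))" for y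
      using that GJ pE unfolding top by (auto simp del: Q_space_simps)
  qed
  moreover have "second_ff ?M N J p X Y = (\<lambda>i. 0)"
    if U: "openin (mtop ?M) U" "p \<in> U" and Y: "vector_field_on ?M U Y" and X: "X \<in> tangent_space ?M p" for U Y p X
  proof -
    have pt: "p \<in> topspace (mtop ?M)" using S.tangent_space_topspace[OF X] .
    have pp: "p \<in> points (Q_space \<kappa> n)" using pt unfolding top .
    have YT: "Y y \<in> tangent_space ?M y" if "y \<in> U" for y using Y that by (simp add: vector_field_on_def)
    define w where "w = dvec X (\<lambda>y. dvec (Y y) (\<lambda>z. z))"
    have "smooth_fun_on ?M U (\<lambda>y. dvec (Y y) (\<lambda>z. z) i)" for i
      using Y U(1) S.smooth_vecD[OF S.smooth_vec_subset[OF Q_id_smooth[OF \<kappa>] openin_subset[OF U(1)]], of i]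
      unfolding vector_field_on_def dvec_def by blast
    then have sm: "smooth_vec_on ?M U (\<lambda>y. dvec (Y y) (\<lambda>z. z))" by (simp add: smooth_vec_on_def)
    have "dvec X (\<lambda>y. dvec (Y y) J) = dvec X (\<lambda>y. mat_app (Suc n) A (dvec (Y y) (\<lambda>z. z)))"
      by (rule S.dvec_cong[OF X U]) (use dJ[OF YT] in \<open>simp add: J_def\<close>)
    also have "\<dots> = J w" unfolding w_def J_def by (rule S.dvec_mat_app[OF U(1) sm X U(2)])
    finally have eq: "dvec X (\<lambda>y. dvec (Y y) J) = J w" .
    have wE: "w \<in> ?E"
    proof -
      have "w i = 0" if i: "i \<ge> Suc n" for i
      proof -
        have "X (\<lambda>y. dvec (Y y) (\<lambda>z. z) i) = X (\<lambda>y. 0)"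
          by (rule S.tangent_cong[OF X U]) (use tE[OF Q_dvec_id_tspace[OF \<kappa> YT]] i in \<open>simp add: topspace_Euclidean_space\<close>)
        then show ?thesis by (simp add: w_def dvec_app S.tangent_const[OF X])
      qed
      then show ?thesis by (simp add: topspace_Euclidean_space)
    qed
    define c where "c = \<kappa> * ?B w p"
    define v where "v = (\<lambda>i. w i - c * p i)"
    have "?B p v = 0"
      unfolding v_def form_diff2[OF fB] form_scale2[OF fB] c_def using pp \<kappa> form_sym[OF fB, of w p] by simp
    then have "v \<in> tspace (Q_space \<kappa> n) p" using wE pE[OF pp] by (simp add: v_def topspace_Euclidean_space)
    then obtain Z where Z: "Z \<in> tangent_space ?M p" "dvec Z (\<lambda>z. z) = v" using Q_tangent_exists[OF \<kappa> pp] by blast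
    have Jv: "J v \<in> image_tangent ?M J p" unfolding image_tangent_def using dJ[OF Z(1)] Z by force
    have "w = (\<lambda>i. 1 * v i + c * p i)" by (simp add: v_def)
    then have Jw: "J w i = J v i + 0 + c * J p i" for i
      using mat_app_lin[of "Suc n" A 1 v c p] unfolding J_def by simp
    show ?thesis unfolding second_ff_def target_conn_def eq
    proof (rule J.normal_tangent_projI[OF pt Jv _ _ Jw])
      show "(\<lambda>i. 0) \<in> normal_space ?M N J p" by (rule subsp_zero[OF J.normal_space_subsp[OF pt]])
      show "form N (\<lambda>i. c * J p i) u = 0" if "u \<in> tspace N (J p)" for u
        using pos[OF pp that] by (simp add: form_scale[OF fN])
    qed
  qed
  ultimately show ?thesis using ii unfolding totally_geodesic_embedding_def by blast
qed

section \<open>Scalar products and derivatives in a product of space forms\<close>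

lemma is_form_scale: "is_form B \<Longrightarrow> is_form (\<lambda>u v. c * B u v)"
proof -
  assume "is_form B"
  then obtain \<sigma> I where I: "finite I" "B = (\<lambda>w z. \<Sum>i\<in>I. \<sigma> i * w i * z i)" by (rule is_formE)
  show ?thesis unfolding is_form_def I(2)
    by (intro exI[of _ "\<lambda>i. c * \<sigma> i"] exI[of _ I]) (simp add: I(1) sum_distrib_left mult.assoc)
qed

lemma vec_span_base: "v \<in> V \<Longrightarrow> v \<in> vec_span V"
  unfolding vec_span_def
  by (rule CollectI, rule exI[of _ 1], rule exI[of _ "\<lambda>j. 1"], rule exI[of _ "\<lambda>j. v"]) auto

lemma mat_app_isometry:
  assumes B: "is_form B" and on: "\<And>i j. i < N \<Longrightarrow> j < N \<Longrightarrow> B (v i) (v j) = (if i = j then c * fsgn k i else 0)"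
  shows "B (mat_app N v u) (mat_app N v w) = c * flat_ip (sig k) N u w"
proof -
  have "B (mat_app N v u) (mat_app N v w) = (\<Sum>i<N. u i * (\<Sum>j<N. w j * B (v i) (v j)))"
    unfolding mat_app_def form_sum[OF B] form_sum2[OF B] ..
  also have "\<dots> = (\<Sum>i<N. c * (fsgn k i * u i * w i))"
  proof (intro sum.cong refl)
    fix i assume i: "i \<in> {..<N}"
    have "(\<Sum>j<N. w j * B (v i) (v j)) = (\<Sum>j<N. if j = i then w j * (c * fsgn k i) else 0)"
      using on i by (intro sum.cong) auto
    then show "u i * (\<Sum>j<N. w j * B (v i) (v j)) = c * (fsgn k i * u i * w i)" using i by simp
  qed
  finally show ?thesis by (simp add: flat_ip_fsgn sum_distrib_left)
qed

locale product_immersion = immersion M N f for M :: "'a rmanifold" and N :: "(nat + nat) target" and f +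
  fixes k1 k2 :: real and n1 n2 :: nat
  assumes N: "N = product_target (Q_space k1 n1) (Q_space k2 n2)" and k1: "k1 \<noteq> 0" and k2: "k2 \<noteq> 0"
begin

abbreviation "B1 u v \<equiv> flat_ip (sig k1) (Suc n1) (u \<circ> Inl) (v \<circ> Inl)"
abbreviation "B2 u v \<equiv> flat_ip (sig k2) (Suc n2) (u \<circ> Inr) (v \<circ> Inr)"

lemma form_N: "form N u v = B1 u v + B2 u v"
  by (simp add: N)

lemma form_proj2: "form N (proj2 u) v = B2 u v"
  unfolding N by (rule proj2_form)

lemma proj2_in_tspace: "w \<in> tspace N z \<Longrightarrow> proj2 w \<in> tspace N z"
  unfolding N by (rule proj2_tspace)

lemma tspaceD: "v \<in> tspace N z \<Longrightarrow> B1 z v = 0 \<and> B2 z v = 0"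
  by (simp add: N)

lemma B_nonneg:
  assumes "x \<in> topspace (mtop M)" "v \<in> tspace N (f x)" shows "B1 v v \<ge> 0" "B2 v v \<ge> 0"
proof -
  have p: "f x \<circ> Inl \<in> points (Q_space k1 n1)" "f x \<circ> Inr \<in> points (Q_space k2 n2)"
    using f_points[OF assms(1)] by (simp_all add: N)
  have t: "v \<circ> Inl \<in> tspace (Q_space k1 n1) (f x \<circ> Inl)" "v \<circ> Inr \<in> tspace (Q_space k2 n2) (f x \<circ> Inr)"
    using assms(2) by (simp_all add: N)
  have nn: "flat_ip s n w w \<ge> 0" if "posdef (flat_ip s n) V" "w \<in> V" for s n V w
    using that form_zero[OF is_form_flat_ip] unfolding posdef_def by (cases "w = (\<lambda>i. 0)") (auto simp: less_imp_le)
  show "B1 v v \<ge> 0" "B2 v v \<ge> 0"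
    by (rule nn[OF Q_space_posdef[OF p(1)] t(1)], rule nn[OF Q_space_posdef[OF p(2)] t(2)])
qed

lemma f_square: "x \<in> topspace (mtop M) \<Longrightarrow> B1 (f x) (f x) = 1 / k1 \<and> B2 (f x) (f x) = 1 / k2"
  using f_points[of x] by (simp add: N)

text \<open>In the passage from (ii) to (i) the tensors \<open>R\<close>, \<open>S\<close> and
  \<open>T\<close> enter through the scalar products in this and the next two lemmas, which evaluate
  their definite descriptions.\<close>

lemma R_tensor_form:
  assumes X: "X \<in> tangent_space M x" and Y: "Y \<in> tangent_space M x"
  shows "form N (dvec (R_tensor M N f x X) f) (dvec Y f) = B2 (dvec X f) (dvec Y f)"
proof -
  have x: "x \<in> topspace (mtop M)" using tangent_space_topspace[OF X] .
  obtain t \<nu> where t: "t \<in> image_tangent M f x" "\<And>u. u \<in> image_tangent M f x \<Longrightarrow> form N t u = form N (proj2 (dvec X f)) u"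
    using tangent_decomp[OF x proj2_in_tspace[OF dvec_tspace[OF X]]] by blast
  have pr: "orth_proj (form N) (image_tangent M f x) (proj2 (dvec X f)) = t" by (rule tangent_projI[OF x t])
  obtain Z where Z: "Z \<in> tangent_space M x" "t = dvec Z f" using t(1) by (auto simp: image_tangent_def)
  have "R_tensor M N f x X = Z"
    unfolding R_tensor_def pr Z(2) using Z(1) dvec_inj by (intro the_equality) auto
  then show ?thesis using t(2)[of "dvec Y f"] Y unfolding Z(2) form_proj2 by (simp add: image_tangent_def)
qed

lemma S_tensor_orth:
  assumes X: "X \<in> tangent_space M x" and \<xi>: "\<xi> \<in> normal_orth M N f x (S_tensor M N f x ` tangent_space M x)"
  shows "B2 (dvec X f) \<xi> = 0"
proof -
  have x: "x \<in> topspace (mtop M)" using tangent_space_topspace[OF X] .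
  obtain t \<nu> where t: "t \<in> image_tangent M f x" "\<nu> \<in> normal_space M N f x" "proj2 (dvec X f) = (\<lambda>i. t i + \<nu> i)"
    using tangent_decomp[OF x proj2_in_tspace[OF dvec_tspace[OF X]]] by blast
  have "S_tensor M N f x X = \<nu>" unfolding S_tensor_def t(3) by (rule normal_projI[OF x t(1,2)])
  then have "form N \<xi> \<nu> = 0" using \<xi> X by (auto simp: normal_orth_def)
  moreover have "form N \<xi> t = 0" using \<xi> t(1) by (auto simp: normal_orth_def normal_space_def)
  ultimately have "form N (proj2 (dvec X f)) \<xi> = 0"
    unfolding t(3) form_add[OF B] using form_sym[OF B, of \<xi>] by simp
  then show ?thesis unfolding form_proj2 .
qed

lemma T_tensor_form:
  assumes x: "x \<in> topspace (mtop M)" and \<xi>: "\<xi> \<in> normal_space M N f x" and \<eta>: "\<eta> \<in> normal_space M N f x"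
  shows "form N (T_tensor M N f x \<xi>) \<eta> = B2 \<xi> \<eta>"
proof -
  have "proj2 \<xi> \<in> tspace N (f x)" using proj2_in_tspace \<xi> by (simp add: normal_space_def)
  then obtain t \<nu> where t: "t \<in> image_tangent M f x" "\<nu> \<in> normal_space M N f x" "proj2 \<xi> = (\<lambda>i. t i + \<nu> i)"
    using tangent_decomp[OF x] by blast
  have "T_tensor M N f x \<xi> = \<nu>" unfolding T_tensor_def t(3) by (rule normal_projI[OF x t(1,2)])
  moreover have "form N t \<eta> = 0" using \<eta> t(1) form_sym[OF B, of t \<eta>] by (simp add: normal_space_def)
  ultimately have "form N (T_tensor M N f x \<xi>) \<eta> = form N (proj2 \<xi>) \<eta>" unfolding t(3) form_add[OF B] by simp
  then show ?thesis unfolding form_proj2 .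
qed

text \<open>In flat space the product has two normal directions, the position vectors of the two
  factors. Differentiating the orthogonality of \<open>f\<close> and \<open>Z\<close> in each factor
  separately gives their coefficients, each with its own curvature.\<close>

lemma derivative_decomp:
  assumes U: "openin (mtop M) U" "x \<in> U" and Z: "smooth_vec_on M U Z" "\<And>y. y \<in> U \<Longrightarrow> Z y \<in> tspace N (f y)"
    and X: "X \<in> tangent_space M x"
  obtains t where "t \<in> image_tangent M f x"
    "\<And>i. dvec X Z i = t i + orth_proj (form N) (normal_space M N f x) (target_conn N f x X Z) i +
       case_sum (\<lambda>j. - k1 * B1 (dvec X f) (Z x) * f x (Inl j)) (\<lambda>j. - k2 * B2 (dvec X f) (Z x) * f x (Inr j)) i"
proof -
  have x: "x \<in> topspace (mtop M)" using tangent_space_topspace[OF X] .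
  note f1 = is_form_flat_ip[of "sig k1" "Suc n1"] and f2 = is_form_flat_ip[of "sig k2" "Suc n2"]
  let ?w = "dvec X Z"
  define c1 where "c1 = - k1 * B1 (dvec X f) (Z x)"
  define c2 where "c2 = - k2 * B2 (dvec X f) (Z x)"
  define p where "p = case_sum (\<lambda>j. c1 * f x (Inl j)) (\<lambda>j. c2 * f x (Inr j))"
  have sf: "smooth_vec_on M U f" by (rule f_smooth_on[OF U(1)])
  have "X (\<lambda>y. B1 (f y) (Z y)) = X (\<lambda>y. 0)" "X (\<lambda>y. B2 (f y) (Z y)) = X (\<lambda>y. 0)"
    by (rule tangent_cong[OF X U], use tspaceD[OF Z(2)] in blast)+
  then have d: "B1 (dvec X f) (Z x) + B1 (f x) ?w = 0" "B2 (dvec X f) (Z x) + B2 (f x) ?w = 0"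
    using tangent_form[OF f1 U(1) smooth_vec_o[OF sf] smooth_vec_o[OF Z(1)] X U(2), of Inl Inl]
      tangent_form[OF f2 U(1) smooth_vec_o[OF sf] smooth_vec_o[OF Z(1)] X U(2), of Inr Inr]
    by (simp_all add: tangent_const[OF X] dvec_o[symmetric])
  define v where "v = (\<lambda>i. ?w i - p i)"
  have v1: "v \<circ> Inl = (\<lambda>j. (?w \<circ> Inl) j - c1 * (f x \<circ> Inl) j)" and v2: "v \<circ> Inr = (\<lambda>j. (?w \<circ> Inr) j - c2 * (f x \<circ> Inr) j)"
    by (auto simp: v_def p_def fun_eq_iff)
  have fE: "f y \<circ> Inl \<in> topspace (Euclidean_space (Suc n1))" "f y \<circ> Inr \<in> topspace (Euclidean_space (Suc n2))"
    if "y \<in> topspace (mtop M)" for y using f_points[OF that] by (simp_all add: N)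
  have wE: "?w \<circ> Inl \<in> topspace (Euclidean_space (Suc n1))" "?w \<circ> Inr \<in> topspace (Euclidean_space (Suc n2))"
  proof -
    have ZE: "Z y \<circ> Inl \<in> topspace (Euclidean_space (Suc n1))" "Z y \<circ> Inr \<in> topspace (Euclidean_space (Suc n2))"
      if "y \<in> U" for y using Z(2)[OF that] by (simp_all add: N)
    have "?w (Inl j) = 0" if j: "j \<ge> Suc n1" for j
    proof -
      have "X (\<lambda>y. Z y (Inl j)) = X (\<lambda>y. 0)"
        by (rule tangent_cong[OF X U]) (use ZE(1) j in \<open>auto simp: topspace_Euclidean_space\<close>)
      then show ?thesis by (simp add: dvec_app tangent_const[OF X])
    qed
    moreover have "?w (Inr j) = 0" if j: "j \<ge> Suc n2" for j
    proof -
      have "X (\<lambda>y. Z y (Inr j)) = X (\<lambda>y. 0)"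
        by (rule tangent_cong[OF X U]) (use ZE(2) j in \<open>auto simp: topspace_Euclidean_space\<close>)
      then show ?thesis by (simp add: dvec_app tangent_const[OF X])
    qed
    ultimately show "?w \<circ> Inl \<in> topspace (Euclidean_space (Suc n1))" "?w \<circ> Inr \<in> topspace (Euclidean_space (Suc n2))"
      by (simp_all add: topspace_Euclidean_space)
  qed
  have "B1 (f x) v = 0" unfolding v1 form_diff2[OF f1] form_scale2[OF f1]
    using f_square[OF x] d(1) k1 by (simp add: c1_def del: o_apply)
  moreover have "B2 (f x) v = 0" unfolding v2 form_diff2[OF f2] form_scale2[OF f2]
    using f_square[OF x] d(2) k2 by (simp add: c2_def del: o_apply)
  moreover have "v \<circ> Inl \<in> topspace (Euclidean_space (Suc n1))" "v \<circ> Inr \<in> topspace (Euclidean_space (Suc n2))"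
    unfolding v1 v2 using wE fE[OF x] by (simp_all add: topspace_Euclidean_space)
  ultimately have "v \<in> tspace N (f x)" by (simp add: N)
  then obtain t \<nu> where t: "t \<in> image_tangent M f x" "\<nu> \<in> normal_space M N f x" "v = (\<lambda>i. t i + \<nu> i)"
    using tangent_decomp[OF x] by blast
  have w: "?w i = t i + \<nu> i + p i" for i using fun_cong[OF t(3), of i] by (simp add: v_def)
  have "form N p u = 0" if "u \<in> tspace N (f x)" for u
  proof -
    have p12: "p \<circ> Inl = (\<lambda>j. c1 * (f x \<circ> Inl) j)" "p \<circ> Inr = (\<lambda>j. c2 * (f x \<circ> Inr) j)" by (auto simp: p_def)
    show ?thesis unfolding form_N p12 form_scale[OF f1] form_scale[OF f2] using tspaceD[OF that] by (simp del: o_apply)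
  qed
  from normal_tangent_projI[OF x t(1,2) this w]
  have "orth_proj (form N) (normal_space M N f x) (target_conn N f x X Z) = \<nu>" by (simp add: target_conn_def)
  then show thesis using that[OF t(1)] w unfolding p_def c1_def c2_def by simp
qed

end

section \<open>From a parallel subbundle to a factorization\<close>

context product_immersion
begin

text \<open>This form vanishes on a subspace exactly where the second projection scales the flat scalar product by \<open>r\<close>
  and the first one by \<open>1 - r\<close>.\<close>

definition "defect r u v = (- r) * B1 u v + (1 - r) * B2 u v"

lemma is_form_defect: "is_form (defect r)"
  unfolding defect_def[abs_def]
  by (rule is_form_sum[of "\<lambda>u v. (- r) * flat_ip (sig k1) (Suc n1) u v" "\<lambda>u v. (1 - r) * flat_ip (sig k2) (Suc n2) u v"])
    (rule is_form_scale is_form_flat_ip)+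

lemma defect_zero: "defect r u v = 0 \<Longrightarrow> B2 u v = r * form N u v" "defect r u v = 0 \<Longrightarrow> B1 u v = (1 - r) * form N u v"
  and defect_zeroI: "B2 u v = r * form N u v \<Longrightarrow> defect r u v = 0"
  unfolding form_N defect_def by (simp_all add: algebra_simps)

text \<open>\<open>\<Phi> = 0\<close> makes \<open>R\<close> equal to \<open>k1 / (k1 + k2)\<close>
  times the identity. On a nonzero tangent vector both factors contribute nonnegatively, so this
  ratio and \<open>k2 / (k1 + k2)\<close> are nonnegative; they are nonzero, hence positive. If
  \<open>k1 + k2\<close> were 0, then \<open>k1 X = 0\<close> for a nonzero \<open>X\<close>, which
  exists as \<open>mdim M \<ge> 1\<close>.\<close>

lemma Phi_zero_imp:
  assumes Phi: "\<forall>x\<in>topspace (mtop M). \<forall>X\<in>tangent_space M x. Phi_tensor k1 k2 M N f x X = (\<lambda>h. 0)"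
    and m: "mdim M \<ge> 1" and ne: "topspace (mtop M) \<noteq> {}"
  shows "k1 / (k1 + k2) > 0" "k2 / (k1 + k2) > 0"
    "\<And>x X Y. X \<in> tangent_space M x \<Longrightarrow> Y \<in> tangent_space M x \<Longrightarrow>
       B2 (dvec X f) (dvec Y f) = k1 / (k1 + k2) * form N (dvec X f) (dvec Y f)"
proof -
  have R: "k1 * X h = (k1 + k2) * R_tensor M N f x X h" if "X \<in> tangent_space M x" for x X h
    using Phi tangent_space_topspace[OF that] that by (auto simp: Phi_tensor_def fun_eq_iff)
  obtain x where x: "x \<in> topspace (mtop M)" using ne by blast
  obtain c where c: "c \<in> atlas M" "x \<in> fst c" using topspace_chart[OF x] .
  define X where "X = coord_vec M c x 0"
  have X: "X \<in> tangent_space M x" unfolding X_def using coord_vec_tangent[OF c] m by simp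
  have X1: "X (\<lambda>y. snd c y 0) = 1" unfolding X_def using coord_vec_chart[OF c, of 0 0] m by simp
  have k12: "k1 + k2 \<noteq> 0"
  proof
    assume "k1 + k2 = 0"
    then show False using R[OF X, of "\<lambda>y. snd c y 0"] X1 k1 by simp
  qed
  show B2: "B2 (dvec X f) (dvec Y f) = k1 / (k1 + k2) * form N (dvec X f) (dvec Y f)"
    if X: "X \<in> tangent_space M x" and Y: "Y \<in> tangent_space M x" for x X Y
  proof -
    have "R_tensor M N f x X = (\<lambda>h. k1 / (k1 + k2) * X h)"
    proof
      fix h show "R_tensor M N f x X h = k1 / (k1 + k2) * X h"
        using R[OF X, of h] k12 by (simp add: field_simps)
    qed
    then have "dvec (R_tensor M N f x X) f = (\<lambda>i. k1 / (k1 + k2) * dvec X f i)" by (simp add: dvec_def)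
    then have "form N (dvec (R_tensor M N f x X) f) (dvec Y f) = k1 / (k1 + k2) * form N (dvec X f) (dvec Y f)"
      by (simp only: form_scale[OF B])
    then show ?thesis using R_tensor_form[OF X Y] by simp
  qed
  have "X \<noteq> (\<lambda>h. 0)" using X1 by auto
  then have pos: "form N (dvec X f) (dvec X f) > 0" using f_isometric[OF X X] metric_pos[OF x X] by simp
  have "0 \<le> k1 / (k1 + k2) * form N (dvec X f) (dvec X f)"
    using B_nonneg(2)[OF x dvec_tspace[OF X]] B2[OF X X] by simp
  then have "k1 / (k1 + k2) \<ge> 0"
    using pos zero_le_mult_iff[of "k1 / (k1 + k2)" "form N (dvec X f) (dvec X f)"] by linarith
  moreover have "k1 / (k1 + k2) \<noteq> 0" using k1 k12 by simp
  ultimately show "k1 / (k1 + k2) > 0" by linarith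
  have r: "1 - k1 / (k1 + k2) = k2 / (k1 + k2)" using k12 by (simp add: field_simps)
  have "B1 (dvec X f) (dvec X f) = (1 - k1 / (k1 + k2)) * form N (dvec X f) (dvec X f)"
    using form_N[of "dvec X f" "dvec X f"] B2[OF X X] by (simp add: algebra_simps)
  then have "0 \<le> k2 / (k1 + k2) * form N (dvec X f) (dvec X f)"
    using B_nonneg(1)[OF x dvec_tspace[OF X]] r by simp
  then have "k2 / (k1 + k2) \<ge> 0"
    using pos zero_le_mult_iff[of "k2 / (k1 + k2)" "form N (dvec X f) (dvec X f)"] by linarith
  moreover have "k2 / (k1 + k2) \<noteq> 0" using k2 k12 by simp
  ultimately show "k2 / (k1 + k2) > 0" by linarith
qed

end

text \<open>Assertion (ii) with \<open>r\<close> for \<open>b^2\<close> and with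
  \<open>\<Phi> = 0\<close> already converted into the homothety on tangent vectors.\<close>

locale reducible_immersion = product_immersion M N f k1 k2 n1 n2
  for M :: "'a rmanifold" and N f k1 k2 n1 n2 +
  fixes l :: nat and L :: "'a \<Rightarrow> (nat + nat \<Rightarrow> real) set" and k r :: real
  assumes r: "r = k1 / (k1 + k2)" and k: "k = k1 * k2 / (k1 + k2)" and pos1: "k1 / (k1 + k2) > 0" and pos2: "k2 / (k1 + k2) > 0"
    and tangent_homothety: "\<And>x X Y. X \<in> tangent_space M x \<Longrightarrow> Y \<in> tangent_space M x \<Longrightarrow>
       B2 (dvec X f) (dvec Y f) = r * form N (dvec X f) (dvec Y f)"
    and conn: "connected_space (mtop M)"
    and L_bundle: "normal_subbundle M N f l L"
    and L_S: "\<And>x. x \<in> topspace (mtop M) \<Longrightarrow> L x \<subseteq> normal_orth M N f x (S_tensor M N f x ` tangent_space M x)"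
    and L_N1: "\<And>x. x \<in> topspace (mtop M) \<Longrightarrow> first_normal_space M N f x \<subseteq> L x"
    and L_T: "\<And>x \<xi>. x \<in> topspace (mtop M) \<Longrightarrow> \<xi> \<in> L x \<Longrightarrow>
       (\<lambda>i. T_tensor M N f x \<xi> i - r * \<xi> i) \<in> normal_orth M N f x (L x)"
    and L_par: "parallel_subbundle M N f L"
begin

lemma k12: "k1 + k2 \<noteq> 0" using pos1 by auto

lemma one_minus_r: "1 - r = k2 / (k1 + k2)" using k12 by (simp add: r field_simps)

lemma k_nonzero: "k \<noteq> 0" using k1 k2 k12 by (simp add: k)

text \<open>The first two identities equate the coefficients of the two corrections in
  \<open>derivative_decomp\<close>; the last two relate the square of \<open>f\<close> to those of
  its components.\<close>

lemma k_scale: "k1 * (1 - r) = k" "k2 * r = k" "1 / k = 1 / k1 + 1 / k2" "r * (1 / k) = 1 / k2"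
proof -
  show "k1 * (1 - r) = k" "k2 * r = k" unfolding one_minus_r by (simp_all add: r k)
  have k': "1 / k = (k1 + k2) / (k1 * k2)" by (simp add: k)
  show "1 / k = 1 / k1 + 1 / k2" unfolding k' using k1 k2 by (simp add: field_simps)
  show "r * (1 / k) = 1 / k2" unfolding k' r using k1 k2 k12 by simp
qed

lemma f_form: "x \<in> topspace (mtop M) \<Longrightarrow> form N (f x) (f x) = 1 / k"
  using f_square[of x] by (simp add: form_N k_scale)

lemma f_tspace: "v \<in> tspace N (f x) \<Longrightarrow> form N (f x) v = 0"
  using tspaceD[of v "f x"] by (simp add: form_N)

lemma L_normal: "x \<in> topspace (mtop M) \<Longrightarrow> L x \<subseteq> normal_space M N f x"
  using L_bundle by (simp add: normal_subbundle_def)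

lemma normal_tspace: "\<nu> \<in> normal_space M N f x \<Longrightarrow> \<nu> \<in> tspace N (f x)"
  by (simp add: normal_space_def)

lemma L_frame:
  assumes "x \<in> topspace (mtop M)"
  shows "\<exists>U e. openin (mtop M) U \<and> x \<in> U \<and> (\<forall>j<l. smooth_vec_on M U (e j)) \<and>
    (\<forall>y\<in>U. L y = lspan l (\<lambda>j. e j y) \<and>
      (\<forall>c. (\<forall>i. (\<Sum>j<l. c j * e j y i) = 0) \<longrightarrow> (\<forall>j<l. c j = 0)))"
  using L_bundle assms unfolding normal_subbundle_def lspan_def by simp

lemma L_subsp:
  assumes "x \<in> topspace (mtop M)" shows "subsp (L x)"
proof -
  obtain U e where "x \<in> U" and "\<forall>y\<in>U. L y = lspan l (\<lambda>j. e j y) \<and>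
      (\<forall>c. (\<forall>i. (\<Sum>j<l. c j * e j y i) = 0) \<longrightarrow> (\<forall>j<l. c j = 0))"
    using L_frame[OF assms] by (elim exE conjE)
  then show ?thesis using subsp_lspan[of l "\<lambda>j. e j x"] by simp
qed

lemma B2_tangent_L:
  assumes "X \<in> tangent_space M x" "\<xi> \<in> L x" shows "B2 (dvec X f) \<xi> = 0"
  using S_tensor_orth[OF assms(1)] L_S[OF tangent_space_topspace[OF assms(1)]] assms(2) by blast

lemma B1_tangent_L:
  assumes "X \<in> tangent_space M x" "\<xi> \<in> L x" shows "B1 (dvec X f) \<xi> = 0"
proof -
  have "form N \<xi> (dvec X f) = 0"
    using L_normal[OF tangent_space_topspace[OF assms(1)]] assms by (auto simp: normal_space_def image_tangent_def)
  then show ?thesis using B2_tangent_L[OF assms] form_N form_sym[OF B, of \<xi>] by simp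
qed

lemma defect_L:
  assumes x: "x \<in> topspace (mtop M)" and \<xi>: "\<xi> \<in> L x" and \<eta>: "\<eta> \<in> L x" shows "defect r \<xi> \<eta> = 0"
proof (rule defect_zeroI)
  have "form N (\<lambda>i. T_tensor M N f x \<xi> i - r * \<xi> i) \<eta> = 0"
    using L_T[OF x \<xi>] \<eta> by (simp add: normal_orth_def)
  moreover have "form N (T_tensor M N f x \<xi>) \<eta> = B2 \<xi> \<eta>"
    using T_tensor_form[OF x] L_normal[OF x] \<xi> \<eta> by blast
  ultimately show "B2 \<xi> \<eta> = r * form N \<xi> \<eta>" by (simp add: form_diff[OF B] form_scale[OF B])
qed

text \<open>The subspace \<open>F(x)\<close> of the overview.\<close>

definition flat_span :: "'a \<Rightarrow> (nat + nat \<Rightarrow> real) set" where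
  "flat_span x = {(\<lambda>i. c * f x i + (t i + \<xi> i)) | c t \<xi>. t \<in> image_tangent M f x \<and> \<xi> \<in> L x}"

lemma flat_spanI: "t \<in> image_tangent M f x \<Longrightarrow> \<xi> \<in> L x \<Longrightarrow> (\<And>i. w i = c * f x i + (t i + \<xi> i)) \<Longrightarrow> w \<in> flat_span x"
  unfolding flat_span_def by blast

text \<open>Checked on generators: \<open>f(x)\<close> is orthogonal to tangent vectors and to
  \<open>L\<close> in each factor separately, tangent vectors scale by the homothety, tangent
  vectors and \<open>L\<close> are orthogonal in each factor by the condition on \<open>S\<close>,
  and pairs from \<open>L\<close> scale by the condition on \<open>T\<close>. For
  \<open>f(x)\<close> with itself the claim is \<open>r / k = 1 / k2\<close>.\<close>

lemma defect_flat_span: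
  assumes x: "x \<in> topspace (mtop M)" and u: "u \<in> flat_span x" and v: "v \<in> flat_span x"
  shows "defect r u v = 0"
proof -
  note D = is_form_defect[of r]
  have ff: "defect r (f x) (f x) = 0"
    by (rule defect_zeroI) (use f_square[OF x] f_form[OF x] k_scale in simp)
  have fv: "defect r (f x) w = 0" "defect r w (f x) = 0" if "w \<in> tspace N (f x)" for w
    using tspaceD[OF that] form_sym[OF D, of w "f x"] by (simp_all add: defect_def)
  have tt: "defect r t t' = 0" if "t \<in> image_tangent M f x" "t' \<in> image_tangent M f x" for t t'
    using that tangent_homothety by (auto simp: image_tangent_def intro!: defect_zeroI)
  have tx: "defect r t \<xi> = 0" "defect r \<xi> t = 0" if "t \<in> image_tangent M f x" "\<xi> \<in> L x" for t \<xi>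
  proof -
    show "defect r t \<xi> = 0" using that B1_tangent_L B2_tangent_L by (auto simp: image_tangent_def defect_def)
    then show "defect r \<xi> t = 0" using form_sym[OF D, of t \<xi>] by simp
  qed
  obtain c t \<xi> where u: "u = (\<lambda>i. c * f x i + (t i + \<xi> i))" "t \<in> image_tangent M f x" "\<xi> \<in> L x"
    using u by (auto simp: flat_span_def)
  obtain c' t' \<xi>' where v: "v = (\<lambda>i. c' * f x i + (t' i + \<xi>' i))" "t' \<in> image_tangent M f x" "\<xi>' \<in> L x"
    using v by (auto simp: flat_span_def)
  have T: "t \<in> tspace N (f x)" "t' \<in> tspace N (f x)" "\<xi> \<in> tspace N (f x)" "\<xi>' \<in> tspace N (f x)"
    using u v image_tangent_tspace[OF x] L_normal[OF x] normal_tspace by blast+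
  show ?thesis
    unfolding u(1) v(1) form_add[OF D] form_add2[OF D] form_scale[OF D] form_scale2[OF D]
    using ff fv T tt[OF u(2) v(2)] tx[OF u(2) v(3)] tx[OF v(2) u(3)] defect_L[OF x u(3) v(3)] by simp
qed

definition frame :: "'a chart \<Rightarrow> (nat \<Rightarrow> 'a \<Rightarrow> nat + nat \<Rightarrow> real) \<Rightarrow> nat \<Rightarrow> 'a \<Rightarrow> nat + nat \<Rightarrow> real" where
  "frame c e j y = (if j < mdim M then dvec (coord_vec M c y j) f else e (j - mdim M) y)"

lemma sum_frame:
  "(\<Sum>j<mdim M + l. d j * frame c e j y i) =
    (\<Sum>j<mdim M. d j * dvec (coord_vec M c y j) f i) + (\<Sum>j<l. d (mdim M + j) * e j y i)"
proof -
  have "(\<Sum>j<mdim M + l. d j * frame c e j y i) =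
     (\<Sum>j<mdim M. d j * frame c e j y i) + (\<Sum>j<l. d (mdim M + j) * frame c e (mdim M + j) y i)"
    by (induction l) simp_all
  then show ?thesis by (simp add: frame_def)
qed

lemma frame_span:
  assumes c: "c \<in> atlas M" "y \<in> fst c" and L: "L y = lspan l (\<lambda>j. e j y)"
  shows "lspan (Suc (mdim M + l)) (case_nat (f y) (\<lambda>j. frame c e j y)) = flat_span y"
proof
  have E: "(\<Sum>j<Suc (mdim M + l). d j * case_nat (f y) (\<lambda>j. frame c e j y) j i) =
     d 0 * f y i + ((\<Sum>j<mdim M. d (Suc j) * dvec (coord_vec M c y j) f i) + (\<Sum>j<l. d (Suc (mdim M + j)) * e j y i))" for d i
    using sum_frame[of "\<lambda>j. d (Suc j)" c e y i] by (simp add: sum.lessThan_Suc_shift del: sum.lessThan_Suc)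
  show "lspan (Suc (mdim M + l)) (case_nat (f y) (\<lambda>j. frame c e j y)) \<subseteq> flat_span y"
  proof
    fix v assume "v \<in> lspan (Suc (mdim M + l)) (case_nat (f y) (\<lambda>j. frame c e j y))"
    then obtain d where v: "v = (\<lambda>i. \<Sum>j<Suc (mdim M + l). d j * case_nat (f y) (\<lambda>j. frame c e j y) j i)"
      unfolding lspan_def by blast
    show "v \<in> flat_span y"
    proof (rule flat_spanI)
      show "(\<lambda>i. \<Sum>j<mdim M. d (Suc j) * dvec (coord_vec M c y j) f i) \<in> image_tangent M f y"
        unfolding image_tangent_chart[OF c] by (rule lspanI)
      show "(\<lambda>i. \<Sum>j<l. d (Suc (mdim M + j)) * e j y i) \<in> L y" unfolding L by (rule lspanI)
    qed (simp only: v E)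
  qed
  show "flat_span y \<subseteq> lspan (Suc (mdim M + l)) (case_nat (f y) (\<lambda>j. frame c e j y))"
  proof
    fix v assume "v \<in> flat_span y"
    then obtain q a b where v: "v = (\<lambda>i. q * f y i + ((\<Sum>j<mdim M. a j * dvec (coord_vec M c y j) f i) + (\<Sum>j<l. b j * e j y i)))"
      unfolding flat_span_def L image_tangent_chart[OF c] lspan_def by blast
    define d where "d = case_nat q (\<lambda>j. if j < mdim M then a j else b (j - mdim M))"
    have "v = (\<lambda>i. \<Sum>j<Suc (mdim M + l). d j * case_nat (f y) (\<lambda>j. frame c e j y) j i)"
      unfolding E v by (simp add: d_def)
    then show "v \<in> lspan (Suc (mdim M + l)) (case_nat (f y) (\<lambda>j. frame c e j y))"
      by (simp only: lspanI)
  qed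
qed

lemma frame_tspace:
  assumes c: "c \<in> atlas M" "y \<in> fst c" and L: "L y = lspan l (\<lambda>j. e j y)" and j: "j < mdim M + l"
  shows "frame c e j y \<in> tspace N (f y)"
proof (cases "j < mdim M")
  case True
  then show ?thesis using dvec_tspace[OF coord_vec_tangent[OF c True]] by (simp add: frame_def)
next
  case False
  then have "e (j - mdim M) y \<in> L y" unfolding L using lspan_base[of "j - mdim M" l "\<lambda>j. e j y"] j by simp
  then show ?thesis using False L_normal[OF chart_topspace[OF c]] normal_tspace by (auto simp: frame_def)
qed

text \<open>The tangent and the normal part are orthogonal with nonnegative squares, and a nonzero
  coefficient makes one of them nonzero because each half of the frame is independent.\<close>

lemma frame_positive:
  assumes c: "c \<in> atlas M" "y \<in> fst c" and L: "L y = lspan l (\<lambda>j. e j y)"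
    and ind: "\<And>c. (\<And>i. (\<Sum>j<l. c j * e j y i) = 0) \<Longrightarrow> \<forall>j<l. c j = 0"
    and d: "\<exists>j<mdim M + l. d j \<noteq> 0"
  shows "form N (\<lambda>i. \<Sum>j<mdim M + l. d j * frame c e j y i) (\<lambda>i. \<Sum>j<mdim M + l. d j * frame c e j y i) > 0"
proof -
  have y: "y \<in> topspace (mtop M)" by (rule chart_topspace[OF c])
  define t where "t = (\<lambda>i. \<Sum>j<mdim M. d j * dvec (coord_vec M c y j) f i)"
  define \<xi> where "\<xi> = (\<lambda>i. \<Sum>j<l. d (mdim M + j) * e j y i)"
  have t: "t \<in> image_tangent M f y" unfolding image_tangent_chart[OF c] t_def by (rule lspanI)
  have \<xi>: "\<xi> \<in> L y" unfolding L \<xi>_def by (rule lspanI)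
  have \<xi>N: "\<xi> \<in> normal_space M N f y" using \<xi> L_normal[OF y] by blast
  have xt: "form N \<xi> t = 0" "form N t \<xi> = 0"
    using \<xi>N t form_sym[OF B, of t \<xi>] by (simp_all add: normal_space_def)
  have eq: "(\<lambda>i. \<Sum>j<mdim M + l. d j * frame c e j y i) = (\<lambda>i. t i + \<xi> i)"
    unfolding sum_frame t_def \<xi>_def ..
  have E: "form N (\<lambda>i. t i + \<xi> i) (\<lambda>i. t i + \<xi> i) = form N t t + form N \<xi> \<xi>"
    unfolding form_add[OF B] form_add2[OF B] using xt by simp
  have nn: "form N v v \<ge> 0" if "v \<in> tspace N (f y)" for v
    using B_nonneg[OF y that] by (simp add: form_N)
  have tT: "t \<in> tspace N (f y)" and \<xi>T: "\<xi> \<in> tspace N (f y)"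
    using t image_tangent_tspace[OF y] normal_tspace[OF \<xi>N] by auto
  show ?thesis
  proof (cases "\<exists>j<mdim M. d j \<noteq> 0")
    case True
    then have "form N t t > 0" unfolding t_def by (rule frame_pos[OF c])
    then show ?thesis unfolding eq E using nn[OF \<xi>T] by linarith
  next
    case False
    obtain j where j: "j < mdim M + l" "d j \<noteq> 0" using d by blast
    then have "\<not> j < mdim M" using False by blast
    have "\<xi> \<noteq> (\<lambda>i. 0)"
    proof
      assume 0: "\<xi> = (\<lambda>i. 0)"
      have "\<forall>j<l. d (mdim M + j) = 0" by (rule ind) (use fun_cong[OF 0] in \<open>simp add: \<xi>_def\<close>)
      then show False using j \<open>\<not> j < mdim M\<close> by (metis add_diff_inverse_nat nat_add_left_cancel_less)
    qed
    then have "form N \<xi> \<xi> > 0" using tspace_posdef[OF y] \<xi>T unfolding posdef_def by blast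
    then show ?thesis unfolding eq E using nn[OF tT] by linarith
  qed
qed

text \<open>The normal part is a value of the second fundamental form, hence in \<open>L\<close>. By
  the homothety the two position corrections are \<open>-k g\<close> times the two components of
  \<open>f\<close>, so together they are a multiple of \<open>f\<close>.\<close>

lemma flat_span_parallel_tangent:
  assumes c: "c \<in> atlas M" "y \<in> fst c" and ij: "i < mdim M" "j < mdim M"
  shows "dvec (coord_vec M c y i) (\<lambda>z. dvec (coord_vec M c z j) f) \<in> flat_span y"
proof -
  let ?X = "coord_vec M c y i" and ?Z = "\<lambda>z. dvec (coord_vec M c z j) f"
  have X: "?X \<in> tangent_space M y" and Y: "coord_vec M c y j \<in> tangent_space M y" using coord_vec_tangent[OF c] ij by auto
  obtain t where t: "t \<in> image_tangent M f y"
    "\<And>i. dvec ?X ?Z i = t i + orth_proj (form N) (normal_space M N f y) (target_conn N f y ?X ?Z) i +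
       case_sum (\<lambda>j. - k1 * B1 (dvec ?X f) (?Z y) * f y (Inl j)) (\<lambda>j. - k2 * B2 (dvec ?X f) (?Z y) * f y (Inr j)) i"
    using derivative_decomp[OF chart_open[OF c(1)] c(2) frame_smooth[OF c(1) ij(2)] _ X]
      dvec_tspace[OF coord_vec_tangent[OF c(1) _ ij(2)]] by blast
  let ?\<nu> = "second_ff M N f y ?X (\<lambda>z. coord_vec M c z j)"
  have "?\<nu> \<in> first_normal_space M N f y"
    unfolding first_normal_space_def
    by (rule vec_span_base) (use X chart_open[OF c(1)] c(2) coord_vector_field[OF c(1) ij(2)] in blast)
  then have \<nu>: "?\<nu> \<in> L y" using L_N1[OF chart_topspace[OF c]] by blast
  define g where "g = form N (dvec ?X f) (?Z y)"
  have b2: "B2 (dvec ?X f) (?Z y) = r * g" unfolding g_def by (rule tangent_homothety[OF X Y])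
  then have b1: "B1 (dvec ?X f) (?Z y) = (1 - r) * g" using form_N[of "dvec ?X f" "?Z y"] by (simp add: g_def algebra_simps)
  have "case_sum (\<lambda>j. - k1 * B1 (dvec ?X f) (?Z y) * f y (Inl j)) (\<lambda>j. - k2 * B2 (dvec ?X f) (?Z y) * f y (Inr j)) i = (- k * g) * f y i" for i
    unfolding b1 b2 using k_scale(1,2) by (cases i) (simp_all add: mult.assoc[symmetric])
  then show ?thesis
    by (intro flat_spanI[OF t(1) \<nu>, of _ "- k * g"]) (simp add: t(2) second_ff_def)
qed

text \<open>Parallelism puts the normal part into \<open>L\<close>; the position corrections vanish
  because tangent vectors and \<open>L\<close> are orthogonal in each factor.\<close>

lemma flat_span_parallel_L:
  assumes U: "openin (mtop M) U" "y \<in> U" and Z: "smooth_vec_on M U Z" "\<And>z. z \<in> U \<Longrightarrow> Z z \<in> L z" and X: "X \<in> tangent_space M y"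
  shows "dvec X Z \<in> flat_span y"
proof -
  have Ut: "z \<in> topspace (mtop M)" if "z \<in> U" for z using openin_subset[OF U(1)] that by blast
  have ZT: "Z z \<in> tspace N (f z)" if "z \<in> U" for z using Z(2)[OF that] L_normal[OF Ut[OF that]] normal_tspace by blast
  obtain t where t: "t \<in> image_tangent M f y"
    "\<And>i. dvec X Z i = t i + orth_proj (form N) (normal_space M N f y) (target_conn N f y X Z) i +
       case_sum (\<lambda>j. - k1 * B1 (dvec X f) (Z y) * f y (Inl j)) (\<lambda>j. - k2 * B2 (dvec X f) (Z y) * f y (Inr j)) i"
    using derivative_decomp[OF U Z(1) ZT X] by blast
  have \<nu>: "normal_conn M N f y X Z \<in> L y"
    using L_par U Z X unfolding parallel_subbundle_def by blast
  have "case_sum (\<lambda>j. - k1 * B1 (dvec X f) (Z y) * f y (Inl j)) (\<lambda>j. - k2 * B2 (dvec X f) (Z y) * f y (Inr j)) i = 0" for i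
    using B1_tangent_L[OF X Z(2)[OF U(2)]] B2_tangent_L[OF X Z(2)[OF U(2)]] by (cases i) simp_all
  then show ?thesis
    by (intro flat_spanI[OF t(1) \<nu>, of _ 0]) (simp add: t(2) normal_conn_def)
qed

lemma flat_span_locally_constant:
  assumes x: "x \<in> topspace (mtop M)"
  shows "\<exists>V. openin (mtop M) V \<and> x \<in> V \<and> (\<forall>y\<in>V. flat_span y = flat_span x)"
proof -
  obtain c where c: "c \<in> atlas M" "x \<in> fst c" using topspace_chart[OF x] .
  obtain U e where U: "openin (mtop M) U" "x \<in> U" and e': "\<forall>j<l. smooth_vec_on M U (e j)"
    and Le': "\<forall>y\<in>U. L y = lspan l (\<lambda>j. e j y) \<and>
      (\<forall>c. (\<forall>i. (\<Sum>j<l. c j * e j y i) = 0) \<longrightarrow> (\<forall>j<l. c j = 0))"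
    using L_frame[OF x] by (elim exE conjE)
  have e: "smooth_vec_on M U (e j)" if "j < l" for j using e' that by simp
  have Le: "L y = lspan l (\<lambda>j. e j y)" if "y \<in> U" for y using Le' that by simp
  have ind: "\<forall>j<l. c j = 0" if "y \<in> U" "\<And>i. (\<Sum>j<l. c j * e j y i) = 0" for y c using Le' that by simp
  define W where "W = fst c \<inter> U"
  have W: "openin (mtop M) W" "W \<subseteq> fst c" "x \<in> W" using U c chart_open[OF c(1)] by (auto simp: W_def)
  have Wc: "y \<in> fst c" and WU: "y \<in> U" if "y \<in> W" for y using that by (auto simp: W_def)
  let ?E = "\<lambda>y. lspan (Suc (mdim M + l)) (case_nat (f y) (\<lambda>j. frame c e j y))"
  have E: "?E y = flat_span y" if "y \<in> W" for y by (rule frame_span[where e = e, OF c(1) Wc[OF that] Le[OF WU[OF that]]])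
  have Xt: "coord_vec M c y i \<in> tangent_space M y" if "y \<in> W" "i < mdim M" for y i
    using coord_vec_tangent[OF c(1) Wc[OF that(1)] that(2)] .
  show ?thesis
  proof (rule parallel_span_locally_constant[OF B c(1) W f_smooth_on[OF W(1)], of "mdim M + l" "frame c e" k ?E])
    show "smooth_vec_on M W (frame c e j)" if "j < mdim M + l" for j
    proof (cases "j < mdim M")
      case True
      then show ?thesis using smooth_vec_subset[OF frame_smooth[OF c(1) True] W(2)] by (simp add: frame_def[abs_def])
    next
      case False
      then have "smooth_vec_on M W (e (j - mdim M))" using that smooth_vec_subset[OF e, of "j - mdim M" W] by (auto simp: W_def)
      then show ?thesis using False by (simp add: frame_def[abs_def])
    qed
    show "k \<noteq> 0" by (rule k_nonzero)
    show "form N (f y) (f y) = 1 / k" if "y \<in> W" for y by (rule f_form[OF chart_topspace[OF c(1) Wc[OF that]]])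
    show "form N (f y) (frame c e j y) = 0" if "y \<in> W" "j < mdim M + l" for y j
      by (rule f_tspace[OF frame_tspace[where e = e, OF c(1) Wc[OF that(1)] Le[OF WU[OF that(1)]] that(2)]])
    show "0 < form N (\<lambda>i. \<Sum>j<mdim M + l. d j * frame c e j x i) (\<lambda>i. \<Sum>j<mdim M + l. d j * frame c e j x i)"
      if "\<exists>j<mdim M + l. d j \<noteq> 0" for d
      by (rule frame_positive[where e = e, OF c Le[OF U(2)] ind[OF U(2)] that])
    show "dvec (coord_vec M c y i) f \<in> ?E y" if "y \<in> W" "i < mdim M" for y i
      unfolding E[OF that(1)]
      by (rule flat_spanI[of "dvec (coord_vec M c y i) f" y "\<lambda>i. 0" _ 0])
        (use Xt[OF that] subsp_zero[OF L_subsp[OF tangent_space_topspace[OF Xt[OF that]]]] in \<open>auto simp: image_tangent_def\<close>)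
    show "dvec (coord_vec M c y i) (frame c e j) \<in> ?E y" if y: "y \<in> W" and i: "i < mdim M" and j: "j < mdim M + l" for y i j
    proof (cases "j < mdim M")
      case True
      then show ?thesis unfolding E[OF y] using flat_span_parallel_tangent[OF c(1) Wc[OF y] i True]
        by (simp add: frame_def[abs_def])
    next
      case False
      then have jl: "j - mdim M < l" using j by simp
      have "e (j - mdim M) z \<in> L z" if "z \<in> U" for z
        unfolding Le[OF that] using lspan_base[OF jl, of "\<lambda>j. e j z"] .
      then have "dvec (coord_vec M c y i) (e (j - mdim M)) \<in> flat_span y"
        by (rule flat_span_parallel_L[OF U(1) WU[OF y] e[OF jl] _ Xt[OF y i]])
      then show ?thesis unfolding E[OF y] using False by (simp add: frame_def[abs_def])
    qed
    fix V assume V: "openin (mtop M) V" "x \<in> V" "V \<subseteq> W" "\<And>y. y \<in> V \<Longrightarrow> ?E y = ?E x"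
    have "flat_span y = flat_span x" if "y \<in> V" for y using V(4)[OF that] E[of y] E[OF W(3)] that V(3) by auto
    then show ?thesis using V(1,2) by blast
  qed simp
qed

lemma flat_span_constant: "x \<in> topspace (mtop M) \<Longrightarrow> y \<in> topspace (mtop M) \<Longrightarrow> flat_span y = flat_span x"
  by (rule connected_locally_constant[OF conn flat_span_locally_constant])

end

section \<open>Linear models of the totally geodesic maps\<close>

lemma linear_Q_embedding:
  assumes \<kappa>: "\<kappa> \<noteq> 0" and wE: "\<And>s. s < Suc n \<Longrightarrow> w s \<in> topspace (Euclidean_space (Suc n'))"
    and on: "\<And>i j. i < Suc n \<Longrightarrow> j < Suc n \<Longrightarrow> flat_ip (sig \<kappa>) (Suc n') (w i) (w j) = (if i = j then fsgn \<kappa> i else 0)"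
    and w0: "q \<in> points (Q_space \<kappa> n')" "c > 0" "w 0 = (\<lambda>i. c * q i)"
  shows "totally_geodesic_embedding (Q_manifold \<kappa> n) (Q_space \<kappa> n') (mat_app (Suc n) w)"
proof (rule linear_totally_geodesic[OF \<kappa>])
  let ?B = "flat_ip (sig \<kappa>) (Suc n')"
  note fB = is_form_flat_ip[of "sig \<kappa>" "Suc n'"]
  have iso: "?B (mat_app (Suc n) w u) (mat_app (Suc n) w v) = flat_ip (sig \<kappa>) (Suc n) u v" for u v
    using mat_app_isometry[OF fB, of "Suc n" w 1 \<kappa> u v] on by simp
  show "is_form (form (Q_space \<kappa> n'))" using fB by simp
  show "form (Q_space \<kappa> n') (mat_app (Suc n) w u) (mat_app (Suc n) w v) = flat_ip (sig \<kappa>) (Suc n) u v" for u v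
    using iso by simp
  fix p assume p: "p \<in> points (Q_space \<kappa> n)"
  have JE: "mat_app (Suc n) w p \<in> topspace (Euclidean_space (Suc n'))"
    using wE by (auto simp: mat_app_def topspace_Euclidean_space intro!: sum.neutral simp del: sum.lessThan_Suc)
  have JJ: "?B (mat_app (Suc n) w p) (mat_app (Suc n) w p) = 1 / \<kappa>" using iso p by simp
  show "mat_app (Suc n) w p \<in> points (Q_space \<kappa> n')"
  proof (cases "\<kappa> < 0")
    case True
    show ?thesis
    proof (rule Q_space_futureI[OF True w0(1) JE JJ])
      \<comment> \<open>The image must lie on the chosen sheet. As \<open>w 0\<close> is a positive
        multiple of a point \<open>q\<close> of that sheet, the product of \<open>q\<close> with the
        image has the sign of \<open>- p 0\<close>, and \<open>Q_space_futureI\<close>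
        applies.\<close>
      have "c * ?B q (mat_app (Suc n) w p) = ?B (w 0) (mat_app (Suc n) w p)"
        unfolding w0(3) form_scale[OF fB] ..
      also have "\<dots> = (\<Sum>s<Suc n. p s * ?B (w 0) (w s))" unfolding mat_app_def form_sum2[OF fB] ..
      also have "\<dots> = (\<Sum>s<Suc n. if s = 0 then p s * fsgn \<kappa> 0 else 0)" using on by (intro sum.cong) auto
      also have "\<dots> = - p 0" using True by (simp add: fsgn_def sig_neg del: sum.lessThan_Suc)
      also have "\<dots> < 0" using p True by simp
      finally show "?B q (mat_app (Suc n) w p) < 0" using w0(2) by (simp add: mult_less_0_iff)
    qed
  next
    case False
    then show ?thesis using JE JJ by simp
  qed
  show "form (Q_space \<kappa> n') (mat_app (Suc n) w p) v = 0" if "v \<in> tspace (Q_space \<kappa> n') (mat_app (Suc n) w p)" for v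
    using that by simp
next
  show "isometric_immersion (Q_manifold \<kappa> n) (Q_space \<kappa> n') (mat_app (Suc n) w) \<Longrightarrow>
    immersion (Q_manifold \<kappa> n) (Q_space \<kappa> n') (mat_app (Suc n) w)"
    by (rule immersion_Q_manifold[OF \<kappa> \<kappa>])
qed

lemma sig_eq_iff: "sig x = sig y \<longleftrightarrow> (x < 0 \<longleftrightarrow> y < 0)"
  by (simp add: sig_def)

text \<open>\<open>a^2 / k = 1 / k1\<close> and \<open>b^2 / k = 1 / k2\<close> make the two scaled
  copies of a point land on the factors, and positive \<open>a\<close> and \<open>b\<close> preserve
  the sheet. The position vector of the image is orthogonal to the target in each factor.\<close>

lemma diagonal_totally_geodesic:
  fixes a b :: real and n :: nat
  defines "G \<equiv> mat_app (Suc n) (\<lambda>s. case_sum (\<lambda>i. a * (if i = s then 1 else 0)) (\<lambda>i. b * (if i = s then 1 else 0)))"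
  assumes k: "k \<noteq> 0" "k1 \<noteq> 0" "k2 \<noteq> 0" "sig k1 = sig k" "sig k2 = sig k"
    and ab: "a > 0" "b > 0" "a\<^sup>2 + b\<^sup>2 = 1" "a\<^sup>2 / k = 1 / k1" "b\<^sup>2 / k = 1 / k2"
  shows "\<And>u. u \<in> topspace (Euclidean_space (Suc n)) \<Longrightarrow> G u = case_sum (\<lambda>i. a * u i) (\<lambda>i. b * u i)"
    and "totally_geodesic_embedding (Q_manifold k n) (product_target (Q_space k1 n) (Q_space k2 n)) G"
proof -
  let ?N = "product_target (Q_space k1 n) (Q_space k2 n)" and ?E = "topspace (Euclidean_space (Suc n))"
  note fB = is_form_flat_ip[of "sig k" "Suc n"]
  show G: "G u = case_sum (\<lambda>i. a * u i) (\<lambda>i. b * u i)" if u: "u \<in> ?E" for u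
  proof
    fix i
    have e: "u j = (\<Sum>s<Suc n. u s * (if j = s then 1 else 0))" for j using fun_cong[OF Euclidean_expand[OF u], of j] .
    have m: "(\<Sum>s<Suc n. u s * (c * (if j = s then 1 else 0))) = c * u j" for c j
      by (subst e[of j]) (simp only: sum_distrib_left mult.left_commute)
    show "G u i = case_sum (\<lambda>i. a * u i) (\<lambda>i. b * u i) i"
      unfolding G_def mat_app_def by (cases i) (simp_all only: m sum.case)
  qed
  have sg: "k1 < 0 \<longleftrightarrow> k < 0" "k2 < 0 \<longleftrightarrow> k < 0" using k(4,5) unfolding sig_eq_iff by blast+
  show "totally_geodesic_embedding (Q_manifold k n) ?N G"
    unfolding G_def
  proof (rule linear_totally_geodesic[OF k(1)], fold G_def)
    show "is_form (form ?N)" using is_form_sum[OF is_form_flat_ip is_form_flat_ip] by simp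
    show "form ?N (G u) (G v) = flat_ip (sig k) (Suc n) u v" if "u \<in> ?E" "v \<in> ?E" for u v
    proof -
      have "form ?N (G u) (G v) = (a\<^sup>2 + b\<^sup>2) * flat_ip (sig k) (Suc n) u v"
        unfolding G[OF that(1)] G[OF that(2)] product_target_simps case_sum_o Q_space_simps k(4,5) form_scale[OF fB] form_scale2[OF fB]
        by (simp add: power2_eq_square algebra_simps)
      then show ?thesis by (simp add: ab)
    qed
    fix p assume p: "p \<in> points (Q_space k n)"
    then have pE: "p \<in> ?E" and pp: "flat_ip (sig k) (Suc n) p p = 1 / k" and p0: "k < 0 \<Longrightarrow> p 0 > 0" by simp_all
    have "(\<lambda>i. a * p i) \<in> ?E" "(\<lambda>i. b * p i) \<in> ?E" using pE by (simp_all add: topspace_Euclidean_space)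
    then show "G p \<in> points ?N"
      unfolding G[OF pE] product_target_simps case_sum_o Q_space_simps k(4,5) form_scale[OF fB] form_scale2[OF fB] pp sg
      using ab p0 by (simp add: power2_eq_square[symmetric] mult.assoc[symmetric])
    show "form ?N (G p) v = 0" if "v \<in> tspace ?N (G p)" for v using that by simp
  next
    interpret smooth_atlas "Q_manifold k n" by (rule smooth_atlas_Q[OF k(1)])
    show "isometric_immersion (Q_manifold k n) ?N G \<Longrightarrow> immersion (Q_manifold k n) ?N G"
      by (rule immersion_product[OF k(2,3) _ Q_metric_pos[OF k(1)]])
  qed
qed

context reducible_immersion
begin

lemma r_bounds: "0 < r" "0 < 1 - r"
  using pos1 pos2 one_minus_r by (simp_all add: r)

lemma sig_eq: "sig k1 = sig k" "sig k2 = sig k"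
proof -
  have "k < 0 \<longleftrightarrow> k1 < 0" using k_scale(1) r_bounds(2) by (metis mult_less_0_iff not_less_iff_gr_or_eq)
  moreover have "k < 0 \<longleftrightarrow> k2 < 0" using k_scale(2) r_bounds(1) by (metis mult_less_0_iff not_less_iff_gr_or_eq)
  ultimately show "sig k1 = sig k" "sig k2 = sig k" by (simp_all add: sig_def)
qed

lemma flat_span_subsp:
  assumes "x \<in> topspace (mtop M)" shows "subsp (flat_span x)"
proof -
  obtain c where c: "c \<in> atlas M" "x \<in> fst c" using topspace_chart[OF assms] .
  obtain U e where "x \<in> U" and "\<forall>y\<in>U. L y = lspan l (\<lambda>j. e j y) \<and>
      (\<forall>c. (\<forall>i. (\<Sum>j<l. c j * e j y i) = 0) \<longrightarrow> (\<forall>j<l. c j = 0))"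
    using L_frame[OF assms] by (elim exE conjE)
  then have "L x = lspan l (\<lambda>j. e j x)" by simp
  from frame_span[where e = e, OF c this, symmetric] show ?thesis using subsp_lspan by simp
qed

lemma f_flat_span: "x \<in> topspace (mtop M) \<Longrightarrow> f x \<in> flat_span x"
  by (rule flat_spanI[of "\<lambda>i. 0" x "\<lambda>i. 0" _ 1]) (simp_all add: subsp_zero[OF L_subsp] subsp_zero[OF image_tangent_subsp])

text \<open>The rescaled position vector is the only basis vector that may be time-like; the others
  come from Gram-Schmidt on the frame. The Gram matrix is therefore that of the flat space of index
  \<open>sig k\<close>.\<close>

lemma flat_span_basis:
  assumes x: "x \<in> topspace (mtop M)"
  shows "\<exists>v. (\<forall>i<Suc (mdim M + l). v i \<in> flat_span x) \<and> flat_span x \<subseteq> lspan (Suc (mdim M + l)) v \<and>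
     (\<forall>i<Suc (mdim M + l). \<forall>j<Suc (mdim M + l). form N (v i) (v j) = (if i = j then fsgn k i else 0)) \<and>
     v 0 = (\<lambda>i. sqrt \<bar>k\<bar> * f x i)"
proof -
  let ?r = "mdim M + l"
  obtain c where c: "c \<in> atlas M" "x \<in> fst c" using topspace_chart[OF x] .
  obtain U e where U: "openin (mtop M) U" "x \<in> U" and e: "\<forall>j<l. smooth_vec_on M U (e j)"
    and Le': "\<forall>y\<in>U. L y = lspan l (\<lambda>j. e j y) \<and>
      (\<forall>c. (\<forall>i. (\<Sum>j<l. c j * e j y i) = 0) \<longrightarrow> (\<forall>j<l. c j = 0))"
    using L_frame[OF x] by (elim exE conjE)
  have Le: "L x = lspan l (\<lambda>j. e j x)" using Le' U(2) by simp
  have ind: "\<forall>j<l. c j = 0" if "\<And>i. (\<Sum>j<l. c j * e j x i) = 0" for c using Le' U(2) that by simp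
  define W where "W = fst c \<inter> U"
  have W: "openin (mtop M) W" "x \<in> W" using U c chart_open[OF c(1)] by (auto simp: W_def)
  have "\<exists>V u C. openin (mtop M) V \<and> x \<in> V \<and> V \<subseteq> W \<and> (\<forall>j<?r. smooth_vec_on M V (u j)) \<and>
      (\<forall>j<?r. \<forall>l<?r. smooth_fun_on M V (C j l)) \<and>
      (\<forall>y\<in>V. \<forall>j<?r. u j y = (\<lambda>i. \<Sum>l<?r. C j l y * frame c e l y i)) \<and>
      (\<forall>y\<in>V. \<forall>j<?r. \<forall>l<?r. form N (u j y) (u l y) = (if j = l then 1 else 0)) \<and>
      (\<forall>y\<in>V. \<forall>j<?r. frame c e j y \<in> lspan ?r (\<lambda>l. u l y))"
  proof (rule Gram_Schmidt[OF B W])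
    show "smooth_vec_on M W (frame c e j)" if "j < ?r" for j
    proof (cases "j < mdim M")
      case True
      then show ?thesis using smooth_vec_subset[OF frame_smooth[OF c(1) True], of W] by (simp add: frame_def[abs_def] W_def)
    next
      case False
      then show ?thesis using that smooth_vec_subset[OF e[rule_format], of "j - mdim M" W] by (simp add: frame_def[abs_def] W_def)
    qed
    show "0 < form N (\<lambda>i. \<Sum>j<?r. d j * frame c e j x i) (\<lambda>i. \<Sum>j<?r. d j * frame c e j x i)"
      if "\<exists>j<?r. d j \<noteq> 0" for d
      by (rule frame_positive[where e = e, OF c Le ind that])
  qed
  then obtain V u C where V: "x \<in> V"
    and uC: "\<forall>y\<in>V. \<forall>j<?r. u j y = (\<lambda>i. \<Sum>l<?r. C j l y * frame c e l y i)"
    and on: "\<forall>y\<in>V. \<forall>j<?r. \<forall>l<?r. form N (u j y) (u l y) = (if j = l then 1 else 0)"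
    and sp: "\<forall>y\<in>V. \<forall>j<?r. frame c e j y \<in> lspan ?r (\<lambda>l. u l y)" by (elim exE conjE)
  define s where "s = sqrt \<bar>k\<bar>"
  have s: "s > 0" "s * s = \<bar>k\<bar>" using k_nonzero by (auto simp: s_def)
  define v where "v = case_nat (\<lambda>i. s * f x i) (\<lambda>j. u j x)"
  have fs: "lspan (Suc ?r) (case_nat (f x) (\<lambda>j. frame c e j x)) = flat_span x" by (rule frame_span[where e = e, OF c Le])
  have ux: "u j x = (\<lambda>i. \<Sum>l<?r. C j l x * frame c e l x i)" if "j < ?r" for j using uC V that by blast
  have fr: "frame c e j x \<in> flat_span x" if "j < ?r" for j
    using lspan_base[of "Suc j" "Suc ?r" "case_nat (f x) (\<lambda>j. frame c e j x)"] that unfolding fs by simp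
  have uF: "u j x \<in> flat_span x" if "j < ?r" for j
    unfolding ux[OF that] by (rule subsp_sum[OF flat_span_subsp[OF x]]) (use fr in auto)
  have uT: "u j x \<in> tspace N (f x)" if "j < ?r" for j
    unfolding ux[OF that] by (rule subsp_sum[OF tspace_subsp[OF x]]) (use frame_tspace[where e = e, OF c Le] in auto)
  have fu: "form N (f x) (u j x) = 0" "form N (u j x) (f x) = 0" if "j < ?r" for j
    using f_tspace[OF uT[OF that]] form_sym[OF B, of "u j x" "f x"] by simp_all
  have "s * (s * (1 / k)) = fsgn k 0"
    using s(2) k_nonzero by (simp add: mult.assoc[symmetric] abs_if fsgn_def sig_def)
  then have v00: "form N (\<lambda>i. s * f x i) (\<lambda>i. s * f x i) = fsgn k 0"
    using f_form[OF x] by (simp add: form_scale[OF B] form_scale2[OF B])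
  have fS: "fsgn k (Suc j) = 1" for j by (simp add: fsgn_def sig_def)
  show ?thesis
  proof (intro exI[of _ v] conjI allI impI)
    show "v i \<in> flat_span x" if "i < Suc ?r" for i
      using that uF subsp_scale[OF flat_span_subsp[OF x] f_flat_span[OF x]] by (cases i) (simp_all add: v_def)
    show "form N (v i) (v j) = (if i = j then fsgn k i else 0)" if "i < Suc ?r" "j < Suc ?r" for i j
      using that v00 fu on V fS by (cases i; cases j) (simp_all add: v_def form_scale[OF B] form_scale2[OF B])
    have sub: "lspan ?r (\<lambda>l. u l x) \<subseteq> lspan (Suc ?r) v"
    proof (rule lspan_subset[OF subsp_lspan])
      show "u j x \<in> lspan (Suc ?r) v" if "j < ?r" for j
        using lspan_base[of "Suc j" "Suc ?r" v] that by (simp add: v_def)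
    qed
    have "(\<lambda>i. inverse s * (s * f x i)) \<in> lspan (Suc ?r) v"
      using subsp_scale[OF subsp_lspan lspan_base[of 0 "Suc ?r" v], of "inverse s"] by (simp add: v_def)
    then have Fv: "f x \<in> lspan (Suc ?r) v" using s(1) by (simp add: mult.assoc[symmetric])
    show "flat_span x \<subseteq> lspan (Suc ?r) v"
      unfolding fs[symmetric]
    proof (rule lspan_subset[OF subsp_lspan])
      fix j assume "j < Suc ?r"
      then show "case_nat (f x) (\<lambda>j. frame c e j x) j \<in> lspan (Suc ?r) v"
        using Fv subsetD[OF sub] sp V by (cases j) auto
    qed
    show "v 0 = (\<lambda>i. sqrt \<bar>k\<bar> * f x i)" by (simp add: v_def s_def)
  qed
qed

text \<open>No rotations enter \<open>g\<close>: the columns of \<open>j1\<close> and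
  \<open>j2\<close> are the rescaled components of the basis \<open>v\<close>, so \<open>T1\<close>
  and \<open>T2\<close> can be the identity.\<close>

lemma factorization:
  fixes a b :: real
  defines "n \<equiv> mdim M + l"
  assumes ne: "topspace (mtop M) \<noteq> {}" and ab: "a > 0" "b > 0" "a\<^sup>2 = 1 - r" "b\<^sup>2 = r"
  shows "\<exists>fbar g j1 j2. isometric_immersion M (Q_space k n) fbar \<and>
     (\<forall>x\<in>points (Q_space k n). g x = case_sum (\<lambda>i. a * x i) (\<lambda>i. b * x i)) \<and>
     totally_geodesic_embedding (Q_manifold k n) (product_target (Q_space k1 n) (Q_space k2 n)) g \<and>
     totally_geodesic_embedding (Q_manifold k1 n) (Q_space k1 n1) j1 \<and>
     totally_geodesic_embedding (Q_manifold k2 n) (Q_space k2 n2) j2 \<and>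
     (\<forall>x\<in>topspace (mtop M). f x = case_sum (j1 (g (fbar x) \<circ> Inl)) (j2 (g (fbar x) \<circ> Inr)))"
proof -
  obtain x0 where x0: "x0 \<in> topspace (mtop M)" using ne by blast
  obtain v where vF: "\<forall>i<Suc n. v i \<in> flat_span x0" and vsp: "flat_span x0 \<subseteq> lspan (Suc n) v"
    and von: "\<forall>i<Suc n. \<forall>j<Suc n. form N (v i) (v j) = (if i = j then fsgn k i else 0)"
    and v0: "v 0 = (\<lambda>i. sqrt \<bar>k\<bar> * f x0 i)"
    using flat_span_basis[OF x0] unfolding n_def by (elim exE conjE)
  have s: "sqrt \<bar>k\<bar> > 0" using k_nonzero by simp
  note f1 = is_form_flat_ip[of "sig k1" "Suc n1"] and f2 = is_form_flat_ip[of "sig k2" "Suc n2"]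
  have fsg: "fsgn k1 = fsgn k" "fsgn k2 = fsgn k" by (simp_all add: fsgn_def[abs_def] sig_eq)
  have iso: "form N (mat_app (Suc n) v u) (mat_app (Suc n) v w) = flat_ip (sig k) (Suc n) u w" for u w
    using mat_app_isometry[OF B, of "Suc n" v 1 k u w] von by simp
  \<comment> \<open>Coordinates of \<open>f x\<close> in the basis \<open>v\<close>; the sign
    \<open>fsgn k i\<close> is the inverse of the square of \<open>v i\<close>. As scalar products
    with fixed vectors they are smooth in \<open>x\<close>.\<close>
  define fbar where "fbar x i = (if i < Suc n then fsgn k i * form N (f x) (v i) else 0)" for x i
  have fv: "f x = mat_app (Suc n) v (fbar x)" if x: "x \<in> topspace (mtop M)" for x
  proof -
    have "f x \<in> lspan (Suc n) v" using f_flat_span[OF x] flat_span_constant[OF x0 x] vsp by auto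
    then obtain d where d: "f x = (\<lambda>i. \<Sum>j<Suc n. d j * v j i)" unfolding lspan_def by blast
    have "fbar x i = d i" if i: "i < Suc n" for i
    proof -
      have "form N (f x) (v i) = (\<Sum>j<Suc n. if j = i then d j * fsgn k i else 0)"
        unfolding d form_sum[OF B] using von i by (intro sum.cong) auto
      also have "\<dots> = d i * fsgn k i" using i by (simp del: sum.lessThan_Suc)
      finally show ?thesis using i by (simp add: fbar_def mult.left_commute)
    qed
    then show ?thesis unfolding mat_app_def by (subst d) (intro ext sum.cong, auto)
  qed
  have cs: "smooth_vec_on M (topspace (mtop M)) (\<lambda>y. z)" for z :: "nat + nat \<Rightarrow> real"
    unfolding smooth_vec_on_def by (intro allI smooth_const openin_topspace)
  have fbs: "smooth_vec_on M (topspace (mtop M)) fbar"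
    unfolding smooth_vec_on_def
  proof
    fix i show "smooth_fun_on M (topspace (mtop M)) (\<lambda>x. fbar x i)"
      using smooth_mult[OF openin_topspace smooth_const[OF openin_topspace] smooth_form[OF B openin_topspace f_smooth cs]]
        smooth_const[OF openin_topspace] by (cases "i < Suc n") (simp_all add: fbar_def)
  qed
  have fbE: "fbar x \<in> topspace (Euclidean_space (Suc n))" for x by (simp add: fbar_def topspace_Euclidean_space)
  have fbp: "fbar x \<in> points (Q_space k n)" if x: "x \<in> topspace (mtop M)" for x
  proof -
    have "flat_ip (sig k) (Suc n) (fbar x) (fbar x) = 1 / k"
      using iso[of "fbar x" "fbar x"] fv[OF x] f_form[OF x] by simp
    \<comment> \<open>\<open>f x\<close> and \<open>f x0\<close> lie on the same sheet in each
      factor, so their product is negative. As \<open>v 0\<close> is a positive multiple of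
      \<open>f x0\<close>, the sign -1 of coordinate 0 makes \<open>fbar x 0\<close>
      positive.\<close>
    moreover have "fbar x 0 > 0" if "k < 0"
    proof -
      have "k1 < 0" "k2 < 0" using that sig_eq unfolding sig_eq_iff by blast+
      moreover have "f x \<circ> Inl \<in> points (Q_space k1 n1)" "f x \<circ> Inr \<in> points (Q_space k2 n2)"
        "f x0 \<circ> Inl \<in> points (Q_space k1 n1)" "f x0 \<circ> Inr \<in> points (Q_space k2 n2)"
        using f_points[OF x] f_points[OF x0] unfolding N product_target_simps(1) by simp_all
      ultimately have "B1 (f x) (f x0) < 0" "B2 (f x) (f x0) < 0" by (blast intro: Q_space_future)+
      then have "form N (f x) (f x0) < 0" unfolding form_N by linarith
      then show ?thesis using s that by (simp add: fbar_def v0 form_scale2[OF B] fsgn_def sig_def mult_less_0_iff)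
    qed
    ultimately show ?thesis using fbE by simp
  qed
  have df: "dvec X f = mat_app (Suc n) v (dvec X fbar)" if X: "X \<in> tangent_space M x" for X x
  proof -
    have xt: "x \<in> topspace (mtop M)" by (rule tangent_space_topspace[OF X])
    have "dvec X f = dvec X (\<lambda>y. mat_app (Suc n) v (fbar y))" by (rule dvec_cong[OF X openin_topspace xt fv])
    also have "\<dots> = mat_app (Suc n) v (dvec X fbar)" by (rule dvec_mat_app[OF openin_topspace fbs X xt])
    finally show ?thesis .
  qed
  have fb: "isometric_immersion M (Q_space k n) fbar"
    unfolding isometric_immersion_def
  proof (intro conjI ballI fbs)
    show "fbar ` topspace (mtop M) \<subseteq> points (Q_space k n)" using fbp by blast
    show "form (Q_space k n) (dvec X fbar) (dvec Y fbar) = metric M x X Y"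
      if "X \<in> tangent_space M x" "Y \<in> tangent_space M x" for x X Y
      using f_isometric[OF that] iso[of "dvec X fbar" "dvec Y fbar"] df[OF that(1)] df[OF that(2)] by simp
  qed
  have vE: "v i \<circ> Inl \<in> topspace (Euclidean_space (Suc n1))" "v i \<circ> Inr \<in> topspace (Euclidean_space (Suc n2))" if i: "i < Suc n" for i
  proof -
    obtain c t \<xi> where "v i = (\<lambda>q. c * f x0 q + (t q + \<xi> q))" "t \<in> image_tangent M f x0" "\<xi> \<in> L x0"
      using vF i unfolding flat_span_def by blast
    moreover have "t \<in> tspace N (f x0)" "\<xi> \<in> tspace N (f x0)"
      using calculation(2,3) image_tangent_tspace[OF x0] L_normal[OF x0] normal_tspace by blast+
    ultimately show "v i \<circ> Inl \<in> topspace (Euclidean_space (Suc n1))" "v i \<circ> Inr \<in> topspace (Euclidean_space (Suc n2))"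
      using f_points[OF x0] by (simp_all add: N topspace_Euclidean_space)
  qed
  \<comment> \<open>On \<open>flat_span\<close> the first component scales squares by
    \<open>a^2\<close> and the second by \<open>b^2\<close>. Division by \<open>a\<close> and
    \<open>b\<close> restores orthonormality up to signs, and \<open>g\<close> multiplies the
    factors back.\<close>
  define w1 where "w1 i = (\<lambda>q. (1 / a) * (v i \<circ> Inl) q)" for i
  define w2 where "w2 i = (\<lambda>q. (1 / b) * (v i \<circ> Inr) q)" for i
  have j1: "totally_geodesic_embedding (Q_manifold k1 n) (Q_space k1 n1) (mat_app (Suc n) w1)"
  proof (rule linear_Q_embedding[OF k1])
    show "w1 i \<in> topspace (Euclidean_space (Suc n1))" if "i < Suc n" for i
      using vE(1)[OF that] by (simp add: w1_def topspace_Euclidean_space)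
    show "flat_ip (sig k1) (Suc n1) (w1 i) (w1 j) = (if i = j then fsgn k1 i else 0)" if "i < Suc n" "j < Suc n" for i j
    proof -
      have "B1 (v i) (v j) = (1 - r) * form N (v i) (v j)" using defect_zero(2) defect_flat_span[OF x0] vF that by blast
      also have "\<dots> = a\<^sup>2 * (if i = j then fsgn k i else 0)" using von that unfolding ab(3) by simp
      finally have e: "B1 (v i) (v j) = a\<^sup>2 * (if i = j then fsgn k i else 0)" .
      have c: "1 / a * (1 / a * (a\<^sup>2 * z)) = z" for z using ab(1) by (simp add: power2_eq_square)
      show ?thesis unfolding w1_def form_scale[OF f1] form_scale2[OF f1] fsg e c ..
    qed
    show "f x0 \<circ> Inl \<in> points (Q_space k1 n1)" using f_points[OF x0] by (simp add: N)
    show "sqrt \<bar>k\<bar> / a > 0" using s ab(1) by simp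
    show "w1 0 = (\<lambda>i. sqrt \<bar>k\<bar> / a * (f x0 \<circ> Inl) i)" by (simp add: w1_def v0)
  qed
  have j2: "totally_geodesic_embedding (Q_manifold k2 n) (Q_space k2 n2) (mat_app (Suc n) w2)"
  proof (rule linear_Q_embedding[OF k2])
    show "w2 i \<in> topspace (Euclidean_space (Suc n2))" if "i < Suc n" for i
      using vE(2)[OF that] by (simp add: w2_def topspace_Euclidean_space)
    show "flat_ip (sig k2) (Suc n2) (w2 i) (w2 j) = (if i = j then fsgn k2 i else 0)" if "i < Suc n" "j < Suc n" for i j
    proof -
      have "B2 (v i) (v j) = r * form N (v i) (v j)" using defect_zero(1) defect_flat_span[OF x0] vF that by blast
      also have "\<dots> = b\<^sup>2 * (if i = j then fsgn k i else 0)" using von that unfolding ab(4) by simp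
      finally have e: "B2 (v i) (v j) = b\<^sup>2 * (if i = j then fsgn k i else 0)" .
      have c: "1 / b * (1 / b * (b\<^sup>2 * z)) = z" for z using ab(2) by (simp add: power2_eq_square)
      show ?thesis unfolding w2_def form_scale[OF f2] form_scale2[OF f2] fsg e c ..
    qed
    show "f x0 \<circ> Inr \<in> points (Q_space k2 n2)" using f_points[OF x0] by (simp add: N)
    show "sqrt \<bar>k\<bar> / b > 0" using s ab(2) by simp
    show "w2 0 = (\<lambda>i. sqrt \<bar>k\<bar> / b * (f x0 \<circ> Inr) i)" by (simp add: w2_def v0)
  qed
  define g where "g = mat_app (Suc n) (\<lambda>s. case_sum (\<lambda>i. a * (if i = s then 1 else 0)) (\<lambda>i. b * (if i = s then 1 else 0)))"
  have "(1 - r) * (1 / k) = 1 / k - r * (1 / k)" by (simp only: left_diff_distrib mult_1_left)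
  then have "(1 - r) * (1 / k) = 1 / k1" unfolding k_scale(4) by (simp add: k_scale(3))
  then have abk: "a\<^sup>2 + b\<^sup>2 = 1" "a\<^sup>2 / k = 1 / k1" "b\<^sup>2 / k = 1 / k2"
    using ab(3,4) k_scale(4) by simp_all
  have g: "g u = case_sum (\<lambda>i. a * u i) (\<lambda>i. b * u i)" if "u \<in> topspace (Euclidean_space (Suc n))" for u
    unfolding g_def by (rule diagonal_totally_geodesic(1)[OF k_nonzero k1 k2 sig_eq ab(1,2) abk that])
  have gt: "totally_geodesic_embedding (Q_manifold k n) (product_target (Q_space k1 n) (Q_space k2 n)) g"
    unfolding g_def by (rule diagonal_totally_geodesic(2)[OF k_nonzero k1 k2 sig_eq ab(1,2) abk])
  have "f x = case_sum (mat_app (Suc n) w1 (g (fbar x) \<circ> Inl)) (mat_app (Suc n) w2 (g (fbar x) \<circ> Inr))"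
    if x: "x \<in> topspace (mtop M)" for x
  proof
    fix i
    show "f x i = case_sum (mat_app (Suc n) w1 (g (fbar x) \<circ> Inl)) (mat_app (Suc n) w2 (g (fbar x) \<circ> Inr)) i"
      unfolding g[OF fbE] case_sum_o fun_cong[OF fv[OF x], of i]
      using ab(1,2) by (cases i) (simp_all add: mat_app_def w1_def w2_def del: sum.lessThan_Suc)
  qed
  then show ?thesis using fb g gt j1 j2
    by (intro exI[of _ fbar] exI[of _ g] exI[of _ "mat_app (Suc n) w1"] exI[of _ "mat_app (Suc n) w2"]) auto
qed

end

section \<open>The equivalence of (i) and (ii)\<close>

lemma linear_isometry_id: "linear_isometry_of s N (\<lambda>x. x)"
  unfolding linear_isometry_of_def by (simp add: bij_betw_def inj_on_def)

theorem theorem22: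
  fixes k1 k2 k a b :: real
    and m n1 n2 :: nat
    and M :: "'a rmanifold"
    and N :: "(nat + nat) target"
    and f :: "'a \<Rightarrow> nat + nat \<Rightarrow> real"
  assumes "k1 * k2 \<noteq> 0"
    and "riemannian_manifold M" and "mdim M = m" and "m \<ge> 1"
    and N: "N = product_target (Q_space k1 n1) (Q_space k2 n2)"
    and "isometric_immersion M N f"
    and k: "k = k1 * k2 / (k1 + k2)"
    and a: "a = sqrt (k2 / (k1 + k2))"
    and b: "b = sqrt (k1 / (k1 + k2))"
  shows
    "(k1 * k2 > 0 \<and>
      (\<exists>l fbar g T1 T2 j1 j2.
         isometric_immersion M (Q_space k (m + l)) fbar \<and>
         linear_isometry_of (sig k1) (m + l + 1) T1 \<and>
         linear_isometry_of (sig k1) (m + l + 1) T2 \<and>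
         (\<forall>x\<in>points (Q_space k (m + l)).
            g x = case_sum (\<lambda>i. a * T1 x i) (\<lambda>i. b * T2 x i)) \<and>
         totally_geodesic_embedding (Q_manifold k (m + l))
           (product_target (Q_space k1 (m + l)) (Q_space k2 (m + l))) g \<and>
         totally_geodesic_embedding (Q_manifold k1 (m + l)) (Q_space k1 n1) j1 \<and>
         totally_geodesic_embedding (Q_manifold k2 (m + l)) (Q_space k2 n2) j2 \<and>
         (\<forall>x\<in>topspace (mtop M).
            f x = case_sum (j1 (g (fbar x) \<circ> Inl)) (j2 (g (fbar x) \<circ> Inr)))))
     \<longleftrightarrow>
     ((\<forall>x\<in>topspace (mtop M). \<forall>X\<in>tangent_space M x. Phi_tensor k1 k2 M N f x X = (\<lambda>h. 0)) \<and>
      (\<exists>l L. normal_subbundle M N f l L \<and>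
         (\<forall>x\<in>topspace (mtop M).
            L x \<subseteq> normal_orth M N f x (S_tensor M N f x ` tangent_space M x) \<and>
            first_normal_space M N f x \<subseteq> L x \<and>
            (\<forall>\<xi>\<in>L x. (\<lambda>i. T_tensor M N f x \<xi> i - b\<^sup>2 * \<xi> i) \<in> normal_orth M N f x (L x))) \<and>
         parallel_subbundle M N f L))"
  (is "?i \<longleftrightarrow> ?ii")
proof -
  have k12: "k1 \<noteq> 0" "k2 \<noteq> 0" using assms(1) by auto
  have M: "smooth_manifold M" "connected_space (mtop M)"
    using assms(2) unfolding riemannian_manifold_def by blast+
  have ne: "topspace (mtop M) \<noteq> {}"
    using M(1) unfolding smooth_manifold_def by blast
  have mp: "metric M x X X > 0" if "x \<in> topspace (mtop M)" "X \<in> tangent_space M x" "X \<noteq> (\<lambda>h. 0)" for x X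
    using assms(2) that unfolding riemannian_manifold_def by blast
  interpret S: smooth_atlas M by (rule smooth_manifold_imp_smooth_atlas[OF M(1)])
  have imf: "immersion M N f" using S.immersion_product[OF k12 assms(6)[unfolded N] mp] unfolding N by blast
  interpret f: product_immersion M N f k1 k2 n1 n2
    by (intro product_immersion.intro product_immersion_axioms.intro imf N k12)
  show ?thesis
  proof
    assume ?i
    then have pos: "k1 * k2 > 0" and ex: "\<exists>l fbar g T1 T2 j1 j2.
         isometric_immersion M (Q_space k (m + l)) fbar \<and>
         linear_isometry_of (sig k1) (m + l + 1) T1 \<and>
         linear_isometry_of (sig k1) (m + l + 1) T2 \<and>
         (\<forall>x\<in>points (Q_space k (m + l)).
            g x = case_sum (\<lambda>i. a * T1 x i) (\<lambda>i. b * T2 x i)) \<and>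
         totally_geodesic_embedding (Q_manifold k (m + l))
           (product_target (Q_space k1 (m + l)) (Q_space k2 (m + l))) g \<and>
         totally_geodesic_embedding (Q_manifold k1 (m + l)) (Q_space k1 n1) j1 \<and>
         totally_geodesic_embedding (Q_manifold k2 (m + l)) (Q_space k2 n2) j2 \<and>
         (\<forall>x\<in>topspace (mtop M).
            f x = case_sum (j1 (g (fbar x) \<circ> Inl)) (j2 (g (fbar x) \<circ> Inr)))" by blast+
    from ex obtain l F g T1 T2 j1 j2 where
      F: "isometric_immersion M (Q_space k (m + l)) F"
      and T1: "linear_isometry_of (sig k1) (m + l + 1) T1" and T2: "linear_isometry_of (sig k1) (m + l + 1) T2"
      and g: "\<forall>x\<in>points (Q_space k (m + l)). g x = case_sum (\<lambda>i. a * T1 x i) (\<lambda>i. b * T2 x i)"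
      and gt: "totally_geodesic_embedding (Q_manifold k (m + l)) (product_target (Q_space k1 (m + l)) (Q_space k2 (m + l))) g"
      and j1: "totally_geodesic_embedding (Q_manifold k1 (m + l)) (Q_space k1 n1) j1"
      and j2: "totally_geodesic_embedding (Q_manifold k2 (m + l)) (Q_space k2 n2) j2"
      and fac: "\<forall>x\<in>topspace (mtop M). f x = case_sum (j1 (g (F x) \<circ> Inl)) (j2 (g (F x) \<circ> Inr))"
      by (elim exE conjE)
    let ?n = "m + l"
    have sgn: "(k1 > 0 \<and> k2 > 0) \<or> (k1 < 0 \<and> k2 < 0)" using pos by (simp add: zero_less_mult_iff)
    then have s0: "k1 + k2 \<noteq> 0" by auto
    have k0: "k \<noteq> 0" using k k12 s0 by simp
    \<comment> \<open>With \<open>k1\<close> and \<open>k2\<close> of one sign, \<open>k\<close> has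
      that sign too, so the flat spaces of all three curvatures share their index.\<close>
    have sg: "sig k = sig k1" "sig k = sig k2" using sgn unfolding k by (auto simp: sig_def zero_less_mult_iff divide_less_0_iff mult_less_0_iff)
    have rp: "k1 / (k1 + k2) > 0" "k2 / (k1 + k2) > 0" using sgn by (auto simp: zero_less_divide_iff)
    have ab2: "a\<^sup>2 = k2 / (k1 + k2)" "b\<^sup>2 = k1 / (k1 + k2)" unfolding a b using rp by simp_all
    have ab: "a\<^sup>2 + b\<^sup>2 = 1" "(k1 + k2) * b\<^sup>2 = k1" unfolding ab2 using s0 by (simp_all add: add_divide_distrib[symmetric] add.commute)
    have imF: "immersion M (Q_space k ?n) F" by (rule S.immersion_Q[OF k0 F mp])
    have Fs: "smooth_vec_on M (topspace (mtop M)) F" and Fp: "\<And>x. x \<in> topspace (mtop M) \<Longrightarrow> F x \<in> points (Q_space k ?n)"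
      using F unfolding isometric_immersion_def by blast+
    have gp: "g q \<in> points (product_target (Q_space k1 ?n) (Q_space k2 ?n))" if "q \<in> points (Q_space k ?n)" for q
      using conjunct1[OF gt[unfolded totally_geodesic_embedding_def isometric_immersion_def, THEN conjunct1]] that
      unfolding topspace_Q[OF k0] by (rule subsetD[OF _ imageI])
    \<comment> \<open>That \<open>a T1 q\<close> and \<open>b T2 q\<close> lie on the chosen
      components is read off from \<open>g\<close>, which maps into the product.\<close>
    have aT: "(\<lambda>i. a * T1 q i) \<in> points (Q_space k1 ?n)" and bT: "(\<lambda>i. b * T2 q i) \<in> points (Q_space k2 ?n)"
      if "q \<in> points (Q_space k ?n)" for q
      using gp[OF that] unfolding g[rule_format, OF that] product_target_simps case_sum_o by blast+
    \<comment> \<open>The image of a normal vector of \<open>F\<close> under the differentials of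
      \<open>j1\<close> and \<open>j2\<close>. Being defined without the local matrices, it gives
      \<open>L\<close> on all of \<open>M\<close>.\<close>
    define P where "P x \<nu> = case_sum (push k1 ?n j1 (\<lambda>i. a * T1 (F x) i) (\<lambda>i. a * T1 \<nu> i))
        (push k2 ?n j2 (\<lambda>i. b * T2 (F x) i) (\<lambda>i. b * T2 \<nu> i))" for x \<nu>
    define L where "L x = P x ` normal_space M (Q_space k ?n) F x" for x
    have T1': "linear_isometry_of (sig k1) (Suc ?n) T1" and T2': "linear_isometry_of (sig k2) (Suc ?n) T2"
      using T1 T2 sg by simp_all
    let ?B = "flat_ip (sig k) (Suc ?n)" and ?E = "topspace (Euclidean_space (Suc ?n))"
    have fac': "\<exists>A W. openin (mtop M) W \<and> x \<in> W \<and>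
       (\<forall>y\<in>W. f y = mat_app (Suc ?n) A (F y) \<and> L y = mat_app (Suc ?n) A ` normal_space M (Q_space k ?n) F y) \<and>
       (\<forall>u\<in>?E. mat_app (Suc ?n) A u \<circ> Inl \<in> topspace (Euclidean_space (Suc n1)) \<and>
           mat_app (Suc ?n) A u \<circ> Inr \<in> topspace (Euclidean_space (Suc n2))) \<and>
       (\<forall>u\<in>?E. \<forall>v\<in>?E.
         flat_ip (sig k1) (Suc n1) (mat_app (Suc ?n) A u \<circ> Inl) (mat_app (Suc ?n) A v \<circ> Inl) = a\<^sup>2 * ?B u v \<and>
         flat_ip (sig k2) (Suc n2) (mat_app (Suc ?n) A u \<circ> Inr) (mat_app (Suc ?n) A v \<circ> Inr) = b\<^sup>2 * ?B u v)"
      if x: "x \<in> topspace (mtop M)" for x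
    proof -
      have "\<exists>A W. openin (mtop M) W \<and> x \<in> W \<and>
          (\<forall>y\<in>W. case_sum (j1 (\<lambda>i. a * T1 (F y) i)) (j2 (\<lambda>i. b * T2 (F y) i)) = mat_app (Suc ?n) A (F y) \<and>
           (\<forall>v\<in>tspace (Q_space k ?n) (F y).
          case_sum (push k1 ?n j1 (\<lambda>i. a * T1 (F y) i) (\<lambda>i. a * T1 v i)) (push k2 ?n j2 (\<lambda>i. b * T2 (F y) i) (\<lambda>i. b * T2 v i)) =
          mat_app (Suc ?n) A v)) \<and>
          (\<forall>u\<in>?E. mat_app (Suc ?n) A u \<circ> Inl \<in> topspace (Euclidean_space (Suc n1)) \<and>
           mat_app (Suc ?n) A u \<circ> Inr \<in> topspace (Euclidean_space (Suc n2))) \<and>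
          (\<forall>u\<in>?E. \<forall>v\<in>?E.
         flat_ip (sig k1) (Suc n1) (mat_app (Suc ?n) A u \<circ> Inl) (mat_app (Suc ?n) A v \<circ> Inl) = a\<^sup>2 * ?B u v \<and>
         flat_ip (sig k2) (Suc n2) (mat_app (Suc ?n) A u \<circ> Inr) (mat_app (Suc ?n) A v \<circ> Inr) = b\<^sup>2 * ?B u v)"
        by (rule S.composition_locally_linear[OF k12 k0 sg Fs Fp T1' T2' aT bT j1 j2 x])
      then obtain A W where W: "openin (mtop M) W" "x \<in> W"
        and A1: "\<forall>y\<in>W. case_sum (j1 (\<lambda>i. a * T1 (F y) i)) (j2 (\<lambda>i. b * T2 (F y) i)) = mat_app (Suc ?n) A (F y) \<and>
           (\<forall>v\<in>tspace (Q_space k ?n) (F y).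
          case_sum (push k1 ?n j1 (\<lambda>i. a * T1 (F y) i) (\<lambda>i. a * T1 v i)) (push k2 ?n j2 (\<lambda>i. b * T2 (F y) i) (\<lambda>i. b * T2 v i)) =
          mat_app (Suc ?n) A v)"
        and A2: "\<forall>u\<in>?E. mat_app (Suc ?n) A u \<circ> Inl \<in> topspace (Euclidean_space (Suc n1)) \<and>
           mat_app (Suc ?n) A u \<circ> Inr \<in> topspace (Euclidean_space (Suc n2))"
        and A3: "\<forall>u\<in>?E. \<forall>v\<in>?E.
         flat_ip (sig k1) (Suc n1) (mat_app (Suc ?n) A u \<circ> Inl) (mat_app (Suc ?n) A v \<circ> Inl) = a\<^sup>2 * ?B u v \<and>
         flat_ip (sig k2) (Suc n2) (mat_app (Suc ?n) A u \<circ> Inr) (mat_app (Suc ?n) A v \<circ> Inr) = b\<^sup>2 * ?B u v"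
        by (elim exE conjE)
      have "f y = mat_app (Suc ?n) A (F y) \<and> L y = mat_app (Suc ?n) A ` normal_space M (Q_space k ?n) F y" if y: "y \<in> W" for y
      proof
        have yt: "y \<in> topspace (mtop M)" using openin_subset[OF W(1)] y by blast
        show "f y = mat_app (Suc ?n) A (F y)"
          using fac[rule_format, OF yt] A1 y unfolding g[rule_format, OF Fp[OF yt]] case_sum_o by simp
        have "P y v = mat_app (Suc ?n) A v" if "v \<in> normal_space M (Q_space k ?n) F y" for v
          using A1[rule_format, OF y] that unfolding P_def normal_space_def by blast
        then show "L y = mat_app (Suc ?n) A ` normal_space M (Q_space k ?n) F y"
          unfolding L_def by (rule image_cong[OF refl])
      qed
      then show ?thesis using W A2 A3 by blast
    qed
    note res = factor_imp_parallel_subbundle[OF imf[unfolded N] imF assms(3) k0 ab fac', folded N]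
    show ?ii using res by blast
  next
    assume ?ii
    then obtain l L where Phi: "\<forall>x\<in>topspace (mtop M). \<forall>X\<in>tangent_space M x. Phi_tensor k1 k2 M N f x X = (\<lambda>h. 0)"
      and L1: "normal_subbundle M N f l L"
      and L2: "\<forall>x\<in>topspace (mtop M).
            L x \<subseteq> normal_orth M N f x (S_tensor M N f x ` tangent_space M x) \<and>
            first_normal_space M N f x \<subseteq> L x \<and>
            (\<forall>\<xi>\<in>L x. (\<lambda>i. T_tensor M N f x \<xi> i - b\<^sup>2 * \<xi> i) \<in> normal_orth M N f x (L x))"
      and L3: "parallel_subbundle M N f L" by (elim exE conjE)
    have m: "mdim M \<ge> 1" using assms(3,4) by simp
    note P = f.Phi_zero_imp[OF Phi m ne]
    have b2: "b\<^sup>2 = k1 / (k1 + k2)" unfolding b using P(1) by simp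
    interpret r: reducible_immersion M N f k1 k2 n1 n2 l L k "b\<^sup>2"
    proof (rule reducible_immersion.intro[OF f.product_immersion_axioms reducible_immersion_axioms.intro])
      show "f.B2 (dvec X f) (dvec Y f) = b\<^sup>2 * form N (dvec X f) (dvec Y f)"
        if "X \<in> tangent_space M x" "Y \<in> tangent_space M x" for x X Y
        unfolding b2 using that by (rule P(3))
      show "L x \<subseteq> normal_orth M N f x (S_tensor M N f x ` tangent_space M x)" if "x \<in> topspace (mtop M)" for x
        by (rule bspec[OF L2 that, THEN conjunct1])
      show "first_normal_space M N f x \<subseteq> L x" if "x \<in> topspace (mtop M)" for x
        by (rule bspec[OF L2 that, THEN conjunct2, THEN conjunct1])
      show "(\<lambda>i. T_tensor M N f x \<xi> i - b\<^sup>2 * \<xi> i) \<in> normal_orth M N f x (L x)"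
        if "x \<in> topspace (mtop M)" and xi: "\<xi> \<in> L x" for x \<xi>
        by (rule bspec[OF bspec[OF L2 that(1), THEN conjunct2, THEN conjunct2] xi])
    qed (rule b2 k P(1,2) M(2) L1 L3)+
    have ab: "a > 0" "b > 0" "a\<^sup>2 = 1 - b\<^sup>2" "b\<^sup>2 = b\<^sup>2"
      using P(1,2) r.one_minus_r unfolding a b by simp_all
    obtain F g j1 j2 where F: "isometric_immersion M (Q_space k (m + l)) F"
      and g: "\<forall>x\<in>points (Q_space k (m + l)). g x = case_sum (\<lambda>i. a * x i) (\<lambda>i. b * x i)"
      and gt: "totally_geodesic_embedding (Q_manifold k (m + l)) (product_target (Q_space k1 (m + l)) (Q_space k2 (m + l))) g"
      and j1: "totally_geodesic_embedding (Q_manifold k1 (m + l)) (Q_space k1 n1) j1"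
      and j2: "totally_geodesic_embedding (Q_manifold k2 (m + l)) (Q_space k2 n2) j2"
      and fac: "\<forall>x\<in>topspace (mtop M). f x = case_sum (j1 (g (F x) \<circ> Inl)) (j2 (g (F x) \<circ> Inr))"
      using r.factorization[OF ne ab] unfolding assms(3) by (elim exE conjE)
    \<comment> \<open>This product is \<open>k1 k2\<close> divided by a square, so its sign is that
      of \<open>k1 k2\<close>.\<close>
    have "(k1 / (k1 + k2)) * (k2 / (k1 + k2)) > 0" using P(1,2) by (rule mult_pos_pos)
    then have pos: "k1 * k2 > 0" by (simp add: zero_less_divide_iff not_square_less_zero)
    show ?i
      by (rule conjI[OF pos], rule exI[of _ l], rule exI[of _ F], rule exI[of _ g], rule exI[of _ "\<lambda>x. x"],
          rule exI[of _ "\<lambda>x. x"], rule exI[of _ j1], rule exI[of _ j2])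
        (intro conjI F linear_isometry_id g gt j1 j2 fac)
  qed
qed

end
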